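(* Let $M$ be a nonflat complete space-like stationary surface in $\mathbb{R}^{3,1}$ whose Gauss map $(\psi_1,\psi_2)$ satisfies $\psi_2=f(\psi_1)$ with $f$ a rational function of degree $m$. Then the number $q_1$ of exceptional values of $\psi_1$ (points of $\mathbb{C}^*=\mathbb{C}\cup\{\infty\}$ not taken by $\psi_1$) satisfies $$|E_f|\leq q_1\leq m-|E_f|+3,$$ where $E_f=\{w\in\mathbb{C}^*: f(w)=\bar w\}$.
   Context: $\mathbb{R}^{3,1}$ is $\mathbb{R}^4$ with the Minkowski inner product $\langle u,v\rangle=u_1v_1+u_2v_2+u_3v_3-u_4v_4$, extended complex-bilinearly to $\mathbb{C}^4$. A space-like surface is a connected oriented surface with an immersion $\mathbf{x}:M\to\mathbb{R}^{3,1}$ whose induced metric is positive definite; it is stationary if its mean curvature vector field vanishes identically, complete if the induced metric is complete, nonflat if its Gauss curvature is not identically $0$. Let $Q_{1,1}=\{[z]\in\mathbb{CP}^3:\langle z,z\rangle=0\}$, $Q_{1,1}^+=\{[z]\in Q_{1,1}:\langle z,\bar z\rangle>0\}$, $\mathbb{C}^*=\mathbb{C}\cup\{\infty\}$ with $\overline{\infty}=\infty$. There is a biholomorphism $\Psi:Q_{1,1}\to\mathbb{C}^*\times\mathbb{C}^*$ whose inverse is $(w_1,w_2)\mapsto[(w_1+w_2,-i(w_1-w_2),1-w_1w_2,1+w_1w_2)]$ for $w_1,w_2\in\mathbb{C}$, $(w_1,\infty)\mapsto[(1,i,-w_1,w_1)]$, $(\infty,w_2)\mapsto[(1,-i,-w_2,w_2)]$,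 $(\infty,\infty)\mapsto[(0,0,-1,1)]$; it maps $Q_{1,1}^+$ onto $\{w_2\neq\bar w_1\}$. For a space-like stationary surface with local complex coordinate $z=u+iv$ from oriented isothermal parameters, the Gauss map sends $p$ to $[\mathbf{x}_z]\in Q_{1,1}^+$, and $(\psi_1,\psi_2):=\Psi([\mathbf{x}_z])$; both are holomorphic maps $M\to\mathbb{C}^*$ and $\psi_2\ne\bar\psi_1$ everywhere. *)

theory Defs
  imports "HOL-Analysis.Analysis" "HOL-Computational_Algebra.Polynomial"
begin

section \<open>The Minkowski product\<close>

text \<open>For \<open>'a = complex\<close> this is the complex-bilinear (not sesquilinear) extension.\<close>

definition mink :: "'a::comm_ring_1 ^ 4 \<Rightarrow> 'a ^ 4 \<Rightarrow> 'a" where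
  "mink u v = u $ 1 * v $ 1 + u $ 2 * v $ 2 + u $ 3 * v $ 3 - u $ 4 * v $ 4"


section \<open>Smooth maps on open sets of the coordinate plane\<close>

text \<open>The coordinate plane \<open>\<real>\<^sup>2\<close> is \<open>complex\<close>, with real coordinates \<open>u + iv\<close>. Coordinate directions
  are indexed by the two-element type \<open>2\<close>.\<close>

definition coord_dir :: "2 \<Rightarrow> complex" where
  "coord_dir i = (if i = 1 then 1 else \<i>)"

definition pd :: "2 \<Rightarrow> (complex \<Rightarrow> 'b::real_normed_vector) \<Rightarrow> complex \<Rightarrow> 'b" where
  "pd i f z = frechet_derivative f (at z) (coord_dir i)"

fun Ck_on :: "nat \<Rightarrow> (complex \<Rightarrow> 'b::real_normed_vector) \<Rightarrow> complex set \<Rightarrow> bool" where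
  "Ck_on 0 f S \<longleftrightarrow> continuous_on S f"
| "Ck_on (Suc k) f S \<longleftrightarrow> (\<forall>z\<in>S. f differentiable (at z)) \<and> (\<forall>i. Ck_on k (pd i f) S)"

definition smooth_on :: "complex set \<Rightarrow> (complex \<Rightarrow> 'b::real_normed_vector) \<Rightarrow> bool" where
  "smooth_on S f \<longleftrightarrow> (\<forall>k. Ck_on k f S)"

definition jacobian :: "(complex \<Rightarrow> complex) \<Rightarrow> complex \<Rightarrow> real" where
  "jacobian f z = Re (pd 1 f z) * Im (pd 2 f z) - Re (pd 2 f z) * Im (pd 1 f z)"


section \<open>Connected oriented surfaces\<close>

text \<open>A chart is a pair of its domain and its coordinate map.\<close>

type_synonym 'a chart = "'a set \<times> ('a \<Rightarrow> complex)"

definition is_chart :: "'a topology \<Rightarrow> 'a chart \<Rightarrow> bool" where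
  "is_chart M = (\<lambda>(U, \<phi>). openin M U \<and> open (\<phi> ` U) \<and>
     homeomorphic_map (subtopology M U) (top_of_set (\<phi> ` U)) \<phi>)"

definition oriented_transition :: "'a chart \<Rightarrow> 'a chart \<Rightarrow> bool" where
  "oriented_transition = (\<lambda>(U, \<phi>) (V, \<theta>).
     smooth_on (\<phi> ` (U \<inter> V)) (\<theta> \<circ> inv_into U \<phi>) \<and>
     (\<forall>z \<in> \<phi> ` (U \<inter> V). jacobian (\<theta> \<circ> inv_into U \<phi>) z > 0))"

definition oriented_surface :: "'a topology \<Rightarrow> 'a chart set \<Rightarrow> bool" where
  "oriented_surface M A \<longleftrightarrow>
     Hausdorff_space M \<and> second_countable M \<and> connected_space M \<and>
     (\<forall>c\<in>A. is_chart M c) \<and> (\<Union>c\<in>A. fst c) = topspace M \<and>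
     (\<forall>c\<in>A. \<forall>d\<in>A. oriented_transition c d)"

text \<open>The charts of the maximal oriented atlas generated by \<open>A\<close>.\<close>

definition oriented_chart :: "'a topology \<Rightarrow> 'a chart set \<Rightarrow> 'a chart \<Rightarrow> bool" where
  "oriented_chart M A c \<longleftrightarrow> is_chart M c \<and>
     (\<forall>d\<in>A. oriented_transition c d \<and> oriented_transition d c)"

definition local_rep :: "('a \<Rightarrow> 'b) \<Rightarrow> 'a chart \<Rightarrow> complex \<Rightarrow> 'b" where
  "local_rep x = (\<lambda>(U, \<phi>). x \<circ> inv_into U \<phi>)"

definition chart_image :: "'a chart \<Rightarrow> complex set" where
  "chart_image = (\<lambda>(U, \<phi>). \<phi> ` U)"


section \<open>Space-like immersions and their curvature\<close>

definition induced_metric :: "(complex \<Rightarrow> real ^ 4) \<Rightarrow> complex \<Rightarrow> real ^ 2 ^ 2" where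
  "induced_metric y z = (\<chi> i j. mink (pd i y z) (pd j y z))"

definition spacelike_immersion :: "'a chart set \<Rightarrow> ('a \<Rightarrow> real ^ 4) \<Rightarrow> bool" where
  "spacelike_immersion A x \<longleftrightarrow> (\<forall>c\<in>A. smooth_on (chart_image c) (local_rep x c) \<and>
     (\<forall>z \<in> chart_image c. inj (frechet_derivative (local_rep x c) (at z)) \<and>
        (\<forall>h. h \<noteq> 0 \<longrightarrow> h \<bullet> (induced_metric (local_rep x c) z *v h) > 0)))"

definition tangential_part :: "(complex \<Rightarrow> real ^ 4) \<Rightarrow> complex \<Rightarrow> real ^ 4 \<Rightarrow> real ^ 4" where
  "tangential_part y z v = (\<Sum>i\<in>UNIV. \<Sum>j\<in>UNIV.
     (matrix_inv (induced_metric y z) $ i $ j * mink v (pd i y z)) *\<^sub>R pd j y z)"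

definition second_fundamental_form ::
    "(complex \<Rightarrow> real ^ 4) \<Rightarrow> 2 \<Rightarrow> 2 \<Rightarrow> complex \<Rightarrow> real ^ 4" where
  "second_fundamental_form y i j z =
     pd i (pd j y) z - tangential_part y z (pd i (pd j y) z)"

definition mean_curvature_vector :: "(complex \<Rightarrow> real ^ 4) \<Rightarrow> complex \<Rightarrow> real ^ 4" where
  "mean_curvature_vector y z = (1 / 2) *\<^sub>R (\<Sum>i\<in>UNIV. \<Sum>j\<in>UNIV.
     matrix_inv (induced_metric y z) $ i $ j *\<^sub>R second_fundamental_form y i j z)"

definition stationary :: "'a chart set \<Rightarrow> ('a \<Rightarrow> real ^ 4) \<Rightarrow> bool" where
  "stationary A x \<longleftrightarrow>
     (\<forall>c\<in>A. \<forall>z \<in> chart_image c. mean_curvature_vector (local_rep x c) z = 0)"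

text \<open>\<open>christoffel g l i j\<close> is \<open>\<Gamma>\<close> with upper index \<open>l\<close> and lower indices \<open>i\<close>, \<open>j\<close>;
  \<open>riemann g l k i j\<close> is the \<open>l\<close>-th component of \<open>R(\<partial>\<^sub>i, \<partial>\<^sub>j) \<partial>\<^sub>k\<close>, where
  \<open>R(X, Y) = [\<nabla>\<^sub>X, \<nabla>\<^sub>Y] - \<nabla>\<^bsub>[X, Y]\<^esub>\<close>; the Gauss curvature is
  \<open>\<langle>R(\<partial>\<^sub>1, \<partial>\<^sub>2) \<partial>\<^sub>2, \<partial>\<^sub>1\<rangle> / det g\<close>.\<close>

definition christoffel :: "(complex \<Rightarrow> real ^ 2 ^ 2) \<Rightarrow> 2 \<Rightarrow> 2 \<Rightarrow> 2 \<Rightarrow> complex \<Rightarrow> real" where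
  "christoffel g l i j z = (1 / 2) * (\<Sum>k\<in>UNIV. matrix_inv (g z) $ l $ k *
     (pd i (\<lambda>w. g w $ j $ k) z + pd j (\<lambda>w. g w $ i $ k) z - pd k (\<lambda>w. g w $ i $ j) z))"

definition riemann :: "(complex \<Rightarrow> real ^ 2 ^ 2) \<Rightarrow> 2 \<Rightarrow> 2 \<Rightarrow> 2 \<Rightarrow> 2 \<Rightarrow> complex \<Rightarrow> real" where
  "riemann g l k i j z =
     pd i (christoffel g l j k) z - pd j (christoffel g l i k) z +
     (\<Sum>m\<in>UNIV. christoffel g l i m z * christoffel g m j k z
              - christoffel g l j m z * christoffel g m i k z)"

definition gauss_curvature :: "(complex \<Rightarrow> real ^ 2 ^ 2) \<Rightarrow> complex \<Rightarrow> real" where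
  "gauss_curvature g z = (\<Sum>l\<in>UNIV. g z $ 1 $ l * riemann g l 2 1 2 z) / det (g z)"

definition nonflat :: "'a chart set \<Rightarrow> ('a \<Rightarrow> real ^ 4) \<Rightarrow> bool" where
  "nonflat A x \<longleftrightarrow>
     (\<exists>c\<in>A. \<exists>z \<in> chart_image c. gauss_curvature (induced_metric (local_rep x c)) z \<noteq> 0)"


section \<open>Completeness of the induced metric\<close>

text \<open>The finite exceptional set \<open>S\<close> may be enlarged, so that the end points of \<open>[0, 1]\<close>, where
  \<open>C1_differentiable_on\<close> would ask for two-sided derivatives, impose nothing.\<close>

definition piecewise_C1_curve ::
    "'a topology \<Rightarrow> 'a chart set \<Rightarrow> 'a \<Rightarrow> 'a \<Rightarrow> (real \<Rightarrow> 'a) \<Rightarrow> bool" where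
  "piecewise_C1_curve M A p q \<gamma> \<longleftrightarrow> pathin M \<gamma> \<and> \<gamma> 0 = p \<and> \<gamma> 1 = q \<and>
     (\<exists>S. finite S \<and> (\<forall>(U, \<phi>)\<in>A. (\<phi> \<circ> \<gamma>) C1_differentiable_on {t \<in> {0..1} - S. \<gamma> t \<in> U}))"

text \<open>The induced metric evaluated on \<open>\<gamma>'\<close> is the Minkowski square of \<open>(x \<circ> \<gamma>)'\<close>.\<close>

definition curve_length :: "('a \<Rightarrow> real ^ 4) \<Rightarrow> (real \<Rightarrow> 'a) \<Rightarrow> ennreal" where
  "curve_length x \<gamma> = (\<integral>\<^sup>+t\<in>{0..1}.
     ennreal (sqrt (mink (vector_derivative (x \<circ> \<gamma>) (at t)) (vector_derivative (x \<circ> \<gamma>) (at t))))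
     \<partial>lborel)"

definition induced_dist ::
    "'a topology \<Rightarrow> 'a chart set \<Rightarrow> ('a \<Rightarrow> real ^ 4) \<Rightarrow> 'a \<Rightarrow> 'a \<Rightarrow> real" where
  "induced_dist M A x p q = (if p \<in> topspace M \<and> q \<in> topspace M
     then enn2real (INF \<gamma> \<in> Collect (piecewise_C1_curve M A p q). curve_length x \<gamma>) else 0)"

definition complete_surface :: "'a topology \<Rightarrow> 'a chart set \<Rightarrow> ('a \<Rightarrow> real ^ 4) \<Rightarrow> bool" where
  "complete_surface M A x \<longleftrightarrow> Metric_space.mcomplete (topspace M) (induced_dist M A x)"


section \<open>The extended plane and rational functions\<close>

text \<open>\<open>None\<close> is the point at infinity.\<close>

type_synonym ext_complex = "complex option"

definition ext_cnj :: "ext_complex \<Rightarrow> ext_complex" where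
  "ext_cnj = map_option cnj"

text \<open>The self-map of the extended plane given by \<open>p / q\<close> for coprime \<open>p\<close>, \<open>q\<close>. Its value at
  infinity is the quotient of the coefficients of degree \<open>max (degree p) (degree q)\<close>.\<close>

definition rational_map :: "complex poly \<Rightarrow> complex poly \<Rightarrow> ext_complex \<Rightarrow> ext_complex" where
  "rational_map p q w = (case w of
       Some a \<Rightarrow> if poly q a = 0 then None else Some (poly p a / poly q a)
     | None \<Rightarrow> (let n = max (degree p) (degree q) in
         if coeff q n = 0 then None else Some (coeff p n / coeff q n)))"

definition coincidence_set :: "(ext_complex \<Rightarrow> ext_complex) \<Rightarrow> ext_complex set" where
  "coincidence_set f = {w. f w = ext_cnj w}"

definition rational_of_degree :: "(ext_complex \<Rightarrow> ext_complex) \<Rightarrow> nat \<Rightarrow> bool" where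
  "rational_of_degree f m \<longleftrightarrow> (\<exists>p q. q \<noteq> 0 \<and> coprime p q \<and>
     m = max (degree p) (degree q) \<and> f = rational_map p q)"


section \<open>The Gauss map\<close>

text \<open>The point of \<open>\<complex>P\<^sup>3\<close> with homogeneous coordinates \<open>z \<noteq> 0\<close>, as the set of all its
  representatives.\<close>

definition cproj :: "complex ^ 4 \<Rightarrow> (complex ^ 4) set" where
  "cproj z = {c *s z | c. c \<noteq> 0}"

definition Q11 :: "(complex ^ 4) set set" where
  "Q11 = {cproj z | z. z \<noteq> 0 \<and> mink z z = 0}"

fun Psi_inv :: "ext_complex \<times> ext_complex \<Rightarrow> (complex ^ 4) set" where
  "Psi_inv (Some w1, Some w2) =
     cproj (vector [w1 + w2, - \<i> * (w1 - w2), 1 - w1 * w2, 1 + w1 * w2])"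
| "Psi_inv (Some w1, None) = cproj (vector [1, \<i>, - w1, w1])"
| "Psi_inv (None, Some w2) = cproj (vector [1, - \<i>, - w2, w2])"
| "Psi_inv (None, None) = cproj (vector [0, 0, - 1, 1])"

lemma vector_4:
  "(vector [a, b, c, d] :: 'a::zero ^ 4) $ 1 = a" "(vector [a, b, c, d] :: 'a ^ 4) $ 2 = b"
  "(vector [a, b, c, d] :: 'a ^ 4) $ 3 = c" "(vector [a, b, c, d] :: 'a ^ 4) $ 4 = d"
  unfolding vector_def by simp_all

lemma cproj_eq_iff:
  "cproj y = cproj z \<longleftrightarrow> (\<exists>c. c \<noteq> 0 \<and> y = c *s z)"
proof
  assume "cproj y = cproj z"
  moreover have "y \<in> cproj y"
    unfolding cproj_def by (auto intro!: exI[of _ 1])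
  ultimately show "\<exists>c. c \<noteq> 0 \<and> y = c *s z"
    by (auto simp: cproj_def)
next
  assume "\<exists>c. c \<noteq> 0 \<and> y = c *s z"
  then obtain c where c: "c \<noteq> 0" "y = c *s z" by blast
  show "cproj y = cproj z"
  proof (intro equalityI subsetI)
    fix w assume "w \<in> cproj y"
    then obtain d where "d \<noteq> 0" "w = d *s y" by (auto simp: cproj_def)
    then show "w \<in> cproj z"
      using c by (auto simp: cproj_def vector_smult_assoc intro!: exI[of _ "d * c"])
  next
    fix w assume "w \<in> cproj z"
    then obtain d where "d \<noteq> 0" "w = d *s z" by (auto simp: cproj_def)
    then show "w \<in> cproj y"
      using c by (auto simp: cproj_def vector_smult_assoc intro!: exI[of _ "d / c"])
  qed
qed

lemma bij_betw_Psi_inv: "bij_betw Psi_inv UNIV Q11"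
proof (rule bij_betw_imageI)
  note simps = cproj_eq_iff vec_eq_iff forall_4 vector_4 vector_scalar_mult_def
  show "inj Psi_inv"
  proof (rule injI)
    fix v w :: "ext_complex \<times> ext_complex"
    assume eq: "Psi_inv v = Psi_inv w"
    have fin: "p = q \<and> r = s" if "p + r = c * (q + s)" "- \<i> * (p - r) = c * (- \<i> * (q - s))"
      "1 - p * r = c * (1 - q * s)" "1 + p * r = c * (1 + q * s)" for p q r s c :: complex
    proof -
      have "2 = c * 2" using that(3,4) by algebra
      then have c: "c = 1" by simp
      have "\<i> * (p - r) = \<i> * (q - s)" using that(2) c by simp
      then have "p - r = q - s" by simp
      with that(1) c show ?thesis by (simp add: complex_eq_iff)
    qed
    consider p r q s where "v = (Some p, Some r)" "w = (Some q, Some s)"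
      | "\<not> (\<exists>p r. v = (Some p, Some r)) \<or> \<not> (\<exists>p r. w = (Some p, Some r))"
      by blast
    then show "v = w"
    proof cases
      case 1
      with eq obtain c where "p + r = c * (q + s)" "- \<i> * (p - r) = c * (- \<i> * (q - s))"
        "1 - p * r = c * (1 - q * s)" "1 + p * r = c * (1 + q * s)"
        unfolding 1 Psi_inv.simps simps vec_lambda_beta by blast
      then show ?thesis using fin 1 by blast
    next
      case 2
      show ?thesis
        using eq 2
        apply (cases v rule: Psi_inv.cases; cases w rule: Psi_inv.cases)
        apply (simp_all add: simps)
        apply safe
        apply (simp_all add: algebra_simps)
        done
    qed
  qed
  show "Psi_inv ` UNIV = Q11"
  proof (intro equalityI subsetI)
    fix L assume "L \<in> range Psi_inv"
    then obtain v where L: "L = Psi_inv v" by blast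
    have in_Q11: "cproj (vector [a, b, c, d]) \<in> Q11"
      if "a * a + b * b + c * c = d * d" "a \<noteq> 0 \<or> d \<noteq> 0 \<or> c \<noteq> 0" for a b c d :: complex
      unfolding Q11_def using that
      by (auto simp: mink_def vector_4 vec_eq_iff forall_4 intro!: exI[of _ "vector [a, b, c, d]"])
    have "1 - x \<noteq> 0 \<or> 1 + x \<noteq> 0" for x :: complex
      by (auto simp: complex_eq_iff)
    then show "L \<in> Q11"
      unfolding L by (cases v rule: Psi_inv.cases) (auto intro!: in_Q11 simp: algebra_simps)
  next
    fix L assume "L \<in> Q11"
    then obtain z where L: "L = cproj z" "z \<noteq> 0" "mink z z = 0" by (auto simp: Q11_def)
    define a b c d where abcd: "a = z $ 1" "b = z $ 2" "c = z $ 3" "d = z $ 4"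
    have nz: "a \<noteq> 0 \<or> b \<noteq> 0 \<or> c \<noteq> 0 \<or> d \<noteq> 0"
      using L(2) by (auto simp: abcd vec_eq_iff forall_4)
    have q: "a * a + b * b + c * c = d * d"
      using L(3) by (simp add: abcd mink_def)
    have ii: "\<i> * \<i> = -1" by simp
    show "L \<in> range Psi_inv"
    proof (cases "c + d = 0")
      case False
      define p r where "p = (a + \<i> * b) / (c + d)" and "r = (a - \<i> * b) / (c + d)"
      have p: "(c + d) * p = a + \<i> * b" and r: "(c + d) * r = a - \<i> * b"
        using False by (simp_all add: p_def r_def)
      have pr: "(c + d) * (p * r) = d - c"
      proof -
        have "(c + d) * ((c + d) * (p * r)) = (c + d) * (d - c)"
          using p r q ii by algebra
        with False show ?thesis by simp
      qed
      have "z = ((c + d) / 2) *s vector [p + r, - \<i> * (p - r), 1 - p * r, 1 + p * r]"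
        (is "z = ?k *s ?v")
        using p r pr ii unfolding simps vec_lambda_beta abcd[symmetric]
        by (simp add: field_simps) (use ii in algebra)
      then have "L = Psi_inv (Some p, Some r)"
        unfolding L(1) Psi_inv.simps cproj_eq_iff using False by (intro exI[of _ ?k] conjI) simp_all
      then show ?thesis by blast
    next
      case True
      then have c: "c = - d" by (simp add: eq_neg_iff_add_eq_0)
      have "(b - \<i> * a) * (b + \<i> * a) = 0" using q c ii by algebra
      then consider "a = 0" "b = 0" | "a \<noteq> 0" "b = \<i> * a" | "a \<noteq> 0" "b = - \<i> * a"
        by (cases "a = 0") (auto simp: eq_neg_iff_add_eq_0)
      then show ?thesis
      proof cases
        case 1
        then have "L = Psi_inv (None, None)"
          using nz c unfolding L(1) Psi_inv.simps simps vec_lambda_beta abcd[symmetric]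
          by (auto intro!: exI[of _ d])
        then show ?thesis by blast
      next
        case 2
        then have "L = Psi_inv (Some (d / a), None)"
          using c unfolding L(1) Psi_inv.simps simps vec_lambda_beta abcd[symmetric]
          by (auto intro!: exI[of _ a])
        then show ?thesis by blast
      next
        case 3
        then have "L = Psi_inv (None, Some (d / a))"
          using c unfolding L(1) Psi_inv.simps simps vec_lambda_beta abcd[symmetric]
          by (auto intro!: exI[of _ a])
        then show ?thesis by blast
      qed
    qed
  qed
qed

definition Psi :: "(complex ^ 4) set \<Rightarrow> ext_complex \<times> ext_complex" where
  "Psi = inv_into UNIV Psi_inv"

definition oriented_isothermal_chart ::
    "'a topology \<Rightarrow> 'a chart set \<Rightarrow> ('a \<Rightarrow> real ^ 4) \<Rightarrow> 'a chart \<Rightarrow> bool" where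
  "oriented_isothermal_chart M A x c \<longleftrightarrow> oriented_chart M A c \<and>
     (\<forall>z \<in> chart_image c. let g = induced_metric (local_rep x c) z in
        g $ 1 $ 1 = g $ 2 $ 2 \<and> g $ 1 $ 2 = 0)"

text \<open>The Wirtinger derivative \<open>y\<^sub>z = (y\<^sub>u - i y\<^sub>v) / 2\<close>.\<close>

definition wirtinger :: "(complex \<Rightarrow> real ^ 4) \<Rightarrow> complex \<Rightarrow> complex ^ 4" where
  "wirtinger y z = (\<chi> k. (of_real (pd 1 y z $ k) - \<i> * of_real (pd 2 y z $ k)) / 2)"

text \<open>The point of \<open>Q11\<close> is the same for all oriented isothermal charts around \<open>p\<close>, since these
  differ by holomorphic coordinate changes.\<close>

definition gauss_point ::
    "'a topology \<Rightarrow> 'a chart set \<Rightarrow> ('a \<Rightarrow> real ^ 4) \<Rightarrow> 'a \<Rightarrow> (complex ^ 4) set" where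
  "gauss_point M A x p = (THE L. \<exists>U \<phi>. oriented_isothermal_chart M A x (U, \<phi>) \<and> p \<in> U \<and>
     L = cproj (wirtinger (local_rep x (U, \<phi>)) (\<phi> p)))"

definition gauss_map ::
    "'a topology \<Rightarrow> 'a chart set \<Rightarrow> ('a \<Rightarrow> real ^ 4) \<Rightarrow> 'a \<Rightarrow> ext_complex \<times> ext_complex" where
  "gauss_map M A x p = Psi (gauss_point M A x p)"

definition psi1 :: "'a topology \<Rightarrow> 'a chart set \<Rightarrow> ('a \<Rightarrow> real ^ 4) \<Rightarrow> 'a \<Rightarrow> ext_complex" where
  "psi1 M A x p = fst (gauss_map M A x p)"

definition psi2 :: "'a topology \<Rightarrow> 'a chart set \<Rightarrow> ('a \<Rightarrow> real ^ 4) \<Rightarrow> 'a \<Rightarrow> ext_complex" where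
  "psi2 M A x p = snd (gauss_map M A x p)"

definition exceptional_values :: "'a topology \<Rightarrow> ('a \<Rightarrow> ext_complex) \<Rightarrow> ext_complex set" where
  "exceptional_values M \<psi> = UNIV - \<psi> ` topspace M"

end

theory Submission
  imports Defs "HOL-Complex_Analysis.Great_Picard"
begin

text \<open>A value \<open>w \<in> E\<^sub>f\<close> is omitted by \<open>\<psi>\<^sub>1\<close> because \<open>\<psi>\<^sub>2 \<noteq> cnj \<psi>\<^sub>1\<close>; this is the lower bound. For the upper
  bound suppose that \<open>\<psi>\<^sub>1\<close> omits a set \<open>S\<close> of \<open>k + 3\<close> values with \<open>m + 1 \<le> k + \<bar>E\<^sub>f\<bar>\<close>. A Moebius map
  sends one of them to infinity and turns \<open>\<psi>\<^sub>1\<close> into a holomorphic function \<open>G\<close>, with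
  \<open>x\<^sub>z = H \<cdot> nv(G)\<close> and \<open>\<bar>cf u\<bar> = O(\<Prod>\<bar>u - e\<bar> (1 + \<bar>u\<bar>)\<^sup>k)\<close>, where \<open>ds = 2 \<bar>H\<bar> \<bar>cf(G)\<bar> \<bar>dz\<bar>\<close> and \<open>e\<close> runs over
  the finite points of \<open>E\<^sub>f\<close>. Put \<open>N = 2k + 3\<close> and let \<open>X\<close> be the holomorphic vector field
  \<open>G'\<^sup>N / ((H \<Prod>(G - e))\<^bsup>N+1\<^esup> \<Prod>(G - a)\<^bsup>N-1\<^esup>)\<close>, where \<open>a\<close> runs over the finite points of \<open>S\<close>. It replaces the
  passage to the universal covering in Fujimoto's method: nonflatness gives a point with \<open>G' \<noteq> 0\<close>, and
  by Landau's theorem, applied to \<open>G\<close> along a complex trajectory of \<open>X\<close> defined on a disc of radius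
  \<open>R\<close>, the radius is bounded and the speed at \<open>w\<close> is \<open>O((R - \<bar>w\<bar>)\<^bsup>-N/(N+1)\<^esup>)\<close>. For a maximal disc, the
  trajectory cannot be continued across some boundary point, although the radius to that point is
  mapped to a curve of finite length, contradicting completeness.\<close>


section \<open>Calculus of smooth maps in the plane\<close>

text \<open>The field \<open>X\<close> is dual to the flat metric of Fujimoto's method. That metric
  is singular where \<open>G'\<close> vanishes; \<open>X\<close> is holomorphic on all of
  \<open>M\<close>, because the omitted values keep its denominator free of zeros, and its
  trajectories live on discs from the start. Under a change of coordinate both \<open>G'\<close> and
  \<open>H\<close> scale by the derivative of the transition, so \<open>N\<close> factors against
  \<open>N + 1\<close> leave weight -1, that of a vector field.

  The count rests on \<open>cf\<close>, which has degree 1 in \<open>u\<close> and \<open>m\<close>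
  in the conjugate of \<open>u\<close>: growth \<open>m + 1\<close>, less one for each zero. Of the
  \<open>k + 3\<close> omitted values \<open>k + 2\<close> stay finite, and \<open>N\<close> is the
  one number for which the powers of \<open>1 + \<bar>u\<bar>\<close> on the two sides of the Landau
  estimate balance, two of them being spent on its logarithm. Since \<open>N / (N + 1) < 1\<close>,
  the bound on the speed is integrable along the radius.

  The given charts are merely smooth. Stationarity makes the Hodge dual of \<open>dy\<close> closed,
  and the conjugate functions obtained from it yield conformal charts in which \<open>x_z\<close> is
  holomorphic.\<close>

lemma coord_dir_simps [simp]: "coord_dir 1 = 1" "coord_dir 2 = \<i>"
  by (simp_all add: coord_dir_def)

lemma pd_eqI:
  assumes "(f has_derivative f') (at z)"
  shows "pd i f z = f' (coord_dir i)"
  unfolding pd_def using frechet_derivative_at[OF assms] by simp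

lemma has_derivative_pd:
  fixes f :: "complex \<Rightarrow> 'b::real_normed_vector"
  assumes "f differentiable (at z)"
  shows "(f has_derivative (\<lambda>h. Re h *\<^sub>R pd 1 f z + Im h *\<^sub>R pd 2 f z)) (at z)"
proof -
  have d: "(f has_derivative frechet_derivative f (at z)) (at z)"
    using assms frechet_derivative_works by blast
  interpret bounded_linear "frechet_derivative f (at z)"
    by (rule has_derivative_bounded_linear[OF d])
  have "frechet_derivative f (at z) h = Re h *\<^sub>R pd 1 f z + Im h *\<^sub>R pd 2 f z" for h
  proof -
    have "h = Re h *\<^sub>R 1 + Im h *\<^sub>R \<i>" by (simp add: complex_eq_iff)
    then have "frechet_derivative f (at z) h = frechet_derivative f (at z)
        (Re h *\<^sub>R 1 + Im h *\<^sub>R \<i>)"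
      by simp
    then show ?thesis by (simp only: add scaleR pd_def coord_dir_simps)
  qed
  then have "frechet_derivative f (at z) = (\<lambda>h. Re h *\<^sub>R pd 1 f z + Im h *\<^sub>R pd 2 f z)" by blast
  with d show ?thesis by simp
qed

lemma has_derivative_imp_pd:
  assumes "(f has_derivative (\<lambda>h. Re h *\<^sub>R a + Im h *\<^sub>R b)) (at z)"
  shows "pd 1 f z = a" "pd 2 f z = b"
  using pd_eqI[OF assms, of 1] pd_eqI[OF assms, of 2] by simp_all

text \<open>Functions that agree near \<open>z\<close> have the same derivatives there, and
  \<open>frechet_derivative\<close> is a choice among these. The equality thus holds even where
  neither function is differentiable, which keeps the transfer lemmas free of side
  conditions.\<close>

lemma pd_cong:
  assumes "open S" "z \<in> S" "\<And>w. w \<in> S \<Longrightarrow> f w = g w"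
  shows "pd i f z = pd i g z"
proof -
  have "(f has_derivative f') (at z) \<longleftrightarrow> (g has_derivative f') (at z)" for f'
    using has_derivative_transform_within_open[OF _ assms(1,2), of f f' UNIV g]
      has_derivative_transform_within_open[OF _ assms(1,2), of g f' UNIV f] assms(3) by auto
  then show ?thesis by (simp add: pd_def frechet_derivative_def)
qed

lemma differentiable_cong_open:
  assumes "open S" "z \<in> S" "\<And>w. w \<in> S \<Longrightarrow> f w = g w"
  shows "f differentiable (at z) \<longleftrightarrow> g differentiable (at z)"
  unfolding differentiable_def
  using has_derivative_transform_within_open[OF _ assms(1,2), of f _ UNIV g]
      has_derivative_transform_within_open[OF _ assms(1,2), of g _ UNIV f] assms(3) by metis

lemma Ck_on_cong:
  assumes "open S" "\<And>w. w \<in> S \<Longrightarrow> f w = g w"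
  shows "Ck_on k f S \<longleftrightarrow> Ck_on k g S"
  using assms(2)
proof (induction k arbitrary: f g)
  case 0
  then show ?case using continuous_on_cong[of S S f g] by simp
next
  case (Suc k)
  have "Ck_on k (pd i f) S \<longleftrightarrow> Ck_on k (pd i g) S" for i
    by (rule Suc.IH) (use pd_cong[OF assms(1)] Suc.prems in blast)
  then show ?case using differentiable_cong_open[OF assms(1), of _ f g] Suc.prems by auto
qed

lemma Ck_on_subset: "Ck_on k f S \<Longrightarrow> T \<subseteq> S \<Longrightarrow> Ck_on k f T"
  by (induction k arbitrary: f) (auto intro: continuous_on_subset)

lemma Ck_on_SucD: "Ck_on (Suc k) f S \<Longrightarrow> Ck_on k f S"
proof (induction k arbitrary: f)
  case 0
  then show ?case
    by (auto intro!: differentiable_imp_continuous_on simp: differentiable_on_def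
        differentiable_at_withinI)
next
  case (Suc k)
  then show ?case by (metis Ck_on.simps(2))
qed

lemma Ck_on_const [simp]: "Ck_on k (\<lambda>z. c) S"
proof (induction k arbitrary: c)
  case (Suc k)
  have "pd i (\<lambda>z. c) = (\<lambda>z. 0)" for i by (intro ext pd_eqI[THEN trans, of _ "\<lambda>h. 0"]) simp_all
  with Suc show ?case by simp
qed simp

lemma pd_bounded_linear:
  assumes "bounded_linear L" "f differentiable (at z)"
  shows "pd i (\<lambda>w. L (f w)) z = L (pd i f z)"
proof -
  have "(f has_derivative frechet_derivative f (at z)) (at z)"
    using assms(2) frechet_derivative_works by blast
  from pd_eqI[OF bounded_linear.has_derivative[OF assms(1) this]] show ?thesis by (simp add: pd_def)
qed

lemma Ck_on_bounded_linear:
  assumes "bounded_linear L" "open S" "Ck_on k f S"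
  shows "Ck_on k (\<lambda>w. L (f w)) S"
  using assms(3)
proof (induction k arbitrary: f)
  case 0
  then show ?case using bounded_linear.continuous_on[OF assms(1)] by simp
next
  case (Suc k)
  have "Ck_on k (pd i (\<lambda>w. L (f w))) S \<longleftrightarrow> Ck_on k (\<lambda>w. L (pd i f w)) S" for i
    by (rule Ck_on_cong[OF assms(2)]) (use pd_bounded_linear[OF assms(1)] Suc.prems in auto)
  then show ?case
    using Suc
        by (auto simp: differentiable_def) (blast intro: bounded_linear.has_derivative[OF assms(1)])
qed

lemma pd_add:
  assumes "f differentiable (at z)" "g differentiable (at z)"
  shows "pd i (\<lambda>w. f w + g w) z = pd i f z + pd i g z"
  using pd_eqI[OF has_derivative_add[OF assms[unfolded frechet_derivative_works]]]
      by (simp add: pd_def)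

lemma Ck_on_add:
  assumes "open S" "Ck_on k f S" "Ck_on k g S"
  shows "Ck_on k (\<lambda>w. f w + g w) S"
  using assms(2,3)
proof (induction k arbitrary: f g)
  case 0
  then show ?case by (auto intro: continuous_intros)
next
  case (Suc k)
  have "Ck_on k (pd i (\<lambda>w. f w + g w)) S \<longleftrightarrow> Ck_on k (\<lambda>w. pd i f w + pd i g w) S" for i
    by (rule Ck_on_cong[OF assms(1)]) (use Suc.prems in \<open>auto intro!: pd_add\<close>)
  then show ?case using Suc by auto
qed

lemma pd_bilinear:
  assumes "bounded_bilinear bop" "f differentiable (at z)" "g differentiable (at z)"
  shows "pd i (\<lambda>w. bop (f w) (g w)) z = bop (f z) (pd i g z) + bop (pd i f z) (g z)"
  using pd_eqI[OF
      bounded_bilinear.FDERIV[OF assms(1) assms(2,3)[unfolded frechet_derivative_works]]]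
  by (simp add: pd_def)

lemma differentiable_bilinear:
  assumes "bounded_bilinear bop" "f differentiable (at z)" "g differentiable (at z)"
  shows "(\<lambda>w. bop (f w) (g w)) differentiable (at z)"
  using bounded_bilinear.FDERIV[OF assms(1) assms(2,3)[unfolded frechet_derivative_works]]
  unfolding differentiable_def by blast

lemma Ck_on_bilinear:
  assumes "bounded_bilinear bop" "open S" "Ck_on k f S" "Ck_on k g S"
  shows "Ck_on k (\<lambda>w. bop (f w) (g w)) S"
  using assms(3,4)
proof (induction k arbitrary: f g)
  case 0
  then show ?case using bounded_bilinear.continuous_on[OF assms(1)] by simp
next
  case (Suc k)
  have "Ck_on k (pd i (\<lambda>w. bop (f w) (g w))) S \<longleftrightarrow>
      Ck_on k (\<lambda>w. bop (f w) (pd i g w) + bop (pd i f w) (g w)) S" for i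
    by (rule Ck_on_cong[OF assms(2)]) (use pd_bilinear[OF assms(1)] Suc.prems in auto)
  moreover have "Ck_on k (\<lambda>w. bop (f w) (pd i g w) + bop (pd i f w) (g w)) S" for i
    using Suc.prems
        by (intro Ck_on_add[OF assms(2)] Suc.IH) (auto intro: Ck_on_SucD simp del: Ck_on.simps simp:
            Ck_on.simps(2))
  ultimately show ?case
    using Suc.prems by (auto intro!: differentiable_bilinear[OF assms(1)])
qed

lemma has_derivative_pd_compose:
  fixes f :: "complex \<Rightarrow> 'b::real_normed_vector" and g :: "complex \<Rightarrow> complex"
  assumes "f differentiable (at (g z))" "g differentiable (at z)"
  shows "(\<lambda>w. f (g w)) differentiable (at z)"
    and "pd i (\<lambda>w. f (g w)) z = Re (pd i g z) *\<^sub>R pd 1 f (g z) + Im (pd i g z) *\<^sub>R pd 2 f (g z)"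
proof -
  have d: "((\<lambda>w. f (g w)) has_derivative
     (\<lambda>h. Re (frechet_derivative g (at z) h) *\<^sub>R pd 1 f (g z) + Im (frechet_derivative g (at z) h)
         *\<^sub>R pd 2 f (g z))) (at z)"
    by (rule has_derivative_compose[OF assms(2)[unfolded frechet_derivative_works]
        has_derivative_pd[OF assms(1)]])
  then show "(\<lambda>w. f (g w)) differentiable (at z)" unfolding differentiable_def by blast
  show "pd i (\<lambda>w. f (g w)) z = Re (pd i g z) *\<^sub>R pd 1 f (g z) + Im (pd i g z) *\<^sub>R pd 2 f (g z)"
    using pd_eqI[OF d] by (simp add: pd_def)
qed

lemma Ck_on_compose:
  fixes f :: "complex \<Rightarrow> 'b::real_normed_vector" and g :: "complex \<Rightarrow> complex"
  assumes "open S" "Ck_on k g S" "Ck_on k f T" "g ` S \<subseteq> T"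
  shows "Ck_on k (\<lambda>w. f (g w)) S"
  using assms(2,3)
proof (induction k arbitrary: f)
  case 0
  then show ?case using continuous_on_compose2[of T f S g] assms(4) by auto
next
  case (Suc k)
  have d: "g differentiable (at z)" "f differentiable (at (g z))" if "z \<in> S" for z
    using Suc.prems assms(4) that by auto
  have "Ck_on k (pd i (\<lambda>w. f (g w))) S \<longleftrightarrow>
      Ck_on k (\<lambda>w. Re (pd i g w) *\<^sub>R pd 1 f (g w) + Im (pd i g w) *\<^sub>R pd 2 f (g w)) S" for i
    by (rule Ck_on_cong[OF assms(1)]) (intro has_derivative_pd_compose(2) d)
  moreover have "Ck_on k (\<lambda>w. Re (pd i g w) *\<^sub>R pd 1 f (g w) + Im (pd i g w) *\<^sub>R pd 2 f (g w)) S"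
      for i
  proof (intro Ck_on_add[OF assms(1)] Ck_on_bilinear[OF bounded_bilinear_scaleR assms(1)])
    show "Ck_on k (\<lambda>w. Re (pd i g w)) S" "Ck_on k (\<lambda>w. Im (pd i g w)) S"
      using Suc.prems(1)
          by (auto intro: Ck_on_bounded_linear bounded_linear_Re bounded_linear_Im assms(1))
    show "Ck_on k (\<lambda>w. pd 1 f (g w)) S" "Ck_on k (\<lambda>w. pd 2 f (g w)) S"
      using Suc.prems Ck_on_SucD by (auto intro!: Suc.IH)
  qed
  ultimately show ?case using has_derivative_pd_compose(1)[OF d(2) d(1)] by auto
qed

lemma pd_powr:
  fixes h :: "complex \<Rightarrow> real"
  assumes "h differentiable (at z)" "h z > 0"
  shows "(\<lambda>w. h w powr a) differentiable (at z)"
    and "pd i (\<lambda>w. h w powr a) z = (a * h z powr (a - 1)) * pd i h z"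
proof -
  have "((\<lambda>w. h w powr a) has_derivative
      (\<lambda>y. frechet_derivative h (at z) y * (a * h z powr (a - 1)))) (at z)"
    by (rule has_derivative_compose[OF assms(1)[unfolded frechet_derivative_works], of
        "\<lambda>x. x powr a" "\<lambda>y. y * (a * h z powr (a - 1))"])
      (rule has_derivative_eq_rhs[OF has_real_derivative_powr[OF assms(2), of a, unfolded
          has_field_derivative_def]],
        rule ext, rule mult.commute)
  then show "(\<lambda>w. h w powr a) differentiable (at z)"
    "pd i (\<lambda>w. h w powr a) z = (a * h z powr (a - 1)) * pd i h z"
    by (auto simp: differentiable_def pd_eqI) (simp add: pd_def)
qed

text \<open>The exponent is generalised in the induction because each differentiation lowers it by
  one. Quotients and square roots are then the exponents -1 and 1/2.\<close>

lemma Ck_on_powr: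
  fixes h :: "complex \<Rightarrow> real"
  assumes "open S" "Ck_on k h S" "\<And>z. z \<in> S \<Longrightarrow> h z > 0"
  shows "Ck_on k (\<lambda>w. h w powr a) S"
  using assms(2)
proof (induction k arbitrary: a)
  case 0
  then show ?case using assms(3)
    by (auto intro!: continuous_intros less_imp_neq[THEN not_sym] dest: assms(3))
next
  case (Suc k)
  have "Ck_on k (pd i (\<lambda>w. h w powr a)) S \<longleftrightarrow> Ck_on k (\<lambda>w. (a * h w powr (a - 1)) * pd i h w) S" for i
    by (rule Ck_on_cong[OF assms(1)]) (use pd_powr(2)[OF _ assms(3)] Suc.prems in auto)
  moreover have "Ck_on k (\<lambda>w. (a * h w powr (a - 1)) * pd i h w) S" for i
    using Suc.prems Ck_on_SucD[OF Suc.prems]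
    by (intro Ck_on_bilinear[OF bounded_bilinear_mult assms(1)] Ck_on_const Suc.IH) auto
  ultimately show ?case using pd_powr(1)[OF _ assms(3)] Suc.prems by auto
qed

lemma smooth_on_cong: "open S \<Longrightarrow> (\<And>w. w \<in> S \<Longrightarrow> f w = g w) \<Longrightarrow> smooth_on S f \<longleftrightarrow> smooth_on S g"
  unfolding smooth_on_def using Ck_on_cong by blast

lemma smooth_on_subset: "smooth_on S f \<Longrightarrow> T \<subseteq> S \<Longrightarrow> smooth_on T f"
  unfolding smooth_on_def using Ck_on_subset by blast

lemma smooth_on_Un:
  assumes "\<And>T. T \<in> C \<Longrightarrow> smooth_on T f" "\<And>T. T \<in> C \<Longrightarrow> open T"
  shows "smooth_on (\<Union>C) f"
proof -
  have "Ck_on k f (\<Union>C)" for k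
    using assms(1)[unfolded smooth_on_def, rule_format, of _ k]
  proof (induction k arbitrary: f)
    case 0
    then show ?case using assms(2) continuous_on_open_Union[of C f] by auto
  qed auto
  then show ?thesis by (simp add: smooth_on_def)
qed

lemma smooth_on_pd: "smooth_on S f \<Longrightarrow> smooth_on S (pd i f)"
  unfolding smooth_on_def by (metis Ck_on.simps(2))

lemma smooth_on_differentiable: "smooth_on S f \<Longrightarrow> z \<in> S \<Longrightarrow> f differentiable (at z)"
  unfolding smooth_on_def by (metis Ck_on.simps(2))

lemma smooth_on_continuous_on: "smooth_on S f \<Longrightarrow> continuous_on S f"
  unfolding smooth_on_def by (metis Ck_on.simps(1))

lemma smooth_on_const [simp]: "smooth_on S (\<lambda>z. c)"
  by (simp add: smooth_on_def)

lemma smooth_on_add: "open S \<Longrightarrow> smooth_on S f \<Longrightarrow> smooth_on S g \<Longrightarrow> smooth_on S (\<lambda>z. f z + g z)"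
  unfolding smooth_on_def using Ck_on_add by blast

lemma smooth_on_bounded_linear:
  "bounded_linear L \<Longrightarrow> open S \<Longrightarrow> smooth_on S f \<Longrightarrow> smooth_on S (\<lambda>z. L (f z))"
  unfolding smooth_on_def using Ck_on_bounded_linear by blast

lemma smooth_on_bilinear:
  "bounded_bilinear bop \<Longrightarrow> open S \<Longrightarrow> smooth_on S f \<Longrightarrow> smooth_on S g \<Longrightarrow>
    smooth_on S (\<lambda>z. bop (f z) (g z))"
  unfolding smooth_on_def using Ck_on_bilinear by blast

lemma smooth_on_mult:
  fixes f g :: "complex \<Rightarrow> 'a::real_normed_algebra"
  shows "open S \<Longrightarrow> smooth_on S f \<Longrightarrow> smooth_on S g \<Longrightarrow> smooth_on S (\<lambda>z. f z * g z)"
  by (rule smooth_on_bilinear[OF bounded_bilinear_mult])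

lemma smooth_on_minus: "open S \<Longrightarrow> smooth_on S f \<Longrightarrow> smooth_on S (\<lambda>z. - f z)"
  by (rule smooth_on_bounded_linear[OF bounded_linear_minus[OF bounded_linear_ident]])

lemma smooth_on_diff: "open S \<Longrightarrow> smooth_on S f \<Longrightarrow> smooth_on S g \<Longrightarrow> smooth_on S (\<lambda>z. f z - g z)"
  using smooth_on_add[of S f "\<lambda>z. - g z"] smooth_on_minus[of S g] by simp

lemma smooth_on_compose:
  fixes g :: "complex \<Rightarrow> complex"
  shows "open S \<Longrightarrow> smooth_on S g \<Longrightarrow> smooth_on T f \<Longrightarrow> g ` S \<subseteq> T \<Longrightarrow> smooth_on S (\<lambda>z. f (g z))"
  unfolding smooth_on_def using Ck_on_compose by blast

lemma smooth_on_powr: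
  fixes h :: "complex \<Rightarrow> real"
  shows "open S \<Longrightarrow> smooth_on S h \<Longrightarrow> (\<And>z. z \<in> S \<Longrightarrow> h z > 0) \<Longrightarrow> smooth_on S (\<lambda>z. h z powr a)"
  unfolding smooth_on_def using Ck_on_powr by blast

lemma smooth_on_divide:
  fixes f h :: "complex \<Rightarrow> real"
  assumes "open S" "smooth_on S f" "smooth_on S h" "\<And>z. z \<in> S \<Longrightarrow> h z > 0"
  shows "smooth_on S (\<lambda>z. f z / h z)"
proof -
  have "smooth_on S (\<lambda>z. f z * h z powr (-1))"
    by (intro smooth_on_mult smooth_on_powr assms)
  then show ?thesis
    by (rule smooth_on_cong[THEN iffD1, rotated 2])
      (use assms(1,4) in \<open>auto simp: powr_minus_divide less_imp_le\<close>)
qed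

lemma smooth_on_sqrt:
  fixes h :: "complex \<Rightarrow> real"
  assumes "open S" "smooth_on S h" "\<And>z. z \<in> S \<Longrightarrow> h z > 0"
  shows "smooth_on S (\<lambda>z. sqrt (h z))"
  by (rule smooth_on_cong[THEN iffD1, OF _ _ smooth_on_powr[of S h "1/2"]])
    (use assms in \<open>auto simp: powr_half_sqrt less_imp_le\<close>)

lemma smooth_on_Complex:
  assumes "open S" "smooth_on S f" "smooth_on S g"
  shows "smooth_on S (\<lambda>z. Complex (f z) (g z))"
proof -
  have "smooth_on S (\<lambda>z. of_real (f z) + \<i> * of_real (g z))"
    by (intro smooth_on_add smooth_on_mult smooth_on_const
        smooth_on_bounded_linear[OF bounded_linear_of_real] assms)
  then show ?thesis by (simp add: Complex_eq)
qed

lemmas smooth_on_Re = smooth_on_bounded_linear[OF bounded_linear_Re]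
lemmas smooth_on_Im = smooth_on_bounded_linear[OF bounded_linear_Im]
lemmas smooth_on_nth = smooth_on_bounded_linear[OF bounded_linear_vec_nth]
lemmas pd_nth = pd_bounded_linear[OF bounded_linear_vec_nth]

lemma holomorphic_imp_smooth_on:
  assumes "open S" "f holomorphic_on S"
  shows "smooth_on S f"
proof -
  have "Ck_on k f S" for k
    using assms(2)
  proof (induction k arbitrary: f)
    case 0
    then show ?case by (simp add: holomorphic_on_imp_continuous_on)
  next
    case (Suc k)
    have d: "(f has_derivative (\<lambda>h. deriv f z * h)) (at z)" if "z \<in> S" for z
      using holomorphic_derivI[OF Suc.prems assms(1) that] by (simp add: has_field_derivative_def)
    have "Ck_on k (pd i f) S" for i
      by (rule Ck_on_cong[THEN iffD1, OF assms(1) _ Suc.IH[of "\<lambda>z. deriv f z * coord_dir i"]])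
        (use pd_eqI[OF d] Suc.prems assms(1) in \<open>auto intro!: holomorphic_intros\<close>)
    then show ?case using d by (auto simp: differentiable_def)
  qed
  then show ?thesis by (simp add: smooth_on_def)
qed

text \<open>\<open>D z\<close> is the inverse of the Jacobian matrix, written out by Cramer's rule.
  The partial derivatives of \<open>g\<close> are the smooth expression \<open>D\<close> evaluated
  at \<open>g\<close>; so a \<open>C^k\<close> inverse has \<open>C^k\<close> partial derivatives
  and is \<open>C^(k+1)\<close>. The induction starts from the continuity contained in
  \<open>hom\<close>.\<close>

lemma smooth_on_inverse:
  fixes f g :: "complex \<Rightarrow> complex"
  assumes "open S" "smooth_on S f" "\<And>z. z \<in> S \<Longrightarrow> jacobian f z > 0"
    and fS: "open (f ` S)" and hom: "homeomorphism S (f ` S) f g"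
  shows "smooth_on (f ` S) g"
    and "\<And>z. z \<in> S \<Longrightarrow> \<exists>D. (g has_derivative D) (at (f z)) \<and>
       (\<forall>w. Re (D w) *\<^sub>R pd 1 f z + Im (D w) *\<^sub>R pd 2 f z = w)"
proof -
  have gf: "g (f z) = z" if "z \<in> S" for z using hom that by (simp add: homeomorphism_def)
  have contg: "continuous_on (f ` S) g" using hom by (simp add: homeomorphism_def)
  define D where "D z w = Complex ((Re w * Im (pd 2 f z) - Im w * Re (pd 2 f z)) / jacobian f z)
         ((Im w * Re (pd 1 f z) - Re w * Im (pd 1 f z)) / jacobian f z)" for z w
  have D: "Re (D z w) *\<^sub>R pd 1 f z + Im (D z w) *\<^sub>R pd 2 f z = w" if "z \<in> S" for z w
    using assms(3)[OF that] unfolding D_def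
    by (simp add: complex_eq_iff field_simps) (simp add: jacobian_def algebra_simps)
  have der: "(g has_derivative D z) (at (f z))" if z: "z \<in> S" for z
  proof (rule has_derivative_inverse_strong_x[of S g "f z" f])
    show "(f has_derivative (\<lambda>h. Re h *\<^sub>R pd 1 f z + Im h *\<^sub>R pd 2 f z)) (at (g (f z)))"
      unfolding gf[OF z] by (rule has_derivative_pd[OF smooth_on_differentiable[OF assms(2) z]])
    show "(\<lambda>h. Re h *\<^sub>R pd 1 f z + Im h *\<^sub>R pd 2 f z) \<circ> D z = id" using D[OF z] by auto
  qed (use z gf assms smooth_on_continuous_on in auto)
  with D show "\<And>z. z \<in> S \<Longrightarrow> \<exists>D. (g has_derivative D) (at (f z)) \<and>
       (\<forall>w. Re (D w) *\<^sub>R pd 1 f z + Im (D w) *\<^sub>R pd 2 f z = w)"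
    by blast
  have smD: "smooth_on S (\<lambda>z. D z w)" for w
    unfolding D_def jacobian_def
    by (intro smooth_on_Complex smooth_on_divide smooth_on_diff smooth_on_mult smooth_on_const
      smooth_on_Re smooth_on_Im smooth_on_pd assms(1,2) assms(3)[unfolded jacobian_def])
  have "Ck_on k g (f ` S)" for k
  proof (induction k)
    case 0
    then show ?case using contg by simp
  next
    case (Suc k)
    have "Ck_on k (\<lambda>w. D (g w) (coord_dir i)) (f ` S)" for i
      by (rule Ck_on_compose[OF fS Suc.IH, of _ S]) (use smD gf in \<open>auto simp: smooth_on_def\<close>)
    then have "Ck_on k (pd i g) (f ` S)" for i
      by (rule Ck_on_cong[THEN iffD1, OF fS, rotated]) (use pd_eqI[OF der] gf in auto)
    then show ?case using der by (auto simp: differentiable_def)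
  qed
  then show "smooth_on (f ` S) g" by (simp add: smooth_on_def)
qed

lemma smooth_onI_pd:
  assumes "\<And>z. z \<in> S \<Longrightarrow> f differentiable (at z)" "\<And>i. smooth_on S (pd i f)"
  shows "smooth_on S f"
  unfolding smooth_on_def by (rule allI, rule Ck_on_SucD) (use assms in \<open>auto simp: smooth_on_def\<close>)

lemma jacobian_compose:
  assumes "f differentiable (at (g z))" "g differentiable (at z)"
  shows "jacobian (\<lambda>w. f (g w)) z = jacobian f (g z) * jacobian g z"
  unfolding jacobian_def has_derivative_pd_compose(2)[OF assms] by (simp add: algebra_simps)

lemma continuous_on_jacobian:
  assumes "open S" "smooth_on S f"
  shows "continuous_on S (jacobian f)"
  unfolding jacobian_def
  by (intro continuous_intros smooth_on_continuous_on[OF smooth_on_pd[OF assms(2)]])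

text \<open>Continuity of the partial derivatives is continuity of the derivative in operator norm,
  which together with the Cramer inverse \<open>D\<close> at \<open>z0\<close> gives injectivity on
  a ball; invariance of domain then makes the image open. The ball is taken inside the set of
  positive Jacobian so that \<open>smooth_on_inverse\<close> applies on all of it.\<close>

lemma smooth_local_inverse:
  fixes f :: "complex \<Rightarrow> complex"
  assumes S: "open S" and sm: "smooth_on S f" and z0: "z0 \<in> S" "jacobian f z0 > 0"
  obtains W g where "open W" "z0 \<in> W" "W \<subseteq> S" "\<And>z. z \<in> W \<Longrightarrow> jacobian f z > 0"
    "open (f ` W)" "homeomorphism W (f ` W) f g"
proof -
  define T where "T = {z \<in> S. jacobian f z > 0}"
  have T: "open T"
  proof -
    have "open (jacobian f -` {0<..} \<inter> S)"
      using continuous_on_jacobian[OF S sm] continuous_on_open_vimage[OF S] open_greaterThan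
          by blast
    moreover have "T = jacobian f -` {0<..} \<inter> S" by (auto simp: T_def)
    ultimately show ?thesis by simp
  qed
  have zT: "z0 \<in> T" and TS: "T \<subseteq> S" using z0 by (auto simp: T_def)
  define f' where "f' z h = Re h *\<^sub>R pd 1 f z + Im h *\<^sub>R pd 2 f z" for z and h :: complex
  define D where "D w = Complex ((Re w * Im (pd 2 f z0) - Im w * Re (pd 2 f z0)) / jacobian f z0)
         ((Im w * Re (pd 1 f z0) - Re w * Im (pd 1 f z0)) / jacobian f z0)" for w
  have "D (f' z0 h) = h" for h
    using z0(2)
        by (simp add: D_def f'_def complex_eq_iff field_simps)
            (simp add: jacobian_def algebra_simps)
  then have Df: "D \<circ> f' z0 = id" by auto
  have "linear D"
    by (rule linearI) (simp_all add: D_def complex_eq_iff algebra_simps add_divide_distrib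
        diff_divide_distrib)
  then have blD: "bounded_linear D" by (rule linear_conv_bounded_linear[THEN iffD1])
  obtain r where r: "r > 0" "ball z0 r \<subseteq> T" "inj_on f (ball z0 r)"
  proof (rule has_derivative_locally_injective[where f' = f' and g' = D, OF zT T blD])
    show "D \<circ> f' z0 = id" by (rule Df)
    show "(f has_derivative f' x) (at x)" if "x \<in> T" for x
      unfolding f'_def by (rule has_derivative_pd[OF smooth_on_differentiable[OF sm]])
          (use that TS in auto)
    fix e :: real assume e: "e > 0"
    have "isCont (pd i f) z0" for i
      using smooth_on_differentiable[OF smooth_on_pd[OF sm] z0(1)]
          differentiable_imp_continuous_within by blast
    then have "\<forall>i. \<exists>d>0. \<forall>x. dist x z0 < d \<longrightarrow> dist (pd i f x) (pd i f z0) < e / 3"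
      unfolding continuous_at_eps_delta using e by (metis zero_less_divide_iff zero_less_numeral)
    then obtain d
        where d: "\<And>i. d i > 0" "\<And>i x. dist x z0 < d i \<Longrightarrow> dist (pd i f x) (pd i f z0) < e / 3"
      by metis
    have "onorm (\<lambda>v. f' x v - f' z0 v) < e" if x: "dist z0 x < min (d 1) (d 2)" for x
    proof -
      have "norm (f' x v - f' z0 v) \<le> (2 * e / 3) * norm v" for v
      proof -
        have "f' x v - f' z0 v = Re v *\<^sub>R (pd 1 f x - pd 1 f z0) + Im v *\<^sub>R (pd 2 f x - pd 2 f z0)"
          by (simp add: f'_def algebra_simps)
        then have "norm (f' x v - f' z0 v) \<le> \<bar>Re v\<bar> * norm (pd 1 f x - pd 1 f z0) + \<bar>Im v\<bar> * norm
            (pd 2 f x - pd 2 f z0)"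
          using norm_triangle_ineq[of "Re v *\<^sub>R (pd 1 f x - pd 1 f z0)"
              "Im v *\<^sub>R (pd 2 f x - pd 2 f z0)"]
          unfolding norm_scaleR by simp
        also have "\<dots> \<le> norm v * (e / 3) + norm v * (e / 3)"
          using d(2)[of x 1] d(2)[of x 2] x
          by (intro add_mono mult_mono abs_Re_le_cmod abs_Im_le_cmod)
              (auto simp: dist_norm norm_minus_commute)
        finally show ?thesis by simp
      qed
      then have "onorm (\<lambda>v. f' x v - f' z0 v) \<le> 2 * e / 3" using e by (intro onorm_bound) auto
      then show ?thesis using e by simp
    qed
    then show "\<exists>d>0. \<forall>x. dist z0 x < d \<longrightarrow> onorm (\<lambda>v. f' x v - f' z0 v) < e"
      using d(1) by (intro exI[of _ "min (d 1) (d 2)"]) auto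
  qed
  have cont: "continuous_on (ball z0 r) f"
    using smooth_on_continuous_on[OF sm] r(2) TS continuous_on_subset by blast
  obtain g where "homeomorphism (ball z0 r) (f ` ball z0 r) f g"
    using invariance_of_domain_homeomorphism[OF open_ball cont _ r(3)] by auto
  moreover have "open (f ` ball z0 r)" by (rule invariance_of_domain[OF cont open_ball r(3)])
  ultimately show ?thesis
    using that[of "ball z0 r" g] r(1) subset_trans[OF r(2) TS] subsetD[OF r(2)] by (simp add: T_def)
qed

section \<open>Symmetry of second derivatives\<close>

lemma DERIV_pd:
  fixes f :: "complex \<Rightarrow> real"
  assumes "f differentiable (at (z + of_real t * coord_dir i))"
  shows
      "((\<lambda>t. f (z + of_real t * coord_dir i)) has_real_derivative pd i f
          (z + of_real t * coord_dir i)) (at t)"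
proof -
  let ?w = "z + of_real t * coord_dir i"
  have 1: "((\<lambda>t. z + of_real t * coord_dir i) has_derivative (\<lambda>h. of_real h * coord_dir i)) (at t)"
    by (auto intro!: derivative_eq_intros)
  have "((\<lambda>t. f (z + of_real t * coord_dir i)) has_derivative
      (\<lambda>h. frechet_derivative f (at ?w) (of_real h * coord_dir i))) (at t)"
    by (rule has_derivative_compose[OF 1 assms[unfolded frechet_derivative_works]])
  moreover have "frechet_derivative f (at ?w) (of_real h * coord_dir i) = pd i f ?w * h" for h
    using linear_scale[OF linear_frechet_derivative[OF assms], of h "coord_dir i"]
    by (simp add: pd_def scaleR_conv_of_real mult.commute)
  ultimately show ?thesis by (simp add: has_field_derivative_def)
qed

text \<open>Mean value theorem twice: in direction \<open>i\<close> for the difference of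
  \<open>f\<close> in direction \<open>j\<close>, then in direction \<open>j\<close> for
  \<open>pd i f\<close>. The second difference is symmetric in \<open>i\<close> and
  \<open>j\<close>, which is what Schwarz's theorem exploits.\<close>

lemma pd_second_difference:
  fixes f :: "complex \<Rightarrow> real"
  assumes sm: "smooth_on (ball z r) f" and h: "h > 0" "2 * h < r" and ij: "i \<noteq> j"
  obtains s t where "0 < s" "s < h" "0 < t" "t < h"
    "f (z + of_real h * coord_dir i + of_real h * coord_dir j) - f (z + of_real h * coord_dir i)
      - f (z + of_real h * coord_dir j) + f z
     = h * h * pd j (pd i f) (z + of_real s * coord_dir i + of_real t * coord_dir j)"
proof -
  have nc: "norm (coord_dir l) = 1" for l by (simp add: coord_dir_def)
  have inb: "z + of_real s * coord_dir i + of_real t * coord_dir j \<in> ball z r"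
    if "0 \<le> s" "s \<le> h" "0 \<le> t" "t \<le> h" for s t
  proof -
    have "norm (of_real s * coord_dir i + of_real t * coord_dir j) \<le> s + t"
      by (rule norm_triangle_le) (use that nc in \<open>auto simp: norm_mult\<close>)
    also have "\<dots> < r" using that h by simp
    finally show ?thesis
      by (simp add: dist_norm add.assoc
          norm_minus_cancel[of "of_real s * coord_dir i + of_real t * coord_dir j", symmetric]
          del: norm_minus_cancel)
  qed
  have d0: "f differentiable (at w)" "pd i f differentiable (at w)" if "w \<in> ball z r" for w
    using smooth_on_differentiable[OF sm that] smooth_on_differentiable[OF smooth_on_pd[OF sm] that]
        by auto
  have dT: "((\<lambda>s. f (z + of_real s * coord_dir i + of_real t * coord_dir j)) has_real_derivative
      pd i f (z + of_real s * coord_dir i + of_real t * coord_dir j)) (at s)"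
    if "0 \<le> s" "s \<le> h" "0 \<le> t" "t \<le> h" for s t
    using DERIV_pd[of f "z + of_real t * coord_dir j" s i] d0(1)[OF inb[OF that]]
    by (simp add: add_ac)
  have "\<exists>s>0. s < h \<and> (\<lambda>s. f (z + of_real s * coord_dir i + of_real h * coord_dir j) - f
      (z + of_real s * coord_dir i + of_real 0 * coord_dir j)) h
      - (\<lambda>s. f (z + of_real s * coord_dir i + of_real h * coord_dir j) - f
          (z + of_real s * coord_dir i + of_real 0 * coord_dir j)) 0
      = (h - 0) * (pd i f (z + of_real s * coord_dir i + of_real h * coord_dir j) - pd i f
          (z + of_real s * coord_dir i + of_real 0 * coord_dir j))"
    by (rule MVT2[OF h(1)]) (use h in \<open>auto intro!: DERIV_diff dT dT[of _ 0, simplified]\<close>)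
  then obtain s where s: "0 < s" "s < h"
    "f (z + of_real h * coord_dir i + of_real h * coord_dir j) - f (z + of_real h * coord_dir i)
      - (f (z + of_real h * coord_dir j) - f z)
      = h * (pd i f (z + of_real s * coord_dir i + of_real h * coord_dir j) - pd i f
          (z + of_real s * coord_dir i))"
    by auto
  have "\<exists>t>0. t < h \<and> pd i f (z + of_real s * coord_dir i + of_real h * coord_dir j)
        - pd i f (z + of_real s * coord_dir i + of_real 0 * coord_dir j)
      = (h - 0) * pd j (pd i f) (z + of_real s * coord_dir i + of_real t * coord_dir j)"
    by (rule MVT2[OF h(1)]) (use s in \<open>auto intro!: DERIV_pd d0 inb\<close>)
  then obtain t
      where "0 < t" "t < h" "pd i f (z + of_real s * coord_dir i + of_real h * coord_dir j)
        - pd i f (z + of_real s * coord_dir i)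
      = h * pd j (pd i f) (z + of_real s * coord_dir i + of_real t * coord_dir j)" by auto
  then show ?thesis using s by (intro that[of s t]) auto
qed

text \<open>For every \<open>n\<close> one and the same second difference, divided by the square of
  \<open>h n\<close>, is a value of each of the two mixed derivatives at a point near
  \<open>z\<close>; continuity finishes as \<open>h n\<close> tends to 0.\<close>

lemma pd_commute_real:
  fixes f :: "complex \<Rightarrow> real"
  assumes "open S" "smooth_on S f" "z \<in> S"
  shows "pd i (pd j f) z = pd j (pd i f) z"
proof (cases "i = j")
  case ij: False
  obtain r where r: "r > 0" "ball z r \<subseteq> S" using assms open_contains_ball by blast
  have sm: "smooth_on (ball z r) f" using assms(2) r smooth_on_subset by blast
  define h where "h n = r / 4 / real (Suc n)" for n
  have h: "h n > 0" "2 * h n < r" for n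
    using r by (auto simp: h_def divide_simps)
  have "(\<lambda>n. r / 4 * inverse (real (Suc n))) \<longlonglongrightarrow> r / 4 * 0"
    by (intro tendsto_mult tendsto_const LIMSEQ_inverse_real_of_nat)
  moreover have "h = (\<lambda>n. r / 4 * inverse (real (Suc n)))"
    by (rule ext) (simp only: h_def divide_inverse)
  ultimately have h0: "h \<longlonglongrightarrow> 0" by (simp only: mult_zero_right)
  have lim: "(\<lambda>n. pd b (pd a f) (z + of_real (s n) * coord_dir a + of_real (t n) * coord_dir b)) \<longlonglongrightarrow>
      pd b (pd a f) z"
    if st: "\<And>n. 0 < s n" "\<And>n. s n < h n" "\<And>n. 0 < t n" "\<And>n. t n < h n" for a b s t
  proof -
    have "s \<longlonglongrightarrow> 0" "t \<longlonglongrightarrow> 0"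
      by (rule tendsto_sandwich[OF _ _ tendsto_const h0]; use st
          in \<open>auto intro!: always_eventually less_imp_le\<close>)+
    then have "(\<lambda>n. z + of_real (s n) * coord_dir a + of_real (t n) * coord_dir b) \<longlonglongrightarrow> z + of_real 0 *
        coord_dir a + of_real 0 * coord_dir b"
      by (intro tendsto_intros)
    moreover have "isCont (pd b (pd a f)) z"
      using smooth_on_differentiable[OF smooth_on_pd[OF smooth_on_pd[OF assms(2)]] assms(3)]
        differentiable_imp_continuous_within by blast
    ultimately show ?thesis
      by (intro isCont_tendsto_compose[of z "pd b (pd a f)"])
          (simp_all only: of_real_0 mult_zero_left add_0_right)
  qed
  have "\<forall>n. \<exists>s t. 0 < s \<and> s < h n \<and> 0 < t \<and> t < h n \<and>
    f (z + of_real (h n) * coord_dir a + of_real (h n) * coord_dir b) - f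
        (z + of_real (h n) * coord_dir a)
      - f (z + of_real (h n) * coord_dir b) + f z
     = h n * h n * pd b (pd a f) (z + of_real s * coord_dir a + of_real t * coord_dir b)" if "a \<noteq>
         b" for a b
    using pd_second_difference[OF sm h that] by metis
  from this[OF ij] this[OF ij[symmetric]] obtain s t s' t'
      where st: "\<And>n. 0 < s n" "\<And>n. s n < h n" "\<And>n. 0 < t n" "\<And>n. t n < h n"
    "\<And>n. 0 < s' n" "\<And>n. s' n < h n" "\<And>n. 0 < t' n" "\<And>n. t' n < h n"
    and e:
        "\<And>n. f (z + of_real (h n) * coord_dir i + of_real (h n) * coord_dir j) - f
            (z + of_real (h n) * coord_dir i)
      - f (z + of_real (h n) * coord_dir j) + f z
     = h n * h n * pd j (pd i f) (z + of_real (s n) * coord_dir i + of_real (t n) * coord_dir j)"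
    "\<And>n. f (z + of_real (h n) * coord_dir j + of_real (h n) * coord_dir i) - f
        (z + of_real (h n) * coord_dir j)
      - f (z + of_real (h n) * coord_dir i) + f z
     = h n * h n * pd i (pd j f) (z + of_real (s' n) * coord_dir j + of_real (t' n) * coord_dir i)"
    by metis
  have "pd j (pd i f) (z + of_real (s n) * coord_dir i + of_real (t n) * coord_dir j)
      = pd i (pd j f) (z + of_real (s' n) * coord_dir j + of_real (t' n) * coord_dir i)" for n
  proof -
    have "h n * h n * pd j (pd i f) (z + of_real (s n) * coord_dir i + of_real (t n) * coord_dir j)
      = h n * h n * pd i (pd j f) (z + of_real (s' n) * coord_dir j + of_real (t' n) * coord_dir i)"
    proof -
      have c: "z + of_real (h n) * coord_dir j + of_real (h n) * coord_dir i
          = z + of_real (h n) * coord_dir i + of_real (h n) * coord_dir j" by (simp add: add_ac)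
      show ?thesis using e(1)[of n] e(2)[of n] unfolding c by linarith
    qed
    then show ?thesis using h(1)[of n] by simp
  qed
  then show ?thesis
    using lim[of s t j i] lim[of s' t' i j] st LIMSEQ_unique by (metis (no_types, lifting) ext)
qed simp

lemma pd_commute:
  fixes f :: "complex \<Rightarrow> real ^ 'n"
  assumes "open S" "smooth_on S f" "z \<in> S"
  shows "pd i (pd j f) z = pd j (pd i f) z"
proof (rule vec_eq_iff[THEN iffD2], rule allI)
  fix k
  have 1: "pd a (pd b f) z $ k = pd a (pd b (\<lambda>w. f w $ k)) z" for a b
  proof -
    have "pd a (pd b f) z $ k = pd a (\<lambda>w. pd b f w $ k) z"
      using pd_nth[OF smooth_on_differentiable[OF smooth_on_pd[OF assms(2)] assms(3)]] by metis
    also have "\<dots> = pd a (pd b (\<lambda>w. f w $ k)) z"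
      by (rule pd_cong[OF assms(1,3)]) (use pd_nth smooth_on_differentiable[OF assms(2)] in metis)
    finally show ?thesis .
  qed
  show "pd i (pd j f) z $ k = pd j (pd i f) z $ k"
    unfolding 1 by (rule pd_commute_real[OF assms(1) smooth_on_nth[OF assms(1,2)] assms(3)])
qed

text \<open>Poincare lemma: the primitive \<open>g\<close> is the integral of the form along the
  segment from \<open>z0\<close> to \<open>z\<close>, differentiated under the integral
  sign.\<close>

lemma closed_form_exact:
  fixes P Q :: "complex \<Rightarrow> real"
  assumes smP: "smooth_on (ball z0 r) P" and smQ: "smooth_on (ball z0 r) Q"
    and closed: "\<And>z. z \<in> ball z0 r \<Longrightarrow> pd 1 Q z = pd 2 P z"
  obtains g where "\<And>z. z \<in> ball z0 r \<Longrightarrow> (g has_derivative (\<lambda>h. Re h * P z + Im h * Q z)) (at z)"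
proof -
  define U where "U = ball z0 r"
  define c where "c z t = z0 + of_real t * (z - z0)" for z and t :: real
  have cU: "c z t \<in> U" if "z \<in> U" "t \<in> cbox 0 1" for z t
  proof -
    have "norm (of_real t * (z - z0)) \<le> 1 * norm (z - z0)"
      unfolding norm_mult by (rule mult_right_mono) (use that in auto)
    then show ?thesis using that(1) by (simp add: U_def c_def dist_norm norm_minus_commute)
  qed
  have contc: "continuous_on (U \<times> cbox 0 1) (\<lambda>(z, t). c z t)"
    unfolding c_def case_prod_beta by (intro continuous_intros)
  \<comment> \<open>\<open>A F z t\<close> is the derivative of \<open>t * F (c z t)\<close> with
    respect to \<open>t\<close>, so its integral over the unit interval is
    \<open>F z\<close>.\<close>
  define A
      where "A F z t = F (c z t) + t * (Re (z - z0) * pd 1 F (c z t) + Im (z - z0) * pd 2 F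
          (c z t))"
    for F :: "complex \<Rightarrow> real" and z t
  have contA: "continuous_on (U \<times> cbox 0 1) (\<lambda>(z, t). A F z t)" if "smooth_on U F" for F
  proof -
    have *: "continuous_on (U \<times> cbox 0 1) (\<lambda>x. G (c (fst x) (snd x)))" if "smooth_on U G"
        for G :: "complex \<Rightarrow> real"
      by (rule continuous_on_compose2[OF smooth_on_continuous_on[OF that]
          contc[unfolded case_prod_beta]])
        (use cU in auto)
    show ?thesis
      unfolding A_def case_prod_beta using that
      by (intro continuous_intros * smooth_on_pd)
  qed
  have intA: "(A F z has_integral F z) (cbox 0 1)" if sm: "smooth_on U F" and z: "z \<in> U" for F z
  proof -
    have "((\<lambda>t. t * F (c z t)) has_vector_derivative A F z t) (at t within cbox 0 1)"
        if t: "t \<in> cbox 0 1" for t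
    proof -
      have 1: "((\<lambda>t. c z t) has_derivative (\<lambda>s. of_real s * (z - z0))) (at t within cbox 0 1)"
        unfolding c_def by (auto intro!: derivative_eq_intros)
      have "((\<lambda>t. F (c z t)) has_derivative (\<lambda>s. Re (of_real s * (z - z0)) *\<^sub>R pd 1 F (c z t) + Im
          (of_real s * (z - z0)) *\<^sub>R pd 2 F (c z t))) (at t within cbox 0 1)"
        by (rule
            has_derivative_compose[OF 1
                has_derivative_pd[OF smooth_on_differentiable[OF sm cU[OF z t]]]])
      from has_derivative_mult[OF has_derivative_ident this]
      show ?thesis unfolding has_vector_derivative_def A_def
        by (rule has_derivative_eq_rhs) (auto simp: algebra_simps)
    qed
    from fundamental_theorem_of_calculus[OF _ this[unfolded box_real]]
    show ?thesis by (simp add: c_def)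
  qed
  have bl: "blinfun_apply (Blinfun Re) = Re" "blinfun_apply (Blinfun Im) = Im"
    by (simp_all add: bounded_linear_Blinfun_apply bounded_linear_Re bounded_linear_Im)
  define f where "f z t = Re (z - z0) * P (c z t) + Im (z - z0) * Q (c z t)" for z t
  \<comment> \<open>The derivative of \<open>f z t\<close> in \<open>z\<close>. Closedness regroups
    its cross terms into \<open>A P\<close> and \<open>A Q\<close>, whose integrals are known. It is
    packed as a \<open>blinfun\<close> because \<open>leibniz_rule\<close> expects this
    form.\<close>
  define fx where "fx z t = A P z t *\<^sub>R Blinfun Re + A Q z t *\<^sub>R Blinfun Im" for z t
  have sm: "smooth_on U P" "smooth_on U Q" using smP smQ by (auto simp: U_def)
  have dfx: "((\<lambda>z. f z t) has_derivative blinfun_apply (fx z t)) (at z within U)"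
    if z: "z \<in> U" and t: "t \<in> cbox 0 1" for z t
  proof -
    have 1: "((\<lambda>z. c z t) has_derivative (\<lambda>h. of_real t * h)) (at z within U)"
      unfolding c_def by (auto intro!: derivative_eq_intros)
    have 2:
        "((\<lambda>z. F (c z t)) has_derivative (\<lambda>h. Re (of_real t * h) *\<^sub>R pd 1 F (c z t) + Im
            (of_real t * h) *\<^sub>R pd 2 F (c z t))) (at z within U)"
      if "smooth_on U F" for F :: "complex \<Rightarrow> real"
      by (rule
          has_derivative_compose[OF 1
              has_derivative_pd[OF smooth_on_differentiable[OF that cU[OF z t]]]])
    have cl: "pd 1 Q (c z t) = pd 2 P (c z t)" using closed cU[OF z t] by (simp add: U_def)
    show ?thesis
      unfolding f_def
      by (rule has_derivative_eq_rhs, (rule derivative_eq_intros 2 sm refl)+)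
        (rule ext, simp add: fx_def A_def blinfun.add_left blinfun.scaleR_left bl cl, simp add:
            algebra_simps)
  qed
  define g where "g z = integral (cbox 0 1) (f z)" for z
  have contF: "continuous_on (cbox 0 1) (\<lambda>t. F (c z t))" if "z \<in> U" "smooth_on U F"
      for F :: "complex \<Rightarrow> real" and z
    by (rule continuous_on_compose2[OF smooth_on_continuous_on[OF that(2)]])
      (use cU[OF that(1)] in \<open>auto simp: c_def intro!: continuous_intros\<close>)
  show ?thesis
  proof (rule that[of g])
    fix z assume "z \<in> ball z0 r"
    then have z: "z \<in> U" by (simp add: U_def)
    have "(g has_derivative blinfun_apply (integral (cbox 0 1) (fx z))) (at z within U)"
      unfolding g_def
    proof (rule leibniz_rule[OF dfx _ _ z])
      show "f z integrable_on cbox 0 1" if "z \<in> U" for z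
        unfolding f_def by (intro integrable_continuous continuous_intros contF that sm)
      show "continuous_on (U \<times> cbox 0 1) (\<lambda>(z, t). fx z t)"
        unfolding fx_def case_prod_beta
        using contA[OF sm(1)] contA[OF sm(2)]
            by (intro continuous_intros) (simp_all add: case_prod_beta)
    qed (auto simp: U_def)
    moreover have "(fx z has_integral (P z *\<^sub>R Blinfun Re + Q z *\<^sub>R Blinfun Im)) (cbox 0 1)"
      unfolding fx_def by (intro has_integral_add has_integral_scaleR_left intA sm z)
    then have "blinfun_apply (integral (cbox 0 1) (fx z)) = (\<lambda>h. Re h * P z + Im h * Q z)"
      by (simp add: integral_unique blinfun.add_left blinfun.scaleR_left bl fun_eq_iff)
    moreover have "at z within U = at z" by (rule at_within_open[OF z]) (simp add: U_def)
    ultimately show "(g has_derivative (\<lambda>h. Re h * P z + Im h * Q z)) (at z)" by (simp only:)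
  qed
qed


section \<open>Landau-type estimates\<close>

lemma finite_separation:
  fixes T :: "'a::metric_space set"
  assumes "finite T"
  obtains d where "d > 0" "\<And>x y. x \<in> T \<Longrightarrow> y \<in> T \<Longrightarrow> x \<noteq> y \<Longrightarrow> d \<le> dist x y"
proof -
  define D where "D = (\<lambda>(x, y). dist x y) ` {(x, y) \<in> T \<times> T. x \<noteq> y}"
  have fin: "finite D"
    unfolding D_def by (rule finite_imageI, rule finite_subset[of _ "T \<times> T"]) (use assms in auto)
  show ?thesis
  proof (rule that[of "Min (insert 1 D)"])
    show "Min (insert 1 D) > 0" using fin by (auto simp: D_def)
    show "Min (insert 1 D) \<le> dist x y" if "x \<in> T" "y \<in> T" "x \<noteq> y" for x y
      using that fin by (intro Min_le) (auto simp: D_def image_iff)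
  qed
qed

text \<open>The witness \<open>e\<close> is a point of \<open>T\<close> nearest to \<open>u\<close>.
  All other points of \<open>T\<close> are at least half the separation \<open>d\<close> away from
  \<open>u\<close>, hence at a distance comparable to \<open>1 + norm u\<close>; only the factor of
  \<open>e\<close> can be small.\<close>

lemma prod_dist_lower_bound:
  fixes T :: "'a::real_normed_field set"
  assumes "finite T" "T \<noteq> {}"
  obtains c where "c > 0"
    "\<And>u. \<exists>e\<in>T. c * norm (u - e) * (1 + norm u) ^ (card T - 1) \<le> (\<Prod>e\<in>T. norm (u - e))"
proof -
  obtain d where d: "d > 0" "\<And>x y. x \<in> T \<Longrightarrow> y \<in> T \<Longrightarrow> x \<noteq> y \<Longrightarrow> d \<le> dist x y"
    using finite_separation[OF assms(1)] by blast
  obtain K where K: "K \<ge> 0" "\<And>x. x \<in> T \<Longrightarrow> norm x \<le> K"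
    using finite_imp_bounded[OF assms(1)] unfolding bounded_pos by (meson less_imp_le)
  \<comment> \<open>From \<open>d \<le> 2 * norm (u - x)\<close> and \<open>norm x \<le> K\<close>
    follows \<open>1 + norm u \<le> norm (u - x) * (1 + 2 * (1 + K) / d)\<close>.\<close>
  define c where "c = inverse (1 + 2 * (1 + K) / d)"
  have c: "c > 0" using d K by (auto simp: c_def intro!: add_pos_nonneg)
  show ?thesis
  proof (rule that[of "c ^ (card T - 1)"])
    show "c ^ (card T - 1) > 0" using c by simp
    fix u :: 'a
    have "\<exists>e\<in>T. \<forall>x\<in>T. norm (u - e) \<le> norm (u - x)"
      using arg_min_if_finite[OF assms, of "\<lambda>x. norm (u - x)"] by (metis not_le)
    then obtain e where e: "e \<in> T" "\<And>x. x \<in> T \<Longrightarrow> norm (u - e) \<le> norm (u - x)" by blast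
    have le: "c * (1 + norm u) \<le> norm (u - x)" if x: "x \<in> T - {e}" for x
    proof -
      have "d \<le> norm (x - e)" using d(2)[of x e] x e(1) by (auto simp: dist_norm)
      also have "\<dots> \<le> norm (u - e) + norm (u - x)" by (metis dist_norm dist_triangle3 add.commute)
      also have "\<dots> \<le> 2 * norm (u - x)" using e(2)[of x] x by simp
      finally have 1: "d \<le> 2 * norm (u - x)" .
      have "norm u \<le> norm (u - x) + norm x" by (metis norm_triangle_sub add.commute)
      then have "1 + norm u \<le> norm (u - x) + (1 + K)" using K(2)[of x] x by simp
      also have "1 + K \<le> (1 + K) / d * (2 * norm (u - x))"
        using mult_left_mono[OF 1, of "(1 + K) / d"] d(1) K(1) by simp
      finally have "1 + norm u \<le> norm (u - x) * (1 + 2 * (1 + K) / d)" by (simp add: field_simps)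
      then show ?thesis
        unfolding c_def using d(1) K(1)
        by (simp add: divide_inverse[symmetric] pos_divide_le_eq add_pos_nonneg mult.commute)
    qed
    have "(\<Prod>x\<in>T - {e}. c * (1 + norm u)) \<le> (\<Prod>x\<in>T - {e}. norm (u - x))"
      using le c by (intro prod_mono) auto
    then have "c ^ (card T - 1) * (1 + norm u) ^ (card T - 1) \<le> (\<Prod>x\<in>T - {e}. norm (u - x))"
      using assms(1) e(1) by (simp add: power_mult_distrib)
    then have "norm (u - e) * (c ^ (card T - 1) * (1 + norm u) ^ (card T - 1))
        \<le> norm (u - e) * (\<Prod>x\<in>T - {e}. norm (u - x))"
      by (rule mult_left_mono) simp
    also have "\<dots> = (\<Prod>e\<in>T. norm (u - e))"
      using assms(1) e(1) by (simp add: prod.remove)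
    finally show "\<exists>e\<in>T. c ^ (card T - 1) * norm (u - e) * (1 + norm u) ^ (card T - 1)
        \<le> (\<Prod>e\<in>T. norm (u - e))"
      using e(1) by (intro bexI[of _ e]) (simp_all add: mult_ac)
  qed
qed

text \<open>The logarithmic factor comes from applying Schottky's theorem to an \<open>n\<close>-th root of \<open>f\<close>,
  where \<open>n\<close> is about \<open>ln \<bar>f 0\<bar>\<close>, so that the root is of bounded size at \<open>0\<close>.\<close>

lemma landau_aux:
  obtains C where "C > 0"
    "\<And>f. f holomorphic_on cball 0 1 \<Longrightarrow> (\<And>z. z \<in> cball 0 1 \<Longrightarrow> f z \<noteq> 0 \<and> f z \<noteq> 1) \<Longrightarrow>
       norm (f 0) \<ge> 1 \<Longrightarrow> norm (deriv f 0) \<le> C * norm (f 0) * (1 + \<bar>ln (norm (f 0))\<bar>)"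
proof -
  \<comment> \<open>Schottky's bound on the disc of radius 1/2 for a function of modulus at most
    \<open>exp 1\<close> at the origin.\<close>
  define K where "K = exp (pi * exp (pi * (2 + 2 * exp 1 + 12 * (1/2) / (1 - (1/2)))))"
  have K: "K > 0" by (simp add: K_def)
  show ?thesis
  proof (rule that[of "4 * K"])
    show "4 * K > 0" using K by simp
    fix f :: "complex \<Rightarrow> complex"
    assume hol: "f holomorphic_on cball 0 1" and om: "\<And>z. z \<in> cball 0 1 \<Longrightarrow> f z \<noteq> 0 \<and> f z \<noteq> 1"
      and ge: "norm (f 0) \<ge> 1"
    obtain L where L: "L holomorphic_on cball 0 1" "\<And>z. z \<in> cball 0 1 \<Longrightarrow> f z = exp (L z)"
      using contractible_imp_holomorphic_log[OF hol convex_imp_contractible[OF convex_cball]] om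
      by blast
    define l where "l = ln (norm (f 0))"
    have l: "l \<ge> 0" using ge by (simp add: l_def)
    \<comment> \<open>\<open>n \<ge> l\<close> brings the modulus of the root at 0 below
      \<open>exp 1\<close>, while \<open>n \<le> l + 2\<close> keeps the factor \<open>n\<close>
      from differentiating the power logarithmic. The added 1 ensures \<open>n > 0\<close>.\<close>
    define n where "n = nat \<lceil>l\<rceil> + 1"
    have n: "real n \<ge> l" "real n \<le> l + 2" "n > 0" using l by (auto simp: n_def) linarith+
    define h where "h z = exp (L z / of_nat n)" for z
    have holh: "h holomorphic_on cball 0 1" unfolding h_def
      by (intro holomorphic_intros L) (use n in auto)
    have hn: "h z ^ n = f z" if "z \<in> cball 0 1" for z
      using L(2)[OF that] n by (simp add: h_def exp_of_nat_mult[symmetric])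
    have h0: "norm (h 0) ^ n = norm (f 0)" using hn[of 0] by (simp add: norm_power[symmetric])
    have h0ge: "norm (h 0) \<ge> 1"
    proof (rule ccontr)
      assume "\<not> ?thesis"
      then have "norm (h 0) ^ n < 1" using n by (simp add: power_less_one_iff)
      then show False using h0 ge by simp
    qed
    have h0le: "norm (h 0) \<le> exp 1"
    proof (rule ccontr)
      assume "\<not> ?thesis"
      then have "exp 1 ^ n < norm (h 0) ^ n" using n by (intro power_strict_mono) auto
      then have "exp (real n) < norm (f 0)" using h0 by (simp add: exp_of_nat_mult[symmetric])
      then have "real n < l" unfolding l_def using ge
        by (smt (verit) exp_ln ln_less_cancel_iff exp_gt_zero ln_exp)
      then show False using n by simp
    qed
    have hom: "\<not> (h z = 0 \<or> h z = 1)" if "z \<in> cball 0 1" for z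
      using hn[OF that] om[OF that] by (auto simp: h_def)
    have bd: "norm (h z) \<le> K" if "norm z \<le> 1/2" for z
      unfolding K_def by (rule Schottky[OF holh h0le hom]) (use that in auto)
    have "norm ((deriv ^^ 1) h 0) \<le> fact 1 * K / (1/2) ^ 1"
      by (rule Cauchy_inequality)
        (auto intro!: bd holomorphic_on_subset[OF holh] holomorphic_on_imp_continuous_on)
    then have dh: "norm (deriv h 0) \<le> 2 * K" by simp
    have "(h has_field_derivative deriv h 0) (at 0)"
      by (rule holomorphic_derivI[of _ "ball 0 1"]) (auto intro: holomorphic_on_subset[OF holh])
    then have "((\<lambda>z. h z ^ n) has_field_derivative of_nat n * h 0 ^ (n - 1) * deriv h 0) (at 0)"
      by (auto intro!: derivative_eq_intros)
    then have "(f has_field_derivative of_nat n * h 0 ^ (n - 1) * deriv h 0) (at 0)"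
      by (rule has_field_derivative_transform_within_open[of _ _ _ "ball 0 1"]) (auto simp: hn)
    then have "norm (deriv f 0) = real n * norm (h 0) ^ (n - 1) * norm (deriv h 0)"
      by (simp add: DERIV_imp_deriv norm_mult norm_power)
    also have "\<dots> \<le> (l + 2) * norm (f 0) * (2 * K)"
    proof (intro mult_mono dh n)
      show "norm (h 0) ^ (n - 1) \<le> norm (f 0)"
        unfolding h0[symmetric] by (rule power_increasing) (use h0ge in auto)
    qed (use l K in auto)
    also have "\<dots> = (2 * K * norm (f 0)) * (l + 2)" by simp
    also have "\<dots> \<le> (2 * K * norm (f 0)) * (2 * (1 + l))"
      using l K by (intro mult_left_mono) auto
    finally show "norm (deriv f 0) \<le> 4 * K * norm (f 0) * (1 + \<bar>ln (norm (f 0))\<bar>)"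
      using l by (simp add: l_def[symmetric] algebra_simps)
  qed
qed

text \<open>For \<open>norm (f 0) < 1\<close> the bound is applied to \<open>1 / f\<close>, which
  omits the same two values; \<open>\<bar>ln\<bar>\<close> is invariant under inversion.\<close>

lemma landau_omit_0_1:
  obtains C where "C > 0"
    "\<And>f. f holomorphic_on cball 0 1 \<Longrightarrow> (\<And>z. z \<in> cball 0 1 \<Longrightarrow> f z \<noteq> 0 \<and> f z \<noteq> 1) \<Longrightarrow>
       norm (deriv f 0) \<le> C * norm (f 0) * (1 + \<bar>ln (norm (f 0))\<bar>)"
proof -
  obtain C where C: "C > 0"
    "\<And>f. f holomorphic_on cball 0 1 \<Longrightarrow> (\<And>z. z \<in> cball 0 1 \<Longrightarrow> f z \<noteq> 0 \<and> f z \<noteq> 1) \<Longrightarrow>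
       norm (f 0) \<ge> 1 \<Longrightarrow> norm (deriv f 0) \<le> C * norm (f 0) * (1 + \<bar>ln (norm (f 0))\<bar>)"
    using landau_aux by blast
  show ?thesis
  proof (rule that[OF C(1)])
    fix f :: "complex \<Rightarrow> complex"
    assume hol: "f holomorphic_on cball 0 1" and om: "\<And>z. z \<in> cball 0 1 \<Longrightarrow> f z \<noteq> 0 \<and> f z \<noteq> 1"
    show "norm (deriv f 0) \<le> C * norm (f 0) * (1 + \<bar>ln (norm (f 0))\<bar>)"
    proof (cases "norm (f 0) \<ge> 1")
      case True
      then show ?thesis using C(2)[OF hol om] by blast
    next
      case False
      have f0: "f 0 \<noteq> 0" using om[of 0] by simp
      have le: "norm (deriv (\<lambda>z. inverse (f z)) 0)
          \<le> C * norm (inverse (f 0)) * (1 + \<bar>ln (norm (inverse (f 0)))\<bar>)"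
        by (rule C(2)) (use hol om False f0 in \<open>auto intro!: holomorphic_intros simp: norm_inverse
            one_le_inverse_iff\<close>)
      have "(f has_field_derivative deriv f 0) (at 0)"
        by (rule holomorphic_derivI[of _ "ball 0 1"]) (auto intro: holomorphic_on_subset[OF hol])
      then have "((\<lambda>z. inverse (f z)) has_field_derivative -
          (inverse (f 0) * deriv f 0 * inverse (f 0))) (at 0)"
        using f0 by (rule DERIV_inverse')
      then have d: "norm (deriv (\<lambda>z. inverse (f z)) 0) = norm (deriv f 0) / norm (f 0) ^ 2"
        using f0 by (simp add: DERIV_imp_deriv norm_mult norm_divide power2_eq_square field_simps)
      have "norm (deriv f 0) = norm (f 0) ^ 2 * (norm (deriv f 0) / norm (f 0) ^ 2)" using f0
        by simp
      also have "\<dots> \<le> norm (f 0) ^ 2 *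
          (C * norm (inverse (f 0)) * (1 + \<bar>ln (norm (inverse (f 0)))\<bar>))"
        using le unfolding d by (intro mult_left_mono) auto
      also have "\<dots> = C * norm (f 0) * (1 + \<bar>ln (norm (f 0))\<bar>)"
        using f0 by (simp add: norm_inverse ln_inverse power2_eq_square)
      finally show ?thesis .
    qed
  qed
qed

text \<open>Trades the logarithm in Landau's theorem for two powers of \<open>1 + t\<close>. With
  \<open>s = max t (1/t)\<close> the inequality \<open>1 + y \<le> exp y\<close> gives
  \<open>(1 + ln s) ^ N \<le> N ^ N * s\<close>, and \<open>t * s\<close> is either
  \<open>t ^ 2\<close> or 1.\<close>

lemma mult_power_ln_le:
  assumes "t > 0" "N > 0"
  shows "t * (1 + \<bar>ln t\<bar>) ^ N \<le> real N ^ N * (1 + t) ^ 2"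
proof -
  define s where "s = max t (1 / t)"
  have s: "s \<ge> 1 \<and> \<bar>ln t\<bar> = ln s"
  proof (cases "t \<ge> 1")
    case True
    then have "1 / t \<le> t" using order_trans[of "1 / t" 1 t] by simp
    with True show ?thesis by (simp add: s_def)
  next
    case False
    then have "t \<le> 1 / t" using assms(1) order_trans[of t 1 "1 / t"] by simp
    with False assms(1) show ?thesis by (simp add: s_def max_def ln_div)
  qed
  have "1 + ln s / N \<le> exp (ln s / N)" by (rule exp_ge_add_one_self)
  then have "real N + ln s \<le> N * exp (ln s / N)"
    using assms(2) by (simp add: field_simps)
  then have "1 + ln s \<le> N * exp (ln s / N)"
    using assms(2) s by (simp add: field_simps)
  then have "(1 + ln s) ^ N \<le> (N * exp (ln s / N)) ^ N"
    using s by (intro power_mono) auto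
  also have "\<dots> = real N ^ N * s"
    using assms(2) s by (simp add: power_mult_distrib exp_of_nat_mult[symmetric])
  finally have "t * (1 + \<bar>ln t\<bar>) ^ N \<le> t * (real N ^ N * s)"
    using assms(1) s by (intro mult_left_mono) auto
  also have "\<dots> = real N ^ N * (t * s)" by simp
  also have "\<dots> \<le> real N ^ N * (1 + t) ^ 2"
    using assms(1)
        by (intro mult_left_mono) (auto simp: s_def max_def power2_eq_square algebra_simps)
  finally show ?thesis .
qed

text \<open>The factor \<open>norm (f w - a) ^ (N - 1)\<close> records that the derivative is small
  near the omitted value \<open>a\<close>. \<open>fujimoto_estimate\<close> matches it with the one
  factor of the product over \<open>S\<close> that may be small.\<close>

lemma landau_omit_two:
  fixes a b :: complex
  assumes "a \<noteq> b" "N > 0"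
  obtains C where "C > 0"
    "\<And>f w r. r > 0 \<Longrightarrow> f holomorphic_on ball w r \<Longrightarrow> (\<And>z. z \<in> ball w r \<Longrightarrow> f z \<noteq> a \<and> f z \<noteq> b) \<Longrightarrow>
       (norm (deriv f w) * r) ^ N \<le> C * norm (f w - a) ^ (N - 1) * (1 + norm (f w)) ^ 2"
proof -
  obtain C where C: "C > 0"
    "\<And>f. f holomorphic_on cball 0 1 \<Longrightarrow> (\<And>z. z \<in> cball 0 1 \<Longrightarrow> f z \<noteq> 0 \<and> f z \<noteq> 1) \<Longrightarrow>
       norm (deriv f 0) \<le> C * norm (f 0) * (1 + \<bar>ln (norm (f 0))\<bar>)"
    using landau_omit_0_1 by blast
  define D where "D = norm (b - a)"
  have D: "D > 0" using assms by (simp add: D_def)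
  \<comment> \<open>Chosen so that the normalised size \<open>t\<close> satisfies
    \<open>1 + t \<le> A * (1 + norm (f w))\<close>.\<close>
  define A where "A = max (1 / D) (1 + norm a / D)"
  have A: "A > 0" using D by (auto simp: A_def less_max_iff_disj)
  define K where "K = (2 * C * D) ^ N / D ^ (N - 1) * (real N ^ N * A ^ 2)"
  show ?thesis
  proof (rule that[of K])
    show "K > 0" using C D A assms by (simp add: K_def)
    fix f w and r :: real
    assume r: "r > 0" and hol: "f holomorphic_on ball w r"
      and om: "\<And>z. z \<in> ball w r \<Longrightarrow> f z \<noteq> a \<and> f z \<noteq> b"
    \<comment> \<open>The affine normalisation sends \<open>a\<close> and \<open>b\<close> to 0 and
      1; half the radius is used so that the closed unit disc lands inside the open ball.\<close>
    define h where "h z = (f (w + of_real (r/2) * z) - a) / (b - a)" for z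
    have inb: "w + of_real (r/2) * z \<in> ball w r" if "z \<in> cball 0 1" for z
    proof -
      have "norm (of_real (r/2) * z) \<le> r/2 * 1"
        unfolding norm_mult using that r by (intro mult_mono) auto
      then show ?thesis using r by (simp add: dist_norm)
    qed
    have "h holomorphic_on cball 0 1"
      unfolding h_def
      by (intro holomorphic_intros holomorphic_on_compose_gen[of "\<lambda>z. w + of_real (r/2) * z" _ f
          "ball w r", unfolded o_def] hol)
        (use inb assms in auto)
    moreover have "h z \<noteq> 0 \<and> h z \<noteq> 1" if "z \<in> cball 0 1" for z
      using om[OF inb[OF that]] assms by (auto simp: h_def divide_simps)
    ultimately have le: "norm (deriv h 0) \<le> C * norm (h 0) * (1 + \<bar>ln (norm (h 0))\<bar>)"
      by (rule C(2))
    have "(f has_field_derivative deriv f w) (at w)"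
      by (rule holomorphic_derivI[OF hol]) (use r in auto)
    then have df: "(f has_field_derivative deriv f w) (at (w + of_real (r/2) * 0))" by simp
    have "((\<lambda>z. f (w + of_real (r/2) * z)) has_field_derivative deriv f w * of_real (r/2)) (at 0)"
      using df by (rule DERIV_chain2) (auto intro!: derivative_eq_intros)
    then have "(h has_field_derivative deriv f w * of_real (r/2) / (b - a)) (at 0)"
      unfolding h_def using assms by (auto intro!: derivative_eq_intros)
    then have dh: "norm (deriv h 0) = norm (deriv f w) * r / (2 * D)"
      using r by (simp only: DERIV_imp_deriv norm_mult norm_divide D_def norm_of_real)
    define t where "t = norm (h 0)"
    have t: "t = norm (f w - a) / D" by (simp add: t_def h_def norm_divide D_def)
    have t0: "t > 0" using om[of w] r D by (simp add: t)
    have tA: "1 + t \<le> A * (1 + norm (f w))"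
    proof -
      have "norm (f w - a) / D \<le> (norm (f w) + norm a) / D"
        by (rule divide_right_mono[OF norm_triangle_ineq4]) (use D in simp)
      then have "1 + t \<le> (1 + norm a / D) * 1 + (1 / D) * norm (f w)"
        by (simp add: t add_divide_distrib)
      also have "\<dots> \<le> A * 1 + A * norm (f w)"
        by (intro add_mono mult_right_mono) (auto simp: A_def)
      finally show ?thesis by (simp add: algebra_simps)
    qed
    have "norm (deriv f w) * r \<le> (2 * C * D) * (t * (1 + \<bar>ln t\<bar>))"
      using le D unfolding dh t_def[symmetric] by (simp add: field_simps)
    then have "(norm (deriv f w) * r) ^ N \<le> ((2 * C * D) * (t * (1 + \<bar>ln t\<bar>))) ^ N"
      using r by (intro power_mono) auto
    also have "\<dots> = (2 * C * D) ^ N * t ^ (N - 1) * (t * (1 + \<bar>ln t\<bar>) ^ N)"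
    proof -
      have "t ^ N = t ^ (N - 1) * t" using assms(2) by (metis power_minus_mult)
      then show ?thesis by (simp only: power_mult_distrib mult_ac)
    qed
    also have "\<dots> \<le> (2 * C * D) ^ N * t ^ (N - 1) * (real N ^ N * (A * (1 + norm (f w))) ^ 2)"
    proof (intro mult_left_mono order_trans[OF mult_power_ln_le] power_mono tA)
    qed (use C D t0 assms in auto)
    also have "\<dots> = K * norm (f w - a) ^ (N - 1) * (1 + norm (f w)) ^ 2"
      by (simp add: K_def t power_mult_distrib power_divide)
    finally show "(norm (deriv f w) * r) ^ N \<le> K * norm (f w - a) ^ (N - 1) * (1 + norm (f w)) ^ 2"
        .
  qed
qed

text \<open>By Landau's theorem \<open>f'\<close> is of order \<open>f ln f\<close> near infinity. With \<open>N = 2k + 3\<close> the left-hand side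
  has degree \<open>N + k(N + 1)\<close> in \<open>f\<close>, one less than the degree \<open>(k + 2)(N - 1)\<close> of the right-hand side,
  and the spare degree absorbs the logarithm.\<close>

lemma fujimoto_estimate:
  fixes S :: "complex set" and k :: nat
  assumes "finite S" "card S = k + 2"
  obtains B where "B > 0"
    "\<And>f w r. r > 0 \<Longrightarrow> f holomorphic_on ball w r \<Longrightarrow> f ` ball w r \<inter> S = {} \<Longrightarrow>
       (norm (deriv f w) * r) ^ (2*k+3) * (1 + norm (f w)) ^ (k * (2*k+4))
         \<le> B * (\<Prod>a\<in>S. norm (f w - a)) ^ (2*k+2)"
proof -
  define N where "N = 2*k+3"
  have ne: "S \<noteq> {}" using assms(2) by auto
  obtain c where c: "c > 0"
    "\<And>u. \<exists>e\<in>S. c * norm (u - e) * (1 + norm u) ^ (card S - 1) \<le> (\<Prod>e\<in>S. norm (u - e))"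
    using prod_dist_lower_bound[OF assms(1) ne] by blast
  have "\<exists>b\<in>S. a \<noteq> b" if "a \<in> S" for a
  proof (rule ccontr)
    assume "\<not> ?thesis"
    then have "S \<subseteq> {a}" by auto
    then have "card S \<le> 1" using card_mono[of "{a}" S] by simp
    then show False using assms(2) by simp
  qed
  then have "\<forall>a\<in>S. \<exists>C>0. \<forall>f w r. r > 0 \<longrightarrow> f holomorphic_on ball w r \<longrightarrow> f ` ball w r \<inter> S = {} \<longrightarrow>
       (norm (deriv f w) * r) ^ N \<le> C * norm (f w - a) ^ (N - 1) * (1 + norm (f w)) ^ 2"
  proof (intro ballI)
    fix a assume a: "a \<in> S"
    then obtain b where b: "b \<in> S" "a \<noteq> b" using \<open>\<And>a. a \<in> S \<Longrightarrow> \<exists>b\<in>S. a \<noteq> b\<close> by blast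
    obtain C where C: "C > 0"
      "\<And>f w r. r > 0 \<Longrightarrow> f holomorphic_on ball w r \<Longrightarrow> (\<And>z. z \<in> ball w r \<Longrightarrow> f z \<noteq> a \<and> f z \<noteq> b) \<Longrightarrow>
       (norm (deriv f w) * r) ^ N \<le> C * norm (f w - a) ^ (N - 1) * (1 + norm (f w)) ^ 2"
      using landau_omit_two[OF b(2), of N] by (auto simp: N_def)
    show "\<exists>C>0. \<forall>f w r. r > 0 \<longrightarrow> f holomorphic_on ball w r \<longrightarrow> f ` ball w r \<inter> S = {} \<longrightarrow>
       (norm (deriv f w) * r) ^ N \<le> C * norm (f w - a) ^ (N - 1) * (1 + norm (f w)) ^ 2"
    proof (intro exI conjI allI impI)
      fix f w and r :: real
      assume "r > 0" "f holomorphic_on ball w r" "f ` ball w r \<inter> S = {}"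
      then show "(norm (deriv f w) * r) ^ N \<le> C * norm (f w - a) ^ (N - 1) * (1 + norm (f w)) ^ 2"
        using a b(1) by (intro C(2)) blast+
    qed (rule C(1))
  qed
  then obtain Ca where Ca: "\<And>a. a \<in> S \<Longrightarrow> Ca a > 0"
    "\<And>a f w r. a \<in> S \<Longrightarrow> r > 0 \<Longrightarrow> f holomorphic_on ball w r \<Longrightarrow> f ` ball w r \<inter> S = {} \<Longrightarrow>
       (norm (deriv f w) * r) ^ N \<le> Ca a * norm (f w - a) ^ (N - 1) * (1 + norm (f w)) ^ 2"
    by metis
  define C where "C = sum Ca S"
  have CaC: "Ca a \<le> C" if "a \<in> S" for a
    unfolding C_def using that Ca(1) assms(1) by (intro member_le_sum) (auto intro: less_imp_le)
  have C: "C > 0" unfolding C_def using Ca(1) assms(1) ne by (intro sum_pos) auto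
  show ?thesis
  proof (rule that[of "C / c ^ (N - 1)"])
    show "C / c ^ (N - 1) > 0" using C c by simp
    fix f w and r :: real
    assume r: "r > 0" and hol: "f holomorphic_on ball w r" and om: "f ` ball w r \<inter> S = {}"
    define y where "y = 1 + norm (f w)"
    have y: "y > 0" by (simp add: y_def add_pos_nonneg)
    obtain e where e: "e \<in> S" "c * norm (f w - e) * y ^ (card S - 1) \<le> (\<Prod>e\<in>S. norm (f w - e))"
      using c(2)[of "f w"] unfolding y_def by blast
    \<comment> \<open>The condition that determines \<open>N\<close>:
      \<open>k * (N + 1) + 2 = (k + 1) * (N - 1)\<close> holds exactly for \<open>N = 2*k+3\<close>,
      and \<open>k + 1\<close> is \<open>card S - 1\<close>. The powers of \<open>y\<close> are used
      up without remainder.\<close>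
    have "k * (2*k+4) + 2 = (k + 1) * (N - 1)" by (simp add: N_def algebra_simps)
    then have pw: "y ^ 2 * y ^ (k * (2*k+4)) = (y ^ (k + 1)) ^ (N - 1)"
      by (metis power_add power_mult add.commute)
    have "(norm (deriv f w) * r) ^ N * y ^ (k * (2*k+4))
        \<le> (C * norm (f w - e) ^ (N - 1) * y ^ 2) * y ^ (k * (2*k+4))"
    proof (intro mult_right_mono)
      have "(norm (deriv f w) * r) ^ N \<le> Ca e * (norm (f w - e) ^ (N - 1) * y ^ 2)"
        using Ca(2)[OF e(1) r hol om] by (simp add: y_def mult.assoc)
      also have "\<dots> \<le> C * (norm (f w - e) ^ (N - 1) * y ^ 2)"
        using CaC[OF e(1)] y by (intro mult_right_mono) auto
      finally show "(norm (deriv f w) * r) ^ N \<le> C * norm (f w - e) ^ (N - 1) * y ^ 2"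
        by (simp add: mult.assoc)
    qed (use y in auto)
    also have "\<dots> = C * (norm (f w - e) ^ (N - 1) * (y ^ (k+1)) ^ (N - 1))"
      by (simp only: mult.assoc pw)
    also have "\<dots> = C / c ^ (N - 1) * (c * norm (f w - e) * y ^ (card S - 1)) ^ (N - 1)"
      using c(1) assms(2) by (simp add: power_mult_distrib)
    also have "\<dots> \<le> C / c ^ (N - 1) * (\<Prod>e\<in>S. norm (f w - e)) ^ (N - 1)"
      using C c(1) y by (intro mult_left_mono power_mono e) auto
    finally show "(norm (deriv f w) * r) ^ (2*k+3) * (1 + norm (f w)) ^ (k * (2*k+4))
         \<le> C / c ^ (N - 1) * (\<Prod>a\<in>S. norm (f w - a)) ^ (2*k+2)"
      by (simp add: N_def y_def)
  qed
qed


section \<open>Holomorphic vector fields on Riemann surfaces\<close>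

lemma chartD:
  assumes "is_chart M (U, \<phi>)"
  shows "openin M U" "U \<subseteq> topspace M" "open (\<phi> ` U)" "inj_on \<phi> U"
    "homeomorphic_map (subtopology M U) (top_of_set (\<phi> ` U)) \<phi>"
proof -
  show o: "openin M U" and "open (\<phi> ` U)"
    and h: "homeomorphic_map (subtopology M U) (top_of_set (\<phi> ` U)) \<phi>"
    using assms by (auto simp: is_chart_def)
  show U: "U \<subseteq> topspace M" using o openin_subset by blast
  show "inj_on \<phi> U"
    using homeomorphic_imp_injective_map[OF h] U by (simp add: Int_absorb1)
qed

lemma chart_inv_into [simp]:
  assumes "is_chart M (U, \<phi>)" "p \<in> U"
  shows "inv_into U \<phi> (\<phi> p) = p"
  using chartD(4)[OF assms(1)] assms(2) by simp

lemma open_chart_image: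
  assumes "is_chart M (U, \<phi>)" "openin M W"
  shows "open (\<phi> ` (U \<inter> W))"
proof -
  have "open_map (subtopology M U) (top_of_set (\<phi> ` U)) \<phi>"
    using chartD(5)[OF assms(1)] homeomorphic_imp_open_map by blast
  moreover have "openin (subtopology M U) (U \<inter> W)"
    using assms(2) by (auto simp: openin_subtopology)
  ultimately have "openin (top_of_set (\<phi> ` U)) (\<phi> ` (U \<inter> W))"
    unfolding open_map_def by blast
  then show ?thesis using chartD(3)[OF assms(1)] openin_open_trans by blast
qed

lemma openin_chart_preimage:
  assumes "is_chart M (U, \<phi>)" "open B"
  shows "openin M {p \<in> U. \<phi> p \<in> B}"
proof -
  have "continuous_map (subtopology M U) (top_of_set (\<phi> ` U)) \<phi>"
    using chartD(5)[OF assms(1)] homeomorphic_imp_continuous_map by blast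
  moreover have "openin (top_of_set (\<phi> ` U)) (\<phi> ` U \<inter> B)" using assms(2)
    by (simp add: openin_open_Int)
  ultimately have "openin (subtopology M U) {p \<in> topspace (subtopology M U). \<phi> p \<in> \<phi> ` U \<inter> B}"
    unfolding continuous_map_def by blast
  also have "{p \<in> topspace (subtopology M U). \<phi> p \<in> \<phi> ` U \<inter> B} = {p \<in> U. \<phi> p \<in> B}"
    using chartD(2)[OF assms(1)] by auto
  finally show ?thesis using chartD(1)[OF assms(1)] openin_trans_full by blast
qed

section \<open>Differential equations in complex time\<close>

lemma lipschitz_holomorphic_on_cball:
  fixes v :: "complex \<Rightarrow> complex"
  assumes "v holomorphic_on S" "open S" "cball z r \<subseteq> S"
  obtains L
      where "L > 0" "\<And>x y. x \<in> cball z r \<Longrightarrow> y \<in> cball z r \<Longrightarrow> norm (v x - v y) \<le> L * norm (x - y)"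
proof -
  have "continuous_on (cball z r) (deriv v)"
    using holomorphic_on_imp_continuous_on[OF holomorphic_deriv[OF assms(1,2)]] assms(3)
      continuous_on_subset by blast
  then have "bounded (deriv v ` cball z r)"
    by (intro compact_imp_bounded compact_continuous_image) auto
  then obtain L where L: "L > 0" "\<And>x. x \<in> cball z r \<Longrightarrow> norm (deriv v x) \<le> L"
    by (auto simp: bounded_pos)
  show ?thesis
  proof (rule that[OF L(1)])
    show "norm (v x - v y) \<le> L * norm (x - y)" if "x \<in> cball z r" "y \<in> cball z r" for x y
    proof (rule field_differentiable_bound[OF convex_cball[of z r], of v "deriv v"])
      show "(v has_field_derivative deriv v w) (at w within cball z r)" if "w \<in> cball z r" for w
        by (rule has_field_derivative_at_within, rule holomorphic_derivI[OF assms(1,2)])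
          (use that assms(3) in blast)
    qed (use that L in auto)
  qed
qed

lemma uniform_limit_geometric:
  fixes u :: "nat \<Rightarrow> 'a \<Rightarrow> 'b::banach"
  assumes "\<And>n w. w \<in> S \<Longrightarrow> norm (u (Suc n) w - u n w) \<le> c * (1/2) ^ n"
  obtains g where "uniform_limit S u g sequentially"
proof -
  have "uniform_limit S (\<lambda>n x. \<Sum>i<n. u (Suc i) x - u i x) (\<lambda>x. \<Sum>i. u (Suc i) x - u i x)
      sequentially"
    by (rule Weierstrass_m_test[OF assms]) (auto intro!: summable_mult summable_geometric)
  moreover have "(\<Sum>i<n. u (Suc i) x - u i x) = u n x - u 0 x" for n x
    by (rule sum_lessThan_telescope)
  ultimately have *:
      "uniform_limit S (\<lambda>n x. u n x - u 0 x) (\<lambda>x. \<Sum>i. u (Suc i) x - u i x) sequentially"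
    by simp
  have "uniform_limit S (\<lambda>n x. (u n x - u 0 x) + u 0 x) (\<lambda>x. (\<Sum>i. u (Suc i) x - u i x) + u 0 x)
      sequentially"
    by (intro uniform_limit_add * uniform_limit_const)
  then have "uniform_limit S u (\<lambda>x. (\<Sum>i. u (Suc i) x - u i x) + u 0 x) sequentially" by simp
  then show ?thesis by (rule that)
qed

text \<open>Picard iteration with holomorphic iterates. What matters is the order of the
  quantifiers: one radius \<open>r\<close> serves all initial values near \<open>z0\<close> and all
  initial times, and this is what allows continuation across a boundary point.\<close>

lemma holomorphic_ode_local_existence:
  fixes v :: "complex \<Rightarrow> complex"
  assumes hol: "v holomorphic_on S" and S: "open S" and z0: "z0 \<in> S"
  obtains \<rho> r where "\<rho> > 0" "r > 0"
    "\<And>z1 w1. z1 \<in> ball z0 \<rho> \<Longrightarrow> \<exists>u. u w1 = z1 \<and>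
       (\<forall>w\<in>ball w1 r. u w \<in> S \<and> (u has_field_derivative v (u w)) (at w))"
proof -
  obtain \<rho>2 where \<rho>2: "\<rho>2 > 0" "cball z0 \<rho>2 \<subseteq> S" using S z0 open_contains_cball by blast
  define \<rho> where "\<rho> = \<rho>2 / 2"
  have \<rho>: "\<rho> > 0" "\<rho> + \<rho> = \<rho>2" using \<rho>2 by (auto simp: \<rho>_def)
  obtain L
      where L: "L > 0"
          "\<And>x y. x \<in> cball z0 \<rho>2 \<Longrightarrow> y \<in> cball z0 \<rho>2 \<Longrightarrow> norm (v x - v y) \<le> L * norm (x - y)"
    using lipschitz_holomorphic_on_cball[OF hol S \<rho>2(2)] by blast
  have contv: "continuous_on (cball z0 \<rho>2) v"
    using holomorphic_on_imp_continuous_on[OF hol] \<rho>2(2) continuous_on_subset by blast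
  then have "bounded (v ` cball z0 \<rho>2)" by (intro compact_imp_bounded compact_continuous_image) auto
  then obtain B where B: "B > 0" "\<And>x. x \<in> cball z0 \<rho>2 \<Longrightarrow> norm (v x) \<le> B" by (auto simp: bounded_pos)
  \<comment> \<open>\<open>B * r \<le> \<rho>\<close> confines the iterates that start within
    \<open>\<rho>\<close> of \<open>z0\<close> to the ball of radius
    \<open>\<rho>2 = 2 * \<rho>\<close>; \<open>L * r \<le> 1/2\<close> makes consecutive
    differences shrink by one half.\<close>
  define r where "r = min (\<rho> / B) (1 / (2 * L))"
  have r: "r > 0" "B * r \<le> \<rho>" "L * r \<le> 1/2"
    using \<rho> B L by (auto simp: r_def min_def field_simps not_le)
  have "\<exists>u. u w1 = z1 \<and> (\<forall>w\<in>ball w1 r. u w \<in> S \<and> (u has_field_derivative v (u w)) (at w))"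
    if z1: "z1 \<in> ball z0 \<rho>" for z1 w1
  proof -
    define D where "D = ball w1 r"
    have wD: "w1 \<in> D" "open D" "convex D" using r by (auto simp: D_def)
    define P where "P u \<longleftrightarrow> u holomorphic_on D \<and> u ` D \<subseteq> cball z0 \<rho>2 \<and> u w1 = z1" for u
    define Q where "Q u u' \<longleftrightarrow> (\<forall>w\<in>D. (u' has_field_derivative v (u w)) (at w))"
        for u u' :: "complex \<Rightarrow> complex"
    have "\<exists>u. \<forall>n. P (u n) \<and> Q (u n) (u (Suc n))"
    proof (rule dependent_nat_choice)
      have "dist z0 z1 \<le> \<rho>2" using z1 \<rho> by auto
      then have "P (\<lambda>_. z1)" by (auto simp: P_def)
      then show "\<exists>u. P u" by blast
    next
      fix u and n :: nat
      assume u: "P u"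
      have "(\<lambda>w. v (u w)) holomorphic_on D"
        using holomorphic_on_compose_gen[of u D v "cball z0 \<rho>2"] u
            holomorphic_on_subset[OF hol \<rho>2(2)]
        by (auto simp: P_def o_def)
      then obtain g where g: "\<And>w. w \<in> D \<Longrightarrow> (g has_field_derivative v (u w)) (at w)"
        using holomorphic_convex_primitive'[of D "\<lambda>w. v (u w)"] wD at_within_open by (metis)
      define u' where "u' w = z1 + (g w - g w1)" for w
      have du': "(u' has_field_derivative v (u w)) (at w)" if "w \<in> D" for w
        unfolding u'_def using g[OF that] by (auto intro!: derivative_eq_intros)
      have "u' w \<in> cball z0 \<rho>2" if w: "w \<in> D" for w
      proof -
        have "norm (g w - g w1) \<le> B * norm (w - w1)"
        proof (rule field_differentiable_bound[OF wD(3), of g "\<lambda>w. v (u w)"])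
          show "(g has_field_derivative v (u x)) (at x within D)" if "x \<in> D" for x
            by (rule has_field_derivative_at_within[OF g[OF that]])
          show "norm (v (u x)) \<le> B" if "x \<in> D" for x
            by (rule B(2)) (use u that in \<open>auto simp: P_def\<close>)
        qed (rule w wD(1))+
        also have "\<dots> \<le> B * r" using w B by (auto simp: D_def dist_norm norm_minus_commute)
        finally have "norm (u' w - z1) \<le> \<rho>" using r by (simp add: u'_def)
        moreover have "dist z0 (u' w) \<le> dist z0 z1 + norm (u' w - z1)"
          by (metis dist_triangle dist_commute dist_norm)
        ultimately show ?thesis using z1 \<rho> by auto
      qed
      moreover have "u' holomorphic_on D" using du' wD holomorphic_on_open by blast
      moreover have "u' w1 = z1" by (simp add: u'_def)
      ultimately show "\<exists>u'. P u' \<and> Q u u'" using du' unfolding P_def Q_def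
        by (intro exI[of _ u']) auto
    qed
    then obtain u where uP: "\<And>n. P (u n)" and uQ: "\<And>n. Q (u n) (u (Suc n))" by blast
    have uin: "u n w \<in> cball z0 \<rho>2" if "w \<in> D" for n w using uP[of n] that by (auto simp: P_def)
    have est: "norm (u (Suc n) w - u n w) \<le> (2 * \<rho>2) * (1/2) ^ n" if "w \<in> D" for n w
      using that
    proof (induction n arbitrary: w)
      case 0
      have "dist (u 1 w) (u 0 w) \<le> dist z0 (u 1 w) + dist z0 (u 0 w)"
        by (metis dist_triangle3 dist_commute)
      then show ?case using uin[OF 0, of 0] uin[OF 0, of 1] by (simp add: dist_norm)
    next
      case (Suc n)
      have "norm ((u (Suc (Suc n)) w - u (Suc n) w) - (u (Suc (Suc n)) w1 - u (Suc n) w1))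
          \<le> (L * ((2 * \<rho>2) * (1/2) ^ n)) * norm (w - w1)"
      proof (rule field_differentiable_bound[OF wD(3), of _ "\<lambda>x. v (u (Suc n) x) - v (u n x)"])
        fix x assume x: "x \<in> D"
        show "((\<lambda>w. u (Suc (Suc n)) w - u (Suc n) w) has_field_derivative v (u (Suc n) x) - v
            (u n x)) (at x within D)"
          using uQ[of n] uQ[of "Suc n"] x unfolding Q_def
          by (intro has_field_derivative_at_within[OF DERIV_diff]) auto
        have "norm (v (u (Suc n) x) - v (u n x)) \<le> L * norm (u (Suc n) x - u n x)"
          by (rule L(2)) (use uin x in auto)
        also have "\<dots> \<le> L * ((2 * \<rho>2) * (1/2) ^ n)" using Suc.IH[OF x] L(1)
          by (intro mult_left_mono) auto
        finally show "norm (v (u (Suc n) x) - v (u n x)) \<le> L * ((2 * \<rho>2) * (1/2) ^ n)" .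
      qed (use Suc.prems wD in auto)
      also have "\<dots> \<le> (L * ((2 * \<rho>2) * (1/2) ^ n)) * r"
        using Suc.prems L \<rho>2
            by (intro mult_left_mono) (auto simp: D_def dist_norm norm_minus_commute)
      also have "\<dots> = (L * r) * ((2 * \<rho>2) * (1/2) ^ n)" by simp
      also have "\<dots> \<le> (1/2) * ((2 * \<rho>2) * (1/2) ^ n)" using r \<rho>2 by (intro mult_right_mono) auto
      finally show ?case using uP[of "Suc n"] uP[of "Suc (Suc n)"] by (simp add: P_def)
    qed
    obtain g where g: "uniform_limit D u g sequentially"
      using uniform_limit_geometric[of D u, OF est] by blast
    have lim: "(\<lambda>n. u n w) \<longlonglongrightarrow> g w" if "w \<in> D" for w
      using tendsto_uniform_limitI[OF g that] .
    have gin: "g w \<in> cball z0 \<rho>2" if "w \<in> D" for w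
      by (rule closed_sequentially[OF closed_cball _ lim[OF that]]) (use uin that in auto)
    have "\<exists>g'. \<forall>x\<in>D. (g has_field_derivative g' x) (at x) \<and> ((\<lambda>n. v (u n x)) \<longlongrightarrow> g' x) sequentially"
    proof (rule has_complex_derivative_uniform_sequence[OF wD(2), of "\<lambda>n. u (Suc n)"])
      show "(u (Suc n) has_field_derivative v (u n x)) (at x)" if "x \<in> D" for n x
        using uQ that by (auto simp: Q_def)
      have gS: "uniform_limit D (\<lambda>n. u (Suc n)) g sequentially"
        by (rule filterlim_compose[OF g filterlim_Suc])
      show "\<exists>d>0. cball x d \<subseteq> D \<and> uniform_limit (cball x d) (\<lambda>n. u (Suc n)) g sequentially"
          if "x \<in> D" for x
        using that wD(2) open_contains_cball uniform_limit_on_subset[OF gS] by (metis)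
    qed
    then obtain g' where g': "\<And>x. x \<in> D \<Longrightarrow> (g has_field_derivative g' x) (at x)"
      "\<And>x. x \<in> D \<Longrightarrow> (\<lambda>n. v (u n x)) \<longlonglongrightarrow> g' x" by blast
    have "g' x = v (g x)" if x: "x \<in> D" for x
    proof (rule LIMSEQ_unique[OF g'(2)[OF x]])
      show "(\<lambda>n. v (u n x)) \<longlonglongrightarrow> v (g x)"
        by (rule continuous_on_tendsto_compose[OF contv lim[OF x] gin[OF x]]) (use uin x in auto)
    qed
    moreover have "g w1 = z1"
    proof (rule LIMSEQ_unique[OF lim[OF wD(1)]])
      show "(\<lambda>n. u n w1) \<longlonglongrightarrow> z1" using uP by (simp add: P_def)
    qed
    ultimately show ?thesis using g' gin \<rho>2(2) by (intro exI[of _ g]) (auto simp: D_def)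
  qed
  then show ?thesis using that[OF \<rho>(1) r(1)] by blast
qed

text \<open>On a disc with \<open>L * s \<le> 1/2\<close> the maximum of
  \<open>norm (u1 - u2)\<close>, attained at \<open>w0\<close>, is at most half of itself.\<close>

lemma holomorphic_ode_local_uniqueness:
  fixes v :: "complex \<Rightarrow> complex"
  assumes hol: "v holomorphic_on S" and S: "open S" and R: "R > 0"
    and u1: "\<And>w. w \<in> ball w1 R \<Longrightarrow> u1 w \<in> S \<and> (u1 has_field_derivative v (u1 w)) (at w)"
    and u2: "\<And>w. w \<in> ball w1 R \<Longrightarrow> u2 w \<in> S \<and> (u2 has_field_derivative v (u2 w)) (at w)"
    and eq: "u1 w1 = u2 w1"
  obtains s where "s > 0" "s \<le> R" "\<And>w. w \<in> ball w1 s \<Longrightarrow> u1 w = u2 w"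
proof -
  define z0 where "z0 = u1 w1"
  have z0: "z0 \<in> S" using u1[of w1] R by (simp add: z0_def)
  obtain \<rho> where \<rho>: "\<rho> > 0" "cball z0 \<rho> \<subseteq> S" using S z0 open_contains_cball by blast
  obtain L
      where L: "L > 0" "\<And>x y. x \<in> cball z0 \<rho> \<Longrightarrow> y \<in> cball z0 \<rho> \<Longrightarrow> norm (v x - v y) \<le> L * norm (x - y)"
    using lipschitz_holomorphic_on_cball[OF hol S \<rho>(2)] by blast
  have c: "\<exists>d>0. \<forall>w. dist w w1 < d \<longrightarrow> dist (u w) (u w1) < \<rho>"
    if "\<And>w. w \<in> ball w1 R \<Longrightarrow> u w \<in> S \<and> (u has_field_derivative v (u w)) (at w)" for u
    using DERIV_isCont[OF conjunct2[OF that[of w1]]] R \<rho>(1) unfolding continuous_at_eps_delta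
        by auto
  obtain d1 where d1: "d1 > 0" "\<And>w. dist w w1 < d1 \<Longrightarrow> dist (u1 w) (u1 w1) < \<rho>" using c[OF u1]
    by blast
  obtain d2 where d2: "d2 > 0" "\<And>w. dist w w1 < d2 \<Longrightarrow> dist (u2 w) (u2 w1) < \<rho>" using c[OF u2]
    by blast
  define s where "s = Min {d1/2, d2/2, R/2, 1 / (2 * L)}"
  have s: "s > 0" "s < d1" "s < d2" "s < R" "L * s \<le> 1/2"
  proof -
    have "s \<le> d1/2" "s \<le> d2/2" "s \<le> R/2" "s \<le> 1 / (2 * L)" by (auto simp: s_def)
    moreover show "s > 0" using d1 d2 R L by (auto simp: s_def)
    ultimately show "s < d1" "s < d2" "s < R" "L * s \<le> 1/2" using d1 d2 R L
      by (auto simp: field_simps)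
  qed
  define d where "d w = u1 w - u2 w" for w
  have inz: "u1 w \<in> cball z0 \<rho>" "u2 w \<in> cball z0 \<rho>" if "w \<in> cball w1 s" for w
    using d1(2)[of w] d2(2)[of w] that s eq by (auto simp: z0_def dist_commute)
  have dd: "(d has_field_derivative v (u1 w) - v (u2 w)) (at w)" if "w \<in> cball w1 s" for w
    unfolding d_def using u1[of w] u2[of w] that s by (intro DERIV_diff) auto
  have "continuous_on (cball w1 s) (\<lambda>w. norm (d w))"
    using dd DERIV_isCont by (intro continuous_on_norm continuous_at_imp_continuous_on) blast
  then obtain w0 where w0: "w0 \<in> cball w1 s" "\<And>w. w \<in> cball w1 s \<Longrightarrow> norm (d w) \<le> norm (d w0)"
    using continuous_attains_sup[OF compact_cball[of w1 s]] s
        by (metis cball_eq_empty not_less_iff_gr_or_eq)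
  have "norm (d w0 - d w1) \<le> (L * norm (d w0)) * norm (w0 - w1)"
  proof (rule field_differentiable_bound[OF convex_cball[of w1 s], of d "\<lambda>w. v (u1 w) - v (u2 w)"])
    fix w assume w: "w \<in> cball w1 s"
    show "(d has_field_derivative v (u1 w) - v (u2 w)) (at w within cball w1 s)"
      using dd[OF w] has_field_derivative_at_within by blast
    have "norm (v (u1 w) - v (u2 w)) \<le> L * norm (d w)" unfolding d_def by (intro L inz w)
    also have "\<dots> \<le> L * norm (d w0)" using w0(2)[OF w] L(1) by simp
    finally show "norm (v (u1 w) - v (u2 w)) \<le> L * norm (d w0)" .
  qed (use w0 s in auto)
  also have "\<dots> \<le> (L * norm (d w0)) * s"
    using w0(1) L(1) by (intro mult_left_mono) (auto simp: dist_norm norm_minus_commute)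
  also have "\<dots> = (L * s) * norm (d w0)" by simp
  also have "\<dots> \<le> (1/2) * norm (d w0)" using s by (intro mult_right_mono) auto
  finally have "d w0 = 0" using eq by (simp add: d_def)
  then have "u1 w = u2 w" if "w \<in> ball w1 s" for w using w0(2)[of w] that by (simp add: d_def)
  then show ?thesis using that[of s] s by auto
qed

section \<open>Complex trajectories of holomorphic vector fields\<close>

locale holomorphic_surface =
  fixes M :: "'a topology" and C :: "'a chart set"
  assumes hausdorff: "Hausdorff_space M"
    and chart: "(U, \<phi>) \<in> C \<Longrightarrow> is_chart M (U, \<phi>)"
    and cover: "p \<in> topspace M \<Longrightarrow> \<exists>U \<phi>. (U, \<phi>) \<in> C \<and> p \<in> U"
    and holomorphic_transition:
      "(U, \<phi>) \<in> C \<Longrightarrow> (V, \<theta>) \<in> C \<Longrightarrow> (\<theta> \<circ> inv_into U \<phi>) holomorphic_on \<phi> ` (U \<inter> V)"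

locale holomorphic_vector_field = holomorphic_surface +
  fixes X :: "'a chart \<Rightarrow> complex \<Rightarrow> complex"
  assumes X_holomorphic: "(U, \<phi>) \<in> C \<Longrightarrow> X (U, \<phi>) holomorphic_on \<phi> ` U"
    and X_transition: "(U, \<phi>) \<in> C \<Longrightarrow> (V, \<theta>) \<in> C \<Longrightarrow> p \<in> U \<inter> V \<Longrightarrow>
      X (V, \<theta>) (\<theta> p) = deriv (\<theta> \<circ> inv_into U \<phi>) (\<phi> p) * X (U, \<phi>) (\<phi> p)"
begin

text \<open>One suitable chart near each time is asked for;
  \<open>solves_has_field_derivative\<close> carries the equation to every other chart by the
  transition law of \<open>X\<close>. The balls make \<open>D\<close> open.\<close>

definition solves :: "(complex \<Rightarrow> 'a) \<Rightarrow> complex set \<Rightarrow> bool" where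
  "solves \<Phi> D \<longleftrightarrow> (\<forall>w\<in>D. \<exists>U \<phi> r. (U, \<phi>) \<in> C \<and> r > 0 \<and> ball w r \<subseteq> D \<and>
     (\<forall>v\<in>ball w r. \<Phi> v \<in> U \<and> ((\<phi> \<circ> \<Phi>) has_field_derivative X (U, \<phi>) (\<phi> (\<Phi> v))) (at v)))"

lemma solvesE:
  assumes "solves \<Phi> D" "w \<in> D"
  obtains U \<phi> r where "(U, \<phi>) \<in> C" "r > 0" "ball w r \<subseteq> D"
    "\<And>v. v \<in> ball w r \<Longrightarrow> \<Phi> v \<in> U"
    "\<And>v. v \<in> ball w r \<Longrightarrow> ((\<phi> \<circ> \<Phi>) has_field_derivative X (U, \<phi>) (\<phi> (\<Phi> v))) (at v)"
  using assms unfolding solves_def by meson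

lemma solves_cong:
  assumes "solves \<Phi> D" "\<And>w. w \<in> D \<Longrightarrow> \<Psi> w = \<Phi> w"
  shows "solves \<Psi> D"
  unfolding solves_def
proof
  fix w assume w: "w \<in> D"
  obtain U \<phi> r where *: "(U, \<phi>) \<in> C" "r > 0" "ball w r \<subseteq> D"
    "\<And>v. v \<in> ball w r \<Longrightarrow> \<Phi> v \<in> U"
    "\<And>v. v \<in> ball w r \<Longrightarrow> ((\<phi> \<circ> \<Phi>) has_field_derivative X (U, \<phi>) (\<phi> (\<Phi> v))) (at v)"
    using solvesE[OF assms(1) w] by metis
  have "\<Psi> v \<in> U \<and> ((\<phi> \<circ> \<Psi>) has_field_derivative X (U, \<phi>) (\<phi> (\<Psi> v))) (at v)" if v: "v \<in> ball w r"
      for v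
  proof
    have eq: "\<Psi> v = \<Phi> v" using v *(3) assms(2) by auto
    then show "\<Psi> v \<in> U" using *(4)[OF v] by simp
    show "((\<phi> \<circ> \<Psi>) has_field_derivative X (U, \<phi>) (\<phi> (\<Psi> v))) (at v)"
      unfolding eq
      by (rule has_field_derivative_transform_within_open[OF *(5)[OF v] open_ball v])
        (use *(3) assms(2) in auto)
  qed
  then show "\<exists>U \<phi> r. (U, \<phi>) \<in> C \<and> r > 0 \<and> ball w r \<subseteq> D \<and>
     (\<forall>v\<in>ball w r. \<Psi> v \<in> U \<and> ((\<phi> \<circ> \<Psi>) has_field_derivative X (U, \<phi>) (\<phi> (\<Psi> v))) (at v))"
    using * by blast
qed

lemma solves_Union:
  assumes "\<And>i. i \<in> I \<Longrightarrow> solves \<Phi> (D i)"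
  shows "solves \<Phi> (\<Union>i\<in>I. D i)"
  unfolding solves_def
proof
  fix w assume "w \<in> (\<Union>i\<in>I. D i)"
  then obtain i where i: "i \<in> I" "w \<in> D i" by blast
  show "\<exists>U \<phi> r. (U, \<phi>) \<in> C \<and> r > 0 \<and> ball w r \<subseteq> (\<Union>i\<in>I. D i) \<and>
     (\<forall>v\<in>ball w r. \<Phi> v \<in> U \<and> ((\<phi> \<circ> \<Phi>) has_field_derivative X (U, \<phi>) (\<phi> (\<Phi> v))) (at v))"
    by (rule solvesE[OF assms[OF i(1)] i(2)]) (use i(1) in blast)
qed

lemma solves_subset:
  assumes "solves \<Phi> D" "open E" "E \<subseteq> D"
  shows "solves \<Phi> E"
  unfolding solves_def
proof
  fix w assume w: "w \<in> E"
  obtain U \<phi> r where *: "(U, \<phi>) \<in> C" "r > 0" "ball w r \<subseteq> D"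
    "\<And>v. v \<in> ball w r \<Longrightarrow> \<Phi> v \<in> U"
    "\<And>v. v \<in> ball w r \<Longrightarrow> ((\<phi> \<circ> \<Phi>) has_field_derivative X (U, \<phi>) (\<phi> (\<Phi> v))) (at v)"
    using solvesE[OF assms(1) subsetD[OF assms(3) w]] by metis
  obtain e where e: "e > 0" "ball w e \<subseteq> E" using assms(2) w open_contains_ball by blast
  show "\<exists>U \<phi> r. (U, \<phi>) \<in> C \<and> r > 0 \<and> ball w r \<subseteq> E \<and>
     (\<forall>v\<in>ball w r. \<Phi> v \<in> U \<and> ((\<phi> \<circ> \<Phi>) has_field_derivative X (U, \<phi>) (\<phi> (\<Phi> v))) (at v))"
    using * e by (intro exI[of _ U] exI[of _ \<phi>] exI[of _ "min r e"]) auto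
qed

lemma solves_topspace: "solves \<Phi> D \<Longrightarrow> w \<in> D \<Longrightarrow> \<Phi> w \<in> topspace M"
  by (erule (1) solvesE) (meson centre_in_ball chart chartD(2) subsetD)

lemma solves_open_preimage:
  assumes "solves \<Phi> D" "openin M W"
  shows "open {w \<in> D. \<Phi> w \<in> W}"
  unfolding open_contains_ball
proof
  fix w assume "w \<in> {w \<in> D. \<Phi> w \<in> W}"
  then have w: "w \<in> D" "\<Phi> w \<in> W" by auto
  obtain U \<phi> r where *: "(U, \<phi>) \<in> C" "r > 0" "ball w r \<subseteq> D"
    "\<And>v. v \<in> ball w r \<Longrightarrow> \<Phi> v \<in> U"
    "\<And>v. v \<in> ball w r \<Longrightarrow> ((\<phi> \<circ> \<Phi>) has_field_derivative X (U, \<phi>) (\<phi> (\<Phi> v))) (at v)"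
    using solvesE[OF assms(1) w(1)] by metis
  have ch: "is_chart M (U, \<phi>)" by (rule chart[OF *(1)])
  have "continuous_on (ball w r) (\<phi> \<circ> \<Phi>)"
    using *(5) DERIV_isCont continuous_at_imp_continuous_on by blast
  then have "open ((\<phi> \<circ> \<Phi>) -` (\<phi> ` (U \<inter> W)) \<inter> ball w r)"
    using open_chart_image[OF ch assms(2)] continuous_on_open_vimage[OF open_ball] by blast
  moreover have "w \<in> (\<phi> \<circ> \<Phi>) -` (\<phi> ` (U \<inter> W)) \<inter> ball w r" using w *(2) *(4)[of w] by auto
  ultimately obtain e where e: "e > 0" "ball w e \<subseteq> (\<phi> \<circ> \<Phi>) -` (\<phi> ` (U \<inter> W)) \<inter> ball w r"
    using open_contains_ball by blast
  have "ball w e \<subseteq> {w \<in> D. \<Phi> w \<in> W}"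
  proof
    fix v assume v: "v \<in> ball w e"
    then have "\<phi> (\<Phi> v) \<in> \<phi> ` (U \<inter> W)" "v \<in> ball w r" using e by auto
    then have "\<Phi> v \<in> W" using inj_onD[OF chartD(4)[OF ch]] *(4)[of v] by auto
    then show "v \<in> {w \<in> D. \<Phi> w \<in> W}" using \<open>v \<in> ball w r\<close> *(3) by auto
  qed
  then show "\<exists>e>0. ball w e \<subseteq> {w \<in> D. \<Phi> w \<in> W}" using e(1) by blast
qed

lemma solves_has_field_derivative:
  assumes "solves \<Phi> D" "w \<in> D" "(V, \<theta>) \<in> C" "\<Phi> w \<in> V"
  shows "((\<theta> \<circ> \<Phi>) has_field_derivative X (V, \<theta>) (\<theta> (\<Phi> w))) (at w)"
proof -
  obtain U \<phi> r where *: "(U, \<phi>) \<in> C" "r > 0" "ball w r \<subseteq> D"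
    "\<And>v. v \<in> ball w r \<Longrightarrow> \<Phi> v \<in> U"
    "\<And>v. v \<in> ball w r \<Longrightarrow> ((\<phi> \<circ> \<Phi>) has_field_derivative X (U, \<phi>) (\<phi> (\<Phi> v))) (at v)"
    using solvesE[OF assms(1,2)] by metis
  let ?\<tau> = "\<theta> \<circ> inv_into U \<phi>"
  note ch = chart[OF *(1)] chart[OF assms(3)]
  have wr: "w \<in> ball w r" using *(2) by simp
  have wU: "\<Phi> w \<in> U \<inter> V" using *(4)[OF wr] assms(4) by simp
  have "(?\<tau> has_field_derivative deriv ?\<tau> (\<phi> (\<Phi> w))) (at (\<phi> (\<Phi> w)))"
    by (rule holomorphic_derivI[OF holomorphic_transition[OF *(1) assms(3)]])
      (use open_chart_image[OF ch(1) chartD(1)[OF ch(2)]] wU in auto)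
  then have "(?\<tau> has_field_derivative deriv ?\<tau> (\<phi> (\<Phi> w))) (at ((\<phi> \<circ> \<Phi>) w))" by simp
  from DERIV_chain[OF this *(5)[OF wr]]
  have "(?\<tau> \<circ> (\<phi> \<circ> \<Phi>) has_field_derivative X (V, \<theta>) (\<theta> (\<Phi> w))) (at w)"
    using X_transition[OF *(1) assms(3) wU] by simp
  then show ?thesis
    by (rule has_field_derivative_transform_within_open[OF _ open_ball wr]) (use *(4) ch in auto)
qed

text \<open>The set of agreement is open by local uniqueness in a chart, and its complement in
  \<open>D\<close> is open because \<open>M\<close> is Hausdorff; connectedness of \<open>D\<close>
  decides.\<close>

lemma solves_unique:
  assumes s1: "solves \<Phi> D" and s2: "solves \<Psi> D" and D: "open D" "connected D"
    and w0: "w0 \<in> D" "\<Phi> w0 = \<Psi> w0" and w: "w \<in> D"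
  shows "\<Phi> w = \<Psi> w"
proof -
  define E where "E = {w \<in> D. \<Phi> w = \<Psi> w}"
  have "open E"
    unfolding open_contains_ball
  proof
    fix w assume "w \<in> E"
    then have w: "w \<in> D" "\<Phi> w = \<Psi> w" by (auto simp: E_def)
    obtain U \<phi> where c: "(U, \<phi>) \<in> C" "\<Phi> w \<in> U" using cover[OF solves_topspace[OF s1 w(1)]] by blast
    note ch = chart[OF c(1)]
    have "open ({w \<in> D. \<Phi> w \<in> U} \<inter> {w \<in> D. \<Psi> w \<in> U})"
      using solves_open_preimage[OF s1 chartD(1)[OF ch]]
          solves_open_preimage[OF s2 chartD(1)[OF ch]] by blast
    moreover have "w \<in> {w \<in> D. \<Phi> w \<in> U} \<inter> {w \<in> D. \<Psi> w \<in> U}" using w c by auto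
    ultimately obtain e where e: "e > 0" "ball w e \<subseteq> {w \<in> D. \<Phi> w \<in> U} \<inter> {w \<in> D. \<Psi> w \<in> U}"
      using open_contains_ball by blast
    obtain s where s: "s > 0" "s \<le> e" "\<And>v. v \<in> ball w s \<Longrightarrow> (\<phi> \<circ> \<Phi>) v = (\<phi> \<circ> \<Psi>) v"
    proof (rule holomorphic_ode_local_uniqueness[OF X_holomorphic[OF c(1)] chartD(3)[OF ch] e(1), of
        w "\<phi> \<circ> \<Phi>" "\<phi> \<circ> \<Psi>"])
      show "(\<phi> \<circ> \<Phi>) v \<in> \<phi> ` U \<and> (\<phi> \<circ> \<Phi> has_field_derivative X (U, \<phi>) ((\<phi> \<circ> \<Phi>) v)) (at v)"
        if "v \<in> ball w e" for v
        using solves_has_field_derivative[OF s1 _ c(1), of v] that e(2) by auto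
      show "(\<phi> \<circ> \<Psi>) v \<in> \<phi> ` U \<and> (\<phi> \<circ> \<Psi> has_field_derivative X (U, \<phi>) ((\<phi> \<circ> \<Psi>) v)) (at v)"
        if "v \<in> ball w e" for v
        using solves_has_field_derivative[OF s2 _ c(1), of v] that e(2) by auto
    qed (use w in auto)
    have "ball w s \<subseteq> E"
    proof
      fix v assume v: "v \<in> ball w s"
      then have "v \<in> ball w e" using s(2) by auto
      then have "\<Phi> v \<in> U" "\<Psi> v \<in> U" "v \<in> D" using e(2) by auto
      then show "v \<in> E" using s(3)[OF v] inj_onD[OF chartD(4)[OF ch]] by (auto simp: E_def)
    qed
    then show "\<exists>e>0. ball w e \<subseteq> E" using s(1) by blast
  qed
  moreover have "open (D - E)"
    unfolding openI
  proof (subst open_subopen, rule ballI)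
    fix w assume "w \<in> D - E"
    then have w: "w \<in> D" "\<Phi> w \<noteq> \<Psi> w" by (auto simp: E_def)
    obtain A B where AB: "openin M A" "openin M B" "\<Phi> w \<in> A" "\<Psi> w \<in> B" "disjnt A B"
      using hausdorff solves_topspace[OF s1 w(1)] solves_topspace[OF s2 w(1)] w(2)
      unfolding Hausdorff_space_def by metis
    show "\<exists>T. open T \<and> w \<in> T \<and> T \<subseteq> D - E"
      using solves_open_preimage[OF s1 AB(1)] solves_open_preimage[OF s2 AB(2)] w AB
      by (intro exI[of _ "{w \<in> D. \<Phi> w \<in> A} \<inter> {w \<in> D. \<Psi> w \<in> B}"]) (auto simp: E_def disjnt_iff)
  qed
  ultimately have "E \<inter> D = {} \<or> (D - E) \<inter> D = {}"
    by (intro connectedD[OF D(2)]) auto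
  then show ?thesis using w0 w by (auto simp: E_def)
qed

lemma solves_local_existence:
  assumes "q \<in> topspace M"
  obtains W r where "openin M W" "q \<in> W" "r > 0"
    "\<And>p w. p \<in> W \<Longrightarrow> \<exists>\<Phi>. \<Phi> w = p \<and> solves \<Phi> (ball w r)"
proof -
  obtain U \<phi> where c: "(U, \<phi>) \<in> C" "q \<in> U" using cover[OF assms] by blast
  note ch = chart[OF c(1)]
  obtain \<rho> r where r: "\<rho> > 0" "r > 0"
    "\<And>z1 w1. z1 \<in> ball (\<phi> q) \<rho> \<Longrightarrow> \<exists>u. u w1 = z1 \<and>
       (\<forall>w\<in>ball w1 r. u w \<in> \<phi> ` U \<and> (u has_field_derivative X (U, \<phi>) (u w)) (at w))"
    using holomorphic_ode_local_existence[OF X_holomorphic[OF c(1)] chartD(3)[OF ch], of "\<phi> q"] c(2)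
    by (metis imageI)
  show ?thesis
  proof (rule that[OF openin_chart_preimage[OF ch open_ball[of "\<phi> q" \<rho>]] _ r(2)])
    show "q \<in> {p \<in> U. \<phi> p \<in> ball (\<phi> q) \<rho>}" using c r by simp
    fix p w assume p: "p \<in> {p \<in> U. \<phi> p \<in> ball (\<phi> q) \<rho>}"
    then obtain u where u: "u w = \<phi> p"
      "\<And>v. v \<in> ball w r \<Longrightarrow> u v \<in> \<phi> ` U \<and> (u has_field_derivative X (U, \<phi>) (u v)) (at v)"
      using r(3)[of "\<phi> p" w] by auto
    have *: "\<phi> (inv_into U \<phi> (u v)) = u v" "inv_into U \<phi> (u v) \<in> U" if "v \<in> ball w r" for v
      using u(2)[OF that] by (auto intro: f_inv_into_f inv_into_into)
    have "solves (inv_into U \<phi> \<circ> u) (ball w r)"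
      unfolding solves_def
    proof
      fix v assume v: "v \<in> ball w r"
      then obtain e where e: "e > 0" "ball v e \<subseteq> ball w r" using open_contains_ball[of "ball w r"] v
        by blast
      have "((\<phi> \<circ> (inv_into U \<phi> \<circ> u)) has_field_derivative X (U, \<phi>) (\<phi> ((inv_into U \<phi> \<circ> u) x)))
          (at x)"
        if x: "x \<in> ball w r" for x
      proof (rule has_field_derivative_transform_within_open[OF _ open_ball x])
        show "(u has_field_derivative X (U, \<phi>) (\<phi> ((inv_into U \<phi> \<circ> u) x))) (at x)"
          using u(2)[OF x] *[OF x] by simp
      qed (use * in auto)
      then show "\<exists>U' \<phi>' r'. (U', \<phi>') \<in> C \<and> 0 < r' \<and> ball v r' \<subseteq> ball w r \<and>
         (\<forall>x\<in>ball v r'. (inv_into U \<phi> \<circ> u) x \<in> U' \<and>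
           ((\<phi>' \<circ> (inv_into U \<phi> \<circ> u)) has_field_derivative X (U', \<phi>') (\<phi>' ((inv_into U \<phi> \<circ> u) x)))
               (at x))"
        using c(1) e *(2) by (intro exI[of _ U] exI[of _ \<phi>] exI[of _ e]) auto
    qed
    moreover have "(inv_into U \<phi> \<circ> u) w = p" using u(1) p ch by auto
    ultimately show "\<exists>\<Phi>. \<Phi> w = p \<and> solves \<Phi> (ball w r)" by blast
  qed
qed

text \<open>Near the limit \<open>q\<close> all solutions live on discs of one radius
  \<open>r\<close>. Once \<open>w n\<close> is within \<open>r/2\<close> of \<open>w0\<close> and
  \<open>\<Phi> (w n)\<close> is near \<open>q\<close>, the solution started at time
  \<open>w n\<close> covers the disc of radius \<open>r/2\<close> about \<open>w0\<close>;
  uniqueness on the convex overlap identifies it with \<open>\<Phi>\<close>.\<close>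

lemma solves_extend_to_boundary_point:
  assumes sol: "solves \<Phi> (ball 0 R)" and w: "\<And>n. w n \<in> ball 0 R" "w \<longlonglongrightarrow> w0"
    and lim: "limitin M (\<lambda>n. \<Phi> (w n)) q sequentially"
  obtains r \<Psi> where "r > 0" "solves \<Psi> (ball w0 r)" "\<And>v. v \<in> ball w0 r \<inter> ball 0 R \<Longrightarrow> \<Psi> v = \<Phi> v"
proof -
  have q: "q \<in> topspace M" using lim by (simp add: limitin_def)
  obtain W r where W: "openin M W" "q \<in> W" "r > 0"
    "\<And>p w. p \<in> W \<Longrightarrow> \<exists>\<Phi>. \<Phi> w = p \<and> solves \<Phi> (ball w r)"
    using solves_local_existence[OF q] by metis
  have "eventually (\<lambda>n. \<Phi> (w n) \<in> W) sequentially" using lim W by (auto simp: limitin_def)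
  moreover have "eventually (\<lambda>n. dist (w n) w0 < r / 2) sequentially"
    using w(2) W(3) tendstoD half_gt_zero by blast
  ultimately have "eventually (\<lambda>n. \<Phi> (w n) \<in> W \<and> dist (w n) w0 < r / 2) sequentially"
    by (rule eventually_conj)
  then obtain n where n: "\<Phi> (w n) \<in> W" "dist (w n) w0 < r / 2"
    using eventually_happens'[OF sequentially_bot] by blast
  obtain \<Psi> where \<Psi>: "\<Psi> (w n) = \<Phi> (w n)" "solves \<Psi> (ball (w n) r)" using W(4)[OF n(1)] by blast
  have sub: "ball w0 (r/2) \<subseteq> ball (w n) r"
  proof
    fix v assume "v \<in> ball w0 (r/2)"
    then show "v \<in> ball (w n) r" using n(2) dist_triangle[of "w n" v w0] by auto
  qed
  show ?thesis
  proof (rule that[of "r/2" \<Psi>])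
    show "r / 2 > 0" using W by simp
    show "solves \<Psi> (ball w0 (r / 2))" by (rule solves_subset[OF \<Psi>(2) _ sub]) simp
    fix v assume v: "v \<in> ball w0 (r / 2) \<inter> ball 0 R"
    let ?D = "ball (w n) r \<inter> ball 0 R"
    show "\<Psi> v = \<Phi> v"
    proof (rule solves_unique[of \<Psi> ?D \<Phi> "w n"])
      show "solves \<Psi> ?D" "solves \<Phi> ?D"
        by (rule solves_subset[OF \<Psi>(2)] solves_subset[OF sol]; auto)+
      show "connected ?D" by (intro convex_connected convex_Int convex_ball)
    qed (use w \<Psi> W v sub in auto)
  qed
qed

text \<open>Strict convexity of the disc: the point dividing the segment from \<open>a\<close> to
  \<open>b\<close> in the ratio of the radii lies in both small balls and strictly inside the disc.
  Thus two local continuations whose domains overlap share a point at which both equal the original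
  solution.\<close>

lemma balls_on_sphere_meet_ball:
  fixes a b :: complex
  assumes "norm a = R" "norm b = R" "R > 0" "r > 0" "s > 0" "ball a r \<inter> ball b s \<noteq> {}"
  shows "ball a r \<inter> ball b s \<inter> ball 0 R \<noteq> {}"
proof (cases "a = b")
  case True
  define t where "t = min r (min s R) / (2 * R)"
  have t: "0 < t" "t < 1" "t * R < r" "t * R < s"
    using assms by (auto simp: t_def min_def field_simps)
  have "norm (of_real (1 - t) * a) < R"
    using t assms by (simp add: norm_mult del: of_real_diff)
  moreover have "dist a (of_real (1 - t) * a) = t * R"
  proof -
    have "a - of_real (1 - t) * a = of_real t * a" by (simp add: algebra_simps)
    then show ?thesis using t assms by (simp add: dist_norm norm_mult)
  qed
  ultimately have "of_real (1 - t) * a \<in> ball a r \<inter> ball b s \<inter> ball 0 R"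
    using t True by simp
  then show ?thesis by blast
next
  case False
  have d: "dist a b < r + s" using assms(6) dist_triangle_less_add[of a _ r b s]
    by (auto simp: dist_commute)
  define t where "t = r / (r + s)"
  have t: "0 < t" "t < 1" "1 - t = s / (r + s)" using assms by (auto simp: t_def field_simps)
  define v where "v = a + of_real t * (b - a)"
  have "dist a v = t * dist a b" using t by (simp add: v_def dist_norm norm_mult norm_minus_commute)
  also have "\<dots> < t * (r + s)" using d t by simp
  also have "\<dots> = r" using assms by (simp add: t_def)
  finally have 1: "v \<in> ball a r" by simp
  have "b - v = of_real (1 - t) * (b - a)" by (simp add: v_def algebra_simps)
  then have "dist b v = norm (of_real (1 - t) * (b - a))" unfolding dist_norm by (rule arg_cong)
  also have "\<dots> = (1 - t) * dist a b"
    using t(2) unfolding norm_mult norm_of_real by (simp add: dist_norm norm_minus_commute)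
  also have "\<dots> < (1 - t) * (r + s)" by (rule mult_strict_left_mono[OF d]) (use t in simp)
  also have "\<dots> = s" unfolding t(3) using assms by simp
  finally have 2: "v \<in> ball b s" by simp
  have "norm v ^ 2 = (1 - t) * norm a ^ 2 + t * norm b ^ 2 - t * (1 - t) * norm (b - a) ^ 2"
    unfolding cmod_power2 v_def by (simp add: power2_eq_square algebra_simps)
  also have "\<dots> = R ^ 2 - t * (1 - t) * norm (b - a) ^ 2" using assms by (simp add: algebra_simps)
  also have "\<dots> < R ^ 2" using t(1,2) False by simp
  finally have "norm v < R" using assms(3) power_less_imp_less_base by fastforce
  then show ?thesis using 1 2 by auto
qed

text \<open>By uniqueness the solutions on smaller discs glue to one on the disc of radius
  \<open>R\<close>, the supremum of all radii. If a limit existed at every boundary point, the local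
  continuations would glue as well, and compactness of the closed disc would yield a solution on a
  larger disc.\<close>

lemma maximal_disc:
  assumes p: "p \<in> topspace M"
    and bdd: "\<And>R \<Phi>. R > 0 \<Longrightarrow> solves \<Phi> (ball 0 R) \<Longrightarrow> \<Phi> 0 = p \<Longrightarrow> R \<le> B"
  obtains R \<Phi> w0 where "R > 0" "solves \<Phi> (ball 0 R)" "\<Phi> 0 = p" "norm w0 = R"
    "\<And>w q. (\<And>n. w n \<in> ball 0 R) \<Longrightarrow> w \<longlonglongrightarrow> w0 \<Longrightarrow> \<not> limitin M (\<lambda>n. \<Phi> (w n)) q sequentially"
proof -
  define \<R> where "\<R> = {R. R > 0 \<and> (\<exists>\<Phi>. solves \<Phi> (ball 0 R) \<and> \<Phi> 0 = p)}"
  obtain r0 where "r0 > 0" "\<exists>\<Phi>. \<Phi> 0 = p \<and> solves \<Phi> (ball 0 r0)"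
    using solves_local_existence[OF p] by metis
  then have r0: "r0 \<in> \<R>" "r0 > 0" by (auto simp: \<R>_def)
  have bd: "bdd_above \<R>" using bdd by (auto simp: \<R>_def bdd_above_def)
  define R where "R = Sup \<R>"
  have Rle: "r \<le> R" if "r \<in> \<R>" for r unfolding R_def using that bd by (rule cSup_upper)
  have R: "R > 0" using Rle[OF r0(1)] r0(2) by simp
  have "\<forall>r\<in>\<R>. \<exists>\<Phi>. solves \<Phi> (ball 0 r) \<and> \<Phi> 0 = p" by (auto simp: \<R>_def)
  then obtain F where F: "\<And>r. r \<in> \<R> \<Longrightarrow> solves (F r) (ball 0 r)" "\<And>r. r \<in> \<R> \<Longrightarrow> F r 0 = p" by metis
  have Feq: "F r w = F s w" if "r \<in> \<R>" "s \<in> \<R>" "norm w < r" "norm w < s" for r s w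
  proof (rule solves_unique[of "F r" "ball 0 (min r s)" "F s" 0])
    show "solves (F r) (ball 0 (min r s))" "solves (F s) (ball 0 (min r s))"
      by (rule solves_subset[OF F(1)[OF that(1)]] solves_subset[OF F(1)[OF that(2)]]; auto)+
  qed (use that F in \<open>auto simp: \<R>_def\<close>)
  \<comment> \<open>The choice of the radius is immaterial by \<open>Feq\<close>.\<close>
  define \<Phi> where "\<Phi> w = F (SOME r. r \<in> \<R> \<and> norm w < r) w" for w
  have \<Phi>F: "\<Phi> w = F r w" if "r \<in> \<R>" "norm w < r" for r w
  proof -
    have "(SOME r. r \<in> \<R> \<and> norm w < r) \<in> \<R> \<and> norm w < (SOME r. r \<in> \<R> \<and> norm w < r)"
      by (rule someI[of "\<lambda>r. r \<in> \<R> \<and> norm w < r" r]) (use that in blast)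
    then show ?thesis unfolding \<Phi>_def using Feq that by blast
  qed
  have UR: "ball 0 R = (\<Union>r\<in>\<R>. ball (0::complex) r)"
  proof
    show "ball 0 R \<subseteq> (\<Union>r\<in>\<R>. ball (0::complex) r)"
    proof -
      have "\<R> \<noteq> {}" using r0(1) by blast
      from less_cSup_iff[OF this bd] show ?thesis unfolding R_def by auto
    qed
    show "(\<Union>r\<in>\<R>. ball (0::complex) r) \<subseteq> ball 0 R" using Rle by fastforce
  qed
  have sol: "solves \<Phi> (ball 0 R)"
    unfolding UR by (rule solves_Union, rule solves_cong[OF F(1)]) (use \<Phi>F in auto)
  have \<Phi>0: "\<Phi> 0 = p" using \<Phi>F[OF r0(1), of 0] r0 F(2) by simp
  have "\<exists>w0. norm w0 = R \<and> (\<forall>w q. (\<forall>n. w n \<in> ball 0 R) \<longrightarrow> w \<longlonglongrightarrow> w0 \<longrightarrow> \<not> limitin M (\<lambda>n. \<Phi> (w n)) q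
      sequentially)"
  proof (rule ccontr)
    assume neg: "\<not> ?thesis"
    have "\<exists>r \<Psi>. r > 0 \<and> solves \<Psi> (ball w0 r) \<and> (\<forall>v\<in>ball w0 r \<inter> ball 0 R. \<Psi> v = \<Phi> v)"
        if "norm w0 = R" for w0
    proof -
      have "\<exists>w q. (\<forall>n. w n \<in> ball 0 R) \<and> w \<longlonglongrightarrow> w0 \<and> limitin M (\<lambda>n. \<Phi> (w n)) q sequentially"
        using neg that by blast
      then obtain w q where "\<And>n. w n \<in> ball 0 R" "w \<longlonglongrightarrow> w0" "limitin M (\<lambda>n. \<Phi> (w n)) q sequentially"
        by blast
      from solves_extend_to_boundary_point[OF sol this] show ?thesis by metis
    qed
    then obtain r \<Psi>
        where e: "\<And>w0. norm w0 = R \<Longrightarrow> r w0 > 0" "\<And>w0. norm w0 = R \<Longrightarrow> solves (\<Psi> w0) (ball w0 (r w0))"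
      "\<And>w0 v. norm w0 = R \<Longrightarrow> v \<in> ball w0 (r w0) \<inter> ball 0 R \<Longrightarrow> \<Psi> w0 v = \<Phi> v" by metis
    have agree: "\<Psi> a v = \<Psi> b v"
        if ab: "norm a = R" "norm b = R" "v \<in> ball a (r a)" "v \<in> ball b (r b)" for a b v
    proof -
      let ?D = "ball a (r a) \<inter> ball b (r b)"
      obtain w where w: "w \<in> ?D \<inter> ball 0 R"
        using balls_on_sphere_meet_ball[OF ab(1,2) R e(1)[OF ab(1)] e(1)[OF ab(2)]] ab by blast
      show ?thesis
      proof (rule solves_unique[of "\<Psi> a" ?D "\<Psi> b" w])
        show "solves (\<Psi> a) ?D" "solves (\<Psi> b) ?D"
          by (rule solves_subset[OF e(2)[OF ab(1)]] solves_subset[OF e(2)[OF ab(2)]]; auto)+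
        show "connected ?D" by (intro convex_connected convex_Int convex_ball)
        show "\<Psi> a w = \<Psi> b w" using e(3)[OF ab(1)] e(3)[OF ab(2)] w by simp
      qed (use w ab in auto)
    qed
    define S where "S = (\<Union>w0\<in>sphere 0 R. ball w0 (r w0))"
    define \<Omega>
        where "\<Omega> v = (if norm v < R then \<Phi> v else \<Psi> (SOME w0. norm w0 = R \<and> v \<in> ball w0 (r w0)) v)"
            for v
    have \<Omega>\<Psi>: "\<Omega> v = \<Psi> w0 v" if "norm w0 = R" "v \<in> ball w0 (r w0)" for v w0
    proof (cases "norm v < R")
      case True then show ?thesis using e(3)[OF that(1), of v] that by (simp add: \<Omega>_def)
    next
      case False
      define w1 where "w1 = (SOME w0. norm w0 = R \<and> v \<in> ball w0 (r w0))"
      have "norm w1 = R \<and> v \<in> ball w1 (r w1)"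
        unfolding w1_def by (rule someI[of _ w0]) (use that in blast)
      then have "\<Psi> w1 v = \<Psi> w0 v" using agree that by blast
      then show ?thesis using False by (simp add: \<Omega>_def w1_def)
    qed
    have "solves \<Omega> S"
      unfolding S_def by (rule solves_Union, rule solves_cong[OF e(2)]) (use \<Omega>\<Psi> in auto)
    moreover have "solves \<Omega> (ball 0 R)" by (rule solves_cong[OF sol]) (simp add: \<Omega>_def)
    \<comment> \<open>The union of the two domains, indexed by \<open>bool\<close> to fit
      \<open>solves_Union\<close>.\<close>
    ultimately have sol\<Omega>: "solves \<Omega> (\<Union>b\<in>UNIV. if b then S else ball 0 R)"
      by (intro solves_Union) auto
    have "cball 0 R \<subseteq> S \<union> ball 0 R"
      using e(1) by (auto simp: S_def)
    moreover have "open (S \<union> ball 0 R)" by (auto simp: S_def)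
    \<comment> \<open>The continuation radii \<open>r w0\<close> need not be bounded below;
      compactness supplies one width that works all around the circle.\<close>
    ultimately obtain \<epsilon> where \<epsilon>: "\<epsilon> > 0" "(\<Union>x\<in>cball 0 R. ball x \<epsilon>) \<subseteq> S \<union> ball 0 R"
      using compact_subset_open_imp_ball_epsilon_subset[OF compact_cball] by blast
    have "ball 0 (R + \<epsilon>) \<subseteq> S \<union> ball 0 R"
    proof
      fix v :: complex assume v: "v \<in> ball 0 (R + \<epsilon>)"
      show "v \<in> S \<union> ball 0 R"
      proof (cases "norm v \<le> R")
        case True then show ?thesis using \<epsilon> by force
      next
        case False
        then have n: "norm v > 0" using R by linarith
        let ?x = "of_real (R / norm v) * v"
        have "norm ?x = R" using n R by (simp add: norm_mult norm_divide)
        moreover have "dist ?x v < \<epsilon>"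
        proof -
          have "v - ?x = of_real (1 - R / norm v) * v" by (simp add: algebra_simps)
          then have "dist ?x v = \<bar>1 - R / norm v\<bar> * norm v"
            by (simp add: dist_norm norm_minus_commute norm_mult del: of_real_diff)
          also have "\<dots> = norm v - R" using n False by (simp add: field_simps abs_if)
          finally show ?thesis using v by simp
        qed
        ultimately have "v \<in> (\<Union>x\<in>cball 0 R. ball x \<epsilon>)" by (intro UN_I[of ?x]) auto
        then show ?thesis using \<epsilon>(2) by blast
      qed
    qed
    also have "\<dots> = (\<Union>b\<in>UNIV. if b then S else ball 0 R)" by (auto simp: UNIV_bool)
    finally have "solves \<Omega> (ball 0 (R + \<epsilon>))" by (rule solves_subset[OF sol\<Omega> open_ball])
    moreover have "\<Omega> 0 = p" using R \<Phi>0 by (simp add: \<Omega>_def)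
    ultimately have "R + \<epsilon> \<in> \<R>" using R \<epsilon> by (auto simp: \<R>_def)
    then show False using Rle[of "R + \<epsilon>"] \<epsilon>(1) by simp
  qed
  then show ?thesis using that[OF R sol \<Phi>0] by blast
qed

end


section \<open>Conformal coordinates of stationary patches\<close>

lemma mink_add_left: "mink (u + v) w = mink u w + mink v w"
  and mink_add_right: "mink w (u + v) = mink w u + mink w v"
  and mink_diff_left: "mink (u - v) w = mink u w - mink v w"
  and mink_diff_right: "mink w (u - v) = mink w u - mink w v"
  by (simp_all add: mink_def algebra_simps)

lemma mink_scaleR_left: "mink (a *\<^sub>R u) v = a * mink u v"
  and mink_scaleR_right: "mink u (a *\<^sub>R v) = a * mink u v" for u v :: "real ^ 4"
  by (simp_all add: mink_def algebra_simps)

lemma mink_commute: "mink u v = mink v u"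
  by (simp add: mink_def mult.commute)

lemmas mink_linear = mink_add_left mink_add_right mink_diff_left mink_diff_right
  mink_scaleR_left mink_scaleR_right

lemma bounded_bilinear_mink: "bounded_bilinear (mink :: real ^ 4 \<Rightarrow> real ^ 4 \<Rightarrow> real)"
  unfolding bilinear_conv_bounded_bilinear[symmetric] bilinear_def
  by (auto intro!: linearI simp: mink_linear)

lemma matrix_inv_2:
  fixes A :: "real ^ 2 ^ 2"
  assumes "det A \<noteq> 0"
  shows "matrix_inv A $ 1 $ 1 = A $ 2 $ 2 / det A" "matrix_inv A $ 1 $ 2 = - A $ 1 $ 2 / det A"
    "matrix_inv A $ 2 $ 1 = - A $ 2 $ 1 / det A" "matrix_inv A $ 2 $ 2 = A $ 1 $ 1 / det A"
proof -
  define B :: "real ^ 2 ^ 2"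
      where "B = (\<chi> i j. (if i = 1 then (if j = 1 then A $ 2 $ 2 else - A $ 1 $ 2)
    else (if j = 1 then - A $ 2 $ 1 else A $ 1 $ 1)) / det A)"
  have B: "A ** B = mat 1" "B ** A = mat 1"
    using assms by (simp_all add: B_def vec_eq_iff forall_2 matrix_matrix_mult_def mat_def sum_2
        det_2 divide_simps)
  have "A ** matrix_inv A = mat 1 \<and> matrix_inv A ** A = mat 1"
    unfolding matrix_inv_def by (rule someI[of _ B]) (use B in blast)
  then have "matrix_inv A = B"
    using B by (metis matrix_mul_assoc matrix_mul_lid matrix_mul_rid)
  then show "matrix_inv A $ 1 $ 1 = A $ 2 $ 2 / det A" "matrix_inv A $ 1 $ 2 = - A $ 1 $ 2 / det A"
    "matrix_inv A $ 2 $ 1 = - A $ 2 $ 1 / det A" "matrix_inv A $ 2 $ 2 = A $ 1 $ 1 / det A"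
    by (simp_all add: B_def)
qed

locale spacelike_patch =
  fixes y :: "complex \<Rightarrow> real ^ 4" and S :: "complex set"
  assumes open_S: "open S" and smooth: "smooth_on S y"
    and spacelike: "\<And>z a b. z \<in> S \<Longrightarrow> a \<noteq> 0 \<or> b \<noteq> 0 \<Longrightarrow>
      mink (a *\<^sub>R pd 1 y z + b *\<^sub>R pd 2 y z) (a *\<^sub>R pd 1 y z + b *\<^sub>R pd 2 y z) > 0"
begin

text \<open>\<open>gE\<close>, \<open>gF\<close>, \<open>gG\<close> are the classical coefficients
  of the first fundamental form, and \<open>gD\<close> is the area density.\<close>

definition "gE z = mink (pd 1 y z) (pd 1 y z)"
definition "gF z = mink (pd 1 y z) (pd 2 y z)"
definition "gG z = mink (pd 2 y z) (pd 2 y z)"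
definition "gD z = sqrt (gE z * gG z - gF z * gF z)"

text \<open>The ambient product is indefinite, but its restriction to the tangent plane is definite,
  so a tangent vector orthogonal to that plane vanishes.\<close>

lemma tangent_eq_0:
  assumes "z \<in> S" "mink (a *\<^sub>R pd 1 y z + b *\<^sub>R pd 2 y z) (pd 1 y z) = 0"
    "mink (a *\<^sub>R pd 1 y z + b *\<^sub>R pd 2 y z) (pd 2 y z) = 0"
  shows "a = 0" "b = 0"
proof -
  have "mink (a *\<^sub>R pd 1 y z + b *\<^sub>R pd 2 y z) (a *\<^sub>R pd 1 y z + b *\<^sub>R pd 2 y z) = 0"
    using assms(2,3) by (simp only: mink_add_right mink_scaleR_right mult_zero_right add_0_left)
  then show "a = 0" "b = 0" using spacelike[OF assms(1), of a b] by auto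
qed

lemma gE_pos: "z \<in> S \<Longrightarrow> gE z > 0"
  using spacelike[of z 1 0] by (simp add: gE_def)

lemma det_pos: assumes "z \<in> S" shows "gE z * gG z - gF z * gF z > 0"
proof -
  have "mink ((- gF z) *\<^sub>R pd 1 y z + gE z *\<^sub>R pd 2 y z) ((- gF z) *\<^sub>R pd 1 y z + gE z *\<^sub>R pd 2 y z)
      > 0"
    using gE_pos[OF assms] by (intro spacelike assms) simp
  then have "gE z * (gE z * gG z - gF z * gF z) > 0"
    by (simp add: mink_linear gE_def gF_def gG_def mink_commute[of "pd 2 y z" "pd 1 y z"]
        algebra_simps)
  then show ?thesis using gE_pos[OF assms] by (simp add: zero_less_mult_iff)
qed

lemma gD_pos: "z \<in> S \<Longrightarrow> gD z > 0"
  using det_pos by (simp add: gD_def)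

lemma gD_square: "z \<in> S \<Longrightarrow> gD z * gD z = gE z * gG z - gF z * gF z"
  using det_pos[of z] by (simp add: gD_def)

lemma smooth_pd: "smooth_on S (pd i y)"
  by (rule smooth_on_pd[OF smooth])

lemma smooth_g: "smooth_on S gE" "smooth_on S gF" "smooth_on S gG" "smooth_on S gD"
proof -
  show *: "smooth_on S gE" "smooth_on S gF" "smooth_on S gG"
    unfolding gE_def[abs_def] gF_def[abs_def] gG_def[abs_def]
    by (intro smooth_on_bilinear[OF bounded_bilinear_mink open_S] smooth_pd)+
  show "smooth_on S gD"
    unfolding gD_def[abs_def]
    by (intro smooth_on_sqrt smooth_on_diff smooth_on_mult * open_S det_pos)
qed

lemma induced_metric_nth [simp]:
  "induced_metric y z $ 1 $ 1 = gE z" "induced_metric y z $ 1 $ 2 = gF z"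
  "induced_metric y z $ 2 $ 1 = gF z" "induced_metric y z $ 2 $ 2 = gG z"
  by (simp_all add: induced_metric_def gE_def gF_def gG_def mink_commute)

lemma det_induced_metric: "det (induced_metric y z) = gE z * gG z - gF z * gF z"
  by (simp add: det_2)

end

locale stationary_patch = spacelike_patch +
  assumes mean_curvature: "\<And>z. z \<in> S \<Longrightarrow> mean_curvature_vector y z = 0"
begin

text \<open>Vanishing mean curvature says that the normal part of the metric trace of the second
  derivatives is 0. Only this tangentiality is extracted, with the determinant cleared;
  \<open>hodge_closed\<close> determines the tangential part by pairing with the tangent
  vectors.\<close>

lemma laplacian_tangential:
  assumes z: "z \<in> S"
  obtains a b where "gG z *\<^sub>R pd 1 (pd 1 y) z - gF z *\<^sub>R pd 1 (pd 2 y) z - gF z *\<^sub>R pd 2 (pd 1 y) z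
    + gE z *\<^sub>R pd 2 (pd 2 y) z = a *\<^sub>R pd 1 y z + b *\<^sub>R pd 2 y z"
proof -
  define \<Delta> where "\<Delta> = gE z * gG z - gF z * gF z"
  have \<Delta>: "\<Delta> > 0" using det_pos[OF z] by (simp add: \<Delta>_def)
  have d: "det (induced_metric y z) = \<Delta>" by (simp add: det_induced_metric \<Delta>_def)
  have "det (induced_metric y z) \<noteq> 0" using \<Delta> d by simp
  note inv = matrix_inv_2[OF this, unfolded induced_metric_nth d]
  define t1 where "t1 v = (\<Sum>i\<in>UNIV. matrix_inv (induced_metric y z) $ i $ 1 * mink v (pd i y z))"
      for v
  define t2 where "t2 v = (\<Sum>i\<in>UNIV. matrix_inv (induced_metric y z) $ i $ 2 * mink v (pd i y z))"
      for v
  have tang: "tangential_part y z v = t1 v *\<^sub>R pd 1 y z + t2 v *\<^sub>R pd 2 y z" for v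
    by (simp add: tangential_part_def t1_def t2_def sum_2 algebra_simps)
  have "0 = (2 * \<Delta>) *\<^sub>R mean_curvature_vector y z" using mean_curvature[OF z] by simp
  also have "\<dots> = gG z *\<^sub>R second_fundamental_form y 1 1 z - gF z *\<^sub>R second_fundamental_form y 1 2 z
    - gF z *\<^sub>R second_fundamental_form y 2 1 z + gE z *\<^sub>R second_fundamental_form y 2 2 z"
    using \<Delta> by (simp add: mean_curvature_vector_def sum_2 inv scaleR_add_right algebra_simps)
  finally have "gG z *\<^sub>R pd 1 (pd 1 y) z - gF z *\<^sub>R pd 1 (pd 2 y) z - gF z *\<^sub>R pd 2 (pd 1 y) z
    + gE z *\<^sub>R pd 2 (pd 2 y) z
    = (gG z * t1 (pd 1 (pd 1 y) z) - gF z * t1 (pd 1 (pd 2 y) z) - gF z * t1 (pd 2 (pd 1 y) z) + gE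
        z * t1 (pd 2 (pd 2 y) z)) *\<^sub>R pd 1 y z
    + (gG z * t2 (pd 1 (pd 1 y) z) - gF z * t2 (pd 1 (pd 2 y) z) - gF z * t2 (pd 2 (pd 1 y) z) + gE
        z * t2 (pd 2 (pd 2 y) z)) *\<^sub>R pd 2 y z"
    unfolding second_fundamental_form_def tang by (simp add: algebra_simps)
  then show ?thesis by (rule that)
qed

text \<open>The components of the Hodge dual \<open>*dy = P du + Q dv\<close>; it is closed because \<open>y\<close> is harmonic
  for its induced metric.\<close>

definition "hodge1 z = (gF z / gD z) *\<^sub>R pd 1 y z - (gE z / gD z) *\<^sub>R pd 2 y z"
definition "hodge2 z = (gG z / gD z) *\<^sub>R pd 1 y z - (gF z / gD z) *\<^sub>R pd 2 y z"

lemma smooth_hodge: "smooth_on S hodge1" "smooth_on S hodge2"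
proof -
  note intros = smooth_on_diff smooth_on_bilinear[OF bounded_bilinear_scaleR] smooth_on_divide
      smooth_g
    smooth_pd open_S gD_pos
  show "smooth_on S hodge1" unfolding hodge1_def[abs_def] by (intro intros)
  show "smooth_on S hodge2" unfolding hodge2_def[abs_def] by (intro intros)
qed

text \<open>\<open>hodge1\<close> and \<open>hodge2\<close> are the negatives of
  \<open>pd 1 y\<close> and \<open>pd 2 y\<close> rotated by a right angle in the oriented tangent
  plane. Their products with the tangent vectors are \<open>0\<close> or \<open>gD\<close> up to
  sign, which makes them easy to differentiate.\<close>

lemma mink_hodge:
  assumes "z \<in> S"
  shows "mink (hodge1 z) (pd 1 y z) = 0" "mink (hodge1 z) (pd 2 y z) = - gD z"
    "mink (hodge2 z) (pd 1 y z) = gD z" "mink (hodge2 z) (pd 2 y z) = 0"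
  using gD_pos[OF assms] gD_square[OF assms]
  by (simp_all add: hodge1_def hodge2_def mink_linear mink_commute[of "pd 2 y z" "pd 1 y z"]
      flip: gE_def gF_def gG_def) (simp_all add: field_simps)

text \<open>The exterior derivative \<open>Z\<close> is tangential by
  \<open>laplacian_tangential\<close>, and its products with both tangent vectors vanish for any
  immersion, by the product rule and the symmetry of second derivatives. Definiteness of the metric
  then gives \<open>Z = 0\<close>.\<close>

lemma hodge_closed:
  assumes z: "z \<in> S"
  shows "pd 1 hodge2 z = pd 2 hodge1 z"
proof -
  have dif: "pd i y differentiable (at z)" "hodge1 differentiable (at z)"
      "hodge2 differentiable (at z)"
    "gE differentiable (at z)" "gF differentiable (at z)" "gG differentiable (at z)"
        "gD differentiable (at z)"
    "(\<lambda>z. gE z / gD z) differentiable (at z)" "(\<lambda>z. gF z / gD z) differentiable (at z)"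
    "(\<lambda>z. gG z / gD z) differentiable (at z)" for i
    using smooth_on_differentiable[OF _ z] smooth_pd smooth_hodge smooth_g
      smooth_on_differentiable[OF smooth_on_divide[OF open_S smooth_g(1) smooth_g(4) gD_pos] z]
      smooth_on_differentiable[OF smooth_on_divide[OF open_S smooth_g(2) smooth_g(4) gD_pos] z]
      smooth_on_differentiable[OF smooth_on_divide[OF open_S smooth_g(3) smooth_g(4) gD_pos] z]
    by auto
  note yc = pd_commute[OF open_S smooth z, of 2 1]
  note bm = pd_bilinear[OF bounded_bilinear_mink]
  note bs = pd_bilinear[OF bounded_bilinear_scaleR]
  have pd_diff: "pd i (\<lambda>w. f w - g w) z = pd i f z - pd i g z"
    if "f differentiable (at z)" "g differentiable (at z)" for f g :: "complex \<Rightarrow> real ^ 4" and i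
    using pd_eqI[OF has_derivative_diff[OF that[unfolded frechet_derivative_works]]]
        by (simp add: pd_def)
  define Z where "Z = pd 1 hodge2 z - pd 2 hodge1 z"
  obtain a b
      where ab: "gG z *\<^sub>R pd 1 (pd 1 y) z - gF z *\<^sub>R pd 1 (pd 2 y) z - gF z *\<^sub>R pd 2 (pd 1 y) z
    + gE z *\<^sub>R pd 2 (pd 2 y) z = a *\<^sub>R pd 1 y z + b *\<^sub>R pd 2 y z" (is "?W = _")
    using laplacian_tangential[OF z] by blast
  have ds: "(\<lambda>w. c w *\<^sub>R pd i y w) differentiable (at z)" if "c differentiable (at z)"
      for c :: "complex \<Rightarrow> real" and i
    by (rule differentiable_bilinear[OF bounded_bilinear_scaleR that dif(1)])
  have 1: "pd 1 hodge2 z = (gG z / gD z) *\<^sub>R pd 1 (pd 1 y) z + pd 1 (\<lambda>z. gG z / gD z) z *\<^sub>R pd 1 y z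
      - ((gF z / gD z) *\<^sub>R pd 1 (pd 2 y) z + pd 1 (\<lambda>z. gF z / gD z) z *\<^sub>R pd 2 y z)"
    unfolding hodge2_def[abs_def] by (subst pd_diff) (simp_all add: ds dif bs)
  have 2: "pd 2 hodge1 z = (gF z / gD z) *\<^sub>R pd 2 (pd 1 y) z + pd 2 (\<lambda>z. gF z / gD z) z *\<^sub>R pd 1 y z
      - ((gE z / gD z) *\<^sub>R pd 2 (pd 2 y) z + pd 2 (\<lambda>z. gE z / gD z) z *\<^sub>R pd 2 y z)"
    unfolding hodge1_def[abs_def] by (subst pd_diff) (simp_all add: ds dif bs)
  define \<alpha> \<beta> where "\<alpha> = a / gD z + pd 1 (\<lambda>z. gG z / gD z) z - pd 2 (\<lambda>z. gF z / gD z) z"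
    and "\<beta> = b / gD z - pd 1 (\<lambda>z. gF z / gD z) z + pd 2 (\<lambda>z. gE z / gD z) z"
  have "Z = (1 / gD z) *\<^sub>R ?W + (pd 1 (\<lambda>z. gG z / gD z) z - pd 2 (\<lambda>z. gF z / gD z) z) *\<^sub>R pd 1 y z
      + (pd 2 (\<lambda>z. gE z / gD z) z - pd 1 (\<lambda>z. gF z / gD z) z) *\<^sub>R pd 2 y z"
    unfolding Z_def 1 2 by (simp add: algebra_simps)
  also have "\<dots> = \<alpha> *\<^sub>R pd 1 y z + \<beta> *\<^sub>R pd 2 y z"
    unfolding ab by (simp add: \<alpha>_def \<beta>_def algebra_simps)
  finally have Z: "Z = \<alpha> *\<^sub>R pd 1 y z + \<beta> *\<^sub>R pd 2 y z" .
  have der: "pd i (\<lambda>w. mink (h w) (pd j y w)) z = mink (h z) (pd i (pd j y) z) + mink (pd i h z)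
      (pd j y z)"
    if "h differentiable (at z)" for h i j
    by (rule bm[OF that dif(1)])
  have c0: "pd i (\<lambda>w. 0 :: real) z = 0" for i by (rule pd_eqI[THEN trans, of _ "\<lambda>h. 0"]) simp_all
  \<comment> \<open>Differentiating the four identities of \<open>mink_hodge\<close> expresses the
    products of \<open>Z\<close> with the tangent vectors through second derivatives of
    \<open>y\<close> and first derivatives of \<open>gD\<close>.\<close>
  have e11: "mink (pd 2 hodge1 z) (pd 1 y z) = - mink (hodge1 z) (pd 2 (pd 1 y) z)"
    using der[OF dif(2), of 2 1] pd_cong[OF open_S z, of "\<lambda>w. mink (hodge1 w) (pd 1 y w)" "\<lambda>w. 0" 2]
        mink_hodge(1) c0 by simp
  have e22: "mink (pd 1 hodge2 z) (pd 2 y z) = - mink (hodge2 z) (pd 1 (pd 2 y) z)"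
    using der[OF dif(3), of 1 2] pd_cong[OF open_S z, of "\<lambda>w. mink (hodge2 w) (pd 2 y w)" "\<lambda>w. 0" 1]
        mink_hodge(4) c0 by simp
  have e21: "mink (pd 1 hodge2 z) (pd 1 y z) = pd 1 gD z - mink (hodge2 z) (pd 1 (pd 1 y) z)"
    using der[OF dif(3), of 1 1] pd_cong[OF open_S z, of "\<lambda>w. mink (hodge2 w) (pd 1 y w)" gD 1]
        mink_hodge(3) by simp
  have e12: "mink (pd 2 hodge1 z) (pd 2 y z) = - pd 2 gD z - mink (hodge1 z) (pd 2 (pd 2 y) z)"
    using der[OF dif(2), of 2 2] pd_cong[OF open_S z, of "\<lambda>w. mink (hodge1 w) (pd 2 y w)"
        "\<lambda>w. - gD w" 2] mink_hodge(2)
      pd_bounded_linear[OF bounded_linear_minus[OF bounded_linear_ident] dif(7), of 2] by simp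
  have dE: "pd i gE z = 2 * mink (pd 1 y z) (pd i (pd 1 y) z)" for i
    unfolding gE_def[abs_def] by (simp add: bm[OF dif(1) dif(1)] mink_commute)
  have dG: "pd i gG z = 2 * mink (pd 2 y z) (pd i (pd 2 y) z)" for i
    unfolding gG_def[abs_def] by (simp add: bm[OF dif(1) dif(1)] mink_commute)
  have dF: "pd i gF z = mink (pd 1 y z) (pd i (pd 2 y) z) + mink (pd 2 y z) (pd i (pd 1 y) z)" for i
    unfolding gF_def[abs_def] by (simp add: bm[OF dif(1) dif(1)] mink_commute)
  \<comment> \<open>Obtained from \<open>gD_square\<close>, which avoids differentiating the square
    root.\<close>
  have dD: "2 * gD z * pd i gD z = gE z * pd i gG z + pd i gE z * gG z - 2 * gF z * pd i gF z" for i
  proof -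
    note bmul = pd_bilinear[OF bounded_bilinear_mult]
    have dm: "(\<lambda>w. f w * g w) differentiable (at z)"
        if "f differentiable (at z)" "g differentiable (at z)"
      for f g :: "complex \<Rightarrow> real" using that by simp
    have dd: "pd i (\<lambda>w. f w - g w) z = pd i f z - pd i g z"
      if "f differentiable (at z)" "g differentiable (at z)" for f g :: "complex \<Rightarrow> real"
      using pd_eqI[OF has_derivative_diff[OF that[unfolded frechet_derivative_works]]]
          by (simp add: pd_def)
    have "pd i (\<lambda>w. gD w * gD w) z = pd i (\<lambda>w. gE w * gG w - gF w * gF w) z"
      by (rule pd_cong[OF open_S z gD_square])
    then show ?thesis
      by (simp add: bmul[OF dif(7) dif(7)] dd[OF dm[OF dif(4) dif(6)] dm[OF dif(5) dif(5)]]
          bmul[OF dif(4) dif(6)] bmul[OF dif(5) dif(5)])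
  qed
  have D: "gD z > 0" by (rule gD_pos[OF z])
  have h: "gD z * mink (hodge1 z) v = gF z * mink (pd 1 y z) v - gE z * mink (pd 2 y z) v"
    "gD z * mink (hodge2 z) v = gG z * mink (pd 1 y z) v - gF z * mink (pd 2 y z) v" for v
    using D by (simp_all add: hodge1_def hodge2_def mink_linear field_simps)
  have "2 * gD z * mink Z (pd 1 y z) = 0"
  proof -
    have "2 * gD z * mink Z (pd 1 y z) = 2 * gD z * pd 1 gD z - 2 *
        (gD z * mink (hodge2 z) (pd 1 (pd 1 y) z))
       + 2 * (gD z * mink (hodge1 z) (pd 1 (pd 2 y) z))"
      unfolding Z_def mink_diff_left e21 e11 yc by (simp add: algebra_simps)
    also have "\<dots> = 0" unfolding dD h dE dG dF by (simp add: yc algebra_simps)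
    finally show ?thesis .
  qed
  moreover have "2 * gD z * mink Z (pd 2 y z) = 0"
  proof -
    have "2 * gD z * mink Z (pd 2 y z) = 2 * gD z * pd 2 gD z - 2 *
        (gD z * mink (hodge2 z) (pd 1 (pd 2 y) z))
       + 2 * (gD z * mink (hodge1 z) (pd 2 (pd 2 y) z))"
      unfolding Z_def mink_diff_left e22 e12 by (simp add: algebra_simps)
    also have "\<dots> = 0" unfolding dD h dE dG dF by (simp add: yc algebra_simps)
    finally show ?thesis .
  qed
  ultimately have "mink Z (pd 1 y z) = 0" "mink Z (pd 2 y z) = 0" using D by auto
  then have "\<alpha> = 0" "\<beta> = 0" using tangent_eq_0[OF z] unfolding Z by blast+
  then show ?thesis using Z by (simp add: Z_def)
qed

lemma conjugate_exists:
  assumes "ball z0 r \<subseteq> S"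
  obtains \<eta> :: "4 \<Rightarrow> complex \<Rightarrow> real" where "\<And>l z. z \<in> ball z0 r \<Longrightarrow>
    (\<eta> l has_derivative (\<lambda>h. Re h * hodge1 z $ l + Im h * hodge2 z $ l)) (at z)"
proof -
  have "\<exists>g. \<forall>z\<in>ball z0 r. (g has_derivative (\<lambda>h. Re h * hodge1 z $ l + Im h * hodge2 z $ l)) (at z)"
      for l
  proof -
    have sm: "smooth_on (ball z0 r) (\<lambda>z. hodge1 z $ l)" "smooth_on (ball z0 r) (\<lambda>z. hodge2 z $ l)"
      by (intro smooth_on_nth open_ball smooth_on_subset[OF smooth_hodge(1) assms]
          smooth_on_subset[OF smooth_hodge(2) assms])+
    have cl: "pd 1 (\<lambda>z. hodge2 z $ l) z = pd 2 (\<lambda>z. hodge1 z $ l) z" if "z \<in> ball z0 r" for z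
    proof -
      have z: "z \<in> S" using that assms by blast
      show "pd 1 (\<lambda>z. hodge2 z $ l) z = pd 2 (\<lambda>z. hodge1 z $ l) z"
        using hodge_closed[OF z]
            by (simp add: pd_nth smooth_on_differentiable[OF smooth_hodge(1) z]
                smooth_on_differentiable[OF smooth_hodge(2) z])
    qed
    show ?thesis using closed_form_exact[OF sm cl] by metis
  qed
  then show ?thesis using that by metis
qed

text \<open>Every \<open>y\<^sub>l + i \<eta>\<^sub>l\<close> satisfies the same Beltrami equation \<open>\<partial>\<^sub>2 Y = \<mu> \<partial>\<^sub>1 Y\<close>, so each of them is a
  holomorphic function of any other one that is a local coordinate.\<close>

lemma conformal_coordinate:
  assumes z0: "z0 \<in> S"
  obtains W \<zeta> g \<kappa> where "open W" "z0 \<in> W" "W \<subseteq> S" "smooth_on W \<zeta>" "\<And>z. z \<in> W \<Longrightarrow> jacobian \<zeta> z > 0"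
    "open (\<zeta> ` W)" "homeomorphism W (\<zeta> ` W) \<zeta> g"
    "\<And>l. (\<lambda>w. \<kappa> w $ l) holomorphic_on \<zeta> ` W"
    "\<And>w. w \<in> \<zeta> ` W \<Longrightarrow> mink (\<kappa> w) (\<kappa> w) = 0"
    "\<And>w. w \<in> \<zeta> ` W \<Longrightarrow> pd 1 (y \<circ> g) w = (\<chi> l. Re (\<kappa> w $ l))"
    "\<And>w. w \<in> \<zeta> ` W \<Longrightarrow> pd 2 (y \<circ> g) w = (\<chi> l. - Im (\<kappa> w $ l))"
proof -
  obtain r where r: "r > 0" "ball z0 r \<subseteq> S" using open_S z0 open_contains_ball by blast
  obtain \<eta> :: "4 \<Rightarrow> complex \<Rightarrow> real" where \<eta>: "\<And>l z. z \<in> ball z0 r \<Longrightarrow>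
    (\<eta> l has_derivative (\<lambda>h. Re h * hodge1 z $ l + Im h * hodge2 z $ l)) (at z)"
    using conjugate_exists[OF r(2)] by blast
  define B where "B = ball z0 r"
  have BS: "B \<subseteq> S" "open B" "z0 \<in> B" using r by (auto simp: B_def)
  define Y where "Y l z = Complex (y z $ l) (\<eta> l z)" for l z
  define p where "p z l = Complex (pd 1 y z $ l) (hodge1 z $ l)" for z l
  \<comment> \<open>The form \<open>dy + i *dy\<close> has components proportional to
    \<open>(1, \<mu>)\<close> with a factor \<open>\<mu>\<close> independent of \<open>l\<close>,
    because the dual is a rotation of the tangent plane. Its imaginary part \<open>gD / gE\<close>
    is positive, and this gives every \<open>Y l\<close> a nonnegative Jacobian.\<close>
  define \<mu> where "\<mu> z = Complex (gF z / gE z) (gD z / gE z)" for z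
  have qp: "Complex (pd 2 y z $ l) (hodge2 z $ l) = \<mu> z * p z l" if z: "z \<in> S" for z l
  proof -
    have D: "gD z > 0" "gE z > 0" "gD z * gD z = gE z * gG z - gF z * gF z"
      using gD_pos gE_pos gD_square z by auto
    have h: "gD z * hodge2 z $ l = gG z * pd 1 y z $ l - gF z * pd 2 y z $ l"
      "gD z * hodge1 z $ l = gF z * pd 1 y z $ l - gE z * pd 2 y z $ l"
      using D(1) by (simp_all add: hodge1_def hodge2_def field_simps)
    have "gD z * (gE z * hodge2 z $ l) = gD z * (gF z * hodge1 z $ l + gD z * pd 1 y z $ l)"
      using h D(3) by algebra
    then have "gE z * hodge2 z $ l = gF z * hodge1 z $ l + gD z * pd 1 y z $ l" using D(1) by simp
    moreover have "gE z * pd 2 y z $ l = gF z * pd 1 y z $ l - gD z * hodge1 z $ l"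
      using h(2) by simp
    ultimately show ?thesis
      using D(2) by (simp add: \<mu>_def p_def complex_eq_iff field_simps)
  qed
  have dY: "(Y l has_derivative (\<lambda>h. Re h *\<^sub>R p z l + Im h *\<^sub>R (\<mu> z * p z l))) (at z)" if z: "z \<in> B"
      for l z
  proof -
    have zS: "z \<in> S" using z BS by blast
    have 1: "((\<lambda>z. y z $ l) has_derivative (\<lambda>h. Re h * pd 1 y z $ l + Im h * pd 2 y z $ l)) (at z)"
      using bounded_linear.has_derivative[OF bounded_linear_vec_nth
          has_derivative_pd[OF smooth_on_differentiable[OF smooth zS]]]
      by simp
    have "((\<lambda>z. of_real (y z $ l) + \<i> * of_real (\<eta> l z)) has_derivative
       (\<lambda>h. of_real (Re h * pd 1 y z $ l + Im h * pd 2 y z $ l) + \<i> * of_real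
           (Re h * hodge1 z $ l + Im h * hodge2 z $ l))) (at z)"
      by (intro has_derivative_add has_derivative_mult_right has_derivative_of_real 1 \<eta>)
          (use z in \<open>simp add: B_def\<close>)
    then show ?thesis
      unfolding qp[OF zS, symmetric] Y_def[abs_def] Complex_eq
      by (rule has_derivative_eq_rhs) (simp add: p_def fun_eq_iff complex_eq_iff)
  qed
  have pdY: "pd 1 (Y l) z = p z l" "pd 2 (Y l) z = \<mu> z * p z l" if "z \<in> B" for l z
    using has_derivative_imp_pd[OF dY[OF that]] by auto
  have smp: "smooth_on B (\<lambda>z. p z l)" for l
    unfolding p_def
      by (intro smooth_on_Complex BS smooth_on_nth smooth_on_subset[OF smooth_pd BS(1)]
          smooth_on_subset[OF smooth_hodge(1) BS(1)])
  have sm\<mu>: "smooth_on B \<mu>"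
    unfolding \<mu>_def[abs_def]
    by (intro smooth_on_Complex smooth_on_divide smooth_on_subset[OF smooth_g(1) BS(1)]
        smooth_on_subset[OF smooth_g(2) BS(1)]
      smooth_on_subset[OF smooth_g(4) BS(1)] BS gE_pos) (use BS in auto)
  have smY: "smooth_on B (Y l)" for l
  proof (rule smooth_onI_pd)
    show "Y l differentiable (at z)" if "z \<in> B" for z using dY[OF that] differentiable_def by blast
    fix i :: 2
    show "smooth_on B (pd i (Y l))"
    proof (cases "i = 1")
      case True
      then show ?thesis using smooth_on_cong[OF BS(2), of "pd 1 (Y l)" "\<lambda>z. p z l"] pdY(1) smp
        by auto
    next
      case False
      then have "i = 2" using exhaust_2 by blast
      then show ?thesis using smooth_on_cong[OF BS(2), of "pd 2 (Y l)" "\<lambda>z. \<mu> z * p z l"] pdY(2)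
          smooth_on_mult[OF BS(2) sm\<mu> smp] by auto
    qed
  qed
  \<comment> \<open>Some component of \<open>pd 1 y\<close> is nonzero at \<open>z0\<close>; the
    corresponding \<open>Y k\<close> has positive Jacobian there and becomes the coordinate.\<close>
  have "pd 1 y z0 \<noteq> 0" using gE_pos[OF z0] by (auto simp: gE_def mink_def)
  then obtain k where k: "pd 1 y z0 $ k \<noteq> 0" by (auto simp: vec_eq_iff)
  define \<zeta> where "\<zeta> = Y k"
  have jac: "jacobian \<zeta> z = norm (p z k) ^ 2 * (gD z / gE z)" if z: "z \<in> B" for z
    unfolding jacobian_def \<zeta>_def pdY[OF z] cmod_power2
    by (simp add: \<mu>_def power2_eq_square algebra_simps)
  have "p z0 k \<noteq> 0" using k by (simp add: p_def complex_eq_iff)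
  then have jz0: "jacobian \<zeta> z0 > 0" unfolding jac[OF BS(3)] using gD_pos[OF z0] gE_pos[OF z0]
    by simp
  obtain W g where W: "open W" "z0 \<in> W" "W \<subseteq> B" "\<And>z. z \<in> W \<Longrightarrow> jacobian \<zeta> z > 0"
    "open (\<zeta> ` W)" "homeomorphism W (\<zeta> ` W) \<zeta> g"
    using smooth_local_inverse[OF BS(2) smY[of k] BS(3)] jz0 unfolding \<zeta>_def by blast
  have gW: "g w \<in> W" "\<zeta> (g w) = w" if "w \<in> \<zeta> ` W" for w using W(6) that
    by (auto simp: homeomorphism_def)
  \<comment> \<open>\<open>\<kappa> w $ l\<close> is the complex derivative of \<open>Y l\<close>
    with respect to the coordinate \<open>Y k\<close>. As \<open>y\<close> is the real part of
    \<open>Y\<close>, \<open>\<kappa>\<close> is twice the Wirtinger derivative of \<open>y\<close>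
    in that coordinate.\<close>
  define \<kappa> :: "complex \<Rightarrow> complex ^ 4" where "\<kappa> w = (\<chi> l. p (g w) l / p (g w) k)" for w
  have pk: "p z k \<noteq> 0" if "z \<in> W" for z using W(4)[OF that] jac[of z] W(3) that by auto
  have smW: "smooth_on W \<zeta>" using smooth_on_subset[OF smY W(3)] by (simp add: \<zeta>_def)
  have dYg: "((\<lambda>w. Y l (g w)) has_field_derivative \<kappa> w $ l) (at w)" if w: "w \<in> \<zeta> ` W" for l w
  proof -
    let ?z = "g w"
    have zB: "?z \<in> B" "?z \<in> W" using gW[OF w] W(3) by auto
    obtain D where D: "(g has_derivative D) (at (\<zeta> ?z))"
      "\<And>w. Re (D w) *\<^sub>R pd 1 \<zeta> ?z + Im (D w) *\<^sub>R pd 2 \<zeta> ?z = w"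
      using smooth_on_inverse(2)[OF W(1) smW W(4) W(5,6) zB(2)] by blast
    have D1: "(g has_derivative D) (at w)" using D(1) gW(2)[OF w] by simp
    have "((\<lambda>w. Y l (g w)) has_derivative (\<lambda>h. Re (D h) *\<^sub>R p ?z l + Im (D h) *\<^sub>R (\<mu> ?z * p ?z l)))
        (at w)"
      by (rule has_derivative_compose[OF D1 dY[OF zB(1)]])
    moreover have "Re (D h) *\<^sub>R p ?z l + Im (D h) *\<^sub>R (\<mu> ?z * p ?z l) = \<kappa> w $ l * h" for h
    proof -
      have "h = Re (D h) *\<^sub>R p ?z k + Im (D h) *\<^sub>R (\<mu> ?z * p ?z k)"
        using D(2)[of h] pdY[OF zB(1), of k] by (simp add: \<zeta>_def)
      then have "\<kappa> w $ l * h = (p ?z l / p ?z k) *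
          (Re (D h) *\<^sub>R p ?z k + Im (D h) *\<^sub>R (\<mu> ?z * p ?z k))"
        by (simp add: \<kappa>_def)
      also have "\<dots> = Re (D h) *\<^sub>R p ?z l + Im (D h) *\<^sub>R (\<mu> ?z * p ?z l)"
        using pk[OF zB(2)] by (simp add: scaleR_conv_of_real field_simps)
      finally show ?thesis by simp
    qed
    ultimately show ?thesis by (simp add: has_field_derivative_def)
  qed
  have hol: "(\<lambda>w. \<kappa> w $ l) holomorphic_on \<zeta> ` W" for l
  proof -
    have "(\<lambda>w. Y l (g w)) holomorphic_on \<zeta> ` W" using dYg W(5) holomorphic_on_open by blast
    from holomorphic_deriv[OF this W(5)] show ?thesis
      by (rule holomorphic_transform) (use dYg DERIV_imp_deriv in blast)
  qed
  have dyg: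
      "((y \<circ> g) has_derivative (\<lambda>h. Re h *\<^sub>R (\<chi> l. Re (\<kappa> w $ l)) + Im h *\<^sub>R (\<chi> l. - Im (\<kappa> w $ l))))
          (at w)"
    if w: "w \<in> \<zeta> ` W" for w
    unfolding has_derivative_componentwise_within[of "y \<circ> g"]
  proof
    fix b :: "real ^ 4" assume "b \<in> Basis"
    then obtain l where b: "b = axis l 1" by (auto simp: Basis_vec_def)
    have "((\<lambda>w. Re (Y l (g w))) has_derivative (\<lambda>h. Re (\<kappa> w $ l * h))) (at w)"
      using bounded_linear.has_derivative[OF bounded_linear_Re
          dYg[OF w, of l, unfolded has_field_derivative_def]] .
    then show "((\<lambda>x. (y \<circ> g) x \<bullet> b) has_derivative
         (\<lambda>x. (Re x *\<^sub>R (\<chi> l. Re (\<kappa> w $ l)) + Im x *\<^sub>R (\<chi> l. - Im (\<kappa> w $ l))) \<bullet> b)) (at w)"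
      by (simp add: b inner_axis Y_def algebra_simps)
  qed
  have null: "mink (\<kappa> w) (\<kappa> w) = 0" if w: "w \<in> \<zeta> ` W" for w
  proof -
    let ?z = "g w"
    have z: "?z \<in> S" "?z \<in> W" using gW[OF w] W(3) BS by auto
    have D: "gD ?z > 0" "gE ?z > 0" "gD ?z * gD ?z = gE ?z * gG ?z - gF ?z * gF ?z"
      using gD_pos gE_pos gD_square z by auto
    \<comment> \<open>\<open>pd 1 y\<close> and \<open>hodge1\<close> are orthogonal and have equal
      Minkowski squares, so the complex vector composed of them is null.\<close>
    have a: "mink (pd 1 y ?z) (hodge1 ?z) = 0" using mink_hodge(1)[OF z(1)]
      by (simp add: mink_commute)
    have b: "mink (hodge1 ?z) (hodge1 ?z) = gE ?z"
    proof -
      have "mink (hodge1 ?z) (hodge1 ?z) = (gF ?z / gD ?z) * mink (hodge1 ?z) (pd 1 y ?z) -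
          (gE ?z / gD ?z) * mink (hodge1 ?z) (pd 2 y ?z)"
        by (subst (2) hodge1_def) (simp add: mink_linear)
      then show ?thesis using mink_hodge[OF z(1)] D by simp
    qed
    have "mink (\<kappa> w) (\<kappa> w) * (p ?z k * p ?z k) = p ?z 1 * p ?z 1 + p ?z 2 * p ?z 2 + p ?z 3 * p ?z 3
        - p ?z 4 * p ?z 4"
      using pk[OF z(2)] by (simp add: mink_def \<kappa>_def field_simps)
    also have "\<dots> = Complex (mink (pd 1 y ?z) (pd 1 y ?z) - mink (hodge1 ?z) (hodge1 ?z))
        (2 * mink (pd 1 y ?z) (hodge1 ?z))"
      by (simp add: complex_eq_iff p_def mink_def algebra_simps)
    also have "\<dots> = 0" using a b by (simp add: gE_def complex_eq_iff)
    finally show ?thesis using pk[OF z(2)] by simp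
  qed
  show ?thesis
    by (rule that[of W \<zeta> g \<kappa>]) (use W BS smW hol null has_derivative_imp_pd[OF dyg] in auto)
qed

end


section \<open>The conformal atlas of a stationary surface\<close>

lemma chart_image_simp [simp]: "chart_image (U, \<phi>) = \<phi> ` U"
  and local_rep_simp [simp]: "local_rep x (U, \<phi>) = x \<circ> inv_into U \<phi>"
  by (simp_all add: chart_image_def local_rep_def)

lemma smooth_on_transform:
  "open S \<Longrightarrow> smooth_on S g \<Longrightarrow> (\<And>w. w \<in> S \<Longrightarrow> f w = g w) \<Longrightarrow> smooth_on S f"
  using smooth_on_cong[of S f g] by blast

lemma jacobian_cong:
  assumes "open S" "z \<in> S" "\<And>w. w \<in> S \<Longrightarrow> f w = g w"
  shows "jacobian f z = jacobian g z"
  using pd_cong[OF assms] by (simp add: jacobian_def)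

lemma homeomorphism_imp_homeomorphic_map:
  assumes "homeomorphism S T f g"
  shows "homeomorphic_map (top_of_set S) (top_of_set T) f"
proof -
  have "homeomorphic_maps (top_of_set S) (top_of_set T) f g"
    using assms
        by (auto simp: homeomorphic_maps_def homeomorphism_def continuous_map_in_subtopology)
  then show ?thesis by (rule homeomorphic_maps_imp_map)
qed

locale stationary_surface =
  fixes M :: "'a topology" and A :: "'a chart set" and x :: "'a \<Rightarrow> real ^ 4"
  assumes oriented_surface: "oriented_surface M A"
    and spacelike_immersion: "spacelike_immersion A x"
    and stationary: "stationary A x"
begin

lemma atlas_chart: "c \<in> A \<Longrightarrow> is_chart M c"
  and atlas_cover: "p \<in> topspace M \<Longrightarrow> \<exists>U \<phi>. (U, \<phi>) \<in> A \<and> p \<in> U"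
  and atlas_transition: "c \<in> A \<Longrightarrow> d \<in> A \<Longrightarrow> oriented_transition c d"
  using oriented_surface by (auto simp: oriented_surface_def)
    (metis (no_types, lifting) UN_iff prod.collapse)

lemma atlas_oriented: "c \<in> A \<Longrightarrow> oriented_chart M A c"
  using atlas_chart atlas_transition by (simp add: oriented_chart_def)

lemma stationary_patch_atlas:
  assumes "(U, \<phi>) \<in> A"
  shows "stationary_patch (x \<circ> inv_into U \<phi>) (\<phi> ` U)"
proof -
  let ?y = "x \<circ> inv_into U \<phi>"
  have o: "open (\<phi> ` U)" using chartD(3)[OF atlas_chart[OF assms]] .
  have sm: "smooth_on (\<phi> ` U) ?y" using spacelike_immersion assms
    by (auto simp: spacelike_immersion_def)
  have "mink (a *\<^sub>R pd 1 ?y z + b *\<^sub>R pd 2 ?y z) (a *\<^sub>R pd 1 ?y z + b *\<^sub>R pd 2 ?y z) > 0"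
    if "z \<in> \<phi> ` U" "a \<noteq> 0 \<or> b \<noteq> 0" for z a b
  proof -
    define h :: "real ^ 2" where "h = vector [a, b]"
    have h: "h $ 1 = a" "h $ 2 = b" by (simp_all add: h_def)
    then have "h \<noteq> 0" using that(2) by auto
    then have "h \<bullet> (induced_metric ?y z *v h) > 0"
      using spacelike_immersion assms that(1) by (auto simp: spacelike_immersion_def)
    also have "h \<bullet> (induced_metric ?y z *v h) =
      mink (a *\<^sub>R pd 1 ?y z + b *\<^sub>R pd 2 ?y z) (a *\<^sub>R pd 1 ?y z + b *\<^sub>R pd 2 ?y z)"
      by (simp add: h inner_vec_def matrix_vector_mult_def sum_2 induced_metric_def mink_linear
          algebra_simps
          mink_commute[of "pd 2 ?y z" "pd 1 ?y z"])
    finally show ?thesis .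
  qed
  then show ?thesis
    using o sm stationary assms by unfold_locales (auto simp: stationary_def)
qed

lemma transition_to_atlas:
  assumes c: "oriented_chart M A (U, \<xi>)" and d: "(V, \<theta>) \<in> A"
  shows "open (\<xi> ` (U \<inter> V))" "smooth_on (\<xi> ` (U \<inter> V)) (\<theta> \<circ> inv_into U \<xi>)"
    "\<And>z. z \<in> \<xi> ` (U \<inter> V) \<Longrightarrow> jacobian (\<theta> \<circ> inv_into U \<xi>) z > 0"
    "\<And>z. z \<in> \<xi> ` (U \<inter> V) \<Longrightarrow> (\<theta> \<circ> inv_into U \<xi>) z \<in> \<theta> ` (U \<inter> V)"
    "\<And>z. z \<in> \<xi> ` (U \<inter> V) \<Longrightarrow> (x \<circ> inv_into U \<xi>) z = (x \<circ> inv_into V \<theta>) ((\<theta> \<circ> inv_into U \<xi>) z)"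
proof -
  have ch: "is_chart M (U, \<xi>)" "is_chart M (V, \<theta>)" using c atlas_chart[OF d]
    by (auto simp: oriented_chart_def)
  show "open (\<xi> ` (U \<inter> V))" by (rule open_chart_image[OF ch(1) chartD(1)[OF ch(2)]])
  show "smooth_on (\<xi> ` (U \<inter> V)) (\<theta> \<circ> inv_into U \<xi>)"
    "\<And>z. z \<in> \<xi> ` (U \<inter> V) \<Longrightarrow> jacobian (\<theta> \<circ> inv_into U \<xi>) z > 0"
    using c d unfolding oriented_chart_def oriented_transition_def by fastforce+
  show "\<And>z. z \<in> \<xi> ` (U \<inter> V) \<Longrightarrow> (\<theta> \<circ> inv_into U \<xi>) z \<in> \<theta> ` (U \<inter> V)" using ch by auto
  show "\<And>z. z \<in> \<xi> ` (U \<inter> V) \<Longrightarrow> (x \<circ> inv_into U \<xi>) z = (x \<circ> inv_into V \<theta>) ((\<theta> \<circ> inv_into U \<xi>) z)"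
    using ch by auto
qed

text \<open>The immersion is given as smooth and space-like in the charts of \<open>A\<close>,
  whereas the Gauss map ranges over isothermal charts of the maximal atlas. The chain rule transfers
  both properties; a nonzero Jacobian sends nonzero \<open>(a, b)\<close> to nonzero
  \<open>(a', b')\<close>.\<close>

lemma spacelike_patch_oriented:
  assumes c: "oriented_chart M A (U, \<xi>)"
  shows "spacelike_patch (x \<circ> inv_into U \<xi>) (\<xi> ` U)"
proof
  have ch: "is_chart M (U, \<xi>)" using c by (auto simp: oriented_chart_def)
  let ?y = "x \<circ> inv_into U \<xi>"
  show "open (\<xi> ` U)" by (rule chartD(3)[OF ch])
  have cov: "\<xi> ` U = \<Union> {\<xi> ` (U \<inter> V) | V \<theta>. (V, \<theta>) \<in> A}"
  proof (intro equalityI subsetI)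
    fix z assume "z \<in> \<xi> ` U"
    then obtain p where p: "p \<in> U" "z = \<xi> p" by blast
    then obtain V \<theta> where "(V, \<theta>) \<in> A" "p \<in> V" using atlas_cover chartD(2)[OF ch] by blast
    then show "z \<in> \<Union> {\<xi> ` (U \<inter> V) | V \<theta>. (V, \<theta>) \<in> A}" using p by blast
  qed blast
  show "smooth_on (\<xi> ` U) ?y"
    unfolding cov
  proof (rule smooth_on_Un)
    fix T assume "T \<in> {\<xi> ` (U \<inter> V) | V \<theta>. (V, \<theta>) \<in> A}"
    then obtain V \<theta> where V: "T = \<xi> ` (U \<inter> V)" "(V, \<theta>) \<in> A" by blast
    note t = transition_to_atlas[OF c V(2)]
    interpret V: stationary_patch "x \<circ> inv_into V \<theta>" "\<theta> ` V"
      by (rule stationary_patch_atlas[OF V(2)])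
    show "open T" using t(1) V(1) by simp
    have "smooth_on (\<xi> ` (U \<inter> V)) (\<lambda>z. (x \<circ> inv_into V \<theta>) ((\<theta> \<circ> inv_into U \<xi>) z))"
      by (rule smooth_on_compose[OF t(1,2) V.smooth]) (use t(4) in auto)
    from smooth_on_transform[OF t(1) this t(5)] show "smooth_on T ?y" using V(1)
      by (simp add: comp_def)
  qed
  fix z and a b :: real
  assume z: "z \<in> \<xi> ` U" and ab: "a \<noteq> 0 \<or> b \<noteq> 0"
  then obtain p where p: "p \<in> U" "z = \<xi> p" by blast
  then obtain V \<theta> where V: "(V, \<theta>) \<in> A" "p \<in> V" using atlas_cover chartD(2)[OF ch] by blast
  note t = transition_to_atlas[OF c V(1)]
  interpret V: stationary_patch "x \<circ> inv_into V \<theta>" "\<theta> ` V" by (rule stationary_patch_atlas[OF V(1)])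
  let ?\<tau> = "\<theta> \<circ> inv_into U \<xi>"
  have zt: "z \<in> \<xi> ` (U \<inter> V)" using p V by auto
  have pdy: "pd i ?y z = Re (pd i ?\<tau> z) *\<^sub>R pd 1 (x \<circ> inv_into V \<theta>) (?\<tau> z) + Im (pd i ?\<tau> z) *\<^sub>R pd 2
      (x \<circ> inv_into V \<theta>) (?\<tau> z)" for i
  proof -
    have "pd i ?y z = pd i (\<lambda>z. (x \<circ> inv_into V \<theta>) (?\<tau> z)) z" by (rule pd_cong[OF t(1) zt t(5)])
    also have "\<dots> = Re (pd i ?\<tau> z) *\<^sub>R pd 1 (x \<circ> inv_into V \<theta>) (?\<tau> z) + Im (pd i ?\<tau> z) *\<^sub>R pd 2
        (x \<circ> inv_into V \<theta>) (?\<tau> z)"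
      by (rule has_derivative_pd_compose(2)[OF smooth_on_differentiable[OF V.smooth]
          smooth_on_differentiable[OF t(2) zt]])
        (use t(4)[OF zt] in auto)
    finally show ?thesis .
  qed
  define a' where "a' = a * Re (pd 1 ?\<tau> z) + b * Re (pd 2 ?\<tau> z)"
  define b' where "b' = a * Im (pd 1 ?\<tau> z) + b * Im (pd 2 ?\<tau> z)"
  have eq: "a *\<^sub>R pd 1 ?y z + b *\<^sub>R pd 2 ?y z = a' *\<^sub>R pd 1 (x \<circ> inv_into V \<theta>) (?\<tau> z) + b' *\<^sub>R pd 2
      (x \<circ> inv_into V \<theta>) (?\<tau> z)"
    unfolding pdy a'_def b'_def by (simp add: algebra_simps)
  have "a' \<noteq> 0 \<or> b' \<noteq> 0"
  proof (rule ccontr)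
    assume "\<not> ?thesis"
    then have 0: "a' = 0" "b' = 0" by auto
    have "a * jacobian ?\<tau> z = a' * Im (pd 2 ?\<tau> z) - b' * Re (pd 2 ?\<tau> z)"
      "b * jacobian ?\<tau> z = b' * Re (pd 1 ?\<tau> z) - a' * Im (pd 1 ?\<tau> z)"
      by (simp_all add: a'_def b'_def jacobian_def algebra_simps)
    then show False using 0 ab t(3)[OF zt] by auto
  qed
  moreover have "?\<tau> z \<in> \<theta> ` V" using t(4)[OF zt] by blast
  ultimately show "0 < mink (a *\<^sub>R pd 1 ?y z + b *\<^sub>R pd 2 ?y z) (a *\<^sub>R pd 1 ?y z + b *\<^sub>R pd 2 ?y z)"
    unfolding eq using V.spacelike by blast
qed

lemma isothermalD:
  assumes c: "oriented_isothermal_chart M A x (U, \<xi>)"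
  shows "oriented_chart M A (U, \<xi>)" "is_chart M (U, \<xi>)" "spacelike_patch (x \<circ> inv_into U \<xi>) (\<xi> ` U)"
    "\<And>z. z \<in> \<xi> ` U \<Longrightarrow> mink (pd 1 (x \<circ> inv_into U \<xi>) z) (pd 1 (x \<circ> inv_into U \<xi>) z) > 0"
    "\<And>z. z \<in> \<xi> ` U \<Longrightarrow> mink (pd 2 (x \<circ> inv_into U \<xi>) z) (pd 2 (x \<circ> inv_into U \<xi>) z)
      = mink (pd 1 (x \<circ> inv_into U \<xi>) z) (pd 1 (x \<circ> inv_into U \<xi>) z)"
    "\<And>z. z \<in> \<xi> ` U \<Longrightarrow> mink (pd 1 (x \<circ> inv_into U \<xi>) z) (pd 2 (x \<circ> inv_into U \<xi>) z) = 0"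
proof -
  show oc: "oriented_chart M A (U, \<xi>)" using c by (simp add: oriented_isothermal_chart_def)
  then show "is_chart M (U, \<xi>)" by (simp add: oriented_chart_def)
  show sp: "spacelike_patch (x \<circ> inv_into U \<xi>) (\<xi> ` U)" by (rule spacelike_patch_oriented[OF oc])
  interpret spacelike_patch "x \<circ> inv_into U \<xi>" "\<xi> ` U" by (rule sp)
  fix z assume z: "z \<in> \<xi> ` U"
  show "mink (pd 1 (x \<circ> inv_into U \<xi>) z) (pd 1 (x \<circ> inv_into U \<xi>) z) > 0"
    using gE_pos[OF z] by (simp add: gE_def)
  show "mink (pd 2 (x \<circ> inv_into U \<xi>) z) (pd 2 (x \<circ> inv_into U \<xi>) z)
      = mink (pd 1 (x \<circ> inv_into U \<xi>) z) (pd 1 (x \<circ> inv_into U \<xi>) z)"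
    "mink (pd 1 (x \<circ> inv_into U \<xi>) z) (pd 2 (x \<circ> inv_into U \<xi>) z) = 0"
    using c z by (auto simp: oriented_isothermal_chart_def Let_def induced_metric_def)
qed

text \<open>\<open>oriented_chart\<close> relates a chart to the charts of \<open>A\<close>, so two
  such charts are compared by factoring through a chart of \<open>A\<close> around
  \<open>p\<close>.\<close>

lemma oriented_transition_local:
  assumes c: "oriented_chart M A (U, \<xi>)" and d: "oriented_chart M A (V, \<theta>)" and p: "p \<in> U \<inter> V"
  shows "(\<theta> \<circ> inv_into U \<xi>) differentiable (at (\<xi> p))" "jacobian (\<theta> \<circ> inv_into U \<xi>) (\<xi> p) > 0"
proof -
  have ch: "is_chart M (U, \<xi>)" "is_chart M (V, \<theta>)" using c d by (auto simp: oriented_chart_def)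
  obtain W \<psi> where W: "(W, \<psi>) \<in> A" "p \<in> W" using p atlas_cover chartD(2)[OF ch(1)] by blast
  have chW: "is_chart M (W, \<psi>)" by (rule atlas_chart[OF W(1)])
  note t = transition_to_atlas[OF c W(1)]
  let ?z = "\<xi> p" and ?\<sigma> = "\<psi> \<circ> inv_into U \<xi>" and ?\<rho> = "\<theta> \<circ> inv_into W \<psi>"
  have \<rho>: "?\<rho> differentiable (at (\<psi> p))" "jacobian ?\<rho> (\<psi> p) > 0"
  proof -
    have "smooth_on (\<psi> ` (W \<inter> V)) ?\<rho>" "\<And>z. z \<in> \<psi> ` (W \<inter> V) \<Longrightarrow> jacobian ?\<rho> z > 0"
      using d W(1) unfolding oriented_chart_def oriented_transition_def by fastforce+
    moreover have "\<psi> p \<in> \<psi> ` (W \<inter> V)" using p W by blast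
    ultimately show "?\<rho> differentiable (at (\<psi> p))" "jacobian ?\<rho> (\<psi> p) > 0"
      using smooth_on_differentiable by blast+
  qed
  let ?N = "\<xi> ` (U \<inter> (V \<inter> W))"
  have N: "open ?N" "?z \<in> ?N"
    using open_chart_image[OF ch(1) openin_Int[OF chartD(1)[OF ch(2)] chartD(1)[OF chW]]] p W
        by auto
  have eq: "?\<rho> (?\<sigma> z) = (\<theta> \<circ> inv_into U \<xi>) z" if "z \<in> ?N" for z using that ch chW by auto
  have \<sigma>z: "?\<sigma> ?z = \<psi> p" using p ch by simp
  have zt: "?z \<in> \<xi> ` (U \<inter> W)" using p W by blast
  have \<sigma>: "?\<sigma> differentiable (at ?z)" by (rule smooth_on_differentiable[OF t(2) zt])
  have \<rho>': "?\<rho> differentiable (at (?\<sigma> ?z))" using \<rho>(1) \<sigma>z by simp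
  show "(\<theta> \<circ> inv_into U \<xi>) differentiable (at ?z)"
    using has_derivative_pd_compose(1)[OF \<rho>' \<sigma>]
      differentiable_cong_open[OF N, of "\<lambda>z. ?\<rho> (?\<sigma> z)" "\<theta> \<circ> inv_into U \<xi>"] eq by blast
  have "jacobian (\<theta> \<circ> inv_into U \<xi>) ?z = jacobian (\<lambda>z. ?\<rho> (?\<sigma> z)) ?z"
    by (rule jacobian_cong[OF N eq[symmetric]])
  also have "\<dots> = jacobian ?\<rho> (\<psi> p) * jacobian ?\<sigma> ?z" using jacobian_compose[OF \<rho>' \<sigma>] \<sigma>z by simp
  also have "\<dots> > 0" using \<rho>(2) t(3)[OF zt] by simp
  finally show "jacobian (\<theta> \<circ> inv_into U \<xi>) ?z > 0" .
qed

text \<open>In isothermal coordinates the Jacobian matrix of the transition has orthogonal columns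
  of equal length. With positive determinant this is exactly the Cauchy-Riemann system, and the
  chain rule for \<open>x_z\<close> collapses to multiplication by the complex derivative.\<close>

lemma isothermal_transition:
  assumes c: "oriented_isothermal_chart M A x (U, \<xi>)"
      and d: "oriented_isothermal_chart M A x (V, \<theta>)"
    and p: "p \<in> U \<inter> V"
  shows "((\<theta> \<circ> inv_into U \<xi>) has_field_derivative pd 1 (\<theta> \<circ> inv_into U \<xi>) (\<xi> p)) (at (\<xi> p))"
    "pd 1 (\<theta> \<circ> inv_into U \<xi>) (\<xi> p) \<noteq> 0"
    "wirtinger (x \<circ> inv_into U \<xi>) (\<xi> p)
      = pd 1 (\<theta> \<circ> inv_into U \<xi>) (\<xi> p) *s wirtinger (x \<circ> inv_into V \<theta>) (\<theta> p)"
proof -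
  note cD = isothermalD[OF c] and dD = isothermalD[OF d]
  let ?\<tau> = "\<theta> \<circ> inv_into U \<xi>" and ?z = "\<xi> p" and ?y = "x \<circ> inv_into U \<xi>"
      and ?y' = "x \<circ> inv_into V \<theta>"
  interpret V: spacelike_patch ?y' "\<theta> ` V" by (rule dD(3))
  note t = oriented_transition_local[OF cD(1) dD(1) p]
  have \<tau>z: "?\<tau> ?z = \<theta> p" using p cD by simp
  have zU: "?z \<in> \<xi> ` U" "\<theta> p \<in> \<theta> ` V" using p by auto
  define a b c d where abcd: "a = Re (pd 1 ?\<tau> ?z)" "b = Im (pd 1 ?\<tau> ?z)" "c = Re (pd 2 ?\<tau> ?z)"
      "d = Im (pd 2 ?\<tau> ?z)"
  define u v where uv: "u = pd 1 ?y' (\<theta> p)" "v = pd 2 ?y' (\<theta> p)"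
  have N: "open (\<xi> ` (U \<inter> V))" "?z \<in> \<xi> ` (U \<inter> V)"
    using open_chart_image[OF cD(2) chartD(1)[OF dD(2)]] p by auto
  have pdy: "pd i ?y ?z = Re (pd i ?\<tau> ?z) *\<^sub>R u + Im (pd i ?\<tau> ?z) *\<^sub>R v" for i
  proof -
    have "pd i ?y ?z = pd i (\<lambda>z. ?y' (?\<tau> z)) ?z" by (rule pd_cong[OF N]) (use cD dD in auto)
    also have "\<dots> = Re (pd i ?\<tau> ?z) *\<^sub>R pd 1 ?y' (?\<tau> ?z) + Im (pd i ?\<tau> ?z) *\<^sub>R pd 2 ?y' (?\<tau> ?z)"
      by (rule has_derivative_pd_compose(2)[OF smooth_on_differentiable[OF V.smooth] t(1)])
          (use zU \<tau>z in simp)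
    finally show ?thesis unfolding \<tau>z uv .
  qed
  define l where "l = mink u u"
  have l: "l > 0" "mink v v = l" "mink u v = 0" "mink v u = 0"
    using dD(4-6)[OF zU(2)] by (auto simp: l_def uv mink_commute)
  have "mink (pd 1 ?y ?z) (pd 1 ?y ?z) = l * (a * a + b * b)"
      "mink (pd 2 ?y ?z) (pd 2 ?y ?z) = l * (c * c + d * d)"
    "mink (pd 1 ?y ?z) (pd 2 ?y ?z) = l * (a * c + b * d)"
    unfolding pdy abcd using l by (simp_all add: mink_linear l_def[symmetric] algebra_simps)
  then have e: "a * a + b * b = c * c + d * d" "a * c + b * d = 0"
    using cD(5,6)[OF zU(1)] l(1) by auto
  have e3: "a * d - b * c > 0"
    using t(2) by (simp add: abcd jacobian_def mult.commute)
  note e = e e3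
  have nz: "a * a + b * b > 0"
  proof (rule ccontr)
    assume "\<not> ?thesis"
    then have "a = 0" "b = 0" using sum_squares_gt_zero_iff by blast+
    then show False using e(3) by simp
  qed
  \<comment> \<open>With \<open>J = a * d - b * c\<close>, orthogonality determines the second
    column up to the factor \<open>J / (a * a + b * b)\<close>. Equal lengths make its square 1, and
    positivity of \<open>J\<close> makes it 1.\<close>
  have "(a * a + b * b) * c = (- b) * (a * d - b * c)" "(a * a + b * b) * d = a * (a * d - b * c)"
    using e(2) by algebra+
  then have J: "(a * d - b * c) * (a * d - b * c) = (a * a + b * b) * (c * c + d * d)"
    by algebra
  then have "a * d - b * c = a * a + b * b"
    using e nz by (metis abs_of_pos power2_eq_square power2_eq_iff_nonneg less_imp_le)
  then have "(a * a + b * b) * c = (a * a + b * b) * (- b)"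
      "(a * a + b * b) * d = (a * a + b * b) * a"
    using \<open>(a * a + b * b) * c = _\<close> \<open>(a * a + b * b) * d = _\<close> by (simp_all only: mult.commute)
  then have "c = - b" "d = a" using nz by (metis mult_left_cancel less_irrefl)+
  then have p2: "pd 2 ?\<tau> ?z = \<i> * pd 1 ?\<tau> ?z" by (simp add: complex_eq_iff abcd)
  show "(?\<tau> has_field_derivative pd 1 ?\<tau> ?z) (at ?z)"
    unfolding has_field_derivative_def
    by (rule has_derivative_eq_rhs[OF has_derivative_pd[OF t(1)]])
        (simp add: p2 fun_eq_iff complex_eq_iff algebra_simps)
  show "pd 1 ?\<tau> ?z \<noteq> 0" using nz by (auto simp: abcd complex_eq_iff)
  show "wirtinger ?y ?z = pd 1 ?\<tau> ?z *s wirtinger ?y' (\<theta> p)"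
    unfolding wirtinger_def pdy p2
    by (simp add: vec_eq_iff complex_eq_iff field_simps uv)
qed

text \<open>Holomorphy of \<open>x_z\<close> is built in because \<open>conformal_coordinate\<close>
  delivers it together with each chart that it constructs.\<close>

definition conformal_atlas :: "'a chart set" where
  "conformal_atlas = {c. oriented_isothermal_chart M A x c \<and>
     (\<forall>k. (\<lambda>z. wirtinger (local_rep x c) z $ k) holomorphic_on chart_image c)}"

text \<open>The conformal coordinate \<open>\<zeta>\<close> of the patch is composed with a chart of
  \<open>A\<close>. Positive Jacobians of \<open>\<zeta>\<close> and of its inverse keep the result
  in the oriented atlas, and nullity of \<open>\<kappa>\<close> is the isothermal condition.\<close>

lemma conformal_atlas_cover:
  assumes p: "p \<in> topspace M"
  shows "\<exists>U \<phi>. (U, \<phi>) \<in> conformal_atlas \<and> p \<in> U"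
proof -
  obtain U \<phi> where U: "(U, \<phi>) \<in> A" "p \<in> U" using atlas_cover[OF p] by blast
  have ch: "is_chart M (U, \<phi>)" by (rule atlas_chart[OF U(1)])
  let ?y = "x \<circ> inv_into U \<phi>"
  interpret stationary_patch ?y "\<phi> ` U" by (rule stationary_patch_atlas[OF U(1)])
  have "\<phi> p \<in> \<phi> ` U" using U by blast
  from conformal_coordinate[OF this]
  obtain W \<zeta> g \<kappa>
      where W: "open W" "\<phi> p \<in> W" "W \<subseteq> \<phi> ` U" "smooth_on W \<zeta>" "\<And>z. z \<in> W \<Longrightarrow> jacobian \<zeta> z > 0"
    "open (\<zeta> ` W)" "homeomorphism W (\<zeta> ` W) \<zeta> g"
    and hol: "\<And>l. (\<lambda>w. \<kappa> w $ l) holomorphic_on \<zeta> ` W"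
    and null: "\<And>w. w \<in> \<zeta> ` W \<Longrightarrow> mink (\<kappa> w) (\<kappa> w) = 0"
    and p1: "\<And>w. w \<in> \<zeta> ` W \<Longrightarrow> pd 1 (?y \<circ> g) w = (\<chi> l. Re (\<kappa> w $ l))"
    and p2: "\<And>w. w \<in> \<zeta> ` W \<Longrightarrow> pd 2 (?y \<circ> g) w = (\<chi> l. - Im (\<kappa> w $ l))" by metis
  have gW: "g w \<in> W" "\<zeta> (g w) = w" if "w \<in> \<zeta> ` W" for w using W(7) that
    by (auto simp: homeomorphism_def)
  have g\<zeta>: "g (\<zeta> z) = z" if "z \<in> W" for z using W(7) that by (auto simp: homeomorphism_def)
  have smg: "smooth_on (\<zeta> ` W) g" by (rule smooth_on_inverse(1)[OF W(1,4,5,6,7)])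
  define U' where "U' = {q \<in> U. \<phi> q \<in> W}"
  define \<xi> where "\<xi> = \<zeta> \<circ> \<phi>"
  have oU': "openin M U'" unfolding U'_def by (rule openin_chart_preimage[OF ch W(1)])
  have \<phi>U': "\<phi> ` U' = W" using W(3) by (auto simp: U'_def)
  have \<xi>U': "\<xi> ` U' = \<zeta> ` W" unfolding \<xi>_def image_comp[symmetric] \<phi>U' ..
  have U'U: "U' \<subseteq> U" by (auto simp: U'_def)
  have "homeomorphic_map (subtopology (subtopology M U) U') (subtopology (top_of_set (\<phi> ` U)) W) \<phi>"
    by (rule homeomorphic_map_subtopologies[OF chartD(5)[OF ch]])
      (use chartD(2)[OF ch] W(3) in \<open>auto simp: U'_def\<close>)
  then have "homeomorphic_map (subtopology M U') (top_of_set W) \<phi>"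
    using U'U W(3) by (simp add: subtopology_subtopology Int_absorb1)
  from homeomorphic_map_compose[OF this homeomorphism_imp_homeomorphic_map[OF W(7)]]
  have "homeomorphic_map (subtopology M U') (top_of_set (\<xi> ` U')) \<xi>" unfolding \<xi>U'
    by (simp add: \<xi>_def)
  then have ch': "is_chart M (U', \<xi>)" using oU' W(6) by (simp add: is_chart_def \<xi>U')
  have inv: "inv_into U' \<xi> w = inv_into U \<phi> (g w)" if w: "w \<in> \<zeta> ` W" for w
  proof (rule inv_into_f_eq[OF chartD(4)[OF ch']])
    have "g w \<in> \<phi> ` U" using gW[OF w] W(3) by blast
    then show "inv_into U \<phi> (g w) \<in> U'" "\<xi> (inv_into U \<phi> (g w)) = w"
      using gW[OF w] by (auto simp: U'_def \<xi>_def f_inv_into_f inv_into_into)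
  qed
  have jg: "jacobian g w > 0" if w: "w \<in> \<zeta> ` W" for w
  proof -
    let ?z = "g w"
    have "jacobian (\<lambda>z. g (\<zeta> z)) ?z = jacobian (\<lambda>z. z) ?z"
      by (rule jacobian_cong[OF W(1) gW(1)[OF w]]) (rule g\<zeta>)
    also have "\<dots> = 1"
      using has_derivative_imp_pd[of "\<lambda>z. z" 1 \<i> ?z]
        has_derivative_eq_rhs[OF has_derivative_ident[of "at ?z"], of "\<lambda>h. Re h *\<^sub>R 1 + Im h *\<^sub>R \<i>"]
      by (simp add: jacobian_def fun_eq_iff complex_eq_iff)
    finally have "1 = jacobian (\<lambda>z. g (\<zeta> z)) ?z" by simp
    also have "\<dots> = jacobian g (\<zeta> ?z) * jacobian \<zeta> ?z"
      by (rule jacobian_compose[OF smooth_on_differentiable[OF smg]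
          smooth_on_differentiable[OF W(4)]])
        (use gW[OF w] w in simp_all)
    finally have "jacobian g w * jacobian \<zeta> ?z = 1" using gW[OF w] by simp
    then show ?thesis using W(5)[OF gW(1)[OF w]] by (metis zero_less_mult_pos2 zero_less_one)
  qed
  have oc: "oriented_chart M A (U', \<xi>)"
    unfolding oriented_chart_def
  proof (intro conjI ballI)
    show "is_chart M (U', \<xi>)" by (rule ch')
    fix d assume dA: "d \<in> A"
    obtain V \<theta> where d: "d = (V, \<theta>)" by (cases d)
    have chV: "is_chart M (V, \<theta>)" using atlas_chart dA d by blast
    have t1: "smooth_on (\<phi> ` (U \<inter> V)) (\<theta> \<circ> inv_into U \<phi>)"
        "\<And>z. z \<in> \<phi> ` (U \<inter> V) \<Longrightarrow> jacobian (\<theta> \<circ> inv_into U \<phi>) z > 0"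
      and t2: "smooth_on (\<theta> ` (V \<inter> U)) (\<phi> \<circ> inv_into V \<theta>)"
          "\<And>z. z \<in> \<theta> ` (V \<inter> U) \<Longrightarrow> jacobian (\<phi> \<circ> inv_into V \<theta>) z > 0"
      using atlas_transition[OF U(1) dA] atlas_transition[OF dA U(1)]
          unfolding d oriented_transition_def by fastforce+
    let ?N = "\<xi> ` (U' \<inter> V)"
    have oN: "open ?N" by (rule open_chart_image[OF ch' chartD(1)[OF chV]])
    have NW: "?N \<subseteq> \<zeta> ` W" using \<xi>U' by blast
    have gN: "g w \<in> \<phi> ` (U \<inter> V)" if "w \<in> ?N" for w
      using that g\<zeta> by (auto simp: \<xi>_def U'_def)
    have eq1: "(\<theta> \<circ> inv_into U' \<xi>) w = (\<theta> \<circ> inv_into U \<phi>) (g w)" if "w \<in> ?N" for w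
      using inv that NW by auto
    show "oriented_transition (U', \<xi>) d"
      unfolding d oriented_transition_def prod.case
    proof (intro conjI ballI)
      have "smooth_on ?N (\<lambda>w. (\<theta> \<circ> inv_into U \<phi>) (g w))"
        by (rule smooth_on_compose[OF oN smooth_on_subset[OF smg NW] t1(1)]) (use gN in blast)
      from smooth_on_transform[OF oN this eq1] show "smooth_on ?N (\<theta> \<circ> inv_into U' \<xi>)" .
      fix w assume w: "w \<in> ?N"
      have "jacobian (\<theta> \<circ> inv_into U' \<xi>) w = jacobian (\<lambda>w. (\<theta> \<circ> inv_into U \<phi>) (g w)) w"
        by (rule jacobian_cong[OF oN w eq1])
      also have "\<dots> = jacobian (\<theta> \<circ> inv_into U \<phi>) (g w) * jacobian g w"
        by (rule jacobian_compose[OF smooth_on_differentiable[OF t1(1) gN[OF w]]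
            smooth_on_differentiable[OF smg]])
          (use w NW in blast)
      also have "\<dots> > 0" using t1(2)[OF gN[OF w]] jg w NW by (intro mult_pos_pos) auto
      finally show "jacobian (\<theta> \<circ> inv_into U' \<xi>) w > 0" .
    qed
    let ?N' = "\<theta> ` (V \<inter> U')"
    have oN': "open ?N'" by (rule open_chart_image[OF chV oU'])
    have N'U: "?N' \<subseteq> \<theta> ` (V \<inter> U)" using U'U by blast
    have \<phi>N: "(\<phi> \<circ> inv_into V \<theta>) w \<in> W" if "w \<in> ?N'" for w using that chV by (auto simp: U'_def)
    have eq2: "(\<xi> \<circ> inv_into V \<theta>) w = \<zeta> ((\<phi> \<circ> inv_into V \<theta>) w)" for w by (simp add: \<xi>_def)
    show "oriented_transition d (U', \<xi>)"
      unfolding d oriented_transition_def prod.case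
    proof (intro conjI ballI)
      have "smooth_on ?N' (\<lambda>w. \<zeta> ((\<phi> \<circ> inv_into V \<theta>) w))"
        by (rule smooth_on_compose[OF oN' smooth_on_subset[OF t2(1) N'U] W(4)]) (use \<phi>N in blast)
      from smooth_on_transform[OF oN' this eq2] show "smooth_on ?N' (\<xi> \<circ> inv_into V \<theta>)" .
      fix w assume w: "w \<in> ?N'"
      have wU: "w \<in> \<theta> ` (V \<inter> U)" using w N'U by blast
      have "jacobian (\<xi> \<circ> inv_into V \<theta>) w = jacobian (\<lambda>w. \<zeta> ((\<phi> \<circ> inv_into V \<theta>) w)) w"
        by (rule jacobian_cong[OF oN' w eq2])
      also have "\<dots> = jacobian \<zeta> ((\<phi> \<circ> inv_into V \<theta>) w) * jacobian (\<phi> \<circ> inv_into V \<theta>) w"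
        by (rule jacobian_compose[OF smooth_on_differentiable[OF W(4) \<phi>N[OF w]]
            smooth_on_differentiable[OF t2(1) wU]])
      also have "\<dots> > 0" using W(5)[OF \<phi>N[OF w]] t2(2)[OF wU] by simp
      finally show "jacobian (\<xi> \<circ> inv_into V \<theta>) w > 0" .
    qed
  qed
  let ?y' = "x \<circ> inv_into U' \<xi>"
  have pd': "pd 1 ?y' w = (\<chi> l. Re (\<kappa> w $ l))" "pd 2 ?y' w = (\<chi> l. - Im (\<kappa> w $ l))"
      if w: "w \<in> \<zeta> ` W" for w
  proof -
    have "pd i ?y' w = pd i (?y \<circ> g) w" for i
      by (rule pd_cong[OF W(6) w]) (simp add: inv)
    then show "pd 1 ?y' w = (\<chi> l. Re (\<kappa> w $ l))" "pd 2 ?y' w = (\<chi> l. - Im (\<kappa> w $ l))"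
      using p1[OF w] p2[OF w] by simp_all
  qed
  have iso: "oriented_isothermal_chart M A x (U', \<xi>)"
  proof -
    have "mink (pd 1 ?y' w) (pd 1 ?y' w) = mink (pd 2 ?y' w) (pd 2 ?y' w) \<and> mink (pd 1 ?y' w)
        (pd 2 ?y' w) = 0"
      if w: "w \<in> \<zeta> ` W" for w
      using null[OF w] unfolding pd'[OF w] by (simp add: mink_def complex_eq_iff algebra_simps)
    then show ?thesis using oc
      by (simp add: oriented_isothermal_chart_def \<xi>U' induced_metric_def Let_def)
  qed
  have "(\<lambda>w. wirtinger ?y' w $ k) holomorphic_on \<zeta> ` W" for k
  proof (rule holomorphic_transform)
    show "(\<lambda>w. \<kappa> w $ k / 2) holomorphic_on \<zeta> ` W" by (intro holomorphic_intros hol) simp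
    show "\<kappa> w $ k / 2 = wirtinger ?y' w $ k" if "w \<in> \<zeta> ` W" for w
      by (simp add: wirtinger_def pd'[OF that] complex_eq_iff)
  qed
  then have "(U', \<xi>) \<in> conformal_atlas" using iso by (simp add: conformal_atlas_def \<xi>U')
  moreover have "p \<in> U'" using U W by (simp add: U'_def)
  ultimately show ?thesis by blast
qed

lemma conformal_atlas_isothermal: "c \<in> conformal_atlas \<Longrightarrow> oriented_isothermal_chart M A x c"
  by (simp add: conformal_atlas_def)

sublocale holomorphic_surface M conformal_atlas
proof
  show "Hausdorff_space M" using oriented_surface by (simp add: oriented_surface_def)
  fix U \<phi> assume c: "(U, \<phi>) \<in> conformal_atlas"
  show ch: "is_chart M (U, \<phi>)" by (rule isothermalD(2)[OF conformal_atlas_isothermal[OF c]])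
  fix V \<theta> assume d: "(V, \<theta>) \<in> conformal_atlas"
  have ch': "is_chart M (V, \<theta>)" by (rule isothermalD(2)[OF conformal_atlas_isothermal[OF d]])
  have "open (\<phi> ` (U \<inter> V))" by (rule open_chart_image[OF ch chartD(1)[OF ch']])
  then show "(\<theta> \<circ> inv_into U \<phi>) holomorphic_on \<phi> ` (U \<inter> V)"
    using isothermal_transition(1)[OF conformal_atlas_isothermal[OF c]
        conformal_atlas_isothermal[OF d]]
      holomorphic_on_open by blast
qed (rule conformal_atlas_cover)

lemma gauss_point_eq:
  assumes c: "oriented_isothermal_chart M A x (U, \<xi>)" and p: "p \<in> U"
  shows "gauss_point M A x p = cproj (wirtinger (x \<circ> inv_into U \<xi>) (\<xi> p))"
  unfolding gauss_point_def
proof (rule the_equality)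
  show "\<exists>U' \<phi>. oriented_isothermal_chart M A x (U', \<phi>) \<and> p \<in> U' \<and>
     cproj (wirtinger (x \<circ> inv_into U \<xi>) (\<xi> p)) = cproj (wirtinger (local_rep x (U', \<phi>)) (\<phi> p))"
    using c p by (intro exI[of _ U] exI[of _ \<xi>]) simp
  fix L assume "\<exists>U \<phi>. oriented_isothermal_chart M A x (U, \<phi>) \<and> p \<in> U \<and>
     L = cproj (wirtinger (local_rep x (U, \<phi>)) (\<phi> p))"
  then obtain V \<theta> where d: "oriented_isothermal_chart M A x (V, \<theta>)" "p \<in> V"
    "L = cproj (wirtinger (x \<circ> inv_into V \<theta>) (\<theta> p))" by auto
  then show "L = cproj (wirtinger (x \<circ> inv_into U \<xi>) (\<xi> p))"
    unfolding d(3) cproj_eq_iff using isothermal_transition(2,3)[OF d(1) c, of p] p by blast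
qed

lemma wirtinger_isothermal:
  assumes c: "oriented_isothermal_chart M A x (U, \<xi>)" and z: "z \<in> \<xi> ` U"
  defines "y \<equiv> x \<circ> inv_into U \<xi>"
  shows "mink (wirtinger y z) (wirtinger y z) = 0"
    "mink (pd 1 y z) (pd 1 y z) = 2 * (norm (wirtinger y z $ 1) ^ 2 + norm (wirtinger y z $ 2) ^ 2
       + norm (wirtinger y z $ 3) ^ 2 - norm (wirtinger y z $ 4) ^ 2)"
    "wirtinger y z \<noteq> 0"
proof -
  note cD = isothermalD(4-6)[OF c z, folded y_def]
  show "mink (wirtinger y z) (wirtinger y z) = 0"
    using cD(2,3) by (simp add: wirtinger_def mink_def complex_eq_iff field_simps)
  show n:
      "mink (pd 1 y z) (pd 1 y z) = 2 * (norm (wirtinger y z $ 1) ^ 2 + norm (wirtinger y z $ 2) ^ 2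
       + norm (wirtinger y z $ 3) ^ 2 - norm (wirtinger y z $ 4) ^ 2)"
    using cD(2) unfolding cmod_power2
        by (simp add: wirtinger_def mink_def power2_eq_square field_simps)
  show "wirtinger y z \<noteq> 0" using n cD(1) by auto
qed

end


section \<open>Lengths of curves and the induced distance\<close>

lemma has_vector_derivative_pd_compose:
  fixes f :: "complex \<Rightarrow> 'b::real_normed_vector"
  assumes "f differentiable (at (g t))" "(g has_vector_derivative v) (at t)"
  shows "((\<lambda>s. f (g s)) has_vector_derivative (Re v *\<^sub>R pd 1 f (g t) + Im v *\<^sub>R pd 2 f (g t)))
      (at t)"
  unfolding has_vector_derivative_def
  by (rule
      has_derivative_eq_rhs[OF
          has_derivative_compose[OF assms(2)[unfolded has_vector_derivative_def]
              has_derivative_pd[OF assms(1)]]])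
    (simp add: fun_eq_iff algebra_simps)

text \<open>The derivative may be unbounded near the exceptional points. An infinite right-hand side
  is harmless, and a finite one makes the derivative integrable, so that the fundamental theorem
  applies.\<close>

lemma norm_diff_le_nn_integral_derivative:
  fixes f :: "real \<Rightarrow> 'b::euclidean_space"
  assumes ab: "a \<le> b" and S: "finite S" and cont: "continuous_on {a..b} f"
    and der: "\<And>t. t \<in> {a<..<b} - S \<Longrightarrow> (f has_vector_derivative f' t) (at t)"
    and cont': "continuous_on ({a<..<b} - S) f'"
  shows
      "ennreal (norm (f b - f a)) \<le> (\<integral>\<^sup>+t. ennreal (norm (f' t)) * indicator ({a<..<b} - S) t
          \<partial>lborel)"
    (is "_ \<le> ?R")
proof (cases "?R = \<infinity>")
  case False
  define g where "g t = indicat_real ({a<..<b} - S) t *\<^sub>R f' t" for t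
  have m: "g \<in> borel_measurable borel"
    unfolding g_def[abs_def] using S
    by (intro borel_measurable_continuous_on_indicator cont' borel_open open_Diff
        open_greaterThanLessThan finite_imp_closed)
  have n: "(\<integral>\<^sup>+t. ennreal (norm (g t)) \<partial>lborel) = ?R"
    by (rule nn_integral_cong) (auto simp: g_def indicator_def)
  have i: "integrable lborel g"
    by (rule integrableI_bounded) (use m n False in \<open>auto simp: less_top\<close>)
  have "(f' has_integral (f b - f a)) {a..b}"
    by (rule fundamental_theorem_of_calculus_interior_strong[OF S ab der cont]) auto
  then have "(g has_integral (f b - f a)) {a..b}"
    by (rule has_integral_spike_finite[of "insert a (insert b S)", rotated 2])
        (use S in \<open>auto simp: g_def\<close>)
  then have "(g has_integral (f b - f a)) UNIV"
    by (rule has_integral_on_superset) (auto simp: g_def indicator_def)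
  then have "f b - f a = integral\<^sup>L lborel g"
    using has_integral_integral_lborel[OF i] has_integral_unique by blast
  then show ?thesis using integral_norm_bound_ennreal[OF i] n by simp
qed simp

definition reverse_curve :: "(real \<Rightarrow> 'a) \<Rightarrow> real \<Rightarrow> 'a" where
  "reverse_curve c t = c (1 - t)"

definition join_curves :: "(real \<Rightarrow> 'a) \<Rightarrow> (real \<Rightarrow> 'a) \<Rightarrow> real \<Rightarrow> 'a" where
  "join_curves c d t = (if t \<le> 1/2 then c (2 * t) else d (2 * t - 1))"

lemma comp_join_curves: "f \<circ> join_curves c d = join_curves (f \<circ> c) (f \<circ> d)"
  by (auto simp: join_curves_def)

text \<open>Length separated from the surface: reversing and joining are treated for curves in the
  ambient space, where derivatives need no charts.\<close>

definition minkowski_length :: "(real \<Rightarrow> real ^ 4) \<Rightarrow> ennreal" where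
  "minkowski_length c = (\<integral>\<^sup>+t\<in>{0..1}.
     ennreal (sqrt (mink (vector_derivative c (at t)) (vector_derivative c (at t)))) \<partial>lborel)"

lemma curve_length_eq: "curve_length x \<gamma> = minkowski_length (x \<circ> \<gamma>)"
  by (simp add: curve_length_def minkowski_length_def)

lemma minkowski_length_eq:
  assumes S: "finite S" and d: "\<And>t. t \<in> {0<..<1} - S \<Longrightarrow> (c has_vector_derivative c' t) (at t)"
  shows
      "minkowski_length c = (\<integral>\<^sup>+t. ennreal (sqrt (mink (c' t) (c' t))) * indicator ({0<..<1} - S) t
          \<partial>lborel)"
  unfolding minkowski_length_def
proof (rule nn_integral_cong_AE)
  have "finite (insert 0 (insert 1 S))" using S by simp
  then have "AE t in lborel. t \<notin> insert 0 (insert 1 S)"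
    by (intro AE_not_in countable_imp_null_set_lborel countable_finite)
  then show "AE t in lborel. ennreal
      (sqrt (mink (vector_derivative c (at t)) (vector_derivative c (at t)))) * indicator {0..1} t
      = ennreal (sqrt (mink (c' t) (c' t))) * indicator ({0<..<1} - S) t"
  proof (rule AE_mp, intro always_eventually impI allI AE_I2)
    fix t :: real assume t: "t \<notin> insert 0 (insert 1 S)"
    then show "ennreal (sqrt (mink (vector_derivative c (at t)) (vector_derivative c (at t)))) *
        indicator {0..1} t
      = ennreal (sqrt (mink (c' t) (c' t))) * indicator ({0<..<1} - S) t"
      using vector_derivative_at[OF d[of t]] by (cases "t \<in> {0<..<1}") (auto simp: indicator_def)
  qed
qed

lemma speed_measurable:
  fixes c' :: "real \<Rightarrow> real ^ 4"
  assumes "finite S" "continuous_on ({0<..<1} - S) c'"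
  shows "(\<lambda>t. ennreal (sqrt (mink (c' t) (c' t))) * indicator ({0<..<1} - S) t) \<in> borel_measurable
      borel"
proof -
  have "continuous_on ({0<..<1} - S) (\<lambda>t. sqrt (mink (c' t) (c' t)))"
    by (intro continuous_intros bounded_bilinear.continuous_on[OF bounded_bilinear_mink] assms)
  then have "(\<lambda>t. indicat_real ({0<..<1} - S) t *\<^sub>R sqrt (mink (c' t) (c' t))) \<in> borel_measurable
      borel"
    using assms(1)
        by (intro borel_measurable_continuous_on_indicator borel_open open_Diff
            open_greaterThanLessThan finite_imp_closed)
  then have "(\<lambda>t. ennreal (indicat_real ({0<..<1} - S) t *\<^sub>R sqrt (mink (c' t) (c' t)))) \<in>
      borel_measurable borel"
    by measurable
  also have "(\<lambda>t. ennreal (indicat_real ({0<..<1} - S) t *\<^sub>R sqrt (mink (c' t) (c' t))))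
      = (\<lambda>t. ennreal (sqrt (mink (c' t) (c' t))) * indicator ({0<..<1} - S) t)"
    by (auto simp: indicator_def)
  finally show ?thesis .
qed

lemma minkowski_length_reverse:
  assumes S: "finite S" and d: "\<And>t. t \<in> {0<..<1} - S \<Longrightarrow> (c has_vector_derivative c' t) (at t)"
    and cont: "continuous_on ({0<..<1} - S) c'"
  shows "minkowski_length (reverse_curve c) = minkowski_length c"
proof -
  let ?S = "(\<lambda>t. 1 - t) ` S"
  have dr: "(reverse_curve c has_vector_derivative - c' (1 - t)) (at t)" if "t \<in> {0<..<1} - ?S"
      for t
  proof -
    have "(c has_vector_derivative c' (1 - t)) (at (1 - t))"
      by (rule d) (use that in \<open>auto simp: image_iff\<close>)
    moreover have "((\<lambda>t. 1 - t) has_vector_derivative -1) (at t)"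
      by (auto intro!: derivative_eq_intros)
    ultimately have "(c \<circ> (\<lambda>t. 1 - t) has_vector_derivative -1 *\<^sub>R c' (1 - t)) (at t)"
      using vector_diff_chain_at by blast
    then show ?thesis by (simp add: reverse_curve_def[abs_def] comp_def)
  qed
  let ?F = "\<lambda>t. ennreal (sqrt (mink (c' t) (c' t))) * indicator ({0<..<1} - S) t"
  have "minkowski_length (reverse_curve c)
      = (\<integral>\<^sup>+t. ennreal (sqrt (mink (- c' (1 - t)) (- c' (1 - t)))) * indicator ({0<..<1} - ?S) t
          \<partial>lborel)"
    by (rule minkowski_length_eq[OF _ dr]) (use S in auto)
  also have "\<dots> = (\<integral>\<^sup>+t. ?F (1 + (-1) * t) \<partial>lborel)"
    by (rule nn_integral_cong) (auto simp: indicator_def mink_def image_iff)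
  also have "\<dots> = (\<integral>\<^sup>+t. ?F t \<partial>lborel)"
    using nn_integral_real_affine[OF speed_measurable[OF S cont], of "-1" 1] by simp
  also have "\<dots> = minkowski_length c" by (rule minkowski_length_eq[OF S d, symmetric])
  finally show ?thesis .
qed

lemma join_curves_has_vector_derivative:
  assumes "t \<noteq> 1/2"
    and "t < 1/2 \<Longrightarrow> (c1 has_vector_derivative d1) (at (2 * t))"
    and "t > 1/2 \<Longrightarrow> (c2 has_vector_derivative d2) (at (2 * t - 1))"
  shows "((join_curves c1 c2) has_vector_derivative (if t \<le> 1/2 then 2 *\<^sub>R d1 else 2 *\<^sub>R d2))
      (at t)"
proof (cases "t < 1/2")
  case True
  have "((\<lambda>t. 2 * t) has_vector_derivative 2) (at t)" by (auto intro!: derivative_eq_intros)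
  then have "(c1 \<circ> (\<lambda>t. 2 * t) has_vector_derivative 2 *\<^sub>R d1) (at t)"
    using vector_diff_chain_at assms(2)[OF True] by blast
  then have "((join_curves c1 c2) has_vector_derivative 2 *\<^sub>R d1) (at t)"
    by (rule has_vector_derivative_transform_within_open[of _ _ _ "{..<1/2}"])
        (use True in \<open>auto simp: join_curves_def\<close>)
  then show ?thesis using True by simp
next
  case False
  have "((\<lambda>t. 2 * t - 1) has_vector_derivative 2) (at t)" by (auto intro!: derivative_eq_intros)
  then have "(c2 \<circ> (\<lambda>t. 2 * t - 1) has_vector_derivative 2 *\<^sub>R d2) (at t)"
    using vector_diff_chain_at[of "\<lambda>t. 2 * t - 1" 2 t c2 d2] assms(1) assms(3) False by simp
  then have "((join_curves c1 c2) has_vector_derivative 2 *\<^sub>R d2) (at t)"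
    by (rule has_vector_derivative_transform_within_open[of _ _ _ "{1/2<..}"])
        (use assms(1) False in \<open>auto simp: join_curves_def\<close>)
  then show ?thesis using assms(1) False by simp
qed

lemma minkowski_length_join:
  assumes S: "finite S1" "finite S2"
    and d1: "\<And>t. t \<in> {0<..<1} - S1 \<Longrightarrow> (c1 has_vector_derivative c1' t) (at t)"
    and d2: "\<And>t. t \<in> {0<..<1} - S2 \<Longrightarrow> (c2 has_vector_derivative c2' t) (at t)"
    and cont: "continuous_on ({0<..<1} - S1) c1'" "continuous_on ({0<..<1} - S2) c2'"
  shows "minkowski_length (join_curves c1 c2) = minkowski_length c1 + minkowski_length c2"
proof -
  define S where "S = insert (1/2) ((\<lambda>t. t / 2) ` S1 \<union> (\<lambda>t. (t + 1) / 2) ` S2)"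
  have finS: "finite S" using S by (simp add: S_def)
  have notin: "2 * t \<notin> S1" "2 * t - 1 \<notin> S2" "t \<noteq> 1/2" if "t \<notin> S" for t
    using that imageI[of "2 * t" S1 "\<lambda>t. t / 2"] imageI[of "2 * t - 1" S2 "\<lambda>t. (t + 1) / 2"]
    by (auto simp: S_def)
  define c' where "c' t = (if t \<le> 1/2 then 2 *\<^sub>R c1' (2 * t) else 2 *\<^sub>R c2' (2 * t - 1))"
      for t :: real
  have dj: "((join_curves c1 c2) has_vector_derivative c' t) (at t)" if t: "t \<in> {0<..<1} - S" for t
  proof -
    have 1: "2 * t \<notin> S1" "2 * t - 1 \<notin> S2" using notin[of t] t by auto
    show ?thesis
      unfolding c'_def
        by (rule join_curves_has_vector_derivative) (use t 1 notin(3)[of t] in \<open>auto intro!: d1 d2\<close>)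
  qed
  let ?F1 = "\<lambda>t. ennreal (sqrt (mink (c1' t) (c1' t))) * indicator ({0<..<1} - S1) t"
  let ?F2 = "\<lambda>t. ennreal (sqrt (mink (c2' t) (c2' t))) * indicator ({0<..<1} - S2) t"
  have m: "?F1 \<in> borel_measurable borel" "?F2 \<in> borel_measurable borel"
    by (intro speed_measurable S cont)+
  have sq: "sqrt (mink (2 *\<^sub>R v) (2 *\<^sub>R v)) = 2 * sqrt (mink v v)" for v :: "real ^ 4"
  proof -
    have "mink (2 *\<^sub>R v) (2 *\<^sub>R v) = 2\<^sup>2 * mink v v" by (simp add: mink_linear power2_eq_square)
    then show ?thesis by (simp add: real_sqrt_mult)
  qed
  have "minkowski_length (join_curves c1 c2)
      = (\<integral>\<^sup>+t. ennreal (sqrt (mink (c' t) (c' t))) * indicator ({0<..<1} - S) t \<partial>lborel)"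
    by (rule minkowski_length_eq[OF finS dj])
  also have "\<dots> = (\<integral>\<^sup>+t. ennreal 2 * ?F1 (0 + 2 * t) + ennreal 2 * ?F2 (-1 + 2 * t) \<partial>lborel)"
  proof (rule nn_integral_cong_AE)
    have "AE t in lborel. t \<notin> S"
      by (intro AE_not_in countable_imp_null_set_lborel countable_finite finS)
    then show "AE t in lborel. ennreal (sqrt (mink (c' t) (c' t))) * indicator ({0<..<1} - S) t
       = ennreal 2 * ?F1 (0 + 2 * t) + ennreal 2 * ?F2 (-1 + 2 * t)"
    proof (rule AE_mp, intro AE_I2 impI)
      fix t :: real assume t: "t \<notin> S"
      note 1 = notin[OF t]
      show "ennreal (sqrt (mink (c' t) (c' t))) * indicator ({0<..<1} - S) t
       = ennreal 2 * ?F1 (0 + 2 * t) + ennreal 2 * ?F2 (-1 + 2 * t)"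
        using t 1
            by (cases "t < 1/2") (auto simp: c'_def sq indicator_def ennreal_mult'' ennreal_mult'
                mult.commute)
    qed
  qed
  also have "\<dots> = ennreal 2 * (\<integral>\<^sup>+t. ?F1 (0 + 2 * t) \<partial>lborel) + ennreal 2 *
      (\<integral>\<^sup>+t. ?F2 (-1 + 2 * t) \<partial>lborel)"
  proof -
    have m': "(\<lambda>t. ?F1 (0 + 2 * t)) \<in> borel_measurable lborel"
        "(\<lambda>t. ?F2 (-1 + 2 * t)) \<in> borel_measurable lborel"
      by (rule measurable_compose[OF _ m(1)] measurable_compose[OF _ m(2)]; simp)+
    show ?thesis
      by (subst nn_integral_add)
          (use m' in \<open>auto intro!: borel_measurable_times_ennreal simp: nn_integral_cmult\<close>)
  qed
  also have "\<dots> = (\<integral>\<^sup>+t. ?F1 t \<partial>lborel) + (\<integral>\<^sup>+t. ?F2 t \<partial>lborel)"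
    using nn_integral_real_affine[OF m(1), of 2 0] nn_integral_real_affine[OF m(2), of 2 "-1"]
        by simp
  also have "\<dots> = minkowski_length c1 + minkowski_length c2"
    using minkowski_length_eq[OF S(1) d1] minkowski_length_eq[OF S(2) d2] by simp
  finally show ?thesis .
qed

section \<open>Piecewise smooth curves on the surface\<close>

lemma pathin_preimage:
  assumes "pathin M \<gamma>" "openin M W"
  shows "openin (top_of_set {0..1}) {t \<in> {0..1}. \<gamma> t \<in> W}" "open {t \<in> {0<..<1}. \<gamma> t \<in> W}"
proof -
  show o: "openin (top_of_set {0..1}) {t \<in> {0..1}. \<gamma> t \<in> W}"
    using assms unfolding pathin_def continuous_map_def by simp
  then have "\<exists>T. open T \<and> {t \<in> {0..1}. \<gamma> t \<in> W} = {0..1} \<inter> T" by (simp only: openin_open)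
  then obtain T where T: "open T" "{t \<in> {0..1}. \<gamma> t \<in> W} = {0..1} \<inter> T" by (elim exE conjE)
  have "{t \<in> {0<..<1}. \<gamma> t \<in> W} = {0<..<1} \<inter> {t \<in> {0..1}. \<gamma> t \<in> W}" by auto
  also have "\<dots> = {0<..<1} \<inter> T" unfolding T(2) by auto
  finally show "open {t \<in> {0<..<1}. \<gamma> t \<in> W}" using open_Int[OF open_greaterThanLessThan T(1)]
    by simp
qed

lemma pathin_topspace: "pathin M \<gamma> \<Longrightarrow> t \<in> {0..1} \<Longrightarrow> \<gamma> t \<in> topspace M"
  unfolding pathin_def continuous_map_def by auto

lemma pathin_reverse_curve: "pathin M \<gamma> \<Longrightarrow> pathin M (reverse_curve \<gamma>)"
  unfolding pathin_def reverse_curve_def[abs_def]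
  by (rule continuous_map_compose[of _ "top_of_set {0..1}", unfolded comp_def])
    (auto simp: continuous_map_in_subtopology intro!: continuous_intros)

lemma pathin_join_curves:
  assumes "pathin M \<gamma>1" "pathin M \<gamma>2" "\<gamma>1 1 = \<gamma>2 0"
  shows "pathin M (join_curves \<gamma>1 \<gamma>2)"
  unfolding pathin_def join_curves_def[abs_def]
proof (rule continuous_map_cases_le)
  show "continuous_map (subtopology (top_of_set {0..1}) {x \<in> topspace (top_of_set {0..1}). x \<le> 1/2})
      M (\<lambda>t. \<gamma>1 (2 * t))"
    by (rule continuous_map_compose[OF _ assms(1)[unfolded pathin_def], unfolded comp_def])
      (auto simp: continuous_map_in_subtopology subtopology_subtopology intro!: continuous_intros)
  show "continuous_map (subtopology (top_of_set {0..1}) {x \<in> topspace (top_of_set {0..1}). 1/2 \<le> x})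
      M (\<lambda>t. \<gamma>2 (2 * t - 1))"
    by (rule continuous_map_compose[OF _ assms(2)[unfolded pathin_def], unfolded comp_def])
      (auto simp: continuous_map_in_subtopology subtopology_subtopology intro!: continuous_intros)
  show "\<gamma>1 (2 * t) = \<gamma>2 (2 * t - 1)" if "t = 1/2" for t unfolding that using assms(3) by simp
qed auto

context stationary_surface
begin

lemma piecewise_C1_curve_compose_derivative:
  assumes pin: "pathin M \<gamma>" and S: "finite S"
    and C1: "\<And>U \<phi>. (U, \<phi>) \<in> A \<Longrightarrow> (\<phi> \<circ> \<gamma>) C1_differentiable_on {t \<in> {0..1} - S. \<gamma> t \<in> U}"
    and U: "(U, \<phi>) \<in> A" and t: "t \<in> {0<..<1} - S" "\<gamma> t \<in> U"
  shows "((x \<circ> \<gamma>) has_vector_derivative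
      Re (vector_derivative (\<phi> \<circ> \<gamma>) (at t)) *\<^sub>R pd 1 (x \<circ> inv_into U \<phi>) (\<phi> (\<gamma> t)) +
      Im (vector_derivative (\<phi> \<circ> \<gamma>) (at t)) *\<^sub>R pd 2 (x \<circ> inv_into U \<phi>) (\<phi> (\<gamma> t))) (at t)"
proof -
  have ch: "is_chart M (U, \<phi>)" by (rule atlas_chart[OF U])
  interpret stationary_patch "x \<circ> inv_into U \<phi>" "\<phi> ` U" by (rule stationary_patch_atlas[OF U])
  have "((\<phi> \<circ> \<gamma>) has_vector_derivative vector_derivative (\<phi> \<circ> \<gamma>) (at t)) (at t)"
    using C1[OF U] t unfolding C1_differentiable_on_eq by (auto simp: vector_derivative_works)
  from has_vector_derivative_pd_compose[OF _ this, of "x \<circ> inv_into U \<phi>"]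
  have "((\<lambda>s. (x \<circ> inv_into U \<phi>) ((\<phi> \<circ> \<gamma>) s)) has_vector_derivative
      Re (vector_derivative (\<phi> \<circ> \<gamma>) (at t)) *\<^sub>R pd 1 (x \<circ> inv_into U \<phi>) (\<phi> (\<gamma> t)) +
      Im (vector_derivative (\<phi> \<circ> \<gamma>) (at t)) *\<^sub>R pd 2 (x \<circ> inv_into U \<phi>) (\<phi> (\<gamma> t))) (at t)"
    using smooth_on_differentiable[OF smooth] t(2) by simp
  then show ?thesis
    by (rule has_vector_derivative_transform_within_open[OF _
        pathin_preimage(2)[OF pin chartD(1)[OF ch]]])
      (use t ch in auto)
qed

text \<open>\<open>c'\<close> is taken globally as the \<open>vector_derivative\<close> of
  \<open>x \<circ> \<gamma>\<close>, so nothing has to be patched between charts; the expressions in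
  charts only show that it exists and is continuous.\<close>

lemma piecewise_C1_curve_derivative:
  assumes "piecewise_C1_curve M A p q \<gamma>"
  obtains S c' where "finite S" "\<And>t. t \<in> {0<..<1} - S \<Longrightarrow> ((x \<circ> \<gamma>) has_vector_derivative c' t) (at t)"
    "continuous_on ({0<..<1} - S) c'"
proof -
  obtain S where S: "finite S" and pin: "pathin M \<gamma>"
    and C1: "\<And>U \<phi>. (U, \<phi>) \<in> A \<Longrightarrow> (\<phi> \<circ> \<gamma>) C1_differentiable_on {t \<in> {0..1} - S. \<gamma> t \<in> U}"
    using assms unfolding piecewise_C1_curve_def by fastforce
  have der: "((x \<circ> \<gamma>) has_vector_derivative
      Re (vector_derivative (\<phi> \<circ> \<gamma>) (at t)) *\<^sub>R pd 1 (x \<circ> inv_into U \<phi>) (\<phi> (\<gamma> t)) +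
      Im (vector_derivative (\<phi> \<circ> \<gamma>) (at t)) *\<^sub>R pd 2 (x \<circ> inv_into U \<phi>) (\<phi> (\<gamma> t))) (at t)"
    if "(U, \<phi>) \<in> A" "t \<in> {0<..<1} - S" "\<gamma> t \<in> U" for U \<phi> t
    by (rule piecewise_C1_curve_compose_derivative[OF pin S _ that]) (rule C1)
  define c' where "c' t = vector_derivative (x \<circ> \<gamma>) (at t)" for t
  show ?thesis
  proof (rule that[OF S])
    fix t assume t: "t \<in> {0<..<1} - S"
    then have "\<gamma> t \<in> topspace M" by (intro pathin_topspace[OF pin]) auto
    then obtain U \<phi> where "(U, \<phi>) \<in> A" "\<gamma> t \<in> U" using atlas_cover by blast
    from der[OF this(1) t this(2)] show "((x \<circ> \<gamma>) has_vector_derivative c' t) (at t)"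
      unfolding c'_def by (simp add: vector_derivative_at)
  next
    have oS: "open ({0<..<1} - S)" using S by (simp add: finite_imp_closed open_Diff)
    show "continuous_on ({0<..<1} - S) c'"
      unfolding continuous_on_eq_continuous_at[OF oS]
    proof
      fix t assume t: "t \<in> {0<..<1} - S"
      then have "\<gamma> t \<in> topspace M" by (intro pathin_topspace[OF pin]) auto
      then obtain U \<phi> where U: "(U, \<phi>) \<in> A" "\<gamma> t \<in> U" using atlas_cover by blast
      have ch: "is_chart M (U, \<phi>)" by (rule atlas_chart[OF U(1)])
      interpret stationary_patch "x \<circ> inv_into U \<phi>" "\<phi> ` U"
        by (rule stationary_patch_atlas[OF U(1)])
      define N where "N = {t \<in> {0<..<1}. \<gamma> t \<in> U} - S"
      have N: "open N" "t \<in> N"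
        using pathin_preimage(2)[OF pin chartD(1)[OF ch]] S U t
            by (auto simp: N_def finite_imp_closed open_Diff)
      have sub: "N \<subseteq> {t \<in> {0..1} - S. \<gamma> t \<in> U}" by (auto simp: N_def)
      have cv: "continuous_on N (\<lambda>t. vector_derivative (\<phi> \<circ> \<gamma>) (at t))"
        using C1[OF U(1)] continuous_on_subset[OF _ sub] unfolding C1_differentiable_on_eq by blast
      have "continuous_on N (\<phi> \<circ> \<gamma>)"
        using C1_differentiable_imp_continuous_on[OF C1[OF U(1)]] continuous_on_subset[OF _ sub]
            by blast
      then have cp: "continuous_on N (\<lambda>t. pd i (x \<circ> inv_into U \<phi>) (\<phi> (\<gamma> t)))" for i
        using continuous_on_compose2[OF smooth_on_continuous_on[OF smooth_pd], of N "\<phi> \<circ> \<gamma>" i]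
        by (auto simp: N_def)
      have "continuous_on N (\<lambda>t. Re (vector_derivative (\<phi> \<circ> \<gamma>) (at t)) *\<^sub>R pd 1 (x \<circ> inv_into U \<phi>)
          (\<phi> (\<gamma> t)) +
        Im (vector_derivative (\<phi> \<circ> \<gamma>) (at t)) *\<^sub>R pd 2 (x \<circ> inv_into U \<phi>) (\<phi> (\<gamma> t)))"
        by (intro continuous_intros cv cp)
      then have "continuous_on N c'"
      proof (rule continuous_on_eq)
        fix s assume "s \<in> N"
        then have s: "s \<in> {0<..<1} - S" "\<gamma> s \<in> U" by (auto simp: N_def)
        show "Re (vector_derivative (\<phi> \<circ> \<gamma>) (at s)) *\<^sub>R pd 1 (x \<circ> inv_into U \<phi>) (\<phi> (\<gamma> s)) +
          Im (vector_derivative (\<phi> \<circ> \<gamma>) (at s)) *\<^sub>R pd 2 (x \<circ> inv_into U \<phi>) (\<phi> (\<gamma> s)) = c' s"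
          using vector_derivative_at[OF der[OF U(1) s]] by (simp add: c'_def)
      qed
      then show "isCont c' t" using continuous_on_eq_continuous_at[OF N(1)] N(2) by blast
    qed
  qed
qed

lemma piecewise_C1_curve_reverse:
  assumes "piecewise_C1_curve M A p q \<gamma>"
  shows "piecewise_C1_curve M A q p (reverse_curve \<gamma>)"
      "curve_length x (reverse_curve \<gamma>) = curve_length x \<gamma>"
proof -
  obtain S where S: "finite S" and pin: "pathin M \<gamma>" and e: "\<gamma> 0 = p" "\<gamma> 1 = q"
    and C1: "\<And>U \<phi>. (U, \<phi>) \<in> A \<Longrightarrow> (\<phi> \<circ> \<gamma>) C1_differentiable_on {t \<in> {0..1} - S. \<gamma> t \<in> U}"
    using assms unfolding piecewise_C1_curve_def by fastforce
  have "(\<phi> \<circ> reverse_curve \<gamma>) C1_differentiable_on {t \<in> {0..1} - (\<lambda>t. 1 - t) ` S. reverse_curve \<gamma> t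
      \<in> U}"
    (is "_ C1_differentiable_on ?X") if U: "(U, \<phi>) \<in> A" for U \<phi>
  proof -
    obtain D
        where D: "\<And>t. t \<in> {t \<in> {0..1} - S. \<gamma> t \<in> U} \<Longrightarrow> ((\<phi> \<circ> \<gamma>) has_vector_derivative D t) (at t)"
      "continuous_on {t \<in> {0..1} - S. \<gamma> t \<in> U} D"
      using C1[OF U] unfolding C1_differentiable_on_def by blast
    have X: "1 - t \<in> {t \<in> {0..1} - S. \<gamma> t \<in> U}" if "t \<in> ?X" for t
      using that imageI[of "1 - t" S "\<lambda>t. 1 - t"] by (auto simp: reverse_curve_def)
    have "((\<phi> \<circ> reverse_curve \<gamma>) has_vector_derivative - D (1 - t)) (at t)" if t: "t \<in> ?X" for t
    proof -
      have "((\<lambda>t. 1 - t) has_vector_derivative -1) (at t)" by (auto intro!: derivative_eq_intros)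
      from vector_diff_chain_at[OF this D(1)[OF X[OF t]]] show ?thesis
        by (simp add: reverse_curve_def[abs_def] comp_def)
    qed
    moreover have "continuous_on ?X (\<lambda>t. - D (1 - t))"
      by (intro continuous_intros continuous_on_compose2[OF D(2)]) (use X in blast)
    ultimately show ?thesis
      unfolding C1_differentiable_on_def by (intro exI[of _ "\<lambda>t. - D (1 - t)"]) auto
  qed
  then show "piecewise_C1_curve M A q p (reverse_curve \<gamma>)"
    unfolding piecewise_C1_curve_def using pathin_reverse_curve[OF pin] S e
    by (intro conjI exI[of _ "(\<lambda>t. 1 - t) ` S"]) (auto simp: reverse_curve_def)
  obtain S c' where "finite S" "\<And>t. t \<in> {0<..<1} - S \<Longrightarrow> ((x \<circ> \<gamma>) has_vector_derivative c' t) (at t)"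
    "continuous_on ({0<..<1} - S) c'"
    using piecewise_C1_curve_derivative[OF assms] by blast
  from minkowski_length_reverse[OF this]
  show "curve_length x (reverse_curve \<gamma>) = curve_length x \<gamma>"
    by (simp add: curve_length_eq reverse_curve_def[abs_def] comp_def)
qed

lemma piecewise_C1_curve_join:
  assumes c1: "piecewise_C1_curve M A p q \<gamma>1" and c2: "piecewise_C1_curve M A q r \<gamma>2"
  shows "piecewise_C1_curve M A p r (join_curves \<gamma>1 \<gamma>2)"
    "curve_length x (join_curves \<gamma>1 \<gamma>2) = curve_length x \<gamma>1 + curve_length x \<gamma>2"
proof -
  obtain S1 where S1: "finite S1" and pin1: "pathin M \<gamma>1" and e1: "\<gamma>1 0 = p" "\<gamma>1 1 = q"
    and C1: "\<And>U \<phi>. (U, \<phi>) \<in> A \<Longrightarrow> (\<phi> \<circ> \<gamma>1) C1_differentiable_on {t \<in> {0..1} - S1. \<gamma>1 t \<in> U}"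
    using c1 unfolding piecewise_C1_curve_def by fastforce
  obtain S2 where S2: "finite S2" and pin2: "pathin M \<gamma>2" and e2: "\<gamma>2 0 = q" "\<gamma>2 1 = r"
    and C2: "\<And>U \<phi>. (U, \<phi>) \<in> A \<Longrightarrow> (\<phi> \<circ> \<gamma>2) C1_differentiable_on {t \<in> {0..1} - S2. \<gamma>2 t \<in> U}"
    using c2 unfolding piecewise_C1_curve_def by fastforce
  define S where "S = insert (1/2) ((\<lambda>t. t / 2) ` S1 \<union> (\<lambda>t. (t + 1) / 2) ` S2)"
  have finS: "finite S" using S1 S2 by (simp add: S_def)
  have notin: "2 * t \<notin> S1" "2 * t - 1 \<notin> S2" "t \<noteq> 1/2" if "t \<notin> S" for t
    using that imageI[of "2 * t" S1 "\<lambda>t. t / 2"] imageI[of "2 * t - 1" S2 "\<lambda>t. (t + 1) / 2"]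
    by (auto simp: S_def)
  have "(\<phi> \<circ> (join_curves \<gamma>1 \<gamma>2)) C1_differentiable_on {t \<in> {0..1} - S. (join_curves \<gamma>1 \<gamma>2) t \<in> U}"
    (is "_ C1_differentiable_on ?X") if U: "(U, \<phi>) \<in> A" for U \<phi>
  proof -
    let ?X1 = "{t \<in> {0..1} - S1. \<gamma>1 t \<in> U}" and ?X2 = "{t \<in> {0..1} - S2. \<gamma>2 t \<in> U}"
    obtain D1 where D1: "\<And>t. t \<in> ?X1 \<Longrightarrow> ((\<phi> \<circ> \<gamma>1) has_vector_derivative D1 t) (at t)"
        "continuous_on ?X1 D1"
      using C1[OF U] unfolding C1_differentiable_on_def by blast
    obtain D2 where D2: "\<And>t. t \<in> ?X2 \<Longrightarrow> ((\<phi> \<circ> \<gamma>2) has_vector_derivative D2 t) (at t)"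
        "continuous_on ?X2 D2"
      using C2[OF U] unfolding C1_differentiable_on_def by blast
    define D where "D t = (if t \<le> 1/2 then 2 *\<^sub>R D1 (2 * t) else 2 *\<^sub>R D2 (2 * t - 1))" for t
    have X1: "2 * t \<in> ?X1" if "t \<in> ?X" "t \<le> 1/2" for t
      using that notin[of t] by (auto simp: join_curves_def)
    have X2: "2 * t - 1 \<in> ?X2" if "t \<in> ?X" "1/2 \<le> t" for t
      using that notin[of t] by (auto simp: join_curves_def)
    have "(join_curves (\<phi> \<circ> \<gamma>1) (\<phi> \<circ> \<gamma>2) has_vector_derivative D t) (at t)" if t: "t \<in> ?X" for t
      unfolding D_def
        by (rule join_curves_has_vector_derivative) (use t notin[of t] X1[OF t] X2[OF t]
            in \<open>auto intro!: D1 D2\<close>)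
    moreover have "continuous_on ?X D"
      unfolding D_def
    proof (rule continuous_on_cases_le)
      show "continuous_on {t \<in> ?X. t \<le> 1/2} (\<lambda>t. 2 *\<^sub>R D1 (2 * t))"
        by (intro continuous_intros continuous_on_compose2[OF D1(2)]) (use X1 in blast)
      show "continuous_on {t \<in> ?X. 1/2 \<le> t} (\<lambda>t. 2 *\<^sub>R D2 (2 * t - 1))"
        by (intro continuous_intros continuous_on_compose2[OF D2(2)]) (use X2 in blast)
      show "2 *\<^sub>R D1 (2 * t) = 2 *\<^sub>R D2 (2 * t - 1)" if "t \<in> ?X" "t = 1/2" for t
        using that(1) notin(3)[of t] that(2) by blast
    qed (rule continuous_on_id)
    ultimately show ?thesis unfolding C1_differentiable_on_def comp_join_curves by blast
  qed
  then show "piecewise_C1_curve M A p r (join_curves \<gamma>1 \<gamma>2)"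
    unfolding piecewise_C1_curve_def using pathin_join_curves[OF pin1 pin2] finS e1 e2
    by (intro conjI exI[of _ S]) (simp_all add: join_curves_def[of _ _ 0] join_curves_def[of _ _ 1]
        split_beta)
  obtain S1 c1'
      where 1: "finite S1" "\<And>t. t \<in> {0<..<1} - S1 \<Longrightarrow> ((x \<circ> \<gamma>1) has_vector_derivative c1' t) (at t)"
    "continuous_on ({0<..<1} - S1) c1'"
    using piecewise_C1_curve_derivative[OF c1] by blast
  obtain S2 c2'
      where 2: "finite S2" "\<And>t. t \<in> {0<..<1} - S2 \<Longrightarrow> ((x \<circ> \<gamma>2) has_vector_derivative c2' t) (at t)"
    "continuous_on ({0<..<1} - S2) c2'"
    using piecewise_C1_curve_derivative[OF c2] by blast
  show "curve_length x (join_curves \<gamma>1 \<gamma>2) = curve_length x \<gamma>1 + curve_length x \<gamma>2"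
    unfolding curve_length_eq comp_join_curves
      by (rule minkowski_length_join[OF 1(1) 2(1) 1(2) 2(2) 1(3) 2(3)])
qed

text \<open>Common frame for inverses of charts and for solutions of the vector field: in both cases
  images of segments have to be admissible curves of computable length.\<close>

definition smooth_map_on :: "complex set \<Rightarrow> (complex \<Rightarrow> 'a) \<Rightarrow> bool" where
  "smooth_map_on N F \<longleftrightarrow> open N \<and> F ` N \<subseteq> topspace M \<and> (\<forall>W. openin M W \<longrightarrow> open {w \<in> N. F w \<in> W}) \<and>
     (\<forall>U \<phi>. (U, \<phi>) \<in> A \<longrightarrow> smooth_on {w \<in> N. F w \<in> U} (\<phi> \<circ> F))"

lemma smooth_map_on_immersion:
  assumes F: "smooth_map_on N F"
  shows "smooth_on N (x \<circ> F)"
proof -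
  have "N = \<Union> {{w \<in> N. F w \<in> U} | U \<phi>. (U, \<phi>) \<in> A}"
  proof (intro equalityI subsetI)
    fix w assume w: "w \<in> N"
    then have "F w \<in> topspace M" using F by (auto simp: smooth_map_on_def)
    then obtain U \<phi> where "(U, \<phi>) \<in> A" "F w \<in> U" using atlas_cover by blast
    then show "w \<in> \<Union> {{w \<in> N. F w \<in> U} | U \<phi>. (U, \<phi>) \<in> A}" using w by blast
  qed blast
  moreover have "smooth_on (\<Union> {{w \<in> N. F w \<in> U} | U \<phi>. (U, \<phi>) \<in> A}) (x \<circ> F)"
  proof (rule smooth_on_Un)
    fix T assume "T \<in> {{w \<in> N. F w \<in> U} | U \<phi>. (U, \<phi>) \<in> A}"
    then obtain U \<phi> where U: "T = {w \<in> N. F w \<in> U}" "(U, \<phi>) \<in> A" by blast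
    have ch: "is_chart M (U, \<phi>)" by (rule atlas_chart[OF U(2)])
    interpret stationary_patch "x \<circ> inv_into U \<phi>" "\<phi> ` U" by (rule stationary_patch_atlas[OF U(2)])
    show oT: "open T" using F chartD(1)[OF ch] U by (simp add: smooth_map_on_def)
    have "smooth_on T (\<lambda>w. (x \<circ> inv_into U \<phi>) ((\<phi> \<circ> F) w))"
      by (rule smooth_on_compose[OF oT _ smooth])
          (use F U in \<open>auto simp: smooth_map_on_def comp_def\<close>)
    then show "smooth_on T (x \<circ> F)"
      by (rule smooth_on_transform[OF oT]) (use U ch in auto)
  qed
  ultimately show ?thesis by simp
qed

lemma segment_curve:
  assumes F: "smooth_map_on N F" and ab: "\<And>t. t \<in> {0..1} \<Longrightarrow> a + of_real t * (b - a) \<in> N"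
  defines "\<gamma> \<equiv> \<lambda>t. F (a + of_real t * (b - a))"
  shows "piecewise_C1_curve M A (F a) (F b) \<gamma>"
    "\<And>t. t \<in> {0..1} \<Longrightarrow> ((x \<circ> \<gamma>) has_vector_derivative
       Re (b - a) *\<^sub>R pd 1 (x \<circ> F) (a + of_real t * (b - a)) + Im (b - a) *\<^sub>R pd 2 (x \<circ> F)
           (a + of_real t * (b - a))) (at t)"
proof -
  define l where "l t = a + of_real t * (b - a)" for t :: real
  have dl: "(l has_vector_derivative (b - a)) (at t)" for t
    unfolding l_def has_vector_derivative_def
      by (auto intro!: derivative_eq_intros simp: scaleR_conv_of_real)
  have cl: "continuous_on X l" for X unfolding l_def by (intro continuous_intros)
  have lN: "l t \<in> N" if "t \<in> {0..1}" for t using ab[OF that] by (simp add: l_def)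
  have \<gamma>: "\<gamma> = F \<circ> l" by (simp add: \<gamma>_def l_def comp_def)
  have pin: "pathin M \<gamma>"
    unfolding pathin_def continuous_map_def
  proof (intro conjI allI impI)
    show "\<gamma> \<in> topspace (top_of_set {0..1}) \<rightarrow> topspace M" using F lN
      by (auto simp: \<gamma> smooth_map_on_def)
    fix W assume "openin M W"
    then have "open {w \<in> N. F w \<in> W}" using F by (simp add: smooth_map_on_def)
    then have "openin (top_of_set {0..1}) ({0..1} \<inter> l -` {w \<in> N. F w \<in> W})"
      using cl continuous_openin_preimage_gen by blast
    also have "{0..1} \<inter> l -` {w \<in> N. F w \<in> W} = {t \<in> topspace (top_of_set {0..1}). \<gamma> t \<in> W}"
      using lN by (auto simp: \<gamma>)
    finally show "openin (top_of_set {0..1}) {t \<in> topspace (top_of_set {0..1}). \<gamma> t \<in> W}" .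
  qed
  have "(\<phi> \<circ> \<gamma>) C1_differentiable_on {t \<in> {0..1} - {}. \<gamma> t \<in> U}" (is "_ C1_differentiable_on ?X")
      if U: "(U, \<phi>) \<in> A" for U \<phi>
  proof -
    let ?N = "{w \<in> N. F w \<in> U}"
    have sm: "smooth_on ?N (\<phi> \<circ> F)" using F U by (auto simp: smooth_map_on_def)
    have lX: "l ` ?X \<subseteq> ?N" using lN by (auto simp: \<gamma>)
    have "((\<lambda>s. (\<phi> \<circ> F) (l s)) has_vector_derivative Re (b - a) *\<^sub>R pd 1 (\<phi> \<circ> F) (l t) + Im (b - a)
        *\<^sub>R pd 2 (\<phi> \<circ> F) (l t)) (at t)"
      if "t \<in> ?X" for t
      by (rule has_vector_derivative_pd_compose[OF smooth_on_differentiable[OF sm] dl])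
          (use lX that in blast)
    moreover
        have "continuous_on ?X (\<lambda>t. Re (b - a) *\<^sub>R pd 1 (\<phi> \<circ> F) (l t) + Im (b - a) *\<^sub>R pd 2 (\<phi> \<circ> F)
            (l t))"
      by (intro continuous_intros
          continuous_on_compose2[OF smooth_on_continuous_on[OF smooth_on_pd[OF sm]] cl lX])
    moreover have e: "\<phi> \<circ> \<gamma> = (\<lambda>s. (\<phi> \<circ> F) (l s))" by (simp add: \<gamma> comp_def)
    ultimately show ?thesis
      unfolding C1_differentiable_on_def e
      by (intro
          exI[of _ "\<lambda>t. Re (b - a) *\<^sub>R pd 1 (\<phi> \<circ> F) (l t) + Im (b - a) *\<^sub>R pd 2 (\<phi> \<circ> F) (l t)"]
              conjI ballI)
  qed
  then show "piecewise_C1_curve M A (F a) (F b) \<gamma>"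
    unfolding piecewise_C1_curve_def using pin
    by (intro conjI exI[of _ "{}"]) (auto simp: \<gamma>_def)
  fix t :: real assume t: "t \<in> {0..1}"
  have "((\<lambda>s. (x \<circ> F) (l s)) has_vector_derivative Re (b - a) *\<^sub>R pd 1 (x \<circ> F) (l t) + Im (b - a)
      *\<^sub>R pd 2 (x \<circ> F) (l t)) (at t)"
    by (rule
        has_vector_derivative_pd_compose[OF
            smooth_on_differentiable[OF smooth_map_on_immersion[OF F] lN[OF t]] dl])
  then show "((x \<circ> \<gamma>) has_vector_derivative
       Re (b - a) *\<^sub>R pd 1 (x \<circ> F) (a + of_real t * (b - a)) + Im (b - a) *\<^sub>R pd 2 (x \<circ> F)
           (a + of_real t * (b - a))) (at t)"
    by (simp add: \<gamma> l_def comp_def)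
qed

lemma segment_curve_length_le:
  assumes F: "smooth_map_on N F" and ab: "\<And>t. t \<in> {0..1} \<Longrightarrow> a + of_real t * (b - a) \<in> N"
    and B: "\<And>t v. t \<in> {0..1} \<Longrightarrow> v = Re (b - a) *\<^sub>R pd 1 (x \<circ> F) (a + of_real t * (b - a)) + Im
        (b - a) *\<^sub>R pd 2 (x \<circ> F) (a + of_real t * (b - a))
       \<Longrightarrow> sqrt (mink v v) \<le> B"
  shows "curve_length x (\<lambda>t. F (a + of_real t * (b - a))) \<le> ennreal B"
proof -
  let ?c = "\<lambda>t. Re (b - a) *\<^sub>R pd 1 (x \<circ> F) (a + of_real t * (b - a)) + Im (b - a) *\<^sub>R pd 2 (x \<circ> F)
      (a + of_real t * (b - a))"
  have "curve_length x (\<lambda>t. F (a + of_real t * (b - a)))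
      = (\<integral>\<^sup>+t. ennreal (sqrt (mink (?c t) (?c t))) * indicator ({0<..<1} - {}) t \<partial>lborel)"
    unfolding curve_length_eq by (rule minkowski_length_eq) (use segment_curve(2)[OF F ab] in auto)
  also have "\<dots> \<le> (\<integral>\<^sup>+t. ennreal B * indicator {0<..<1::real} t \<partial>lborel)"
    by (rule nn_integral_mono) (use B in \<open>auto simp: indicator_def intro!: ennreal_leI\<close>)
  also have "\<dots> = ennreal B" by (simp add: nn_integral_cmult_indicator)
  finally show ?thesis .
qed

lemma smooth_map_on_chart_inverse:
  assumes U: "(U, \<phi>) \<in> A"
  shows "smooth_map_on (\<phi> ` U) (inv_into U \<phi>)"
  unfolding smooth_map_on_def
proof (intro conjI allI impI)
  have ch: "is_chart M (U, \<phi>)" by (rule atlas_chart[OF U])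
  show "open (\<phi> ` U)" by (rule chartD(3)[OF ch])
  show "inv_into U \<phi> ` \<phi> ` U \<subseteq> topspace M" using chartD(2)[OF ch] by (auto intro!: inv_into_into)
  have eq: "{w \<in> \<phi> ` U. inv_into U \<phi> w \<in> W} = \<phi> ` (U \<inter> W)" for W
    using chart_inv_into[OF ch] by auto
  show "open {w \<in> \<phi> ` U. inv_into U \<phi> w \<in> W}" if "openin M W" for W
    unfolding eq by (rule open_chart_image[OF ch that])
  show "smooth_on {w \<in> \<phi> ` U. inv_into U \<phi> w \<in> V} (\<theta> \<circ> inv_into U \<phi>)" if "(V, \<theta>) \<in> A" for V \<theta>
    unfolding eq by (rule transition_to_atlas(2)[OF atlas_oriented[OF U] that])
qed

lemma ball_segment:
  fixes a b z :: complex
  assumes "a \<in> ball z r" "b \<in> ball z r" "t \<in> {0..1}"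
  shows "a + of_real t * (b - a) \<in> ball z r"
proof -
  have "(1 - t) *\<^sub>R a + t *\<^sub>R b \<in> ball z r"
    using convex_ball[of z r] assms unfolding convex_alt by auto
  then show ?thesis by (simp add: algebra_simps scaleR_conv_of_real)
qed

text \<open>\<open>enn2real\<close> sends infinity to 0, so two points without a connecting curve of
  finite length would get distance 0. The relation serves to exclude this, after which
  \<open>induced_dist\<close> really is the infimum of lengths.\<close>

definition finitely_connected :: "'a \<Rightarrow> 'a \<Rightarrow> bool" where
  "finitely_connected p q \<longleftrightarrow> (\<exists>\<gamma>. piecewise_C1_curve M A p q \<gamma> \<and> curve_length x \<gamma> < \<infinity>)"

lemma finitely_connected_trans:
    "finitely_connected p q \<Longrightarrow> finitely_connected q r \<Longrightarrow> finitely_connected p r"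
  unfolding finitely_connected_def
  by (elim exE conjE, rule exI, rule conjI, erule (1) piecewise_C1_curve_join(1))
    (simp add: piecewise_C1_curve_join(2))

lemma finitely_connected_sym: "finitely_connected p q \<Longrightarrow> finitely_connected q p"
  unfolding finitely_connected_def using piecewise_C1_curve_reverse by metis

lemma finitely_connected_nhd:
  assumes p: "p \<in> topspace M"
  obtains W where "openin M W" "p \<in> W" "\<And>q. q \<in> W \<Longrightarrow> finitely_connected p q"
proof -
  obtain U \<phi> where U: "(U, \<phi>) \<in> A" "p \<in> U" using atlas_cover[OF p] by blast
  have ch: "is_chart M (U, \<phi>)" by (rule atlas_chart[OF U(1)])
  obtain r where r: "r > 0" "ball (\<phi> p) r \<subseteq> \<phi> ` U" using chartD(3)[OF ch] U(2) open_contains_ball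
    by blast
  show ?thesis
  proof (rule that[OF openin_chart_preimage[OF ch open_ball[of "\<phi> p" r]]])
    show "p \<in> {q \<in> U. \<phi> q \<in> ball (\<phi> p) r}" using U r by simp
    fix q assume q: "q \<in> {q \<in> U. \<phi> q \<in> ball (\<phi> p) r}"
    let ?F = "inv_into U \<phi>" and ?l = "\<lambda>t. \<phi> p + of_real t * (\<phi> q - \<phi> p)"
    note F = smooth_map_on_chart_inverse[OF U(1)]
    have l: "?l t \<in> \<phi> ` U" if "t \<in> {0..1}" for t
      using ball_segment[of "\<phi> p" "\<phi> p" r "\<phi> q" t] that r q by auto
    have ends: "?F (\<phi> p) = p" "?F (\<phi> q) = q" using q U ch by auto
    let ?c = "\<lambda>t. Re (\<phi> q - \<phi> p) *\<^sub>R pd 1 (x \<circ> ?F) (?l t) + Im (\<phi> q - \<phi> p) *\<^sub>R pd 2 (x \<circ> ?F) (?l t)"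
    have "continuous_on {0..1} (\<lambda>t. pd i (x \<circ> ?F) (?l t))" for i
      by (rule
          continuous_on_compose2[OF
              smooth_on_continuous_on[OF smooth_on_pd[OF smooth_map_on_immersion[OF F]]]])
        (use l in \<open>auto intro!: continuous_intros\<close>)
    then have "continuous_on {0..1} (\<lambda>t. sqrt (mink (?c t) (?c t)))"
      by (intro continuous_intros bounded_bilinear.continuous_on[OF bounded_bilinear_mink])
    then have "bounded ((\<lambda>t. sqrt (mink (?c t) (?c t))) ` {0..1})"
      by (intro compact_imp_bounded compact_continuous_image) auto
    then obtain B where B0: "\<forall>y\<in>(\<lambda>t. sqrt (mink (?c t) (?c t))) ` {0..1}. norm y \<le> B"
      unfolding bounded_iff by blast
    have B: "sqrt (mink (?c t) (?c t)) \<le> B" if "t \<in> {0..1}" for t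
      using B0[rule_format, OF imageI[OF that]] by (rule order_trans[rotated]) simp
    have "curve_length x (\<lambda>t. ?F (?l t)) \<le> ennreal B"
      by (rule segment_curve_length_le[OF F l]) (use B in auto)
    then have "curve_length x (\<lambda>t. ?F (?l t)) < \<infinity>" by (simp add: le_less_trans)
    moreover have "piecewise_C1_curve M A p q (\<lambda>t. ?F (?l t))"
      using segment_curve(1)[OF F, of "\<phi> p" "\<phi> q"] l ends by simp
    ultimately show "finitely_connected p q" unfolding finitely_connected_def by blast
  qed
qed

text \<open>Being joined by a curve of finite length is an equivalence relation with open
  neighbourhoods inside its classes, and \<open>M\<close> is connected.\<close>

lemma finitely_connected_all:
  assumes p: "p \<in> topspace M" and q: "q \<in> topspace M"
  shows "finitely_connected p q"
proof (rule ccontr)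
  assume nq: "\<not> finitely_connected p q"
  have con: "connected_space M" using oriented_surface by (simp add: oriented_surface_def)
  obtain N where N: "\<And>a. a \<in> topspace M \<Longrightarrow> openin M (N a)" "\<And>a. a \<in> topspace M \<Longrightarrow> a \<in> N a"
    "\<And>a b. a \<in> topspace M \<Longrightarrow> b \<in> N a \<Longrightarrow> finitely_connected a b"
  proof -
    have "\<forall>a\<in>topspace M. \<exists>W. openin M W \<and> a \<in> W \<and> (\<forall>b\<in>W. finitely_connected a b)"
    proof
      fix a assume "a \<in> topspace M"
      then show "\<exists>W. openin M W \<and> a \<in> W \<and> (\<forall>b\<in>W. finitely_connected a b)"
        by (rule finitely_connected_nhd) (intro exI conjI ballI)
    qed
    from bchoice[OF this] obtain N where
      N: "\<forall>a\<in>topspace M. openin M (N a) \<and> a \<in> N a \<and> (\<forall>b\<in>N a. finitely_connected a b)" by (elim exE)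
    show ?thesis by (rule that[of N]) (use N in simp_all)
  qed
  define E1 where "E1 = (\<Union>a\<in>{a \<in> topspace M. finitely_connected p a}. N a)"
  define E2 where "E2 = (\<Union>a\<in>{a \<in> topspace M. \<not> finitely_connected p a}. N a)"
  have "E1 \<inter> E2 = {}"
  proof (rule ccontr)
    assume "E1 \<inter> E2 \<noteq> {}"
    then obtain a b c where "a \<in> topspace M" "finitely_connected p a" "c \<in> N a"
      "b \<in> topspace M" "\<not> finitely_connected p b" "c \<in> N b" by (auto simp: E1_def E2_def)
    then show False using N(3) finitely_connected_sym finitely_connected_trans by metis
  qed
  moreover have "openin M E1" "openin M E2" unfolding E1_def E2_def using N(1)
    by (auto intro!: openin_Union)
  moreover have "topspace M \<subseteq> E1 \<union> E2" using N(2) by (auto simp: E1_def E2_def)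
  moreover have "q \<in> E2" using q nq N(2) by (auto simp: E2_def)
  moreover have "p \<in> E1"
    using p N(2)[OF p] N(3)[OF p N(2)[OF p]] by (auto simp: E1_def)
  ultimately show False using connected_spaceD[OF con] by (metis empty_iff)
qed

lemma induced_dist_le:
  assumes c: "piecewise_C1_curve M A p q \<gamma>" and p: "p \<in> topspace M" "q \<in> topspace M"
    and l: "curve_length x \<gamma> \<le> ennreal B" and B: "B \<ge> 0"
  shows "induced_dist M A x p q \<le> B"
proof -
  have "(INF \<gamma> \<in> Collect (piecewise_C1_curve M A p q). curve_length x \<gamma>) \<le> curve_length x \<gamma>"
    by (rule INF_lower) (use c in simp)
  also note l
  finally have "enn2real (INF \<gamma> \<in> Collect (piecewise_C1_curve M A p q). curve_length x \<gamma>) \<le> B"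
    using B by (simp add: enn2real_leI)
  then show ?thesis using p by (simp add: induced_dist_def)
qed

lemma induced_dist_INF:
  assumes p: "p \<in> topspace M" "q \<in> topspace M"
  shows
      "ennreal (induced_dist M A x p q) = (INF \<gamma> \<in> Collect (piecewise_C1_curve M A p q).
          curve_length x \<gamma>)"
proof -
  obtain \<gamma> where "piecewise_C1_curve M A p q \<gamma>" "curve_length x \<gamma> < \<infinity>"
    using finitely_connected_all[OF p] by (auto simp: finitely_connected_def)
  then have "(INF \<gamma> \<in> Collect (piecewise_C1_curve M A p q). curve_length x \<gamma>) < \<infinity>"
    by (meson INF_lower le_less_trans mem_Collect_eq)
  then show ?thesis using p by (simp add: induced_dist_def)
qed

end

section \<open>The induced distance as a metric controlling the topology of \<open>M\<close>\<close>

lemma continuous_map_chart_inverse: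
  assumes ch: "is_chart M (U, \<phi>)"
  shows "continuous_map (top_of_set (\<phi> ` U)) M (inv_into U \<phi>)"
  unfolding continuous_map_def
proof (intro conjI allI impI)
  show "inv_into U \<phi> \<in> topspace (top_of_set (\<phi> ` U)) \<rightarrow> topspace M"
    using chartD(2)[OF ch] by (auto intro!: inv_into_into)
  fix W assume W: "openin M W"
  have "{w \<in> topspace (top_of_set (\<phi> ` U)). inv_into U \<phi> w \<in> W} = \<phi> ` (U \<inter> W)"
    using chart_inv_into[OF ch] by auto
  then show "openin (top_of_set (\<phi> ` U)) {w \<in> topspace (top_of_set (\<phi> ` U)). inv_into U \<phi> w \<in> W}"
    using open_chart_image[OF ch W] by (simp add: open_subset image_mono)
qed

lemma continuous_on_chart_curve:
  assumes ch: "is_chart M (U, \<phi>)" and pin: "pathin M \<gamma>" and X: "X \<subseteq> {0..1}" "\<gamma> ` X \<subseteq> U"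
  shows "continuous_on X (\<phi> \<circ> \<gamma>)"
  unfolding continuous_openin_preimage_eq
proof (intro allI impI)
  fix B :: "complex set" assume "open B"
  have "openin (top_of_set {0..1}) {t \<in> {0..1}. \<gamma> t \<in> {q \<in> U. \<phi> q \<in> B}}"
    by (rule pathin_preimage(1)[OF pin openin_chart_preimage[OF ch \<open>open B\<close>]])
  then have "openin (top_of_set X) (X \<inter> {t \<in> {0..1}. \<gamma> t \<in> {q \<in> U. \<phi> q \<in> B}})"
    using X(1) openin_subtopology_Int2 openin_subset_trans
    by (metis (no_types, lifting) inf.absorb_iff2 inf_commute openin_subtopology_Int
        subtopology_subtopology)
  also have "X \<inter> {t \<in> {0..1}. \<gamma> t \<in> {q \<in> U. \<phi> q \<in> B}} = X \<inter> (\<phi> \<circ> \<gamma>) -` B"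
    using X by auto
  finally show "openin (top_of_set X) (X \<inter> (\<phi> \<circ> \<gamma>) -` B)" .
qed

text \<open>Determinant over trace bounds the form from below, continuously in the coefficients and
  without computing eigenvalues. By Cayley-Hamilton the difference times the trace is the squared
  length of the image of \<open>(a, b)\<close> under the symmetric matrix.\<close>

lemma quadratic_form_lower_bound:
  fixes E F G a b :: real
  assumes "E + G > 0"
  shows "(E * G - F * F) / (E + G) * (a * a + b * b) \<le> a * a * E + 2 * a * b * F + b * b * G"
proof -
  have "(E + G) * (a * a * E + 2 * a * b * F + b * b * G) - (E * G - F * F) * (a * a + b * b)
      = (a * E + b * F) * (a * E + b * F) + (a * F + b * G) * (a * F + b * G)"
    by (simp add: algebra_simps)
  also have "\<dots> \<ge> 0" by simp
  finally show ?thesis using assms by (simp add: field_simps)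
qed

context stationary_surface
begin

text \<open>On a closed coordinate disc about \<open>p\<close> inside \<open>W\<close> the metric
  dominates a positive multiple \<open>c\<close> of the Euclidean one. A curve that ends outside
  \<open>W\<close> must first cross this disc, which costs at least \<open>c * r\<close>.\<close>

lemma exit_length:
  assumes p: "p \<in> topspace M" and W: "openin M W" "p \<in> W"
  obtains \<delta>
      where "\<delta> > 0" "\<And>q \<gamma>. q \<notin> W \<Longrightarrow> piecewise_C1_curve M A p q \<gamma> \<Longrightarrow> ennreal \<delta> \<le> curve_length x \<gamma>"
proof -
  obtain U \<phi> where U: "(U, \<phi>) \<in> A" "p \<in> U" using atlas_cover[OF p] by blast
  have ch: "is_chart M (U, \<phi>)" by (rule atlas_chart[OF U(1)])
  interpret stationary_patch "x \<circ> inv_into U \<phi>" "\<phi> ` U" by (rule stationary_patch_atlas[OF U(1)])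
  let ?y = "x \<circ> inv_into U \<phi>"
  have "\<phi> p \<in> \<phi> ` (U \<inter> W)" using U W by blast
  then obtain r where r: "r > 0" "cball (\<phi> p) r \<subseteq> \<phi> ` (U \<inter> W)"
    using open_chart_image[OF ch W(1)] open_contains_cball by blast
  let ?K = "cball (\<phi> p) r"
  have KU: "?K \<subseteq> \<phi> ` U" using r(2) by blast
  define m where "m z = (gE z * gG z - gF z * gF z) / (gE z + gG z)" for z
  have gG_pos: "gG z > 0" if "z \<in> \<phi> ` U" for z
    using spacelike[OF that, of 0 1] by (simp add: gG_def)
  have EG: "gE z + gG z > 0" if "z \<in> \<phi> ` U" for z using gE_pos[OF that] gG_pos[OF that] by simp
  have "continuous_on ?K m"
    unfolding m_def using KU EG
    by (intro continuous_intros continuous_on_subset[OF smooth_on_continuous_on[OF smooth_g(1)] KU]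
      continuous_on_subset[OF smooth_on_continuous_on[OF smooth_g(2)] KU]
      continuous_on_subset[OF smooth_on_continuous_on[OF smooth_g(3)] KU]) (metis less_irrefl
          subsetD)
  then obtain z0 where z0: "z0 \<in> ?K" "\<And>z. z \<in> ?K \<Longrightarrow> m z0 \<le> m z"
    using continuous_attains_inf[of ?K m] r(1)
        by (metis cball_eq_empty compact_cball not_less_iff_gr_or_eq)
  have m0: "m z0 > 0" using det_pos EG z0(1) KU unfolding m_def by (meson divide_pos_pos subsetD)
  define c where "c = sqrt (m z0)"
  have c: "c > 0" "c * c = m z0" using m0 by (auto simp: c_def)
  have lower:
      "c * norm v \<le> sqrt (mink (Re v *\<^sub>R pd 1 ?y z + Im v *\<^sub>R pd 2 ?y z)
          (Re v *\<^sub>R pd 1 ?y z + Im v *\<^sub>R pd 2 ?y z))"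
    if z: "z \<in> ?K" for v z
  proof (rule real_le_rsqrt)
    have "(c * norm v)\<^sup>2 = m z0 * (Re v * Re v + Im v * Im v)"
      unfolding power_mult_distrib cmod_power2 using c(2) by (simp add: power2_eq_square)
    also have "\<dots> \<le> m z * (Re v * Re v + Im v * Im v)" by (intro mult_right_mono z0 z) simp
    also have "\<dots> \<le> Re v * Re v * gE z + 2 * Re v * Im v * gF z + Im v * Im v * gG z"
      unfolding m_def by (rule quadratic_form_lower_bound) (use EG z KU in blast)
    also have "\<dots> = mink (Re v *\<^sub>R pd 1 ?y z + Im v *\<^sub>R pd 2 ?y z)
        (Re v *\<^sub>R pd 1 ?y z + Im v *\<^sub>R pd 2 ?y z)"
      by (simp add: mink_linear mink_commute[of "pd 2 ?y z" "pd 1 ?y z"] algebra_simps flip: gE_def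
          gF_def gG_def)
    finally
        show "(c * norm v)\<^sup>2 \<le> mink (Re v *\<^sub>R pd 1 ?y z + Im v *\<^sub>R pd 2 ?y z)
            (Re v *\<^sub>R pd 1 ?y z + Im v *\<^sub>R pd 2 ?y z)" .
  qed
  show ?thesis
  proof (rule that[of "c * r"])
    show "c * r > 0" using c r by simp
    fix q \<gamma> assume q: "q \<notin> W" and curve: "piecewise_C1_curve M A p q \<gamma>"
    obtain S where S: "finite S" and pin: "pathin M \<gamma>" and e: "\<gamma> 0 = p" "\<gamma> 1 = q"
      and C1: "\<And>U \<phi>. (U, \<phi>) \<in> A \<Longrightarrow> (\<phi> \<circ> \<gamma>) C1_differentiable_on {t \<in> {0..1} - S. \<gamma> t \<in> U}"
      using curve unfolding piecewise_C1_curve_def by fastforce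
    define B where "B = {q \<in> U. \<phi> q \<in> ball (\<phi> p) r}"
    have oB: "openin M B" unfolding B_def by (rule openin_chart_preimage[OF ch open_ball])
    have pB: "p \<in> B" using U r by (simp add: B_def)
    have qB: "q \<notin> B"
    proof
      assume "q \<in> B"
      then have "q \<in> U" "\<phi> q \<in> \<phi> ` (U \<inter> W)" using r(2) by (auto simp: B_def)
      then show False using q inj_onD[OF chartD(4)[OF ch]] by auto
    qed
    \<comment> \<open>The least element \<open>t1\<close> of this compact set is the first time at
      which the curve leaves the open disc.\<close>
    define T where "T = {0..1} - {t \<in> {0..1}. \<gamma> t \<in> B}"
    have "closedin (top_of_set {0..1}) T"
      unfolding T_def using pathin_preimage(1)[OF pin oB] openin_closedin_eq
        by (metis closedin_diff closedin_topspace topspace_euclidean_subtopology)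
    then have "compact T" using closedin_compact compact_Icc by blast
    moreover have "1 \<in> T" using e qB by (simp add: T_def)
    ultimately obtain t1 where t1: "t1 \<in> T" "\<And>t. t \<in> T \<Longrightarrow> t1 \<le> t" using compact_attains_inf[of T]
      by blast
    have t1': "0 \<le> t1" "t1 \<le> 1" "\<gamma> t1 \<notin> B" using t1(1) by (auto simp: T_def)
    have "t1 \<noteq> 0" using t1'(3) e pB by auto
    then have t1p: "t1 > 0" using t1' by simp
    have before: "\<gamma> t \<in> B" if "0 \<le> t" "t < t1" for t using t1(2)[of t] that t1'
      by (auto simp: T_def)
    \<comment> \<open>A curve leaving the disc might leave the chart at the same instant. The closed
      disc is compact, hence closed in the Hausdorff space \<open>M\<close>, so at time
      \<open>t1\<close> the curve is still in the chart, at coordinate distance exactly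
      \<open>r\<close>.\<close>
    have "compactin M (inv_into U \<phi> ` ?K)"
      by (rule image_compactin[OF _ continuous_map_chart_inverse[OF ch]])
        (use KU in \<open>simp add: compactin_subtopology\<close>)
    then have "closedin M (inv_into U \<phi> ` ?K)" using compactin_imp_closedin[OF hausdorff] by blast
    then have "closedin (top_of_set {0..1}) {t \<in> topspace (top_of_set {0..1}). \<gamma> t \<in> inv_into U \<phi> `
        ?K}"
      using pin unfolding pathin_def continuous_map_closedin by blast
    then have clZ: "closed {t \<in> {0..1}. \<gamma> t \<in> inv_into U \<phi> ` ?K}"
      using closedin_closed_trans closed_atLeastAtMost by fastforce
    have "{0..<t1} \<subseteq> {t \<in> {0..1}. \<gamma> t \<in> inv_into U \<phi> ` ?K}"
    proof
      fix t assume t: "t \<in> {0..<t1}"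
      then have "\<gamma> t \<in> B" using before by simp
      then have "\<gamma> t = inv_into U \<phi> (\<phi> (\<gamma> t))" "\<phi> (\<gamma> t) \<in> ?K" using ch by (auto simp: B_def)
      then show "t \<in> {t \<in> {0..1}. \<gamma> t \<in> inv_into U \<phi> ` ?K}" using t t1' by auto
    qed
    then have "closure {0..<t1} \<subseteq> {t \<in> {0..1}. \<gamma> t \<in> inv_into U \<phi> ` ?K}" using clZ closure_minimal
      by blast
    then have "{0..t1} \<subseteq> {t \<in> {0..1}. \<gamma> t \<in> inv_into U \<phi> ` ?K}" using t1p by simp
    then have inK: "\<gamma> t \<in> U \<and> \<phi> (\<gamma> t) \<in> ?K" if "t \<in> {0..t1}" for t
    proof -
      have "\<gamma> t \<in> inv_into U \<phi> ` ?K" using \<open>{0..t1} \<subseteq> _\<close> that by blast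
      then obtain z where "z \<in> ?K" "\<gamma> t = inv_into U \<phi> z" by blast
      then show ?thesis using KU by (auto simp: f_inv_into_f inv_into_into subset_iff)
    qed
    have t1r: "norm (\<phi> (\<gamma> t1) - \<phi> p) = r"
      using inK[of t1] t1p t1'(3) by (auto simp: B_def dist_norm norm_minus_commute)
    define f where "f t = c *\<^sub>R (\<phi> \<circ> \<gamma>) t" for t
    define f' where "f' t = c *\<^sub>R vector_derivative (\<phi> \<circ> \<gamma>) (at t)" for t
    have sub: "{0<..<t1} - S \<subseteq> {t \<in> {0..1} - S. \<gamma> t \<in> U}" using inK t1' by auto
    note C1U = C1[OF U(1), unfolded C1_differentiable_on_eq]
    have "ennreal (norm (f t1 - f 0)) \<le> (\<integral>\<^sup>+t. ennreal (norm (f' t)) * indicator ({0<..<t1} - S) t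
        \<partial>lborel)"
    proof (rule norm_diff_le_nn_integral_derivative[OF t1'(1) S])
      have "continuous_on {0..t1} (\<phi> \<circ> \<gamma>)"
        by (rule continuous_on_chart_curve[OF ch pin]) (use t1' inK in auto)
      then show "continuous_on {0..t1} f" unfolding f_def by (intro continuous_intros)
      show "(f has_vector_derivative f' t) (at t)" if "t \<in> {0<..<t1} - S" for t
      proof -
        have "((\<phi> \<circ> \<gamma>) has_vector_derivative vector_derivative (\<phi> \<circ> \<gamma>) (at t)) (at t)"
          using C1U subsetD[OF sub that] unfolding vector_derivative_works by blast
        then show ?thesis
          unfolding f_def f'_def
            by (rule bounded_linear.has_vector_derivative[OF bounded_linear_scaleR_right])
      qed
      show "continuous_on ({0<..<t1} - S) f'"
        unfolding f'_def using C1U continuous_on_subset[OF _ sub] by (intro continuous_intros) blast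
    qed
    also have "\<dots> \<le> curve_length x \<gamma>"
    proof -
      define c' where "c' t = vector_derivative (x \<circ> \<gamma>) (at t)" for t
      have der: "((x \<circ> \<gamma>) has_vector_derivative
        Re (vector_derivative (\<theta> \<circ> \<gamma>) (at t)) *\<^sub>R pd 1 (x \<circ> inv_into V \<theta>) (\<theta> (\<gamma> t)) +
        Im (vector_derivative (\<theta> \<circ> \<gamma>) (at t)) *\<^sub>R pd 2 (x \<circ> inv_into V \<theta>) (\<theta> (\<gamma> t))) (at t)"
        if "(V, \<theta>) \<in> A" "t \<in> {0<..<1} - S" "\<gamma> t \<in> V" for V \<theta> t
        by (rule piecewise_C1_curve_compose_derivative[OF pin S _ that]) (rule C1)
      have dc: "((x \<circ> \<gamma>) has_vector_derivative c' t) (at t)" if t: "t \<in> {0<..<1} - S" for t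
      proof -
        have "\<gamma> t \<in> topspace M" using t by (intro pathin_topspace[OF pin]) auto
        then obtain V \<theta> where "(V, \<theta>) \<in> A" "\<gamma> t \<in> V" using atlas_cover by blast
        from der[OF this(1) t this(2)] show ?thesis unfolding c'_def
          by (simp add: vector_derivative_at)
      qed
      have "curve_length x \<gamma> = (\<integral>\<^sup>+t. ennreal (sqrt (mink (c' t) (c' t))) * indicator ({0<..<1} - S)
          t \<partial>lborel)"
        unfolding curve_length_eq by (rule minkowski_length_eq[OF S dc])
      moreover have "norm (f' t) \<le> sqrt (mink (c' t) (c' t))" if t: "t \<in> {0<..<t1} - S" for t
      proof -
        have tt: "t \<in> {0<..<1} - S" "\<gamma> t \<in> U" "\<phi> (\<gamma> t) \<in> ?K" using t t1' inK[of t] by auto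
        have "c' t = Re (vector_derivative (\<phi> \<circ> \<gamma>) (at t)) *\<^sub>R pd 1 (x \<circ> inv_into U \<phi>) (\<phi> (\<gamma> t)) +
          Im (vector_derivative (\<phi> \<circ> \<gamma>) (at t)) *\<^sub>R pd 2 (x \<circ> inv_into U \<phi>) (\<phi> (\<gamma> t))"
          unfolding c'_def by (rule vector_derivative_at[OF der[OF U(1) tt(1,2)]])
        then show ?thesis using lower[OF tt(3), of "vector_derivative (\<phi> \<circ> \<gamma>) (at t)"] c(1)
          by (simp add: f'_def)
      qed
      ultimately show ?thesis
        using t1' by (auto intro!: nn_integral_mono simp: indicator_def ennreal_leI)
    qed
    also have "norm (f t1 - f 0) = c * r"
      using t1r c(1) e by (simp add: f_def scaleR_diff_right[symmetric] del: scaleR_diff_right)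
    finally show "ennreal (c * r) \<le> curve_length x \<gamma>" .
  qed
qed

text \<open>Every neighbourhood of \<open>p\<close> in \<open>M\<close> contains a ball of
  \<open>induced_dist\<close>. This gives definiteness of the metric and turns metric limits into
  limits in \<open>M\<close>.\<close>

lemma induced_dist_ge_exit:
  assumes p: "p \<in> topspace M" and W: "openin M W" "p \<in> W"
  obtains \<delta> where "\<delta> > 0" "\<And>q. q \<in> topspace M - W \<Longrightarrow> \<delta> \<le> induced_dist M A x p q"
proof -
  obtain \<delta>
      where \<delta>: "\<delta> > 0" "\<And>q \<gamma>. q \<notin> W \<Longrightarrow> piecewise_C1_curve M A p q \<gamma> \<Longrightarrow> ennreal \<delta> \<le> curve_length x \<gamma>"
    using exit_length[OF p W] by blast
  show ?thesis
  proof (rule that[OF \<delta>(1)])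
    fix q assume q: "q \<in> topspace M - W"
    have "ennreal \<delta> \<le> (INF \<gamma> \<in> Collect (piecewise_C1_curve M A p q). curve_length x \<gamma>)"
      by (rule INF_greatest) (use \<delta>(2) q in auto)
    also have "\<dots> = ennreal (induced_dist M A x p q)" using induced_dist_INF[OF p] q by simp
    finally show "\<delta> \<le> induced_dist M A x p q"
      by (simp add: induced_dist_def ennreal_le_iff)
  qed
qed

lemma induced_dist_commute: "induced_dist M A x p q = induced_dist M A x q p"
proof -
  have le:
      "(INF \<gamma> \<in> Collect (piecewise_C1_curve M A p q). curve_length x \<gamma>)
          \<le> (INF \<gamma> \<in> Collect (piecewise_C1_curve M A q p). curve_length x \<gamma>)" for p q
  proof (rule INF_greatest)
    fix \<gamma> assume "\<gamma> \<in> Collect (piecewise_C1_curve M A q p)"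
    then have c: "piecewise_C1_curve M A q p \<gamma>" by simp
    have "(INF \<gamma> \<in> Collect (piecewise_C1_curve M A p q). curve_length x \<gamma>) \<le> curve_length x
        (reverse_curve \<gamma>)"
      by (rule INF_lower) (use piecewise_C1_curve_reverse(1)[OF c] in simp)
    also have "\<dots> = curve_length x \<gamma>" by (rule piecewise_C1_curve_reverse(2)[OF c])
    finally show "(INF \<gamma> \<in> Collect (piecewise_C1_curve M A p q). curve_length x \<gamma>) \<le> curve_length x
        \<gamma>" .
  qed
  show ?thesis unfolding induced_dist_def using antisym[OF le[of p q] le[of q p]] by auto
qed

lemma induced_dist_triangle:
  assumes p: "p \<in> topspace M" "q \<in> topspace M" "r \<in> topspace M"
  shows "induced_dist M A x p r \<le> induced_dist M A x p q + induced_dist M A x q r"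
proof (rule field_le_epsilon)
  fix e :: real assume e: "e > 0"
  have near:
      "\<exists>\<gamma>. piecewise_C1_curve M A a b \<gamma> \<and> curve_length x \<gamma>
          \<le> ennreal (induced_dist M A x a b + e / 2)"
    if ab: "a \<in> topspace M" "b \<in> topspace M" for a b
  proof -
    have "(INF \<gamma> \<in> Collect (piecewise_C1_curve M A a b). curve_length x \<gamma>)
        < ennreal (induced_dist M A x a b + e / 2)"
      unfolding induced_dist_INF[OF ab, symmetric] using e
        by (intro ennreal_lessI) (auto simp: induced_dist_def add_nonneg_pos)
    then show ?thesis unfolding INF_less_iff by (auto intro: less_imp_le)
  qed
  obtain \<gamma>1 \<gamma>2
      where c: "piecewise_C1_curve M A p q \<gamma>1"
          "curve_length x \<gamma>1 \<le> ennreal (induced_dist M A x p q + e / 2)"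
    "piecewise_C1_curve M A q r \<gamma>2" "curve_length x \<gamma>2 \<le> ennreal (induced_dist M A x q r + e / 2)"
    using near p by metis
  have nn: "induced_dist M A x a b \<ge> 0" for a b by (simp add: induced_dist_def)
  show "induced_dist M A x p r \<le> induced_dist M A x p q + induced_dist M A x q r + e"
  proof (rule induced_dist_le[OF piecewise_C1_curve_join(1)[OF c(1,3)] p(1,3)])
    have "curve_length x (join_curves \<gamma>1 \<gamma>2) \<le> ennreal (induced_dist M A x p q + e / 2) + ennreal
        (induced_dist M A x q r + e / 2)"
      unfolding piecewise_C1_curve_join(2)[OF c(1,3)] by (intro add_mono c)
    also have "\<dots> = ennreal (induced_dist M A x p q + induced_dist M A x q r + e)"
      using nn e by (subst ennreal_plus[symmetric]) (auto simp: add_nonneg_pos less_imp_le)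
    finally
        show "curve_length x (join_curves \<gamma>1 \<gamma>2) \<le> ennreal (induced_dist M A x p q + induced_dist M
            A x q r + e)" .
    show "0 \<le> induced_dist M A x p q + induced_dist M A x q r + e" using nn[of p q] nn[of q r] e
      by simp
  qed
qed

lemma induced_dist_self:
  assumes p: "p \<in> topspace M"
  shows "induced_dist M A x p p = 0"
proof -
  obtain U \<phi> where U: "(U, \<phi>) \<in> A" "p \<in> U" using atlas_cover[OF p] by blast
  have ch: "is_chart M (U, \<phi>)" by (rule atlas_chart[OF U(1)])
  note F = smooth_map_on_chart_inverse[OF U(1)]
  have "piecewise_C1_curve M A p p (\<lambda>t. inv_into U \<phi> (\<phi> p + of_real t * (\<phi> p - \<phi> p)))"
    using segment_curve(1)[OF F, of "\<phi> p" "\<phi> p"] U ch by simp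
  moreover have "curve_length x (\<lambda>t. inv_into U \<phi> (\<phi> p + of_real t * (\<phi> p - \<phi> p))) \<le> ennreal 0"
    by (rule segment_curve_length_le[OF F]) (use U in \<open>auto simp: mink_def\<close>)
  ultimately have "induced_dist M A x p p \<le> 0" using induced_dist_le p by blast
  then show ?thesis by (simp add: induced_dist_def antisym)
qed

lemma metric_space_induced_dist: "Metric_space (topspace M) (induced_dist M A x)"
proof
  show "0 \<le> induced_dist M A x p q" for p q by (simp add: induced_dist_def)
  show "induced_dist M A x p q = induced_dist M A x q p" for p q by (rule induced_dist_commute)
  show "induced_dist M A x p r \<le> induced_dist M A x p q + induced_dist M A x q r"
    if "p \<in> topspace M" "q \<in> topspace M" "r \<in> topspace M" for p q r
    by (rule induced_dist_triangle[OF that])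
  fix p q assume pq: "p \<in> topspace M" "q \<in> topspace M"
  show "induced_dist M A x p q = 0 \<longleftrightarrow> p = q"
  proof
    assume 0: "induced_dist M A x p q = 0"
    show "p = q"
    proof (rule ccontr)
      assume "p \<noteq> q"
      then obtain W V where W: "openin M W" "p \<in> W" "openin M V" "q \<in> V" "disjnt W V"
        using hausdorff pq unfolding Hausdorff_space_def by metis
      obtain \<delta> where "\<delta> > 0" "\<And>q. q \<in> topspace M - W \<Longrightarrow> \<delta> \<le> induced_dist M A x p q"
        using induced_dist_ge_exit[OF pq(1) W(1,2)] by blast
      then show False using 0 W pq by (force simp: disjnt_iff)
    qed
  qed (use induced_dist_self pq in auto)
qed

text \<open>Geometric steps make the sequence Cauchy, completeness gives a limit for
  \<open>induced_dist\<close>, and \<open>induced_dist_ge_exit\<close> makes it a limit in the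
  topology of \<open>M\<close>, the sense in which the maximal disc forbids it.\<close>

lemma complete_geometric_limit:
  assumes comp: "complete_surface M A x" and \<sigma>: "\<And>n. \<sigma> n \<in> topspace M"
    and geo: "\<And>n. induced_dist M A x (\<sigma> n) (\<sigma> (Suc n)) \<le> K * \<rho> ^ n" and \<rho>: "0 < \<rho>" "\<rho> < 1"
        and K: "K \<ge> 0"
  obtains q where "limitin M \<sigma> q sequentially"
proof -
  interpret Metric_space "topspace M" "induced_dist M A x" by (rule metric_space_induced_dist)
  have step: "induced_dist M A x (\<sigma> n) (\<sigma> (n + k)) \<le> K * \<rho> ^ n * ((1 - \<rho> ^ k) / (1 - \<rho>))" for n k
  proof (induction k)
    case 0 then show ?case using induced_dist_self[OF \<sigma>] by simp
  next
    case (Suc k)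
    have "induced_dist M A x (\<sigma> n) (\<sigma> (n + Suc k)) \<le> induced_dist M A x (\<sigma> n) (\<sigma> (n + k)) +
        induced_dist M A x (\<sigma> (n + k)) (\<sigma> (Suc (n + k)))"
      using triangle[OF \<sigma> \<sigma> \<sigma>] by simp
    also have "\<dots> \<le> K * \<rho> ^ n * ((1 - \<rho> ^ k) / (1 - \<rho>)) + K * \<rho> ^ (n + k)" using Suc geo
      by (intro add_mono) auto
    also have "\<dots> = K * \<rho> ^ n * ((1 - \<rho> ^ Suc k) / (1 - \<rho>))"
      using \<rho> by (simp add: field_simps power_add)
    finally show ?case .
  qed
  have step': "induced_dist M A x (\<sigma> n) (\<sigma> m) \<le> K / (1 - \<rho>) * \<rho> ^ n" if "n \<le> m" for n m
  proof -
    have "induced_dist M A x (\<sigma> n) (\<sigma> m) \<le> K * \<rho> ^ n * ((1 - \<rho> ^ (m - n)) / (1 - \<rho>))"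
      using step[of n "m - n"] that by simp
    also have "\<dots> \<le> K * \<rho> ^ n * (1 / (1 - \<rho>))" using \<rho> K
      by (intro mult_left_mono divide_right_mono) auto
    finally show ?thesis by simp
  qed
  have "MCauchy \<sigma>"
    unfolding MCauchy_def
  proof (intro conjI allI impI)
    show "range \<sigma> \<subseteq> topspace M" using \<sigma> by auto
    fix e :: real assume e: "e > 0"
    have "(\<lambda>n. K / (1 - \<rho>) * \<rho> ^ n) \<longlonglongrightarrow> K / (1 - \<rho>) * 0"
      using \<rho> by (intro tendsto_mult tendsto_const LIMSEQ_realpow_zero) auto
    then have "eventually (\<lambda>n. K / (1 - \<rho>) * \<rho> ^ n < e) sequentially" using e order_tendstoD(2)
      by fastforce
    then obtain N where N: "\<And>n. n \<ge> N \<Longrightarrow> K / (1 - \<rho>) * \<rho> ^ n < e" unfolding eventually_sequentially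
      by blast
    show "\<exists>N. \<forall>n n'. N \<le> n \<longrightarrow> N \<le> n' \<longrightarrow> induced_dist M A x (\<sigma> n) (\<sigma> n') < e"
    proof (intro exI allI impI)
      fix n n' assume "N \<le> n" "N \<le> n'"
      then show "induced_dist M A x (\<sigma> n) (\<sigma> n') < e"
        using step'[of n n'] step'[of n' n] N[of n] N[of n'] induced_dist_commute[of "\<sigma> n" "\<sigma> n'"]
        by (cases "n \<le> n'") auto
    qed
  qed
  then obtain q where q: "limitin mtopology \<sigma> q sequentially"
    using comp unfolding complete_surface_def mcomplete_def by blast
  have qM: "q \<in> topspace M" using limitin_topspace[OF q] by simp
  have "limitin M \<sigma> q sequentially"
    unfolding limitin_def
  proof (intro conjI allI impI qM)
    fix W assume W: "openin M W \<and> q \<in> W"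
    obtain \<delta> where \<delta>: "\<delta> > 0" "\<And>p. p \<in> topspace M - W \<Longrightarrow> \<delta> \<le> induced_dist M A x q p"
      using induced_dist_ge_exit[OF qM] W by blast
    have "eventually (\<lambda>n. \<sigma> n \<in> topspace M \<and> induced_dist M A x (\<sigma> n) q < \<delta>) sequentially"
      using q \<delta>(1) unfolding limitin_metric by blast
    then show "eventually (\<lambda>n. \<sigma> n \<in> W) sequentially"
    proof eventually_elim
      case (elim n)
      then show ?case using \<delta>(2)[of "\<sigma> n"] induced_dist_commute[of q "\<sigma> n"] by force
    qed
  qed
  then show ?thesis by (rule that)
qed

end


section \<open>Flatness\<close>

context spacelike_patch
begin

text \<open>Christoffel symbols in extrinsic form: the coefficients of \<open>pd 1 y\<close> and
  \<open>pd 2 y\<close> in the tangential part of \<open>pd i (pd j y)\<close>.\<close>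

definition
    "\<Gamma>1 i j z = (gG z * mink (pd i (pd j y) z) (pd 1 y z) - gF z * mink (pd i (pd j y) z)
        (pd 2 y z))
  / (gE z * gG z - gF z * gF z)"
definition
    "\<Gamma>2 i j z = (gE z * mink (pd i (pd j y) z) (pd 2 y z) - gF z * mink (pd i (pd j y) z)
        (pd 1 y z))
  / (gE z * gG z - gF z * gF z)"

lemma smooth_Gamma: "smooth_on S (\<Gamma>1 i j)" "smooth_on S (\<Gamma>2 i j)"
proof -
  note intros = smooth_on_divide smooth_on_diff smooth_on_mult smooth_g open_S smooth_pd det_pos
    smooth_on_bilinear[OF bounded_bilinear_mink] smooth_on_pd[OF smooth_pd]
  show "smooth_on S (\<Gamma>1 i j)" unfolding \<Gamma>1_def[abs_def] by (intro intros)
  show "smooth_on S (\<Gamma>2 i j)" unfolding \<Gamma>2_def[abs_def] by (intro intros)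
qed

text \<open>In the Levi-Civita combination of metric derivatives the symmetry of second derivatives
  cancels everything except \<open>2 * mink (pd i (pd j y) z) (pd k y z)\<close>.\<close>

lemma christoffel_eq:
  assumes z: "z \<in> S"
  shows "christoffel (induced_metric y) 1 i j z = \<Gamma>1 i j z"
    "christoffel (induced_metric y) 2 i j z = \<Gamma>2 i j z"
proof -
  define \<Delta> where "\<Delta> = gE z * gG z - gF z * gF z"
  have \<Delta>: "\<Delta> > 0" using det_pos[OF z] by (simp add: \<Delta>_def)
  have d: "det (induced_metric y z) = \<Delta>" by (simp add: det_induced_metric \<Delta>_def)
  have "det (induced_metric y z) \<noteq> 0" using \<Delta> d by simp
  note inv = matrix_inv_2[OF this, unfolded induced_metric_nth d]
  have dif: "pd i y differentiable (at z)" for i using smooth_on_differentiable[OF smooth_pd z] .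
  have dg: "pd i (\<lambda>w. induced_metric y w $ j $ k) z = mink (pd j y z) (pd i (pd k y) z) + mink
      (pd i (pd j y) z) (pd k y z)"
    for i j k
    unfolding induced_metric_def by (simp add: pd_bilinear[OF bounded_bilinear_mink dif dif])
  have sum: "pd i (\<lambda>w. induced_metric y w $ j $ k) z + pd j (\<lambda>w. induced_metric y w $ i $ k) z - pd
      k (\<lambda>w. induced_metric y w $ i $ j) z
     = 2 * mink (pd i (pd j y) z) (pd k y z)" for k
    unfolding dg pd_commute[OF open_S smooth z, of j i] pd_commute[OF open_S smooth z, of k i]
        pd_commute[OF open_S smooth z, of k j]
    by (simp add: mink_commute)
  show "christoffel (induced_metric y) 1 i j z = \<Gamma>1 i j z"
    "christoffel (induced_metric y) 2 i j z = \<Gamma>2 i j z"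
    unfolding christoffel_def sum sum_2 inv \<Gamma>1_def \<Gamma>2_def \<Delta>_def[symmetric]
    using \<Delta> by (simp_all add: field_simps)
qed

text \<open>If all tangent planes are parallel then \<open>\<partial>\<^sub>i\<partial>\<^sub>j y\<close> is tangential, and the curvature vanishes because
  third derivatives of \<open>y\<close> commute.\<close>

lemma gauss_curvature_parallel_tangent_planes:
  fixes a b :: "real ^ 4 \<Rightarrow> real"
  assumes N: "open N" "N \<subseteq> S" and z0: "z0 \<in> N"
    and ab: "bounded_linear a" "bounded_linear b"
    and plane: "\<And>z i. z \<in> N \<Longrightarrow> pd i y z = a (pd i y z) *\<^sub>R e1 + b (pd i y z) *\<^sub>R e2"
  shows "gauss_curvature (induced_metric y) z0 = 0"
proof -
  note bs = pd_bilinear[OF bounded_bilinear_scaleR]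
  have dif: "pd i y differentiable (at z)" "pd i (pd j y) differentiable (at z)"
    "\<Gamma>1 i j differentiable (at z)" "\<Gamma>2 i j differentiable (at z)" if "z \<in> N" for i j z
    using smooth_on_differentiable[OF smooth_pd]
        smooth_on_differentiable[OF smooth_on_pd[OF smooth_pd]]
      smooth_on_differentiable[OF smooth_Gamma(1)] smooth_on_differentiable[OF smooth_Gamma(2)] that
          N by blast+
  have plane2: "pd i (pd j y) z = a (pd i (pd j y) z) *\<^sub>R e1 + b (pd i (pd j y) z) *\<^sub>R e2"
      if z: "z \<in> N" for i j z
  proof -
    have L: "bounded_linear (\<lambda>v. a v *\<^sub>R e1 + b v *\<^sub>R e2)"
      by (intro bounded_linear_add bounded_linear_scaleR_const ab)
    have "pd i (pd j y) z = pd i (\<lambda>z. a (pd j y z) *\<^sub>R e1 + b (pd j y z) *\<^sub>R e2) z"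
      by (rule pd_cong[OF N(1) z]) (rule plane)
    also have "\<dots> = a (pd i (pd j y) z) *\<^sub>R e1 + b (pd i (pd j y) z) *\<^sub>R e2"
      by (rule pd_bounded_linear[OF L dif(1)[OF z]])
    finally show ?thesis .
  qed
  have tang: "pd i (pd j y) z = \<Gamma>1 i j z *\<^sub>R pd 1 y z + \<Gamma>2 i j z *\<^sub>R pd 2 y z" if z: "z \<in> N"
      for i j z
  proof -
    have zS: "z \<in> S" using z N by blast
    define v where "v = pd i (pd j y) z"
    define a1 b1 a2 b2 s t where "a1 = a (pd 1 y z)" "b1 = b (pd 1 y z)" "a2 = a (pd 2 y z)"
        "b2 = b (pd 2 y z)"
      "s = a v" "t = b v"
    have y: "pd 1 y z = a1 *\<^sub>R e1 + b1 *\<^sub>R e2" "pd 2 y z = a2 *\<^sub>R e1 + b2 *\<^sub>R e2"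
        "v = s *\<^sub>R e1 + t *\<^sub>R e2"
      using plane[OF z] plane2[OF z] unfolding v_def a1_b1_a2_b2_s_t_def by blast+
    define D where "D = a1 * b2 - b1 * a2"
    \<comment> \<open>\<open>D\<close> is the determinant of the two tangent vectors with respect to
      \<open>e1\<close> and \<open>e2\<close>; it is nonzero because definiteness makes them
      independent.\<close>
    have "D \<noteq> 0"
    proof
      assume D: "D = 0"
      have "b2 *\<^sub>R pd 1 y z + (- b1) *\<^sub>R pd 2 y z = D *\<^sub>R e1"
          "a2 *\<^sub>R pd 1 y z + (- a1) *\<^sub>R pd 2 y z = - D *\<^sub>R e2"
        unfolding y D_def by (simp_all add: algebra_simps)
      then have "b2 *\<^sub>R pd 1 y z + (- b1) *\<^sub>R pd 2 y z = 0"
          "a2 *\<^sub>R pd 1 y z + (- a1) *\<^sub>R pd 2 y z = 0"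
        using D by simp_all
      then have "b1 = 0" "a1 = 0"
        using spacelike[OF zS, of b2 "- b1"] spacelike[OF zS, of a2 "- a1"] by (auto simp: mink_def)
      then show False using gE_pos[OF zS] by (simp add: gE_def y mink_def)
    qed
    moreover have "D *\<^sub>R v = (s * b2 - t * a2) *\<^sub>R pd 1 y z + (t * a1 - s * b1) *\<^sub>R pd 2 y z"
      unfolding y D_def by (simp add: algebra_simps)
    ultimately
        have "v = (1 / D) *\<^sub>R ((s * b2 - t * a2) *\<^sub>R pd 1 y z + (t * a1 - s * b1) *\<^sub>R pd 2 y z)"
      by (metis scaleR_one scaleR_scaleR nonzero_eq_divide_eq mult.commute)
    then obtain l m where lm: "v = l *\<^sub>R pd 1 y z + m *\<^sub>R pd 2 y z" by (simp add: scaleR_add_right)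
    have "mink v (pd 1 y z) = l * gE z + m * gF z" "mink v (pd 2 y z) = l * gF z + m * gG z"
      unfolding lm
        by (simp_all add: mink_linear mink_commute[of "pd 2 y z" "pd 1 y z"] gE_def gF_def gG_def)
    then have "\<Gamma>1 i j z = l" "\<Gamma>2 i j z = m"
      using det_pos[OF zS] unfolding \<Gamma>1_def \<Gamma>2_def v_def[symmetric] by (simp_all add: field_simps)
    then show ?thesis using lm by (simp add: v_def)
  qed
  have der: "pd k (pd i (pd j y)) z0 = pd k (\<Gamma>1 i j) z0 *\<^sub>R pd 1 y z0 + \<Gamma>1 i j z0 *\<^sub>R pd k (pd 1 y)
      z0
    + (pd k (\<Gamma>2 i j) z0 *\<^sub>R pd 2 y z0 + \<Gamma>2 i j z0 *\<^sub>R pd k (pd 2 y) z0)" for i j k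
  proof -
    have "pd k (pd i (pd j y)) z0 = pd k (\<lambda>z. \<Gamma>1 i j z *\<^sub>R pd 1 y z + \<Gamma>2 i j z *\<^sub>R pd 2 y z) z0"
      by (rule pd_cong[OF N(1) z0 tang])
    also have "\<dots> = pd k (\<lambda>z. \<Gamma>1 i j z *\<^sub>R pd 1 y z) z0 + pd k (\<lambda>z. \<Gamma>2 i j z *\<^sub>R pd 2 y z) z0"
      by (intro pd_add differentiable_bilinear[OF bounded_bilinear_scaleR] dif z0)
    finally show ?thesis by (simp add: bs dif z0 add.commute)
  qed
  have z0S: "z0 \<in> S" using z0 N by blast
  \<comment> \<open>The two components of \<open>R(\<partial>1, \<partial>2) \<partial>2\<close>.
    They appear as the coefficients of the tangent vectors in the difference of two third
    derivatives of \<open>y\<close>, which is zero.\<close>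
  let ?R1 = "pd 1 (\<Gamma>1 2 2) z0 - pd 2 (\<Gamma>1 1 2) z0 + (\<Gamma>1 1 1 z0 * \<Gamma>1 2 2 z0 - \<Gamma>1 2 1 z0 * \<Gamma>1 1 2 z0
     + (\<Gamma>1 1 2 z0 * \<Gamma>2 2 2 z0 - \<Gamma>1 2 2 z0 * \<Gamma>2 1 2 z0))"
  let ?R2 = "pd 1 (\<Gamma>2 2 2) z0 - pd 2 (\<Gamma>2 1 2) z0 + (\<Gamma>2 1 1 z0 * \<Gamma>1 2 2 z0 - \<Gamma>2 2 1 z0 * \<Gamma>1 1 2 z0
     + (\<Gamma>2 1 2 z0 * \<Gamma>2 2 2 z0 - \<Gamma>2 2 2 z0 * \<Gamma>2 1 2 z0))"
  have "0 = pd 1 (pd 2 (pd 2 y)) z0 - pd 2 (pd 1 (pd 2 y)) z0"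
    using pd_commute[OF open_S smooth_pd z0S, of 1 2 2] by simp
  also have "\<dots> = ?R1 *\<^sub>R pd 1 y z0 + ?R2 *\<^sub>R pd 2 y z0"
    unfolding der unfolding tang[OF z0] by (simp add: algebra_simps)
  finally have "mink (?R1 *\<^sub>R pd 1 y z0 + ?R2 *\<^sub>R pd 2 y z0) v = 0" for v
    by (metis mink_scaleR_left scaleR_zero_left mult_zero_left)
  then have R: "?R1 = 0" "?R2 = 0" using tangent_eq_0[OF z0S] by blast+
  have ch: "pd k (christoffel (induced_metric y) 1 i j) z0 = pd k (\<Gamma>1 i j) z0"
    "pd k (christoffel (induced_metric y) 2 i j) z0 = pd k (\<Gamma>2 i j) z0" for i j k
    by (rule pd_cong[OF open_S z0S]; rule christoffel_eq; assumption)+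
  have "riemann (induced_metric y) 1 2 1 2 z0 = ?R1" "riemann (induced_metric y) 2 2 1 2 z0 = ?R2"
    unfolding riemann_def sum_2 ch christoffel_eq[OF z0S] by simp_all
  then show ?thesis using R by (simp add: gauss_curvature_def sum_2)
qed

end


section \<open>Biaffine polynomials\<close>

lemma norm_poly_le:
  fixes P :: "complex poly"
  assumes "degree P \<le> n"
  obtains C where "C \<ge> 0" "\<And>u. norm (poly P u) \<le> C * (1 + norm u) ^ n"
proof (rule that[of "\<Sum>i\<le>degree P. norm (coeff P i)"])
  show "(\<Sum>i\<le>degree P. norm (coeff P i)) \<ge> 0" by (intro sum_nonneg) simp
  fix u
  have "norm (poly P u) \<le> (\<Sum>i\<le>degree P. norm (coeff P i * u ^ i))"
    unfolding poly_altdef by (rule norm_sum)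
  also have "\<dots> \<le> (\<Sum>i\<le>degree P. norm (coeff P i) * (1 + norm u) ^ n)"
  proof (rule sum_mono)
    fix i assume "i \<in> {..degree P}"
    then have "norm u ^ i \<le> (1 + norm u) ^ i" "(1 + norm u) ^ i \<le> (1 + norm u) ^ n"
      using assms by (auto intro!: power_mono power_increasing)
    then show "norm (coeff P i * u ^ i) \<le> norm (coeff P i) * (1 + norm u) ^ n"
      by (simp add: norm_mult norm_power mult_left_mono)
  qed
  finally show "norm (poly P u) \<le> (\<Sum>i\<le>degree P. norm (coeff P i)) * (1 + norm u) ^ n"
    by (simp add: sum_distrib_right)
qed

lemma norm_poly_diff_le:
  fixes P :: "complex poly"
  assumes "degree P \<le> n"
  obtains C
      where "C \<ge> 0" "\<And>u. norm (poly P u - poly P e) \<le> C * norm (u - e) * (1 + norm u) ^ (n - 1)"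
proof -
  have "poly (P - [:poly P e:]) e = 0" by simp
  then obtain Q where Q: "P - [:poly P e:] = [:-e, 1:] * Q" using poly_eq_0_iff_dvd by (metis dvdE)
  have deg: "degree Q \<le> n - 1"
  proof (cases "Q = 0")
    case False
    then have "degree ([:-e, 1:] * Q) = Suc (degree Q)"
      by (subst degree_mult_eq) auto
    moreover have "degree (P - [:poly P e:]) \<le> n" using assms by (intro degree_diff_le) auto
    ultimately show ?thesis using Q by simp
  qed simp
  obtain C where C: "C \<ge> 0" "\<And>u. norm (poly Q u) \<le> C * (1 + norm u) ^ (n - 1)"
    using norm_poly_le[OF deg] by blast
  show ?thesis
  proof (rule that[OF C(1)])
    fix u
    have "poly P u - poly P e = poly (P - [:poly P e:]) u" by simp
    also have "\<dots> = (u - e) * poly Q u" unfolding Q by (simp add: algebra_simps)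
    finally have "norm (poly P u - poly P e) = norm (u - e) * norm (poly Q u)"
      by (simp add: norm_mult)
    also have "\<dots> \<le> norm (u - e) * (C * (1 + norm u) ^ (n - 1))" by (intro mult_left_mono C) simp
    finally show "norm (poly P u - poly P e) \<le> C * norm (u - e) * (1 + norm u) ^ (n - 1)"
      by (simp add: mult_ac)
  qed
qed

text \<open>For \<open>d > 0\<close> the multiplication by \<open>u\<close> makes up for the lower
  degree of \<open>P\<close>. For \<open>d = 0\<close> the truncated \<open>d - 1\<close> would
  still admit a nonzero constant, hence the separate condition.\<close>

lemma biaffine_poly_growth:
  fixes P Q :: "complex poly"
  assumes P: "degree P \<le> d - 1" "d = 0 \<Longrightarrow> P = 0" and Q: "degree Q \<le> d"
  defines "\<phi> \<equiv> \<lambda>u. u * cnj (poly P u) + cnj (poly Q u)"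
  obtains C where "C \<ge> 0" "\<And>u. norm (\<phi> u) \<le> C * (1 + norm u) ^ d"
proof -
  obtain C1 where C1: "C1 \<ge> 0" "\<And>u. norm (poly P u) \<le> C1 * (1 + norm u) ^ (d - 1)"
    using norm_poly_le[OF P(1)] by blast
  obtain C2 where C2: "C2 \<ge> 0" "\<And>u. norm (poly Q u) \<le> C2 * (1 + norm u) ^ d"
    using norm_poly_le[OF Q] by blast
  show ?thesis
  proof (rule that[of "C1 + C2"])
    show "C1 + C2 \<ge> 0" using C1 C2 by simp
    fix u
    have "norm (u * cnj (poly P u)) \<le> C1 * (1 + norm u) ^ d"
    proof (cases d)
      case 0 then show ?thesis using P(2) C1 by simp
    next
      case (Suc d')
      have "norm (u * cnj (poly P u)) \<le> (1 + norm u) * (C1 * (1 + norm u) ^ (d - 1))"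
        unfolding norm_mult complex_mod_cnj by (intro mult_mono C1) auto
      then show ?thesis using Suc by (simp add: mult_ac)
    qed
    then show "norm (\<phi> u) \<le> (C1 + C2) * (1 + norm u) ^ d"
      unfolding \<phi>_def using C2(2)[of u] norm_triangle_ineq[of "u * cnj (poly P u)" "cnj (poly Q u)"]
      by (simp add: algebra_simps)
  qed
qed

text \<open>Involving both \<open>u\<close> and its conjugate, the function need not be divisible by
  \<open>u - e\<close>. Still, subtracting its value at \<open>e\<close> splits it into three terms,
  each of which has modulus \<open>norm (u - e)\<close> times a power of
  \<open>1 + norm u\<close>.\<close>

lemma biaffine_poly_zero:
  fixes P Q :: "complex poly"
  assumes P: "degree P \<le> d - 1" "d = 0 \<Longrightarrow> P = 0" and Q: "degree Q \<le> d"
  defines "\<phi> \<equiv> \<lambda>u. u * cnj (poly P u) + cnj (poly Q u)"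
  assumes e: "\<phi> e = 0"
  obtains C where "C \<ge> 0" "\<And>u. norm (\<phi> u) \<le> C * norm (u - e) * (1 + norm u) ^ (d - 1)"
proof -
  obtain C1 where C1: "C1 \<ge> 0" "\<And>u. norm (poly P u) \<le> C1 * (1 + norm u) ^ (d - 1)"
    using norm_poly_le[OF P(1)] by blast
  obtain C2
      where C2: "C2 \<ge> 0"
          "\<And>u. norm (poly P u - poly P e) \<le> C2 * norm (u - e) * (1 + norm u) ^ (d - 1 - 1)"
    using norm_poly_diff_le[OF P(1)] by blast
  obtain C3
      where C3: "C3 \<ge> 0"
          "\<And>u. norm (poly Q u - poly Q e) \<le> C3 * norm (u - e) * (1 + norm u) ^ (d - 1)"
    using norm_poly_diff_le[OF Q] by blast
  show ?thesis
  proof (rule that[of "C1 + norm e * C2 + C3"])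
    show "C1 + norm e * C2 + C3 \<ge> 0" using C1 C2 C3 by simp
    fix u
    define X where "X = norm (u - e) * (1 + norm u) ^ (d - 1)"
    have "\<phi> u = \<phi> u - \<phi> e" using e by simp
    also have "\<dots> = (u - e) * cnj (poly P u) + e * cnj (poly P u - poly P e) + cnj
        (poly Q u - poly Q e)"
      by (simp add: \<phi>_def algebra_simps)
    finally
        have "norm (\<phi> u) = norm ((u - e) * cnj (poly P u) + e * cnj (poly P u - poly P e) + cnj
            (poly Q u - poly Q e))"
      by (rule arg_cong)
    also have "\<dots> \<le> norm ((u - e) * cnj (poly P u)) + norm (e * cnj (poly P u - poly P e)) + norm
        (cnj (poly Q u - poly Q e))"
      by (rule norm_triangle_le, rule add_right_mono, rule norm_triangle_ineq)
    also have "norm ((u - e) * cnj (poly P u)) \<le> C1 * X"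
      using mult_left_mono[OF C1(2)[of u], of "norm (u - e)"] by (simp add: norm_mult X_def mult_ac)
    also have "norm (e * cnj (poly P u - poly P e)) \<le> norm e * (C2 * X)"
    proof -
      have "norm (poly P u - poly P e) \<le> C2 * norm (u - e) * (1 + norm u) ^ (d - 1 - 1)"
        by (rule C2)
      also have "\<dots> \<le> C2 * norm (u - e) * (1 + norm u) ^ (d - 1)"
        using C2(1) by (intro mult_left_mono power_increasing) auto
      finally have "norm (poly P u - poly P e) \<le> C2 * X" by (simp add: X_def mult_ac)
      then show ?thesis unfolding norm_mult complex_mod_cnj by (intro mult_left_mono) auto
    qed
    also have "norm (cnj (poly Q u - poly Q e)) \<le> C3 * X"
      using C3(2)[of u] unfolding complex_mod_cnj by (simp add: X_def mult_ac)
    finally show "norm (\<phi> u) \<le> (C1 + norm e * C2 + C3) * norm (u - e) * (1 + norm u) ^ (d - 1)"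
      by (simp add: X_def algebra_simps)
  qed
qed

text \<open>The zeros cannot be divided out together, so they are treated one at a time: at each
  \<open>u\<close> the estimate for a single zero, the one supplied by
  \<open>prod_dist_lower_bound\<close>, suffices, as the other factors of the product behave like
  \<open>1 + norm u\<close>. The sum of the constants serves all zeros.\<close>

lemma biaffine_poly_bound:
  fixes P Q :: "complex poly"
  assumes P: "degree P \<le> d - 1" "d = 0 \<Longrightarrow> P = 0" and Q: "degree Q \<le> d"
  defines "\<phi> \<equiv> \<lambda>u. u * cnj (poly P u) + cnj (poly Q u)"
  assumes T: "finite T" "\<And>e. e \<in> T \<Longrightarrow> \<phi> e = 0" and k: "d \<le> k + card T"
  obtains C where "C > 0" "\<And>u. norm (\<phi> u) \<le> C * (\<Prod>e\<in>T. norm (u - e)) * (1 + norm u) ^ k"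
proof (cases "T = {}")
  case True
  obtain C where C: "C \<ge> 0" "\<And>u. norm (\<phi> u) \<le> C * (1 + norm u) ^ d"
    using biaffine_poly_growth[OF P Q] unfolding \<phi>_def by blast
  show ?thesis
  proof (rule that[of "C + 1"])
    fix u
    have "norm (\<phi> u) \<le> C * (1 + norm u) ^ d" by (rule C)
    also have "\<dots> \<le> (C + 1) * (1 + norm u) ^ k"
      using C(1) k True by (intro mult_mono power_increasing) auto
    finally show "norm (\<phi> u) \<le> (C + 1) * (\<Prod>e\<in>T. norm (u - e)) * (1 + norm u) ^ k" using True by simp
  qed (use C in simp)
next
  case False
  have "\<exists>C\<ge>0. \<forall>u. norm (\<phi> u) \<le> C * norm (u - e) * (1 + norm u) ^ (d - 1)" if "e \<in> T" for e
    using biaffine_poly_zero[OF P Q, of e] T(2)[OF that] unfolding \<phi>_def by metis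
  then obtain Ce
      where Ce: "\<And>e. e \<in> T \<Longrightarrow> Ce e \<ge> 0"
          "\<And>e u. e \<in> T \<Longrightarrow> norm (\<phi> u) \<le> Ce e * norm (u - e) * (1 + norm u) ^ (d - 1)"
    by metis
  define C where "C = sum Ce T"
  have CeC: "Ce e \<le> C" if "e \<in> T" for e unfolding C_def using that Ce(1) T(1)
    by (intro member_le_sum) auto
  have C0: "C \<ge> 0" unfolding C_def using Ce(1) by (intro sum_nonneg)
  obtain c :: real
      where c: "c > 0" "\<And>u :: complex. \<exists>e\<in>T. c * norm (u - e) * (1 + norm u) ^ (card T - 1)
          \<le> (\<Prod>e\<in>T. norm (u - e))"
    using prod_dist_lower_bound[OF T(1) False] by blast
  have cT: "card T \<ge> 1" using T(1) False by (simp add: Suc_leI card_gt_0_iff)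
  show ?thesis
  proof (rule that[of "C / c + 1"])
    show "C / c + 1 > 0" using C0 c(1) by (simp add: add_nonneg_pos)
    fix u :: complex
    define X where "X = 1 + norm u"
    have X: "X \<ge> 1" by (simp add: X_def)
    obtain e :: complex
        where e: "e \<in> T" "c * norm (u - e) * X ^ (card T - 1) \<le> (\<Prod>e\<in>T. norm (u - e))" using c(2)
          unfolding X_def by blast
    have "norm (\<phi> u) \<le> Ce e * (norm (u - e) * X ^ (d - 1))" using Ce(2)[OF e(1)]
      by (simp add: X_def mult_ac)
    also have "\<dots> \<le> C * (norm (u - e) * X ^ (d - 1))" using CeC[OF e(1)] X
      by (intro mult_right_mono) auto
    also have "\<dots> \<le> C * (norm (u - e) * X ^ ((card T - 1) + k))"
      using C0 X k cT by (intro mult_left_mono power_increasing) auto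
    also have "\<dots> = C / c * (c * norm (u - e) * X ^ (card T - 1)) * X ^ k" using c(1)
      by (simp add: power_add)
    also have "\<dots> \<le> C / c * (\<Prod>e\<in>T. norm (u - e)) * X ^ k"
      using C0 c(1) X by (intro mult_right_mono mult_left_mono e) auto
    also have "\<dots> \<le> (C / c + 1) * (\<Prod>e\<in>T. norm (u - e)) * X ^ k"
      using X by (intro mult_right_mono prod_nonneg) auto
    finally show "norm (\<phi> u) \<le> (C / c + 1) * (\<Prod>e\<in>T. norm (u - e)) * (1 + norm u) ^ k"
      by (simp add: X_def)
  qed
qed

text \<open>Homogenisation of \<open>P\<close> in degree \<open>m\<close>, possibly above its own
  degree, so that numerator and denominator of a rational map are treated alike.\<close>

definition homog :: "nat \<Rightarrow> complex poly \<Rightarrow> complex \<Rightarrow> complex \<Rightarrow> complex" where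
  "homog m P a b = (\<Sum>i\<le>m. coeff P i * a ^ i * b ^ (m - i))"

lemma homog_scale: "homog m P (t * a) (t * b) = t ^ m * homog m P a b"
proof -
  have "coeff P i * (t * a) ^ i * (t * b) ^ (m - i) = t ^ m * (coeff P i * a ^ i * b ^ (m - i))"
      if "i \<le> m" for i
  proof -
    have "t ^ m = t ^ i * t ^ (m - i)" using that by (simp flip: power_add)
    then show ?thesis by (simp add: power_mult_distrib mult_ac)
  qed
  then show ?thesis unfolding homog_def sum_distrib_left by (intro sum.cong) auto
qed

lemma homog_1_right: "degree P \<le> m \<Longrightarrow> homog m P a 1 = poly P a"
  unfolding homog_def poly_altdef
  by (simp, rule sum.mono_neutral_right) (auto simp: coeff_eq_0)

lemma homog_1_0: "homog m P 1 0 = coeff P m"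
proof -
  have "homog m P 1 0 = (\<Sum>i\<in>{m}. coeff P i * 1 ^ i * 0 ^ (m - i))"
    unfolding homog_def by (rule sum.mono_neutral_right) auto
  then show ?thesis by simp
qed

text \<open>Substitution of the Moebius map
  \<open>u \<mapsto> (\<alpha>u + \<gamma>) / (\<beta>u + \<delta>)\<close> into \<open>P\<close>,
  with denominators cleared in degree \<open>m\<close>.\<close>

definition homog_line :: "nat \<Rightarrow> complex poly \<Rightarrow> complex \<Rightarrow> complex \<Rightarrow> complex \<Rightarrow> complex \<Rightarrow> complex poly"
    where
  "homog_line m P \<alpha> \<beta> \<gamma> \<delta> = (\<Sum>i\<le>m. smult (coeff P i) ([:\<gamma>, \<alpha>:] ^ i * [:\<delta>, \<beta>:] ^ (m - i)))"

lemma poly_homog_line: "poly (homog_line m P \<alpha> \<beta> \<gamma> \<delta>) u = homog m P (\<alpha> * u + \<gamma>) (\<beta> * u + \<delta>)"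
  by (simp add: homog_line_def homog_def poly_sum mult_ac add_ac)

lemma degree_affine_power: "degree ([:c, a:] ^ i :: complex poly) \<le> i"
  by (rule order_trans[OF degree_power_le]) simp

lemma coeff_mult_top:
  fixes P Q :: "complex poly"
  assumes "degree P \<le> i" "degree Q \<le> j"
  shows "coeff (P * Q) (i + j) = coeff P i * coeff Q j"
proof -
  have "coeff (P * Q) (i + j) = (\<Sum>k\<in>{i}. coeff P k * coeff Q (i + j - k))"
    unfolding coeff_mult
  proof (rule sum.mono_neutral_right)
    show "\<forall>k\<in>{..i + j} - {i}. coeff P k * coeff Q (i + j - k) = 0"
    proof
      fix k assume "k \<in> {..i + j} - {i}"
      then have "k > i \<or> i + j - k > j" by auto
      then show "coeff P k * coeff Q (i + j - k) = 0" using assms by (auto intro!: coeff_eq_0)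
    qed
  qed auto
  then show ?thesis by simp
qed

lemma coeff_affine_power: "coeff ([:c, a:] ^ i :: complex poly) i = a ^ i"
proof (induction i)
  case (Suc i)
  have "coeff ([:c, a:] * [:c, a:] ^ i) (1 + i) = coeff [:c, a:] 1 * coeff ([:c, a:] ^ i) i"
    by (rule coeff_mult_top) (auto simp: degree_affine_power)
  then show ?case using Suc by simp
qed simp

lemma degree_homog_line: "degree (homog_line m P \<alpha> \<beta> \<gamma> \<delta>) \<le> m"
  unfolding homog_line_def
proof (rule degree_sum_le)
  fix i assume "i \<in> {..m}"
  then show "degree (smult (coeff P i) ([:\<gamma>, \<alpha>:] ^ i * [:\<delta>, \<beta>:] ^ (m - i))) \<le> m"
    using degree_mult_le[of "[:\<gamma>, \<alpha>:] ^ i" "[:\<delta>, \<beta>:] ^ (m - i)"] degree_affine_power[of \<gamma> \<alpha> i]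
      degree_affine_power[of \<delta> \<beta> "m - i"]
          degree_smult_le[of "coeff P i" "[:\<gamma>, \<alpha>:] ^ i * [:\<delta>, \<beta>:] ^ (m - i)"] by simp
qed simp

text \<open>The coefficient of degree \<open>m\<close> is the value at
  \<open>u = \<infinity>\<close>, the parameter of the point \<open>[\<alpha> : \<beta>]\<close>. It
  is how \<open>cf_bound\<close> sees a coincidence at the value sent to infinity.\<close>

lemma coeff_homog_line: "coeff (homog_line m P \<alpha> \<beta> \<gamma> \<delta>) m = homog m P \<alpha> \<beta>"
proof -
  have "coeff ([:\<gamma>, \<alpha>:] ^ i * [:\<delta>, \<beta>:] ^ (m - i)) m = \<alpha> ^ i * \<beta> ^ (m - i)" if "i \<le> m" for i
    using coeff_mult_top[OF degree_affine_power degree_affine_power, of \<gamma> \<alpha> i \<delta> \<beta> "m - i"] that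
    by (simp add: coeff_affine_power)
  then show ?thesis unfolding homog_line_def homog_def coeff_sum by (intro sum.cong) auto
qed


section \<open>Weierstrass data for a rational Gauss map\<close>

text \<open>Homogeneous coordinates \<open>[lift1 v : lift2 v]\<close>, which treat infinity like
  every other point.\<close>

definition lift1 :: "ext_complex \<Rightarrow> complex" where
  "lift1 v = (case v of Some w \<Rightarrow> w | None \<Rightarrow> 1)"

definition lift2 :: "ext_complex \<Rightarrow> complex" where
  "lift2 v = (case v of Some w \<Rightarrow> 1 | None \<Rightarrow> 0)"

lemma lift_simps [simp]: "lift1 (Some w) = w" "lift1 None = 1" "lift2 (Some w) = 1" "lift2 None = 0"
  by (simp_all add: lift1_def lift2_def)

lemma lift_eq_iff: "lift1 v * lift2 w = lift1 w * lift2 v \<longleftrightarrow> v = w"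
  by (cases v; cases w) auto

lemma lift_cnj_eq_iff: "lift1 v * cnj (lift2 w) = lift2 v * cnj (lift1 w) \<longleftrightarrow> w = ext_cnj v"
  by (cases v; cases w) (auto simp: ext_cnj_def complex_cnj_cancel_iff)

text \<open>\<open>Psi_inv\<close> in homogeneous coordinates \<open>[a : b]\<close> and
  \<open>[c : d]\<close> of its two arguments, covering the four cases of its definition at
  once.\<close>

definition null_vec :: "complex \<Rightarrow> complex \<Rightarrow> complex \<Rightarrow> complex \<Rightarrow> complex ^ 4" where
  "null_vec a b c d = vector [a * d + b * c, - \<i> * (a * d - b * c), b * d - a * c, b * d + a * c]"

lemma null_vec_nth [simp]:
  "null_vec a b c d $ 1 = a * d + b * c" "null_vec a b c d $ 2 = - \<i> * (a * d - b * c)"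
  "null_vec a b c d $ 3 = b * d - a * c" "null_vec a b c d $ 4 = b * d + a * c"
  unfolding null_vec_def vector_4 by simp_all

lemma null_vec_scale: "null_vec (s * a) (s * b) (t * c) (t * d) = (s * t) *s null_vec a b c d"
  by (simp add: vec_eq_iff forall_4 algebra_simps)

text \<open>The Hermitian square of the null vector vanishes exactly when \<open>[c : d]\<close> is
  the conjugate of \<open>[a : b]\<close>. This one identity yields both the metric and the
  exclusion of the coincidence set.\<close>

lemma null_vec_hermitian:
  "norm (null_vec a b c d $ 1) ^ 2 + norm (null_vec a b c d $ 2) ^ 2 + norm (null_vec a b c d $ 3) ^
      2
    - norm (null_vec a b c d $ 4) ^ 2 = 2 * norm (a * cnj d - b * cnj c) ^ 2"
  unfolding null_vec_nth cmod_power2 by (simp add: power2_eq_square algebra_simps)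

lemma Psi_inv_lift: "Psi_inv (v, w) = cproj (null_vec (lift1 v) (lift2 v) (lift1 w) (lift2 w))"
  by (cases v; cases w) (simp_all add: null_vec_def)

text \<open>The homogenised pair represents the value of the map because its entries never vanish
  together: by coprimality at finite points, and at infinity because \<open>m\<close> is the degree
  of \<open>p\<close> or of \<open>q\<close>.\<close>

lemma rational_map_lift:
  assumes "q \<noteq> 0" "coprime p q" "m = max (degree p) (degree q)"
  obtains t where "t \<noteq> 0" "homog m p (lift1 v) (lift2 v) = t * lift1 (rational_map p q v)"
    "homog m q (lift1 v) (lift2 v) = t * lift2 (rational_map p q v)"
proof (cases v)
  case (Some w)
  have h: "homog m p (lift1 v) (lift2 v) = poly p w" "homog m q (lift1 v) (lift2 v) = poly q w"
    using assms(3) by (simp_all add: Some homog_1_right)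
  have nz: "poly q w \<noteq> 0 \<or> poly p w \<noteq> 0"
    using coprime_poly_0[OF assms(2), of w] by blast
  show ?thesis
  proof (cases "poly q w = 0")
    case True
    then show ?thesis using h nz by (intro that[of "poly p w"]) (auto simp: rational_map_def Some)
  next
    case False
    then show ?thesis using h by (intro that[of "poly q w"]) (auto simp: rational_map_def Some)
  qed
next
  case None
  have h: "homog m p (lift1 v) (lift2 v) = coeff p m" "homog m q (lift1 v) (lift2 v) = coeff q m"
    by (simp_all add: None homog_1_0)
  have nz: "coeff q m \<noteq> 0 \<or> coeff p m \<noteq> 0"
  proof (cases "degree q \<ge> degree p")
    case True then show ?thesis using assms(1,3) by (simp add: max_def)
  next
    case False
    then have "m = degree p" "p \<noteq> 0" using assms(3) by (auto simp: max_def)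
    then show ?thesis by simp
  qed
  show ?thesis
  proof (cases "coeff q m = 0")
    case True
    then show ?thesis using h nz assms(3)
      by (intro that[of "coeff p m"]) (auto simp: rational_map_def None Let_def)
  next
    case False
    then show ?thesis using h assms(3)
      by (intro that[of "coeff q m"]) (auto simp: rational_map_def None Let_def)
  qed
qed

context stationary_surface
begin

lemma gauss_map_spec:
  assumes c: "oriented_isothermal_chart M A x (U, \<xi>)" and a: "a \<in> U"
  obtains s where "s \<noteq> 0" "wirtinger (x \<circ> inv_into U \<xi>) (\<xi> a)
    = s *s null_vec (lift1 (psi1 M A x a)) (lift2 (psi1 M A x a)) (lift1 (psi2 M A x a))
        (lift2 (psi2 M A x a))"
proof -
  let ?Y = "wirtinger (x \<circ> inv_into U \<xi>) (\<xi> a)"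
  have z: "\<xi> a \<in> \<xi> ` U" using a by blast
  have "cproj ?Y \<in> Q11" using wirtinger_isothermal(1,3)[OF c z] by (auto simp: Q11_def)
  then have "cproj ?Y \<in> range Psi_inv" using bij_betw_Psi_inv by (auto simp: bij_betw_def)
  then have "Psi_inv (gauss_map M A x a) = cproj ?Y"
    unfolding gauss_map_def gauss_point_eq[OF c a] Psi_def by (rule f_inv_into_f)
  moreover have "gauss_map M A x a = (psi1 M A x a, psi2 M A x a)" by (simp add: psi1_def psi2_def)
  ultimately
      have "cproj ?Y = cproj (null_vec (lift1 (psi1 M A x a)) (lift2 (psi1 M A x a))
          (lift1 (psi2 M A x a)) (lift2 (psi2 M A x a)))"
    using Psi_inv_lift by metis
  then show ?thesis using that unfolding cproj_eq_iff by blast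
qed

text \<open>Equality would annihilate the Hermitian square of \<open>x_z\<close> and with it the
  metric.\<close>

lemma psi2_neq_cnj_psi1:
  assumes a: "a \<in> topspace M"
  shows "psi2 M A x a \<noteq> ext_cnj (psi1 M A x a)"
proof
  assume eq: "psi2 M A x a = ext_cnj (psi1 M A x a)"
  obtain U \<xi> where c: "(U, \<xi>) \<in> conformal_atlas" "a \<in> U" using cover[OF a] by blast
  note iso = conformal_atlas_isothermal[OF c(1)]
  have z: "\<xi> a \<in> \<xi> ` U" using c by blast
  let ?n
      = "null_vec (lift1 (psi1 M A x a)) (lift2 (psi1 M A x a)) (lift1 (psi2 M A x a))
          (lift2 (psi2 M A x a))"
  obtain s where s: "wirtinger (x \<circ> inv_into U \<xi>) (\<xi> a) = s *s ?n"
    using gauss_map_spec[OF iso c(2)] by blast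
  have "lift1 (psi1 M A x a) * cnj (lift2 (psi2 M A x a)) = lift2 (psi1 M A x a) * cnj
      (lift1 (psi2 M A x a))"
    using eq by (simp add: lift_cnj_eq_iff)
  then have "norm (?n $ 1) ^ 2 + norm (?n $ 2) ^ 2 + norm (?n $ 3) ^ 2 - norm (?n $ 4) ^ 2 = 0"
    unfolding null_vec_hermitian by simp
  then have "norm s ^ 2 * (norm (?n $ 1) ^ 2 + norm (?n $ 2) ^ 2 + norm (?n $ 3) ^ 2 - norm (?n $ 4)
      ^ 2) = 0"
    by simp
  then have "mink (pd 1 (x \<circ> inv_into U \<xi>) (\<xi> a)) (pd 1 (x \<circ> inv_into U \<xi>) (\<xi> a)) = 0"
    unfolding wirtinger_isothermal(2)[OF iso z] s
    by (simp add: norm_mult power_mult_distrib algebra_simps del: null_vec_nth)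
  then show False using isothermalD(4)[OF iso z] by simp
qed

end

section \<open>Weierstrass data after moving an omitted value to infinity\<close>

locale rational_gauss_surface = stationary_surface +
  fixes p q :: "complex poly" and m :: nat and s0 :: ext_complex
  assumes q_nonzero: "q \<noteq> 0" and coprime_pq: "coprime p q" and m_eq: "m = max (degree p) (degree q)"
    and psi2_eq: "\<And>a. a \<in> topspace M \<Longrightarrow> psi2 M A x a = rational_map p q (psi1 M A x a)"
    and psi1_omits: "\<And>a. a \<in> topspace M \<Longrightarrow> psi1 M A x a \<noteq> s0"
begin

text \<open>\<open>(\<gamma>, \<delta>)\<close> completes the coordinates
  \<open>(\<alpha>, \<beta>)\<close> of \<open>s0\<close> to a basis. The resulting map
  \<open>mob\<close> is \<open>v \<mapsto> v\<close> if \<open>s0\<close> is infinite and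
  \<open>v \<mapsto> 1 / (v - s0)\<close> if it is finite.\<close>

definition "\<alpha> = lift1 s0"
definition "\<beta> = lift2 s0"
definition "\<gamma> = (if s0 = None then 0 else 1 :: complex)"
definition "\<delta> = (if s0 = None then 1 else 0 :: complex)"

text \<open>The Moebius map that takes the omitted value \<open>s0\<close> to infinity; its inverse is
  \<open>u \<mapsto> [\<alpha>u + \<gamma> : \<beta>u + \<delta>]\<close>.\<close>

definition mob :: "ext_complex \<Rightarrow> complex" where
  "mob v = (\<delta> * lift1 v - \<gamma> * lift2 v) / (\<alpha> * lift2 v - \<beta> * lift1 v)"

lemma mob_det: "\<alpha> * \<delta> - \<beta> * \<gamma> \<noteq> 0"
  unfolding \<alpha>_def \<beta>_def \<gamma>_def \<delta>_def by (cases s0) auto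

lemma mob_denominator: "v \<noteq> s0 \<Longrightarrow> \<alpha> * lift2 v - \<beta> * lift1 v \<noteq> 0"
  using lift_eq_iff[of s0 v] by (auto simp: \<alpha>_def \<beta>_def mult.commute)

lemma mob_lift:
  assumes "v \<noteq> s0"
  shows "(\<alpha> * lift2 v - \<beta> * lift1 v) * (\<alpha> * mob v + \<gamma>) = (\<alpha> * \<delta> - \<beta> * \<gamma>) * lift1 v"
    "(\<alpha> * lift2 v - \<beta> * lift1 v) * (\<beta> * mob v + \<delta>) = (\<alpha> * \<delta> - \<beta> * \<gamma>) * lift2 v"
proof -
  have "(\<alpha> * lift2 v - \<beta> * lift1 v) * mob v = \<delta> * lift1 v - \<gamma> * lift2 v"
    using mob_denominator[OF assms] by (simp add: mob_def)
  then show "(\<alpha> * lift2 v - \<beta> * lift1 v) * (\<alpha> * mob v + \<gamma>) = (\<alpha> * \<delta> - \<beta> * \<gamma>) * lift1 v"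
    "(\<alpha> * lift2 v - \<beta> * lift1 v) * (\<beta> * mob v + \<delta>) = (\<alpha> * \<delta> - \<beta> * \<gamma>) * lift2 v"
    by algebra+
qed

lemma mob_lift':
  assumes "v \<noteq> s0"
  obtains t where "t \<noteq> 0" "lift1 v = t * (\<alpha> * mob v + \<gamma>)" "lift2 v = t * (\<beta> * mob v + \<delta>)"
proof (rule that[of "(\<alpha> * lift2 v - \<beta> * lift1 v) / (\<alpha> * \<delta> - \<beta> * \<gamma>)"])
  show "(\<alpha> * lift2 v - \<beta> * lift1 v) / (\<alpha> * \<delta> - \<beta> * \<gamma>) \<noteq> 0"
    using mob_denominator[OF assms] mob_det by simp
  show "lift1 v = (\<alpha> * lift2 v - \<beta> * lift1 v) / (\<alpha> * \<delta> - \<beta> * \<gamma>) * (\<alpha> * mob v + \<gamma>)"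
    "lift2 v = (\<alpha> * lift2 v - \<beta> * lift1 v) / (\<alpha> * \<delta> - \<beta> * \<gamma>) * (\<beta> * mob v + \<delta>)"
    unfolding times_divide_eq_left mob_lift[OF assms] using mob_det by simp_all
qed

lemma mob_inj:
  assumes "v \<noteq> s0" "w \<noteq> s0" "mob v = mob w"
  shows "v = w"
proof -
  obtain s where s: "lift1 v = s * (\<alpha> * mob v + \<gamma>)" "lift2 v = s * (\<beta> * mob v + \<delta>)"
    using mob_lift'[OF assms(1)] by blast
  obtain t where t: "lift1 w = t * (\<alpha> * mob w + \<gamma>)" "lift2 w = t * (\<beta> * mob w + \<delta>)"
    using mob_lift'[OF assms(2)] by blast
  have "lift1 v * lift2 w = lift1 w * lift2 v" unfolding s t assms(3) by (simp add: mult_ac)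
  then show ?thesis by (simp add: lift_eq_iff)
qed

definition "P = homog_line m p \<alpha> \<beta> \<gamma> \<delta>"
definition "Q = homog_line m q \<alpha> \<beta> \<gamma> \<delta>"

text \<open>In the coordinate \<open>u\<close> the Gauss map is \<open>u \<mapsto> [nv u]\<close>, and \<open>\<langle>nv u, cnj (nv u)\<rangle> = 2 \<bar>cf u\<bar>\<^sup>2\<close>, so that
  \<open>cf\<close> vanishes exactly at the points of \<open>E\<^sub>f\<close>.\<close>

definition nv :: "complex \<Rightarrow> complex ^ 4" where
  "nv u = null_vec (\<alpha> * u + \<gamma>) (\<beta> * u + \<delta>) (poly P u) (poly Q u)"

definition cf :: "complex \<Rightarrow> complex" where
  "cf u = (\<alpha> * u + \<gamma>) * cnj (poly Q u) - (\<beta> * u + \<delta>) * cnj (poly P u)"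

lemma rational_map_mob:
  assumes v: "v \<noteq> s0"
  obtains s t where "s \<noteq> 0" "t \<noteq> 0" "lift1 v = s * (\<alpha> * mob v + \<gamma>)" "lift2 v = s * (\<beta> * mob v + \<delta>)"
    "lift1 (rational_map p q v) = t * poly P (mob v)"
        "lift2 (rational_map p q v) = t * poly Q (mob v)"
proof -
  obtain s where s: "s \<noteq> 0" "lift1 v = s * (\<alpha> * mob v + \<gamma>)" "lift2 v = s * (\<beta> * mob v + \<delta>)"
    using mob_lift'[OF v] by blast
  obtain r where r: "r \<noteq> 0" "homog m p (lift1 v) (lift2 v) = r * lift1 (rational_map p q v)"
    "homog m q (lift1 v) (lift2 v) = r * lift2 (rational_map p q v)"
    using rational_map_lift[OF q_nonzero coprime_pq m_eq] by blast
  have "s ^ m * poly P (mob v) = r * lift1 (rational_map p q v)"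
      "s ^ m * poly Q (mob v) = r * lift2 (rational_map p q v)"
    using r(2,3) unfolding s(2,3) homog_scale by (simp_all add: P_def Q_def poly_homog_line)
  then show ?thesis using that[of s "s ^ m / r"] s r(1) by (simp add: field_simps)
qed

lemma cf_coincidence:
  assumes "v \<noteq> s0" "v \<in> coincidence_set (rational_map p q)"
  shows "cf (mob v) = 0"
proof -
  obtain s t
      where st: "s \<noteq> 0" "t \<noteq> 0" "lift1 v = s * (\<alpha> * mob v + \<gamma>)" "lift2 v = s * (\<beta> * mob v + \<delta>)"
    "lift1 (rational_map p q v) = t * poly P (mob v)"
        "lift2 (rational_map p q v) = t * poly Q (mob v)"
    using rational_map_mob[OF assms(1)] by blast
  have "lift1 v * cnj (lift2 (rational_map p q v)) = lift2 v * cnj (lift1 (rational_map p q v))"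
    using assms(2) by (simp add: lift_cnj_eq_iff coincidence_set_def)
  then have "(s * cnj t) * cf (mob v) = 0" unfolding st(3-6) cf_def by (simp add: algebra_simps)
  then show ?thesis using st(1,2) by simp
qed

text \<open>As a biaffine polynomial \<open>cf\<close> generally has \<open>d = m + 1\<close>. If
  \<open>s0\<close> itself lies in \<open>E\<close>, one zero has gone to infinity and is missing
  from the product; but coincidence at \<open>s0\<close> is the vanishing of the coefficient of
  degree \<open>m\<close> of \<open>F\<close>, which lowers \<open>d\<close> to \<open>m\<close> and
  restores the balance.\<close>

lemma cf_bound:
  assumes E: "finite E" "E \<subseteq> coincidence_set (rational_map p q)" and k: "m + 1 \<le> k + card E"
  obtains C
      where "C > 0" "\<And>u. norm (cf u) \<le> C * (\<Prod>e\<in>mob ` (E - {s0}). norm (u - e)) * (1 + norm u) ^ k"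
proof -
  define F where "F = smult (cnj \<alpha>) Q - smult (cnj \<beta>) P"
  define H where "H = smult (cnj \<gamma>) Q - smult (cnj \<delta>) P"
  have cf: "cf u = u * cnj (poly F u) + cnj (poly H u)" for u
    by (simp add: cf_def F_def H_def algebra_simps)
  have degPQ: "degree P \<le> m" "degree Q \<le> m" by (simp_all add: P_def Q_def degree_homog_line)
  have degF: "degree F \<le> m" and degH: "degree H \<le> m"
    unfolding F_def H_def using degPQ
      by (auto intro!: degree_diff_le order_trans[OF degree_smult_le])
  define d where "d = (if s0 \<in> E then m else m + 1)"
  have F: "degree F \<le> d - 1 \<and> (d = 0 \<longrightarrow> F = 0)"
  proof (cases "s0 \<in> E")
    case True
    obtain t where t: "homog m p (lift1 s0) (lift2 s0) = t * lift1 (rational_map p q s0)"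
      "homog m q (lift1 s0) (lift2 s0) = t * lift2 (rational_map p q s0)"
      using rational_map_lift[OF q_nonzero coprime_pq m_eq] by blast
    have "lift1 s0 * cnj (lift2 (rational_map p q s0)) = lift2 s0 * cnj
        (lift1 (rational_map p q s0))"
      using True E(2) by (auto simp: lift_cnj_eq_iff coincidence_set_def)
    then have "cnj (lift1 s0) * lift2 (rational_map p q s0) = cnj (lift2 s0) * lift1
        (rational_map p q s0)"
      by (metis complex_cnj_cnj complex_cnj_mult)
    then have "coeff F m = 0"
      unfolding F_def by (simp add: P_def Q_def coeff_homog_line \<alpha>_def \<beta>_def t mult.left_commute)
    moreover have "degree F \<le> m" by (rule degF)
    ultimately have "F = 0 \<or> degree F < m"
      by (metis leading_coeff_0_iff le_neq_implies_less)
    then show ?thesis using True by (auto simp: d_def)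
  next
    case False
    then show ?thesis using degF by (simp add: d_def)
  qed
  have H: "degree H \<le> d" using degH by (simp add: d_def)
  have inj: "inj_on mob (E - {s0})" using mob_inj by (auto intro!: inj_onI)
  have card: "card (mob ` (E - {s0})) = card (E - {s0})" by (rule card_image[OF inj])
  have zero: "e * cnj (poly F e) + cnj (poly H e) = 0" if "e \<in> mob ` (E - {s0})" for e
    using that cf_coincidence E(2) unfolding cf[symmetric] by auto
  have "d \<le> k + card (mob ` (E - {s0}))"
    unfolding card using k E(1) by (cases "s0 \<in> E") (auto simp: d_def card_Diff_singleton_if)
  from biaffine_poly_bound[OF conjunct1[OF F] _ H _ zero this] F E(1) show ?thesis
    using that unfolding cf[symmetric] by (metis finite_Diff finite_imageI)
qed

definition G :: "'a \<Rightarrow> complex" where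
  "G a = mob (psi1 M A x a)"

lemma weierstrass:
  assumes c: "oriented_isothermal_chart M A x (U, \<xi>)" and a: "a \<in> U"
  obtains h where "h \<noteq> 0" "wirtinger (x \<circ> inv_into U \<xi>) (\<xi> a) = h *s nv (G a)"
proof -
  have aM: "a \<in> topspace M" using chartD(2)[OF isothermalD(2)[OF c]] a by blast
  obtain s where s: "s \<noteq> 0" "wirtinger (x \<circ> inv_into U \<xi>) (\<xi> a)
    = s *s null_vec (lift1 (psi1 M A x a)) (lift2 (psi1 M A x a)) (lift1 (psi2 M A x a))
        (lift2 (psi2 M A x a))"
    using gauss_map_spec[OF c a] by blast
  obtain t r where tr: "t \<noteq> 0" "r \<noteq> 0" "lift1 (psi1 M A x a) = t * (\<alpha> * G a + \<gamma>)"
      "lift2 (psi1 M A x a) = t * (\<beta> * G a + \<delta>)"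
    "lift1 (psi2 M A x a) = r * poly P (G a)" "lift2 (psi2 M A x a) = r * poly Q (G a)"
    using rational_map_mob[OF psi1_omits[OF aM]] unfolding G_def psi2_eq[OF aM] by metis
  show ?thesis
    by (rule that[of "s * (t * r)"])
      (use s tr in \<open>simp_all add: nv_def null_vec_scale vector_smult_assoc\<close>)
qed

lemma nv_nonzero:
  assumes "a \<in> topspace M"
  shows "nv (G a) \<noteq> 0"
proof -
  obtain U \<xi> where c: "(U, \<xi>) \<in> conformal_atlas" "a \<in> U" using cover[OF assms] by blast
  note iso = conformal_atlas_isothermal[OF c(1)]
  obtain h where "wirtinger (x \<circ> inv_into U \<xi>) (\<xi> a) = h *s nv (G a)" using weierstrass[OF iso c(2)]
    by blast
  moreover have "wirtinger (x \<circ> inv_into U \<xi>) (\<xi> a) \<noteq> 0" using wirtinger_isothermal(3)[OF iso] c(2)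
    by blast
  ultimately show ?thesis by auto
qed

text \<open>The factor is unique because \<open>nv (G a)\<close> is nonzero on the surface, so the
  choice is a function determined by \<open>x_z\<close> and \<open>G\<close>.\<close>

definition Hf :: "'a chart \<Rightarrow> complex \<Rightarrow> complex" where
  "Hf c z = (SOME h. wirtinger (local_rep x c) z = h *s nv (G (inv_into (fst c) (snd c) z)))"

lemma Hf_spec:
  assumes c: "oriented_isothermal_chart M A x (U, \<xi>)" and z: "z \<in> \<xi> ` U"
  shows "wirtinger (x \<circ> inv_into U \<xi>) z = Hf (U, \<xi>) z *s nv (G (inv_into U \<xi> z))" "Hf (U, \<xi>) z \<noteq> 0"
proof -
  have zi: "inv_into U \<xi> z \<in> U" "\<xi> (inv_into U \<xi> z) = z" using z
    by (auto intro: inv_into_into f_inv_into_f)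
  obtain h
      where h: "wirtinger (x \<circ> inv_into U \<xi>) (\<xi> (inv_into U \<xi> z)) = h *s nv (G (inv_into U \<xi> z))"
    using weierstrass[OF c zi(1)] by blast
  show e: "wirtinger (x \<circ> inv_into U \<xi>) z = Hf (U, \<xi>) z *s nv (G (inv_into U \<xi> z))"
    unfolding Hf_def local_rep_simp fst_conv snd_conv by (rule someI[of _ h]) (use h zi in simp)
  show "Hf (U, \<xi>) z \<noteq> 0"
  proof
    assume "Hf (U, \<xi>) z = 0"
    then show False using e wirtinger_isothermal(3)[OF c z] by (simp add: vec_eq_iff)
  qed
qed

text \<open>Two pairs of linear combinations of the components of \<open>x_z\<close> are homogeneous
  coordinates of \<open>psi1\<close>: one is valid where \<open>lift2\<close> of \<open>psi2\<close>
  is nonzero, the other where \<open>lift1\<close> is, and these cannot vanish together. Since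
  \<open>psi1\<close> avoids \<open>s0\<close>, \<open>mob\<close> of either is a quotient with
  nonzero denominator.\<close>

lemma G_holomorphic:
  assumes c: "(U, \<xi>) \<in> conformal_atlas"
  shows "(G \<circ> inv_into U \<xi>) holomorphic_on \<xi> ` U"
proof -
  note iso = conformal_atlas_isothermal[OF c]
  have ch: "is_chart M (U, \<xi>)" by (rule isothermalD(2)[OF iso])
  have op: "open (\<xi> ` U)" by (rule chartD(3)[OF ch])
  define Y where "Y k z = wirtinger (x \<circ> inv_into U \<xi>) z $ k" for k z
  have Y: "Y k holomorphic_on \<xi> ` U" for k using c by (simp add: conformal_atlas_def Y_def[abs_def])
  have local: "(G \<circ> inv_into U \<xi>) field_differentiable (at z0)"
    if z0: "z0 \<in> \<xi> ` U" and hol: "u holomorphic_on \<xi> ` U" "v holomorphic_on \<xi> ` U"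
      and nz: "\<alpha> * v z0 - \<beta> * u z0 \<noteq> 0"
      and eq: "\<And>z. z \<in> \<xi> ` U \<Longrightarrow> \<exists>t. u z = t * lift1 (psi1 M A x (inv_into U \<xi> z)) \<and> v z = t * lift2
          (psi1 M A x (inv_into U \<xi> z))"
    for z0 u v
  proof -
    have "continuous_on (\<xi> ` U) (\<lambda>z. \<alpha> * v z - \<beta> * u z)"
      by (intro continuous_intros holomorphic_on_imp_continuous_on hol)
    then have "open ((\<lambda>z. \<alpha> * v z - \<beta> * u z) -` (- {0}) \<inter> \<xi> ` U)"
      using continuous_on_open_vimage[OF op] by blast
    moreover have "z0 \<in> (\<lambda>z. \<alpha> * v z - \<beta> * u z) -` (- {0}) \<inter> \<xi> ` U" using z0 nz by simp
    ultimately obtain e where e: "e > 0" "ball z0 e \<subseteq> (\<lambda>z. \<alpha> * v z - \<beta> * u z) -` (- {0}) \<inter> \<xi> ` U"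
      using open_contains_ball by blast
    have "(\<lambda>z. (\<delta> * u z - \<gamma> * v z) / (\<alpha> * v z - \<beta> * u z)) holomorphic_on ball z0 e"
      by (intro holomorphic_intros holomorphic_on_subset[OF hol(1)]
          holomorphic_on_subset[OF hol(2)]) (use e in auto)
    then have "(G \<circ> inv_into U \<xi>) holomorphic_on ball z0 e"
    proof (rule holomorphic_transform)
      fix z assume z: "z \<in> ball z0 e"
      then obtain t where t: "u z = t * lift1 (psi1 M A x (inv_into U \<xi> z))"
          "v z = t * lift2 (psi1 M A x (inv_into U \<xi> z))"
        using eq e by blast
      have "\<alpha> * v z - \<beta> * u z \<noteq> 0" using e z by blast
      then have "t \<noteq> 0" using t by auto
      then show "(\<delta> * u z - \<gamma> * v z) / (\<alpha> * v z - \<beta> * u z) = (G \<circ> inv_into U \<xi>) z"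
        unfolding t G_def mob_def comp_def
        by (simp only: mult.left_commute[of _ t] right_diff_distrib[symmetric]) simp
    qed
    then show ?thesis using holomorphic_on_imp_differentiable_at e(1)
      by (metis centre_in_ball open_ball)
  qed
  have rep: "\<exists>s. s \<noteq> 0 \<and> Y 1 z + \<i> * Y 2 z = (2 * s * lift2 b) * lift1 a \<and> Y 3 z + Y 4 z
      = (2 * s * lift2 b) * lift2 a
     \<and> Y 4 z - Y 3 z = (2 * s * lift1 b) * lift1 a \<and> Y 1 z - \<i> * Y 2 z = (2 * s * lift1 b) * lift2
         a"
    if z: "z \<in> \<xi> ` U" and ab: "a = psi1 M A x (inv_into U \<xi> z)" "b = psi2 M A x (inv_into U \<xi> z)"
        for z a b
  proof -
    have zi: "inv_into U \<xi> z \<in> U" "\<xi> (inv_into U \<xi> z) = z" using z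
      by (auto intro: inv_into_into f_inv_into_f)
    obtain s
        where s: "s \<noteq> 0"
            "wirtinger (x \<circ> inv_into U \<xi>) z = s *s null_vec (lift1 a) (lift2 a) (lift1 b) (lift2 b)"
      using gauss_map_spec[OF iso zi(1)] zi(2) ab by metis
    show ?thesis using s(1) unfolding Y_def s(2) by (intro exI[of _ s]) (simp add: algebra_simps)
  qed
  have "(G \<circ> inv_into U \<xi>) field_differentiable (at z0)" if z0: "z0 \<in> \<xi> ` U" for z0
  proof -
    have "inv_into U \<xi> z0 \<in> U" using z0 by (auto intro: inv_into_into)
    then have "psi1 M A x (inv_into U \<xi> z0) \<noteq> s0" using psi1_omits chartD(2)[OF ch] by blast
    note den = mob_denominator[OF this]
    obtain s
        where s: "s \<noteq> 0"
            "Y 1 z0 + \<i> * Y 2 z0 = (2 * s * lift2 (psi2 M A x (inv_into U \<xi> z0))) * lift1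
                (psi1 M A x (inv_into U \<xi> z0))"
      "Y 3 z0 + Y 4 z0 = (2 * s * lift2 (psi2 M A x (inv_into U \<xi> z0))) * lift2
          (psi1 M A x (inv_into U \<xi> z0))"
      "Y 4 z0 - Y 3 z0 = (2 * s * lift1 (psi2 M A x (inv_into U \<xi> z0))) * lift1
          (psi1 M A x (inv_into U \<xi> z0))"
      "Y 1 z0 - \<i> * Y 2 z0 = (2 * s * lift1 (psi2 M A x (inv_into U \<xi> z0))) * lift2
          (psi1 M A x (inv_into U \<xi> z0))"
      using rep[OF z0 refl refl] by blast
    show ?thesis
    proof (cases "lift2 (psi2 M A x (inv_into U \<xi> z0)) = 0")
      case False
      show ?thesis
      proof (rule local[OF z0, of "\<lambda>z. Y 1 z + \<i> * Y 2 z" "\<lambda>z. Y 3 z + Y 4 z"])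
        show "\<alpha> * (Y 3 z0 + Y 4 z0) - \<beta> * (Y 1 z0 + \<i> * Y 2 z0) \<noteq> 0"
          unfolding s using False s(1) den
            by (simp add: mult.left_commute[of \<alpha>] mult.left_commute[of \<beta>]
                right_diff_distrib[symmetric])
        show "(\<lambda>z. Y 1 z + \<i> * Y 2 z) holomorphic_on \<xi> ` U"
            "(\<lambda>z. Y 3 z + Y 4 z) holomorphic_on \<xi> ` U"
          by (intro holomorphic_intros Y)+
        fix z assume z: "z \<in> \<xi> ` U"
        show "\<exists>t. Y 1 z + \<i> * Y 2 z = t * lift1 (psi1 M A x (inv_into U \<xi> z)) \<and>
            Y 3 z + Y 4 z = t * lift2 (psi1 M A x (inv_into U \<xi> z))"
          using rep[OF z refl refl] by blast
      qed
    next
      case True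
      then have l1: "lift1 (psi2 M A x (inv_into U \<xi> z0)) \<noteq> 0"
        by (cases "psi2 M A x (inv_into U \<xi> z0)") auto
      show ?thesis
      proof (rule local[OF z0, of "\<lambda>z. Y 4 z - Y 3 z" "\<lambda>z. Y 1 z - \<i> * Y 2 z"])
        show "\<alpha> * (Y 1 z0 - \<i> * Y 2 z0) - \<beta> * (Y 4 z0 - Y 3 z0) \<noteq> 0"
          unfolding s using l1 s(1) den
            by (simp add: mult.left_commute[of \<alpha>] mult.left_commute[of \<beta>]
                right_diff_distrib[symmetric])
        show "(\<lambda>z. Y 4 z - Y 3 z) holomorphic_on \<xi> ` U"
            "(\<lambda>z. Y 1 z - \<i> * Y 2 z) holomorphic_on \<xi> ` U"
          by (intro holomorphic_intros Y)+
        fix z assume z: "z \<in> \<xi> ` U"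
        show "\<exists>t. Y 4 z - Y 3 z = t * lift1 (psi1 M A x (inv_into U \<xi> z)) \<and>
            Y 1 z - \<i> * Y 2 z = t * lift2 (psi1 M A x (inv_into U \<xi> z))"
          using rep[OF z refl refl] by blast
      qed
    qed
  qed
  then show ?thesis by (simp add: holomorphic_on_def field_differentiable_at_within)
qed

text \<open>Near each point \<open>Hf\<close> is the quotient of a component of \<open>x_z\<close>
  by a nonvanishing component of \<open>nv (G a)\<close>.\<close>

lemma Hf_holomorphic:
  assumes c: "(U, \<xi>) \<in> conformal_atlas"
  shows "Hf (U, \<xi>) holomorphic_on \<xi> ` U"
proof -
  note iso = conformal_atlas_isothermal[OF c]
  have ch: "is_chart M (U, \<xi>)" by (rule isothermalD(2)[OF iso])
  have op: "open (\<xi> ` U)" by (rule chartD(3)[OF ch])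
  let ?g = "G \<circ> inv_into U \<xi>"
  have nvh: "(\<lambda>z. nv (?g z) $ k) holomorphic_on \<xi> ` U" for k
  proof -
    have "(\<lambda>u. nv u $ k) holomorphic_on UNIV"
      unfolding nv_def using exhaust_4[of k] by (auto intro!: holomorphic_intros)
    from holomorphic_on_compose_gen[OF G_holomorphic[OF c] this] show ?thesis
      by (simp add: comp_def)
  qed
  have "Hf (U, \<xi>) field_differentiable (at z0)" if z0: "z0 \<in> \<xi> ` U" for z0
  proof -
    have "inv_into U \<xi> z0 \<in> topspace M" using inv_into_into[OF z0] chartD(2)[OF ch] by blast
    then have "nv (?g z0) \<noteq> 0" using nv_nonzero by simp
    then obtain k where k: "nv (?g z0) $ k \<noteq> 0" by (auto simp: vec_eq_iff)
    have "continuous_on (\<xi> ` U) (\<lambda>z. nv (?g z) $ k)"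
      by (rule holomorphic_on_imp_continuous_on[OF nvh])
    then have "open ((\<lambda>z. nv (?g z) $ k) -` (- {0}) \<inter> \<xi> ` U)"
      using continuous_on_open_vimage[OF op] by blast
    moreover have "z0 \<in> (\<lambda>z. nv (?g z) $ k) -` (- {0}) \<inter> \<xi> ` U" using z0 k by simp
    ultimately obtain e where e: "e > 0" "ball z0 e \<subseteq> (\<lambda>z. nv (?g z) $ k) -` (- {0}) \<inter> \<xi> ` U"
      using open_contains_ball by blast
    have sub: "ball z0 e \<subseteq> \<xi> ` U" using e(2) by blast
    have "(\<lambda>z. wirtinger (x \<circ> inv_into U \<xi>) z $ k / nv (?g z) $ k) holomorphic_on ball z0 e"
      by (intro holomorphic_intros holomorphic_on_subset[OF nvh sub])
        (use c e sub in \<open>auto simp: conformal_atlas_def intro: holomorphic_on_subset\<close>)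
    then have "Hf (U, \<xi>) holomorphic_on ball z0 e"
    proof (rule holomorphic_transform)
      fix z assume z: "z \<in> ball z0 e"
      then have "nv (?g z) $ k \<noteq> 0" using e by blast
      then show "wirtinger (x \<circ> inv_into U \<xi>) z $ k / nv (?g z) $ k = Hf (U, \<xi>) z"
        using Hf_spec(1)[OF iso subsetD[OF sub z]] by simp
    qed
    then show ?thesis using holomorphic_on_imp_differentiable_at e(1)
      by (metis centre_in_ball open_ball)
  qed
  then show ?thesis by (simp add: holomorphic_on_def field_differentiable_at_within)
qed

lemma metric_factor:
  assumes c: "oriented_isothermal_chart M A x (U, \<xi>)" and z: "z \<in> \<xi> ` U"
  defines "y \<equiv> x \<circ> inv_into U \<xi>"
  shows "mink (Re v *\<^sub>R pd 1 y z + Im v *\<^sub>R pd 2 y z) (Re v *\<^sub>R pd 1 y z + Im v *\<^sub>R pd 2 y z)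
    = (2 * norm v * norm (Hf (U, \<xi>) z) * norm (cf (G (inv_into U \<xi> z))))\<^sup>2"
proof -
  let ?h = "Hf (U, \<xi>) z" and ?u = "G (inv_into U \<xi> z)"
  have "mink (pd 1 y z) (pd 1 y z) = 2 * (norm (wirtinger y z $ 1) ^ 2 + norm (wirtinger y z $ 2) ^
      2
       + norm (wirtinger y z $ 3) ^ 2 - norm (wirtinger y z $ 4) ^ 2)"
    unfolding y_def by (rule wirtinger_isothermal(2)[OF c z])
  also have "\<dots>
      = 2 * (norm ?h ^ 2 * (norm (nv ?u $ 1) ^ 2 + norm (nv ?u $ 2) ^ 2 + norm (nv ?u $ 3) ^ 2 -
          norm (nv ?u $ 4) ^ 2))"
    unfolding y_def Hf_spec(1)[OF c z]
      by (simp add: norm_mult power_mult_distrib algebra_simps del: null_vec_nth)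
  also have "\<dots> = (2 * norm ?h * norm (cf ?u))\<^sup>2"
    unfolding nv_def null_vec_hermitian cf_def by (simp add: power_mult_distrib)
  finally have E: "mink (pd 1 y z) (pd 1 y z) = (2 * norm ?h * norm (cf ?u))\<^sup>2" .
  have "mink (Re v *\<^sub>R pd 1 y z + Im v *\<^sub>R pd 2 y z) (Re v *\<^sub>R pd 1 y z + Im v *\<^sub>R pd 2 y z)
    = ((Re v)\<^sup>2 + (Im v)\<^sup>2) * mink (pd 1 y z) (pd 1 y z)"
    using isothermalD(5,6)[OF c z, folded y_def]
    by (simp add: mink_linear mink_commute[of "pd 2 y z" "pd 1 y z"] power2_eq_square algebra_simps)
  also have "\<dots> = (2 * norm v * norm ?h * norm (cf ?u))\<^sup>2"
    unfolding E cmod_power2[symmetric] by (simp add: power_mult_distrib)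
  finally show ?thesis .
qed

lemma psi1_not_coincidence:
  "a \<in> topspace M \<Longrightarrow> psi1 M A x a \<notin> coincidence_set (rational_map p q)"
  using psi2_neq_cnj_psi1[of a] by (simp add: coincidence_set_def psi2_eq)

end


section \<open>Radial curves of finite length\<close>

text \<open>Trajectories are holomorphic in conformal charts, while lengths are defined through
  \<open>A\<close>; smooth transitions connect the two.\<close>

lemma (in stationary_surface) solves_smooth_map_on:
  assumes vf: "holomorphic_vector_field M conformal_atlas X"
    and sol: "holomorphic_vector_field.solves conformal_atlas X \<Phi> D" and D: "open D"
  shows "smooth_map_on D \<Phi>"
proof -
  interpret V: holomorphic_vector_field M conformal_atlas X by (rule vf)
  have top: "\<Phi> w \<in> topspace M" if "w \<in> D" for w by (rule V.solves_topspace[OF sol that])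
  have op: "open {w \<in> D. \<Phi> w \<in> W}" if "openin M W" for W
    by (rule V.solves_open_preimage[OF sol that])
  have "smooth_on {w \<in> D. \<Phi> w \<in> V} (\<theta> \<circ> \<Phi>)" if V: "(V, \<theta>) \<in> A" for V \<theta>
  proof -
    have chV: "is_chart M (V, \<theta>)" by (rule atlas_chart[OF V])
    define \<C> where "\<C> = {{w \<in> D. \<Phi> w \<in> V \<inter> U} | U \<xi>. (U, \<xi>) \<in> conformal_atlas}"
    have "{w \<in> D. \<Phi> w \<in> V} = \<Union> \<C>"
    proof (intro equalityI subsetI)
      fix w assume w: "w \<in> {w \<in> D. \<Phi> w \<in> V}"
      then obtain U \<xi> where "(U, \<xi>) \<in> conformal_atlas" "\<Phi> w \<in> U" using cover top by blast
      then show "w \<in> \<Union> \<C>" using w unfolding \<C>_def by blast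
    qed (auto simp: \<C>_def)
    moreover have "smooth_on (\<Union> \<C>) (\<theta> \<circ> \<Phi>)"
    proof (rule smooth_on_Un)
      fix T assume "T \<in> \<C>"
      then obtain U \<xi> where U: "T = {w \<in> D. \<Phi> w \<in> V \<inter> U}" "(U, \<xi>) \<in> conformal_atlas"
        by (auto simp: \<C>_def)
      have ch: "is_chart M (U, \<xi>)" by (rule chart[OF U(2)])
      note oc = isothermalD(1)[OF conformal_atlas_isothermal[OF U(2)]]
      show oT: "open T" unfolding U(1)
        by (rule op[OF openin_Int[OF chartD(1)[OF chV] chartD(1)[OF ch]]])
      have "(\<xi> \<circ> \<Phi>) holomorphic_on T"
        unfolding holomorphic_on_open[OF oT]
        using V.solves_has_field_derivative[OF sol _ U(2)] U(1) by blast
      then have sm: "smooth_on T (\<xi> \<circ> \<Phi>)" by (rule holomorphic_imp_smooth_on[OF oT])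
      have "smooth_on T (\<lambda>w. (\<theta> \<circ> inv_into U \<xi>) ((\<xi> \<circ> \<Phi>) w))"
        by (rule smooth_on_compose[OF oT sm transition_to_atlas(2)[OF oc V]]) (auto simp: U(1))
      then show "smooth_on T (\<theta> \<circ> \<Phi>)"
        by (rule smooth_on_transform[OF oT]) (use U(1) ch in auto)
    qed
    ultimately show ?thesis by simp
  qed
  then show ?thesis unfolding smooth_map_on_def using D top op by blast
qed

context rational_gauss_surface
begin

text \<open>If \<open>G\<close> had zero derivative in all conformal charts, it would be locally
  constant, and near each point all tangent planes would be spanned by the real and imaginary parts
  of one vector \<open>nv u0\<close>; parallel tangent planes have zero curvature.\<close>

lemma nonflat_derivative:
  assumes "nonflat A x"
  obtains U \<xi> z where "(U, \<xi>) \<in> conformal_atlas" "z \<in> \<xi> ` U" "deriv (G \<circ> inv_into U \<xi>) z \<noteq> 0"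
proof (rule ccontr)
  note witness = that
  assume "\<not> thesis"
  then have d0: "deriv (G \<circ> inv_into U \<xi>) z = 0" if "(U, \<xi>) \<in> conformal_atlas" "z \<in> \<xi> ` U" for U \<xi> z
    using witness[OF that] by blast
  obtain V \<theta> z
      where V: "(V, \<theta>) \<in> A" "z \<in> \<theta> ` V" "gauss_curvature (induced_metric (x \<circ> inv_into V \<theta>)) z \<noteq> 0"
    using assms by (auto simp: nonflat_def)
  have chV: "is_chart M (V, \<theta>)" by (rule atlas_chart[OF V(1)])
  let ?y = "x \<circ> inv_into V \<theta>"
  interpret V: stationary_patch ?y "\<theta> ` V" by (rule stationary_patch_atlas[OF V(1)])
  obtain a where a: "a \<in> V" "z = \<theta> a" using V(2) by blast
  then have aM: "a \<in> topspace M" using chartD(2)[OF chV] by blast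
  obtain U \<xi> where c: "(U, \<xi>) \<in> conformal_atlas" "a \<in> U" using cover[OF aM] by blast
  note iso = conformal_atlas_isothermal[OF c(1)]
  note isoD = isothermalD[OF iso]
  let ?g = "G \<circ> inv_into U \<xi>" and ?yh = "x \<circ> inv_into U \<xi>"
  have op: "open (\<xi> ` U)" by (rule chartD(3)[OF isoD(2)])
  have zU: "\<xi> a \<in> \<xi> ` U" using c by blast
  obtain e where e: "e > 0" "ball (\<xi> a) e \<subseteq> \<xi> ` U" using op zU open_contains_ball by blast
  have "\<exists>u0. \<forall>w\<in>ball (\<xi> a) e. ?g w = u0"
  proof (rule has_field_derivative_zero_constant[OF convex_ball])
    fix w assume "w \<in> ball (\<xi> a) e"
    then have w: "w \<in> \<xi> ` U" using e by blast
    show "(?g has_field_derivative 0) (at w within ball (\<xi> a) e)"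
      using holomorphic_derivI[OF G_holomorphic[OF c(1)] op w] d0[OF c(1) w]
          has_field_derivative_at_within by metis
  qed
  then obtain u0 where u0: "\<And>w. w \<in> ball (\<xi> a) e \<Longrightarrow> ?g w = u0" by blast
  \<comment> \<open>Nullity of \<open>nv u0\<close> makes \<open>e1\<close> and \<open>e2\<close>
    orthogonal of equal Minkowski square \<open>c0\<close>, and \<open>cf u0 \<noteq> 0\<close>
    makes \<open>c0\<close> positive. Products with \<open>e1\<close> and \<open>e2\<close>, divided
    by \<open>c0\<close>, are therefore coordinates on their span.\<close>
  define e1 :: "real ^ 4" where "e1 = (\<chi> k. Re (nv u0 $ k))"
  define e2 :: "real ^ 4" where "e2 = (\<chi> k. Im (nv u0 $ k))"
  have "mink (nv u0) (nv u0) = 0" by (simp add: nv_def mink_def algebra_simps)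
  then have n: "mink e1 e1 = mink e2 e2" "mink e1 e2 = 0"
    by (simp_all add: e1_def e2_def mink_def complex_eq_iff mult.commute)
  define c0 where "c0 = mink e1 e1"
  have "cf u0 \<noteq> 0"
  proof
    assume "cf u0 = 0"
    then have "mink (pd 1 ?yh (\<xi> a)) (pd 1 ?yh (\<xi> a)) = 0"
      using metric_factor[OF iso zU, of 1] u0[of "\<xi> a"] e(1) by simp
    then show False using isoD(4)[OF zU] by simp
  qed
  moreover have "mink e1 e1 + mink e2 e2 = 2 * norm (cf u0) ^ 2"
  proof -
    have "mink e1 e1 + mink e2 e2 = norm (nv u0 $ 1) ^ 2 + norm (nv u0 $ 2) ^ 2 + norm (nv u0 $ 3) ^
        2 - norm (nv u0 $ 4) ^ 2"
      unfolding cmod_power2 by (simp add: e1_def e2_def mink_def power2_eq_square)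
    then show ?thesis unfolding nv_def null_vec_hermitian cf_def .
  qed
  ultimately have c0: "c0 > 0" "mink e2 e2 = c0" using n(1) by (simp_all add: c0_def)
  define W where "W = {b \<in> U. \<xi> b \<in> ball (\<xi> a) e}"
  have oW: "openin M W" unfolding W_def by (rule openin_chart_preimage[OF isoD(2) open_ball])
  let ?N = "\<theta> ` (V \<inter> W)"
  have N: "open ?N" "?N \<subseteq> \<theta> ` V" "z \<in> ?N"
    using open_chart_image[OF chV oW] a c e by (auto simp: W_def)
  have plane: "\<exists>s t. pd i ?y w = s *\<^sub>R e1 + t *\<^sub>R e2" if w: "w \<in> ?N" for w i
  proof -
    obtain b where b: "b \<in> V" "b \<in> U" "\<xi> b \<in> ball (\<xi> a) e" "w = \<theta> b" using w by (auto simp: W_def)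
    let ?\<sigma> = "\<xi> \<circ> inv_into V \<theta>"
    have \<sigma>w: "?\<sigma> w = \<xi> b" using b chV by simp
    have \<sigma>: "?\<sigma> differentiable (at w)"
      using oriented_transition_local(1)[OF atlas_oriented[OF V(1)] isoD(1), of b] b by simp
    have bU: "\<xi> b \<in> \<xi> ` U" using b by blast
    interpret Uh: spacelike_patch ?yh "\<xi> ` U" by (rule isoD(3))
    define h where "h = Hf (U, \<xi>) (\<xi> b)"
    have "wirtinger ?yh (\<xi> b) = h *s nv u0"
      using Hf_spec(1)[OF iso bU] u0[OF b(3)] by (simp add: h_def)
    then have k: "(of_real (pd 1 ?yh (\<xi> b) $ k) - \<i> * of_real (pd 2 ?yh (\<xi> b) $ k)) / 2 = h * nv u0
        $ k" for k
      by (simp add: wirtinger_def vec_eq_iff)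
    have "pd 1 ?yh (\<xi> b) $ k = 2 * Re (h * nv u0 $ k)"
        "pd 2 ?yh (\<xi> b) $ k = - 2 * Im (h * nv u0 $ k)" for k
      unfolding k[symmetric] by simp_all
    then have y12: "pd 1 ?yh (\<xi> b) = (2 * Re h) *\<^sub>R e1 + (- 2 * Im h) *\<^sub>R e2"
      "pd 2 ?yh (\<xi> b) = (- 2 * Im h) *\<^sub>R e1 + (- 2 * Re h) *\<^sub>R e2"
      by (simp_all add: vec_eq_iff e1_def e2_def algebra_simps)
    have "pd i ?y w = pd i (\<lambda>z. ?yh (?\<sigma> z)) w"
      by (rule pd_cong[OF N(1) w]) (use chV isoD(2) in \<open>auto simp: W_def\<close>)
    also have "\<dots> = Re (pd i ?\<sigma> w) *\<^sub>R pd 1 ?yh (?\<sigma> w) + Im (pd i ?\<sigma> w) *\<^sub>R pd 2 ?yh (?\<sigma> w)"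
      by (rule has_derivative_pd_compose(2)[OF smooth_on_differentiable[OF Uh.smooth] \<sigma>])
          (use \<sigma>w bU in simp)
    also have "\<dots> = (Re (pd i ?\<sigma> w) * (2 * Re h) + Im (pd i ?\<sigma> w) * (- 2 * Im h)) *\<^sub>R e1
       + (Re (pd i ?\<sigma> w) * (- 2 * Im h) + Im (pd i ?\<sigma> w) * (- 2 * Re h)) *\<^sub>R e2"
      unfolding \<sigma>w y12 by (simp add: algebra_simps)
    finally show ?thesis by blast
  qed
  have "gauss_curvature (induced_metric ?y) z = 0"
  proof (rule V.gauss_curvature_parallel_tangent_planes[OF N])
    show "bounded_linear (\<lambda>v. mink v e1 / c0)" "bounded_linear (\<lambda>v. mink v e2 / c0)"
      by (intro bounded_linear_compose[OF bounded_linear_divide]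
          bounded_bilinear.bounded_linear_left[OF bounded_bilinear_mink])+
    fix w i assume "w \<in> ?N"
    then obtain s t where st: "pd i ?y w = s *\<^sub>R e1 + t *\<^sub>R e2" using plane by blast
    show "pd i ?y w = (mink (pd i ?y w) e1 / c0) *\<^sub>R e1 + (mink (pd i ?y w) e2 / c0) *\<^sub>R e2"
      unfolding st using c0 n by (simp add: mink_linear c0_def[symmetric] mink_commute[of e2 e1])
  qed
  then show False using V(3) by simp
qed

text \<open>\<open>E\<close> and \<open>S\<close> are finite subsets rather than the full sets,
  since finiteness of the full sets is itself deduced from this lemma.\<close>

lemma no_complete_surface:
  assumes comp: "complete_surface M A x" and nf: "nonflat A x"
    and E: "finite E" "E \<subseteq> coincidence_set (rational_map p q)"
    and S: "finite S" "S \<subseteq> exceptional_values M (psi1 M A x)" "s0 \<in> S"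
    and card: "card S = k + 3" "m + 1 \<le> k + card E"
  shows False
proof -
  define N where "N = 2*k+3"
  have N1: "N + 1 = 2*k+4" "N - 1 = 2*k+2" "N > 0" by (simp_all add: N_def)
  define T where "T = mob ` (E - {s0})"
  define S' where "S' = mob ` (S - {s0})"
  obtain C where C: "C > 0" "\<And>u. norm (cf u) \<le> C * (\<Prod>e\<in>T. norm (u - e)) * (1 + norm u) ^ k"
    using cf_bound[OF E card(2)] unfolding T_def by blast
  have "inj_on mob (S - {s0})" using mob_inj by (auto intro!: inj_onI)
  then have cardS': "card S' = k + 2" using card(1) S
    by (simp add: S'_def card_image card_Diff_singleton)
  have finT: "finite T" "finite S'" using E S by (auto simp: T_def S'_def)
  obtain B where B0: "B > 0"
    "\<And>f w r. r > 0 \<Longrightarrow> f holomorphic_on ball w r \<Longrightarrow> f ` ball w r \<inter> S' = {} \<Longrightarrow>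
       (norm (deriv f w) * r) ^ (2*k+3) * (1 + norm (f w)) ^ (k * (2*k+4))
         \<le> B * (\<Prod>a\<in>S'. norm (f w - a)) ^ (2*k+2)"
    using fujimoto_estimate[OF finT(2) cardS'] by blast
  have B: "B > 0"
    "\<And>f w r. r > 0 \<Longrightarrow> f holomorphic_on ball w r \<Longrightarrow> f ` ball w r \<inter> S' = {} \<Longrightarrow>
       (norm (deriv f w) * r) ^ N * (1 + norm (f w)) ^ (k * (N + 1))
         \<le> B * (\<Prod>a\<in>S'. norm (f w - a)) ^ (N - 1)"
    unfolding N1(1,2) unfolding N_def by (fact B0)+
  have omit: "G b \<notin> T" "G b \<notin> S'" if "b \<in> topspace M" for b
  proof -
    have "psi1 M A x b \<notin> E" "psi1 M A x b \<notin> S"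
      using E(2) psi1_not_coincidence[OF that] S(2) that by (auto simp: exceptional_values_def)
    moreover have "mob (psi1 M A x b) \<notin> mob ` (D - {s0})" if "psi1 M A x b \<notin> D" for D
    proof
      assume "mob (psi1 M A x b) \<in> mob ` (D - {s0})"
      then obtain e where "e \<in> D" "e \<noteq> s0" "mob (psi1 M A x b) = mob e" by blast
      with mob_inj[OF psi1_omits[OF \<open>b \<in> topspace M\<close>]] that show False by blast
    qed
    ultimately show "G b \<notin> T" "G b \<notin> S'" by (simp_all add: G_def T_def S'_def)
  qed
  define g where "g c = G \<circ> inv_into (fst c) (snd c)" for c :: "'a chart"
  define \<omega> where "\<omega> c z = (Hf c z * (\<Prod>e\<in>T. g c z - e)) ^ (N + 1) * (\<Prod>a\<in>S'. g c z - a) ^ (N - 1)"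
      for c z
  txt \<open>The exponents make \<open>X\<close> transform like a vector field, and express the speed of its complex
    trajectories by the quantities in \<open>fujimoto_estimate\<close> for \<open>G\<close> along the trajectory.\<close>
  define X where "X c z = deriv (g c) z ^ N / \<omega> c z" for c z
  have \<omega>0: "\<omega> (U, \<xi>) z \<noteq> 0" if c: "(U, \<xi>) \<in> conformal_atlas" "z \<in> \<xi> ` U" for U \<xi> z
  proof -
    have "inv_into U \<xi> z \<in> topspace M"
      using inv_into_into[OF c(2)] chartD(2)[OF chart[OF c(1)]] by blast
    then show ?thesis
      using omit Hf_spec(2)[OF conformal_atlas_isothermal[OF c(1)] c(2)] finT
      by (auto simp: \<omega>_def g_def prod_zero_iff)
  qed
  have vf: "holomorphic_vector_field M conformal_atlas X"
  proof
    fix U \<xi> assume c: "(U, \<xi>) \<in> conformal_atlas"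
    have op: "open (\<xi> ` U)" by (rule chartD(3)[OF chart[OF c]])
    have gh: "g (U, \<xi>) holomorphic_on \<xi> ` U" using G_holomorphic[OF c] by (simp add: g_def)
    show "X (U, \<xi>) holomorphic_on \<xi> ` U"
      unfolding X_def[abs_def] \<omega>_def
      by (intro holomorphic_intros holomorphic_deriv gh op Hf_holomorphic[OF c])
        (use \<omega>0[OF c] in \<open>simp add: \<omega>_def\<close>)
    fix V \<theta> a assume d: "(V, \<theta>) \<in> conformal_atlas" and a: "a \<in> U \<inter> V"
    note ic = conformal_atlas_isothermal[OF c] and id = conformal_atlas_isothermal[OF d]
    note ch = chart[OF c] chart[OF d]
    let ?\<tau> = "\<theta> \<circ> inv_into U \<xi>" and ?z = "\<xi> a"
    define \<tau>' where "\<tau>' = pd 1 ?\<tau> ?z"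
    note tr = isothermal_transition[OF ic id a, folded \<tau>'_def]
    have z: "?z \<in> \<xi> ` U" "\<theta> a \<in> \<theta> ` V" using a by auto
    have ga: "g (U, \<xi>) ?z = G a" "g (V, \<theta>) (\<theta> a) = G a" using a ch by (simp_all add: g_def)
    have oN: "open (\<xi> ` (U \<inter> V))" "?z \<in> \<xi> ` (U \<inter> V)"
      using open_chart_image[OF ch(1) chartD(1)[OF ch(2)]] a by auto
    have dg: "deriv (g (U, \<xi>)) ?z = deriv (g (V, \<theta>)) (\<theta> a) * \<tau>'"
    proof (rule DERIV_imp_deriv)
      have "(g (V, \<theta>) has_field_derivative deriv (g (V, \<theta>)) (\<theta> a)) (at (?\<tau> ?z))"
        using holomorphic_derivI[OF _ chartD(3)[OF ch(2)] z(2), of "g (V, \<theta>)"] G_holomorphic[OF d] a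
            ch
        by (simp add: g_def)
      from DERIV_chain[OF this tr(1)]
      show "(g (U, \<xi>) has_field_derivative deriv (g (V, \<theta>)) (\<theta> a) * \<tau>') (at ?z)"
        by (rule has_field_derivative_transform_within_open[OF _ oN]) (use ch in \<open>auto simp: g_def\<close>)
    qed
    have H: "Hf (U, \<xi>) ?z = \<tau>' * Hf (V, \<theta>) (\<theta> a)"
    proof -
      have "Hf (U, \<xi>) ?z *s nv (G a) = (\<tau>' * Hf (V, \<theta>) (\<theta> a)) *s nv (G a)"
        using tr(3) Hf_spec(1)[OF ic z(1)] Hf_spec(1)[OF id z(2)] a ch
            by (simp add: vector_smult_assoc)
      moreover have "nv (G a) \<noteq> 0" using nv_nonzero a chartD(2)[OF ch(1)] by blast
      ultimately show ?thesis by (simp add: vector_mul_rcancel)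
    qed
    \<comment> \<open>The numerator scales by the \<open>N\<close>-th power of
      \<open>\<tau>'\<close> and the denominator by its power \<open>N + 1\<close>.\<close>
    have "X (U, \<xi>) ?z = (deriv (g (V, \<theta>)) (\<theta> a) * \<tau>') ^ N / (\<tau>' ^ (N + 1) * \<omega> (V, \<theta>) (\<theta> a))"
      unfolding X_def dg \<omega>_def H ga by (simp add: power_mult_distrib mult_ac)
    then have "\<tau>' * X (U, \<xi>) ?z = X (V, \<theta>) (\<theta> a)"
      using tr(2) by (simp add: X_def power_mult_distrib)
    then show "X (V, \<theta>) (\<theta> a) = deriv ?\<tau> ?z * X (U, \<xi>) ?z"
      using DERIV_imp_deriv[OF tr(1)] by simp
  qed
  interpret X: holomorphic_vector_field M conformal_atlas X by (rule vf)
  have der: "((G \<circ> \<Phi>) has_field_derivative deriv (g (U, \<xi>)) (\<xi> (\<Phi> w)) * X (U, \<xi>) (\<xi> (\<Phi> w))) (at w)"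
    if sol: "X.solves \<Phi> (ball 0 R)" and w: "w \<in> ball 0 R"
        and c: "(U, \<xi>) \<in> conformal_atlas" "\<Phi> w \<in> U" for \<Phi> R w U \<xi>
  proof -
    note ch = chart[OF c(1)]
    have "(g (U, \<xi>) has_field_derivative deriv (g (U, \<xi>)) (\<xi> (\<Phi> w))) (at ((\<xi> \<circ> \<Phi>) w))"
      using holomorphic_derivI[OF _ chartD(3)[OF ch], of "g (U, \<xi>)" "\<xi> (\<Phi> w)"]
          G_holomorphic[OF c(1)] c(2)
      by (simp add: g_def)
    from DERIV_chain[OF this X.solves_has_field_derivative[OF sol w c]]
    show ?thesis
      by (rule has_field_derivative_transform_within_open[OF _
          X.solves_open_preimage[OF sol chartD(1)[OF ch]]])
        (use w c ch in \<open>auto simp: g_def\<close>)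
  qed
  \<comment> \<open>The estimate is used on the largest disc about \<open>w\<close> inside the
    domain; the speed bound inherits its blow-up rate from the radius
    \<open>R - norm w\<close>.\<close>
  have est: "(norm (deriv (G \<circ> \<Phi>) w) * (R - norm w)) ^ N * (1 + norm (G (\<Phi> w))) ^ (k * (N + 1))
         \<le> B * (\<Prod>a\<in>S'. norm (G (\<Phi> w) - a)) ^ (N - 1)"
    if sol: "X.solves \<Phi> (ball 0 R)" and w: "w \<in> ball 0 R" for \<Phi> R w
  proof -
    have sub: "ball w (R - norm w) \<subseteq> ball 0 R"
    proof
      fix v assume "v \<in> ball w (R - norm w)"
      then show "v \<in> ball 0 R" using norm_triangle_sub[of v w]
        by (auto simp: dist_norm norm_minus_commute)
    qed
    have "(G \<circ> \<Phi>) holomorphic_on ball 0 R"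
      unfolding holomorphic_on_open[OF open_ball]
    proof
      fix w :: complex assume w: "w \<in> ball 0 R"
      obtain U \<xi> where "(U, \<xi>) \<in> conformal_atlas" "\<Phi> w \<in> U"
        using cover[OF X.solves_topspace[OF sol w]] by blast
      from der[OF sol w this] show "\<exists>f'. (G \<circ> \<Phi> has_field_derivative f') (at w)" by blast
    qed
    then have "(G \<circ> \<Phi>) holomorphic_on ball w (R - norm w)" using sub holomorphic_on_subset by blast
    moreover have "(G \<circ> \<Phi>) ` ball w (R - norm w) \<inter> S' = {}"
      using omit(2) X.solves_topspace[OF sol] sub by auto
    moreover have "R - norm w > 0" using w by simp
    ultimately show ?thesis using B(2)[of "R - norm w" "G \<circ> \<Phi>" w] by simp
  qed
  \<comment> \<open>Stated for the power \<open>N + 1\<close>, which keeps fractional exponents out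
    until the final root. The vector \<open>v\<close> is the displacement in the parameter
    disc.\<close>
  have speed: "sqrt (mink v' v') ^ (N + 1) * (R - norm w) ^ N \<le> (2 * C * norm v) ^ (N + 1) * B"
    if sol: "X.solves \<Phi> (ball 0 R)" and w: "w \<in> ball 0 R"
      and v': "v' = Re v *\<^sub>R pd 1 (x \<circ> \<Phi>) w + Im v *\<^sub>R pd 2 (x \<circ> \<Phi>) w" for \<Phi> R w v v'
  proof -
    have \<Phi>M: "\<Phi> w \<in> topspace M" by (rule X.solves_topspace[OF sol w])
    obtain U \<xi> where c: "(U, \<xi>) \<in> conformal_atlas" "\<Phi> w \<in> U" using cover[OF \<Phi>M] by blast
    note ch = chart[OF c(1)] and iso = conformal_atlas_isothermal[OF c(1)]
    let ?y = "x \<circ> inv_into U \<xi>" and ?z = "\<xi> (\<Phi> w)"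
    interpret U: spacelike_patch ?y "\<xi> ` U" by (rule isothermalD(3)[OF iso])
    have z: "?z \<in> \<xi> ` U" using c by blast
    define X0 where "X0 = X (U, \<xi>) ?z"
    define h where "h = Hf (U, \<xi>) ?z"
    define u where "u = G (\<Phi> w)"
    have gz: "g (U, \<xi>) ?z = u" using c ch by (simp add: g_def u_def)
    have dX: "((\<xi> \<circ> \<Phi>) has_derivative (\<lambda>t. X0 * t)) (at w)"
      using X.solves_has_field_derivative[OF sol w c] by (simp add: has_field_derivative_def X0_def)
    have pdX: "pd i (\<xi> \<circ> \<Phi>) w = X0 * coord_dir i" for i by (rule pd_eqI[OF dX])
    have N: "open {w \<in> ball 0 R. \<Phi> w \<in> U}" "w \<in> {w \<in> ball 0 R. \<Phi> w \<in> U}"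
      using X.solves_open_preimage[OF sol chartD(1)[OF ch]] w c by auto
    have pdy: "pd i (x \<circ> \<Phi>) w = Re (X0 * coord_dir i) *\<^sub>R pd 1 ?y ?z + Im (X0 * coord_dir i) *\<^sub>R pd
        2 ?y ?z" for i
    proof -
      have "pd i (x \<circ> \<Phi>) w = pd i (\<lambda>w. ?y ((\<xi> \<circ> \<Phi>) w)) w" by (rule pd_cong[OF N]) (use ch in auto)
      also have "\<dots> = Re (pd i (\<xi> \<circ> \<Phi>) w) *\<^sub>R pd 1 ?y ((\<xi> \<circ> \<Phi>) w) + Im (pd i (\<xi> \<circ> \<Phi>) w) *\<^sub>R pd 2 ?y
          ((\<xi> \<circ> \<Phi>) w)"
        by (rule has_derivative_pd_compose(2)[OF smooth_on_differentiable[OF U.smooth]])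
          (use z dX in \<open>auto simp: differentiable_def comp_def\<close>)
      finally show ?thesis by (simp add: pdX)
    qed
    have "v' = Re (X0 * v) *\<^sub>R pd 1 ?y ?z + Im (X0 * v) *\<^sub>R pd 2 ?y ?z"
      unfolding v' pdy by (simp add: algebra_simps)
    then have mv: "mink v' v' = (2 * norm (X0 * v) * norm h * norm (cf u))\<^sup>2"
      using metric_factor[OF iso z, of "X0 * v"] c ch by (simp add: h_def u_def)
    define \<Pi>T where "\<Pi>T = (\<Prod>e\<in>T. norm (u - e))"
    define \<Pi>S where "\<Pi>S = (\<Prod>a\<in>S'. norm (u - a))"
    define Z where "Z = norm X0 * (norm h * \<Pi>T)"
    have pos: "\<Pi>T \<ge> 0" "Z \<ge> 0" by (auto simp: Z_def \<Pi>T_def prod_nonneg)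
    have \<Pi>S: "\<Pi>S > 0" unfolding \<Pi>S_def using omit(2)[OF \<Phi>M] by (intro prod_pos) (auto simp: u_def)
    have "sqrt (mink v' v') = 2 * norm v * (norm X0 * norm h) * norm (cf u)"
      unfolding mv by (simp add: norm_mult)
    also have "\<dots> \<le> 2 * norm v * (norm X0 * norm h) * (C * \<Pi>T * (1 + norm u) ^ k)"
      unfolding \<Pi>T_def by (intro mult_left_mono C) auto
    also have "\<dots> = (2 * C * norm v) * (Z * (1 + norm u) ^ k)" by (simp add: Z_def)
    finally have "sqrt (mink v' v') ^ (N + 1) \<le> ((2 * C * norm v) * (Z * (1 + norm u) ^ k)) ^
        (N + 1)"
      using mv by (intro power_mono) auto
    then have 1: "sqrt (mink v' v') ^ (N + 1) * (R - norm w) ^ N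
       \<le> ((2 * C * norm v) * (Z * (1 + norm u) ^ k)) ^ (N + 1) * (R - norm w) ^ N"
      using w by (intro mult_right_mono) auto
    have "X0 * ((h * (\<Prod>e\<in>T. u - e)) ^ (N + 1) * (\<Prod>a\<in>S'. u - a) ^ (N - 1)) = deriv (g (U, \<xi>)) ?z ^ N"
      using \<omega>0[OF c(1) z] unfolding X0_def X_def \<omega>_def gz h_def by simp
    \<comment> \<open>Multiplying the defining equation of \<open>X\<close> by the
      \<open>N\<close>-th power of \<open>X0\<close> turns the right-hand side into the
      \<open>N\<close>-th power of the derivative of \<open>G \<circ> \<Phi>\<close>, the quantity
      bounded by \<open>est\<close>, and collects \<open>N + 1\<close> factors \<open>X0\<close> on
      the left, as the speed requires.\<close>
    then have "X0 ^ N * (X0 * ((h * (\<Prod>e\<in>T. u - e)) ^ (N + 1) * (\<Prod>a\<in>S'. u - a) ^ (N - 1)))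
        = X0 ^ N * deriv (g (U, \<xi>)) ?z ^ N"
      by simp
    then have "(X0 * (h * (\<Prod>e\<in>T. u - e))) ^ (N + 1) * (\<Prod>a\<in>S'. u - a) ^ (N - 1) = deriv (G \<circ> \<Phi>) w ^
        N"
      unfolding DERIV_imp_deriv[OF der[OF sol w c]] X0_def[symmetric]
      by (simp add: power_mult_distrib mult_ac)
    then have "norm ((X0 * (h * (\<Prod>e\<in>T. u - e))) ^ (N + 1) * (\<Prod>a\<in>S'. u - a) ^ (N - 1))
        = norm (deriv (G \<circ> \<Phi>) w ^ N)"
      by simp
    then have ZN: "Z ^ (N + 1) * \<Pi>S ^ (N - 1) = norm (deriv (G \<circ> \<Phi>) w) ^ N"
      by (simp add: norm_mult norm_power prod_norm Z_def \<Pi>T_def \<Pi>S_def)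
    have "((Z * (1 + norm u) ^ k) ^ (N + 1) * (R - norm w) ^ N) * \<Pi>S ^ (N - 1)
       = (norm (deriv (G \<circ> \<Phi>) w) * (R - norm w)) ^ N * (1 + norm u) ^ (k * (N + 1))"
      unfolding power_mult_distrib ZN[symmetric] power_mult[symmetric] by (simp add: mult_ac)
    also have "\<dots> \<le> B * \<Pi>S ^ (N - 1)" using est[OF sol w] by (simp add: u_def \<Pi>S_def)
    finally have 2: "(Z * (1 + norm u) ^ k) ^ (N + 1) * (R - norm w) ^ N \<le> B"
      using \<Pi>S by simp
    have "((2 * C * norm v) * (Z * (1 + norm u) ^ k)) ^ (N + 1) * (R - norm w) ^ N
       = (2 * C * norm v) ^ (N + 1) * ((Z * (1 + norm u) ^ k) ^ (N + 1) * (R - norm w) ^ N)"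
      unfolding power_mult_distrib[of "2 * C * norm v"] by (simp only: mult.assoc)
    also have "\<dots> \<le> (2 * C * norm v) ^ (N + 1) * B"
      using C(1) by (intro mult_left_mono 2) auto
    finally show ?thesis using 1 by linarith
  qed
  obtain U0 \<xi>0 z0
      where c0: "(U0, \<xi>0) \<in> conformal_atlas" "z0 \<in> \<xi>0 ` U0" "deriv (G \<circ> inv_into U0 \<xi>0) z0 \<noteq> 0"
    using nonflat_derivative[OF nf] by blast
  define p0 where "p0 = inv_into U0 \<xi>0 z0"
  have p0: "p0 \<in> U0" "\<xi>0 p0 = z0" unfolding p0_def using c0(2)
    by (auto intro: inv_into_into f_inv_into_f)
  have p0M: "p0 \<in> topspace M" using chartD(2)[OF chart[OF c0(1)]] p0 by blast
  define D0 where "D0 = norm (deriv (g (U0, \<xi>0)) z0 * X (U0, \<xi>0) z0)"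
  have D0: "D0 > 0" using c0 \<omega>0[OF c0(1,2)] by (simp add: D0_def X_def g_def)
  define K where "K = B * (\<Prod>a\<in>S'. norm (G p0 - a)) ^ (N - 1) / D0 ^ N"
  have K: "K \<ge> 0" using B(1) D0
    by (auto simp: K_def intro!: divide_nonneg_nonneg mult_nonneg_nonneg zero_le_power prod_nonneg)
  \<comment> \<open>At the centre of the disc \<open>est\<close> reads
    \<open>(D0 * R) ^ N \<le> const\<close>, and \<open>D0 > 0\<close> comes from nonflatness. The
    bound \<open>K + 1\<close> on \<open>R\<close> avoids an \<open>N\<close>-th root.\<close>
  have Rbound: "R \<le> K + 1" if R: "R > 0" and sol: "X.solves \<Phi> (ball 0 R)" and \<Phi>0: "\<Phi> 0 = p0" for R \<Phi>
  proof -
    have w0: "0 \<in> ball (0::complex) R" using R by simp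
    have "deriv (G \<circ> \<Phi>) 0 = deriv (g (U0, \<xi>0)) z0 * X (U0, \<xi>0) z0"
      using DERIV_imp_deriv[OF der[OF sol w0 c0(1)]] p0 \<Phi>0 by simp
    then have n: "norm (deriv (G \<circ> \<Phi>) 0) = D0" by (simp add: D0_def)
    have "(D0 * R) ^ N * 1 \<le> (D0 * R) ^ N * (1 + norm (G p0)) ^ (k * (N + 1))"
      using D0 R by (intro mult_left_mono one_le_power) auto
    also have "\<dots> \<le> B * (\<Prod>a\<in>S'. norm (G p0 - a)) ^ (N - 1)" using est[OF sol w0] n \<Phi>0 by simp
    finally have RK: "R ^ N \<le> K" using D0
      by (simp add: K_def power_mult_distrib pos_le_divide_eq mult.commute)
    show ?thesis
    proof (rule ccontr)
      assume "\<not> ?thesis"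
      then have R1: "R > K + 1" by simp
      then have "R ^ 1 \<le> R ^ N" using K N1(3) by (intro power_increasing) auto
      then show False using RK R1 by simp
    qed
  qed
  obtain R :: real and \<Phi> :: "complex \<Rightarrow> 'a" and w0 :: complex
    where R: "R > 0" "X.solves \<Phi> (ball 0 R)" "\<Phi> 0 = p0" "norm w0 = R"
    and nolim: "\<And>w q. (\<And>n. w n \<in> ball 0 R) \<Longrightarrow> w \<longlonglongrightarrow> w0 \<Longrightarrow> \<not> limitin M (\<lambda>n. \<Phi> (w n)) q sequentially"
  proof (rule X.maximal_disc[OF p0M, of "K + 1"])
    show "R \<le> K + 1" if "R > 0" "X.solves \<Phi> (ball 0 R)" "\<Phi> 0 = p0" for R \<Phi> by (rule Rbound[OF that])
    fix R \<Phi> w0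
    assume "R > 0" "X.solves \<Phi> (ball 0 R)" "\<Phi> 0 = p0" "norm w0 = R"
      "\<And>w q. (\<And>n. w n \<in> ball 0 R) \<Longrightarrow> w \<longlonglongrightarrow> w0 \<Longrightarrow> \<not> limitin M (\<lambda>n. \<Phi> (w n)) q sequentially"
    then show thesis by (rule that)
  qed
  \<comment> \<open>Dyadic points on the radius to \<open>w0\<close>: each segment is half as long
    as the previous one, and every point of a segment is at least the length of that segment away
    from the boundary circle.\<close>
  define w where "w n = of_real (1 - (1/2) ^ n) * w0" for n :: nat
  have F: "smooth_map_on (ball 0 R) \<Phi>" by (rule solves_smooth_map_on[OF vf R(2) open_ball])
  have normw: "norm (of_real s * w0) = s * R" if "0 \<le> s" for s using that R(4)
    by (simp add: norm_mult)
  have win: "w n \<in> ball 0 R" for n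
  proof -
    have "(0::real) \<le> 1 - (1/2) ^ n" by (simp add: power_le_one)
    then show ?thesis using R(1) normw[of "1 - (1/2) ^ n"] by (simp add: w_def del: of_real_diff)
  qed
  have "(\<lambda>n. of_real (1 - (1/2) ^ n) * w0) \<longlonglongrightarrow> of_real (1 - 0) * w0"
    by (intro tendsto_intros LIMSEQ_realpow_zero) auto
  then have wlim: "w \<longlonglongrightarrow> w0" unfolding w_def[abs_def] by simp
  \<comment> \<open>On a segment of length \<open>\<epsilon>\<close> the speed bound leaves
    \<open>(2 * C) ^ (N + 1) * B * \<epsilon>\<close> for the power \<open>N + 1\<close> of the
    length. Halving \<open>\<epsilon>\<close> thus shrinks the length bound by the factor
    \<open>\<rho>\<close>.\<close>
  define \<rho> where "\<rho> = root (N + 1) (1/2)"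
  define K0 where "K0 = root (N + 1) ((2 * C) ^ (N + 1) * B * R)"
  have \<rho>: "0 < \<rho>" "\<rho> < 1" "\<rho> ^ (N + 1) = 1/2"
    unfolding \<rho>_def using real_root_lt_1_iff[of "N + 1" "1/2"] real_root_pow_pos2[of "N + 1" "1/2"]
      by auto
  have K0: "K0 \<ge> 0" "K0 ^ (N + 1) = (2 * C) ^ (N + 1) * B * R"
    unfolding K0_def using C(1) B(1) R(1) real_root_pow_pos2[of "N + 1" "(2 * C) ^ (N + 1) * B * R"]
      by auto
  have step: "induced_dist M A x (\<Phi> (w n)) (\<Phi> (w (Suc n))) \<le> K0 * \<rho> ^ n" for n
  proof -
    define \<epsilon> where "\<epsilon> = (1/2) ^ Suc n * R"
    have \<epsilon>: "\<epsilon> > 0" "\<epsilon> \<le> R * (1/2) ^ n" using R(1) by (auto simp: \<epsilon>_def)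
    have pt: "w n + of_real t * (w (Suc n) - w n) = of_real (1 - (1/2) ^ n + t * (1/2) ^ Suc n) *
        w0" for t
      by (simp add: w_def algebra_simps)
    have nrm: "norm (w n + of_real t * (w (Suc n) - w n)) \<le> R - \<epsilon>" if t: "t \<in> {0..1}" for t
    proof -
      have "(0::real) \<le> 1 - (1/2) ^ n + t * (1/2) ^ Suc n"
        using t by (intro add_nonneg_nonneg) (auto simp: power_le_one)
      then have "norm (w n + of_real t * (w (Suc n) - w n)) = (1 - (1/2) ^ n + t * (1/2) ^ Suc n) *
          R"
        unfolding pt by (rule normw)
      also have "\<dots> \<le> (1 - (1/2) ^ n + 1 * (1/2) ^ Suc n) * R"
        using t R(1) by (intro mult_right_mono add_left_mono) auto
      also have "\<dots> = R - \<epsilon>" by (simp add: \<epsilon>_def algebra_simps)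
      finally show ?thesis .
    qed
    have inb: "w n + of_real t * (w (Suc n) - w n) \<in> ball 0 R" if "t \<in> {0..1}" for t
      using nrm[OF that] \<epsilon>(1) by simp
    have nv: "norm (w (Suc n) - w n) = \<epsilon>"
    proof -
      have "w (Suc n) - w n = of_real ((1/2) ^ Suc n) * w0" by (simp add: w_def algebra_simps)
      then show ?thesis using normw[of "(1/2) ^ Suc n"] by (simp only: \<epsilon>_def) simp
    qed
    have "curve_length x (\<lambda>t. \<Phi> (w n + of_real t * (w (Suc n) - w n))) \<le> ennreal (K0 * \<rho> ^ n)"
    proof (rule segment_curve_length_le[OF F inb])
      fix t :: real and v' :: "real ^ 4"
      assume t: "t \<in> {0..1}"
        and v': "v' = Re (w (Suc n) - w n) *\<^sub>R pd 1 (x \<circ> \<Phi>) (w n + of_real t * (w (Suc n) - w n))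
          + Im (w (Suc n) - w n) *\<^sub>R pd 2 (x \<circ> \<Phi>) (w n + of_real t * (w (Suc n) - w n))"
      let ?s = "sqrt (mink v' v')" and ?pt = "w n + of_real t * (w (Suc n) - w n)"
      note sp = speed[OF R(2) inb[OF t] v', unfolded nv]
      \<comment> \<open>\<open>sqrt\<close> is negative on negative arguments, so the nonnegativity
        of the power is taken from its even exponent.\<close>
      have "N + 1 = 2 * (k + 2)" by (simp add: N_def)
      then have s0: "?s ^ (N + 1) \<ge> 0" by (simp only: power_mult) simp
      have "?s ^ (N + 1) * \<epsilon> ^ N \<le> ?s ^ (N + 1) * (R - norm ?pt) ^ N"
        using s0 \<epsilon>(1) nrm[OF t] by (intro mult_left_mono power_mono) auto
      also have "\<dots> \<le> (2 * C * \<epsilon>) ^ (N + 1) * B" by (rule sp)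
      also have "\<dots> = ((2 * C) ^ (N + 1) * B * \<epsilon>) * \<epsilon> ^ N" by (simp add: power_mult_distrib)
      finally have "?s ^ (N + 1) \<le> (2 * C) ^ (N + 1) * B * \<epsilon>" using \<epsilon>(1) by simp
      also have "\<dots> \<le> (2 * C) ^ (N + 1) * B * (R * (1/2) ^ n)"
        using C(1) B(1) by (intro mult_left_mono \<epsilon>) auto
      also have "\<dots> = K0 ^ (N + 1) * (\<rho> ^ (N + 1)) ^ n" unfolding K0(2) \<rho>(3) by simp
      also have "\<dots> = (K0 * \<rho> ^ n) ^ (N + 1)"
        unfolding power_mult_distrib by (simp only: power_mult[symmetric] mult.commute)
      finally have "?s ^ Suc N \<le> (K0 * \<rho> ^ n) ^ Suc N" by (simp only: Suc_eq_plus1)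
      then show "?s \<le> K0 * \<rho> ^ n" by (rule power_le_imp_le_base) (use K0(1) \<rho>(1) in simp)
    qed
    then show ?thesis
      by (intro induced_dist_le[OF segment_curve(1)[OF F inb]])
        (use X.solves_topspace[OF R(2) win] K0(1) \<rho>(1) in auto)
  qed
  obtain q' where "limitin M (\<lambda>n. \<Phi> (w n)) q' sequentially"
    by (rule complete_geometric_limit[OF comp X.solves_topspace[OF R(2) win] step \<rho>(1,2) K0(1)])
  then show False using nolim[OF win wlim] by blast
qed

end

text \<open>Settles degree 0, where a second coincidence point would break the final count because
  of truncated subtraction.\<close>

lemma coincidence_set_constant:
  assumes "degree p = 0" "degree q = 0"
  shows "card (coincidence_set (rational_map p q)) \<le> 1"
proof -
  obtain a b where ab: "p = [:a:]" "q = [:b:]" using assms degree_eq_zeroE by metis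
  define v where "v = (if b = 0 then None else Some (a / b))"
  have "rational_map p q w = v" for w by (cases w) (auto simp: rational_map_def ab v_def)
  moreover have "ext_cnj (ext_cnj w) = w" for w by (cases w) (auto simp: ext_cnj_def)
  ultimately have "coincidence_set (rational_map p q) \<subseteq> {ext_cnj v}"
    by (auto simp: coincidence_set_def)
  then show ?thesis using card_mono[of "{ext_cnj v}"] by simp
qed

theorem theorem1p4:
  fixes M :: "'a topology" and A :: "'a chart set" and x :: "'a \<Rightarrow> real ^ 4"
    and f :: "ext_complex \<Rightarrow> ext_complex" and m :: nat
  assumes "oriented_surface M A"
    and "spacelike_immersion A x"
    and "stationary A x"
    and "complete_surface M A x"
    and "nonflat A x"
    and "rational_of_degree f m"
    and "\<forall>p \<in> topspace M. psi2 M A x p = f (psi1 M A x p)"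
  shows "finite (coincidence_set f) \<and> finite (exceptional_values M (psi1 M A x)) \<and>
    int (card (coincidence_set f)) \<le> int (card (exceptional_values M (psi1 M A x))) \<and>
    int (card (exceptional_values M (psi1 M A x))) \<le> int m - int (card (coincidence_set f)) + 3"
proof -
  interpret stationary_surface M A x by unfold_locales (rule assms(1-3))+
  obtain p q where pq: "q \<noteq> 0" "coprime p q" "m = max (degree p) (degree q)"
      and f: "f = rational_map p q"
    using assms(6) by (auto simp: rational_of_degree_def)
  let ?E = "coincidence_set f" and ?X = "exceptional_values M (psi1 M A x)"
  have loc: "rational_gauss_surface M A x p q m s0" if "s0 \<in> ?X" for s0
    using pq assms(7) that f by unfold_locales (auto simp: exceptional_values_def)
  \<comment> \<open>Any element of \<open>S\<close> may serve as the value sent to infinity.\<close>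
  have no: False if "finite E" "E \<subseteq> ?E" "finite S" "S \<subseteq> ?X" "card S = k + 3" "m + 1 \<le> k + card E"
      for E S k
  proof -
    note S = that
    obtain s0 where s0: "s0 \<in> S" using S(5) by fastforce
    then have "s0 \<in> ?X" using S(4) by blast
    from rational_gauss_surface.no_complete_surface[OF loc[OF this] assms(4,5) S(1) _ S(3,4) s0
        S(5,6)]
    show False using S(2) f by simp
  qed
  have sub: "?E \<subseteq> ?X"
    using psi2_neq_cnj_psi1 assms(7) by (auto simp: exceptional_values_def coincidence_set_def)
  \<comment> \<open>Among \<open>m + 3\<close> coincidence points three form a set of omitted
    values; with \<open>k = 0\<close> the remaining condition \<open>m + 1 \<le> card E\<close>
    holds.\<close>
  have finE: "finite ?E"
  proof (rule ccontr)
    assume inf: "infinite ?E"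
    then obtain E where E: "finite E" "card E = m + 3" "E \<subseteq> ?E" using infinite_arbitrarily_large
      by blast
    then obtain S where "S \<subseteq> E" "card S = 0 + 3" "finite S"
      using obtain_subset_with_card_n[of "0 + 3" E] by auto
    then show False using no[OF E(1,3), of S 0] E sub by auto
  qed
  \<comment> \<open>Truncated subtraction: if \<open>card ?E \<ge> m + 1\<close>, then
    \<open>k = 0\<close> and at most two values are omitted, so also \<open>card ?E \<le> 2\<close>.
    The bound then follows for \<open>m \<ge> 1\<close> from \<open>2 + 2 \<le> m + 3\<close>, and
    for \<open>m = 0\<close> from \<open>card ?E \<le> 1\<close>.\<close>
  define k where "k = m + 1 - card ?E"
  have "m + 1 \<le> k + card ?E" by (simp add: k_def)
  then have noS: "\<not> (S \<subseteq> ?X \<and> finite S \<and> card S = k + 3)" for S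
    using no[OF finE subset_refl, of S k] by blast
  have finX: "finite ?X"
    using noS infinite_arbitrarily_large by blast
  have "card ?X < k + 3"
  proof (rule ccontr)
    assume "\<not> ?thesis"
    then obtain S where "S \<subseteq> ?X" "card S = k + 3" "finite S"
      using obtain_subset_with_card_n[of "k + 3" ?X] by auto
    then show False using noS by blast
  qed
  moreover have EX: "card ?E \<le> card ?X" by (rule card_mono[OF finX sub])
  moreover have "m \<noteq> 0 \<or> card ?E \<le> 1" using coincidence_set_constant[of p q] pq(3) by (auto simp: f)
  ultimately show ?thesis using finE finX by (auto simp: k_def)
qed

end
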